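(* For each $n\ge2$ let $(\mathbf x^\circ,\mathbf b^\circ)_n\in\mathcal Z_n$ be such that the associated functions $u_n^\circ(x)=\frac1n\sum_{i=1}^nb_i^\circ H(x-x_i^\circ)$ satisfy $u_n^\circ\to u^\circ$ uniformly on $\mathbb R$ as $n\to\infty$ for some bounded uniformly continuous $u^\circ:\mathbb R\to\mathbb R$. Let $(\mathbf x,\mathbf b)_n$ be the solution of $(P_n)$ with initial datum $(\mathbf x^\circ,\mathbf b^\circ)_n$, and let $u_n(t,x)=\frac1n\sum_{i=1}^nb_i(t)H(x-x_i(t))$. Then $u_n$ converges locally uniformly on $[0,\infty)\times\mathbb R$ as $n\to\infty$ to the viscosity solution $u$ of (HJ) with initial datum $u^\circ$. Furthermore, $u$ is bounded and uniformly continuous on $[0,\infty)\times\mathbb R$, and for every $t>0$ the function $u(t,\cdot)$ has the same modulus of continuity as $u^\circ$ (every modulus of continuity of $u^\circ$ is one of $u(t,\cdot)$).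
   Context: $H$ is the Heaviside function with $H(0)=1$. Particle system. $\mathcal Z_n:=\{(\mathbf x,\mathbf b)\in\mathbb R^n\times\{-1,0,+1\}^n:\ i>j,\ b_ib_j\ne0\Rightarrow x_i>x_j\}$. A solution of $(P_n)$ on $[0,T]$ with initial datum $(\mathbf x^\circ,\mathbf b^\circ)\in\mathcal Z_n$ is a map $(\mathbf x,\mathbf b):[0,T]\to\mathcal Z_n$ for which there is a finite set $S\subset(0,T]$ such that: (a) each $x_i\in C([0,T])\cap C^1([0,T]\setminus S)$ and each $b_i:[0,T]\to\{-1,0,1\}$ is right-continuous; (b) $(\mathbf x(0),\mathbf b(0))=(\mathbf x^\circ,\mathbf b^\circ)$; (c) each $b_i$ jumps at most once; if $b_i$ jumps at $t$ then $t\in S$, $|b_i(t-)|=1$ and $b_i(t)=0$; and for all $(\tau,y)\in S\times\mathbb R$, $\sum_{i:x_i(\tau)=y}(b_i(\tau)-b_i(\tau-))=0$; (d) on $(0,T)\setminus S$, $\frac{dx_i}{dt}=\frac1n\sum_{j\ne i}\frac{b_ib_j}{x_i-x_j}$ (terms with $b_ib_j=0$ are read as $0$). Such solutions exist for every $T$ and are unique up to relabeling of particles (which does not affect $u_n$), so $u_n$ is defined on $[0,\infty)\times\mathbb R$. Limiting equation (HJ): formally $u_t=\mathcal I[u]\,|u_x|$ with $\mathcal I[w](x)=\int_{\mathbb R}(w(x+z)-w(x)-zw'(x))\frac{dz}{z^2}$. Let $Q=(0,\infty)\times\mathbb R$, $B_\rho=(-\rho,\rho)$. For $\rho>0$, $u$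 bounded and $\phi\in C^2(Q)$, put $$H_\rho[\phi,u](t,x)=|\phi_x(t,x)|\Big(\int_{B_\rho}\big(\phi(t,x+z)-\phi(t,x)-\phi_x(t,x)z\big)\tfrac{dz}{z^2}+\int_{\mathbb R\setminus B_\rho}\big(u(t,x+z)-u(t,x)\big)\tfrac{dz}{z^2}\Big).$$ A bounded upper semicontinuous $u:Q\to\mathbb R$ is a subsolution of (HJ) if whenever $\phi\in C^2(Q)$ and $u-\phi$ has a global maximum at $(\bar t,\bar x)\in Q$: if $\phi_x(\bar t,\bar x)\ne0$ then $\phi_t(\bar t,\bar x)\le H_\rho[\phi,u](\bar t,\bar x)$; if $\phi(t,x)=c|x-\bar x|^4+g(t)$ for some $c\in\mathbb R$ and some $g$, then $\phi_t(\bar t,\bar x)\le0$; otherwise no condition. A bounded lower semicontinuous $v:Q\to\mathbb R$ is a supersolution if whenever $\psi\in C^2(Q)$ and $v-\psi$ has a global minimum at $(\bar t,\bar x)$: if $\psi_x(\bar t,\bar x)\neq0$ then $\psi_t(\bar t,\bar x)\ge H_\rho[\psi,v](\bar t,\bar x)$; if $\psi(t,x)=c|x-\bar x|^4+g(t)$ then $\psi_t(\bar t,\bar x)\ge0$; otherwise no condition. These notions do not depend on the choice of $\rho>0$. Let $u^*,u_*$ be the upper/lower semicontinuous envelopes in all variables, extended to $t=0$ by limsup/liminf from $Q$. $u$ is a viscosity solution if $u^*$ is a subsolution and $u_*$ is a supersolution; it has initial datum $u^\circ$ if $u^*(0,\cdot)=u_*(0,\cdot)=u^\circ$. For bounded uniformly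 continuous $u^\circ$ there is a unique viscosity solution with initial datum $u^\circ$. *)

theory Defs
  imports "HOL-Analysis.Analysis"
begin

subsection \<open>Particle system\<close>

text \<open>
  Configurations are functions on \<open>nat\<close> of which only the values at \<open>1, \<dots>, n\<close> matter;
  trajectories are functions of time of which only the values on the relevant time interval matter.
\<close>

definition heaviside :: "real \<Rightarrow> real" where
  "heaviside y = (if 0 \<le> y then 1 else 0)"

definition configurations :: "nat \<Rightarrow> ((nat \<Rightarrow> real) \<times> (nat \<Rightarrow> real)) set" where
  "configurations n = {(x, b). (\<forall>i\<in>{1..n}. b i \<in> {-1, 0, 1}) \<and>
     (\<forall>i\<in>{1..n}. \<forall>j\<in>{1..n}. i > j \<and> b i * b j \<noteq> 0 \<longrightarrow> x i > x j)}"

definition step_function :: "nat \<Rightarrow> (nat \<Rightarrow> real) \<Rightarrow> (nat \<Rightarrow> real) \<Rightarrow> real \<Rightarrow> real" where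
  "step_function n x b y = (1 / real n) * (\<Sum>i=1..n. b i * heaviside (y - x i))"

text \<open>Unlike \<^const>\<open>C1_differentiable_on\<close>, this uses one-sided derivatives at end points.\<close>

definition C1_within :: "(real \<Rightarrow> real) \<Rightarrow> real set \<Rightarrow> bool" where
  "C1_within f I \<longleftrightarrow>
     (\<exists>f'. (\<forall>t\<in>I. (f has_real_derivative f' t) (at t within I)) \<and> continuous_on I f')"

definition jumps_at :: "real \<Rightarrow> (real \<Rightarrow> real) \<Rightarrow> real \<Rightarrow> bool" where
  "jumps_at T f t \<longleftrightarrow> t \<in> {0..T} \<and> \<not> continuous (at t within {0..T}) f"

text \<open>
  The left limits \<open>b\<^sub>i(\<tau>-)\<close> exist: \<open>b\<^sub>i\<close> has at most one discontinuity and finitely many values.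
  Summands of the velocity with \<open>b\<^sub>i b\<^sub>j = 0\<close> vanish, even for \<open>x\<^sub>i = x\<^sub>j\<close>, because \<open>0 / 0 = 0\<close>.
\<close>

definition particle_solution_on ::
    "nat \<Rightarrow> real \<Rightarrow> (nat \<Rightarrow> real) \<Rightarrow> (nat \<Rightarrow> real) \<Rightarrow>
     (real \<Rightarrow> nat \<Rightarrow> real) \<Rightarrow> (real \<Rightarrow> nat \<Rightarrow> real) \<Rightarrow> bool" where
  "particle_solution_on n T x0 b0 x b \<longleftrightarrow>
     (\<forall>t\<in>{0..T}. (x t, b t) \<in> configurations n) \<and>
     (\<exists>S. finite S \<and> S \<subseteq> {0<..T} \<and>
       (\<forall>i\<in>{1..n}. continuous_on {0..T} (\<lambda>t. x t i) \<and> C1_within (\<lambda>t. x t i) ({0..T} - S)) \<and>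
       (\<forall>i\<in>{1..n}. \<forall>t\<in>{0..<T}. continuous (at t within {t..T}) (\<lambda>s. b s i)) \<and>
       (\<forall>i\<in>{1..n}. x 0 i = x0 i \<and> b 0 i = b0 i) \<and>
       (\<forall>i\<in>{1..n}. \<forall>s t. jumps_at T (\<lambda>r. b r i) s \<and> jumps_at T (\<lambda>r. b r i) t \<longrightarrow> s = t) \<and>
       (\<forall>i\<in>{1..n}. \<forall>t. jumps_at T (\<lambda>r. b r i) t \<longrightarrow>
          t \<in> S \<and> \<bar>Lim (at_left t) (\<lambda>s. b s i)\<bar> = 1 \<and> b t i = 0) \<and>
       (\<forall>\<tau>\<in>S. \<forall>y. (\<Sum>i | i \<in> {1..n} \<and> x \<tau> i = y. b \<tau> i - Lim (at_left \<tau>) (\<lambda>s. b s i)) = 0) \<and>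
       (\<forall>t\<in>{0<..<T} - S. \<forall>i\<in>{1..n}.
          ((\<lambda>s. x s i) has_real_derivative
             (1 / real n) * (\<Sum>j\<in>{1..n} - {i}. b t i * b t j / (x t i - x t j))) (at t)))"

definition particle_solution ::
    "nat \<Rightarrow> (nat \<Rightarrow> real) \<Rightarrow> (nat \<Rightarrow> real) \<Rightarrow>
     (real \<Rightarrow> nat \<Rightarrow> real) \<Rightarrow> (real \<Rightarrow> nat \<Rightarrow> real) \<Rightarrow> bool" where
  "particle_solution n x0 b0 x b \<longleftrightarrow> (\<forall>T>0. particle_solution_on n T x0 b0 x b)"


subsection \<open>Viscosity solutions of the limiting equation\<close>

definition Q :: "(real \<times> real) set" where
  "Q = {0<..} \<times> UNIV"

definition d_t :: "(real \<Rightarrow> real \<Rightarrow> real) \<Rightarrow> real \<Rightarrow> real \<Rightarrow> real" where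
  "d_t f t x = deriv (\<lambda>s. f s x) t"

definition d_x :: "(real \<Rightarrow> real \<Rightarrow> real) \<Rightarrow> real \<Rightarrow> real \<Rightarrow> real" where
  "d_x f t x = deriv (\<lambda>y. f t y) x"

definition C1_Q :: "(real \<Rightarrow> real \<Rightarrow> real) \<Rightarrow> bool" where
  "C1_Q f \<longleftrightarrow>
     (\<forall>(t, x)\<in>Q. (\<lambda>s. f s x) field_differentiable (at t) \<and> (\<lambda>y. f t y) field_differentiable (at x)) \<and>
     continuous_on Q (\<lambda>(t, x). f t x) \<and>
     continuous_on Q (\<lambda>(t, x). d_t f t x) \<and> continuous_on Q (\<lambda>(t, x). d_x f t x)"

definition C2_Q :: "(real \<Rightarrow> real \<Rightarrow> real) \<Rightarrow> bool" where
  "C2_Q f \<longleftrightarrow> C1_Q f \<and> C1_Q (d_t f) \<and> C1_Q (d_x f)"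

definition hamiltonian ::
    "real \<Rightarrow> (real \<Rightarrow> real \<Rightarrow> real) \<Rightarrow> (real \<Rightarrow> real \<Rightarrow> real) \<Rightarrow> real \<Rightarrow> real \<Rightarrow> real" where
  "hamiltonian \<rho> \<phi> u t x = \<bar>d_x \<phi> t x\<bar> *
     ((LINT z:{-\<rho><..<\<rho>}|lborel. (\<phi> t (x + z) - \<phi> t x - d_x \<phi> t x * z) / z\<^sup>2) +
      (LINT z:- {-\<rho><..<\<rho>}|lborel. (u t (x + z) - u t x) / z\<^sup>2))"

definition usc_on :: "(real \<times> real) set \<Rightarrow> (real \<Rightarrow> real \<Rightarrow> real) \<Rightarrow> bool" where
  "usc_on A u \<longleftrightarrow>
     (\<forall>(t, x)\<in>A. \<forall>\<epsilon>>0. \<forall>\<^sub>F (s, y) in at (t, x) within A. u s y < u t x + \<epsilon>)"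

definition lsc_on :: "(real \<times> real) set \<Rightarrow> (real \<Rightarrow> real \<Rightarrow> real) \<Rightarrow> bool" where
  "lsc_on A u \<longleftrightarrow>
     (\<forall>(t, x)\<in>A. \<forall>\<epsilon>>0. \<forall>\<^sub>F (s, y) in at (t, x) within A. u s y > u t x - \<epsilon>)"

definition bounded_Q :: "(real \<Rightarrow> real \<Rightarrow> real) \<Rightarrow> bool" where
  "bounded_Q u \<longleftrightarrow> bounded ((\<lambda>(t, x). u t x) ` Q)"

definition quartic_test :: "real \<Rightarrow> (real \<Rightarrow> real \<Rightarrow> real) \<Rightarrow> bool" where
  "quartic_test x0 \<phi> \<longleftrightarrow> (\<exists>c g. \<forall>(t, x)\<in>Q. \<phi> t x = c * \<bar>x - x0\<bar> ^ 4 + g t)"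

definition subsolution :: "real \<Rightarrow> (real \<Rightarrow> real \<Rightarrow> real) \<Rightarrow> bool" where
  "subsolution \<rho> u \<longleftrightarrow> bounded_Q u \<and> usc_on Q u \<and>
     (\<forall>\<phi> t x. C2_Q \<phi> \<and> (t, x) \<in> Q \<and> (\<forall>(s, y)\<in>Q. u s y - \<phi> s y \<le> u t x - \<phi> t x) \<longrightarrow>
        (d_x \<phi> t x \<noteq> 0 \<longrightarrow> d_t \<phi> t x \<le> hamiltonian \<rho> \<phi> u t x) \<and>
        (quartic_test x \<phi> \<longrightarrow> d_t \<phi> t x \<le> 0))"

definition supersolution :: "real \<Rightarrow> (real \<Rightarrow> real \<Rightarrow> real) \<Rightarrow> bool" where
  "supersolution \<rho> v \<longleftrightarrow> bounded_Q v \<and> lsc_on Q v \<and>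
     (\<forall>\<psi> t x. C2_Q \<psi> \<and> (t, x) \<in> Q \<and> (\<forall>(s, y)\<in>Q. v s y - \<psi> s y \<ge> v t x - \<psi> t x) \<longrightarrow>
        (d_x \<psi> t x \<noteq> 0 \<longrightarrow> d_t \<psi> t x \<ge> hamiltonian \<rho> \<psi> v t x) \<and>
        (quartic_test x \<psi> \<longrightarrow> d_t \<psi> t x \<ge> 0))"

text \<open>
  For \<open>t > 0\<close> the ball contains \<open>(t, x)\<close> itself and these are the semicontinuous envelopes; for
  \<open>t = 0\<close> they are the limsup and liminf from \<^const>\<open>Q\<close>.  They are meaningful only for \<open>u\<close>
  bounded on \<^const>\<open>Q\<close>, since \<open>Sup\<close> and \<open>Inf\<close> are taken in \<open>real\<close>.
\<close>

definition usc_envelope :: "(real \<Rightarrow> real \<Rightarrow> real) \<Rightarrow> real \<Rightarrow> real \<Rightarrow> real" where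
  "usc_envelope u t x = (INF r\<in>{0<..}. SUP (s, y)\<in>ball (t, x) r \<inter> Q. u s y)"

definition lsc_envelope :: "(real \<Rightarrow> real \<Rightarrow> real) \<Rightarrow> real \<Rightarrow> real \<Rightarrow> real" where
  "lsc_envelope u t x = (SUP r\<in>{0<..}. INF (s, y)\<in>ball (t, x) r \<inter> Q. u s y)"

definition viscosity_solution :: "real \<Rightarrow> (real \<Rightarrow> real \<Rightarrow> real) \<Rightarrow> bool" where
  "viscosity_solution \<rho> u \<longleftrightarrow>
     bounded_Q u \<and> subsolution \<rho> (usc_envelope u) \<and> supersolution \<rho> (lsc_envelope u)"

definition has_initial_datum :: "(real \<Rightarrow> real \<Rightarrow> real) \<Rightarrow> (real \<Rightarrow> real) \<Rightarrow> bool" where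
  "has_initial_datum u u0 \<longleftrightarrow> (\<forall>x. usc_envelope u 0 x = u0 x \<and> lsc_envelope u 0 x = u0 x)"

text \<open>
  A viscosity solution is a function on \<^const>\<open>Q\<close>, so uniqueness is uniqueness there; on
  \<open>[0,\<infinity>) \<times> \<real>\<close> it is extended by its initial datum.
\<close>

definition the_viscosity_solution ::
    "real \<Rightarrow> (real \<Rightarrow> real) \<Rightarrow> (real \<Rightarrow> real \<Rightarrow> real) \<Rightarrow> bool" where
  "the_viscosity_solution \<rho> u0 u \<longleftrightarrow>
     viscosity_solution \<rho> u \<and> has_initial_datum u u0 \<and> (\<forall>x. u 0 x = u0 x) \<and>
     (\<forall>v. viscosity_solution \<rho> v \<and> has_initial_datum v u0 \<longrightarrow> (\<forall>(t, x)\<in>Q. v t x = u t x))"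

definition modulus_of_continuity :: "(real \<Rightarrow> real) \<Rightarrow> (real \<Rightarrow> real) \<Rightarrow> bool" where
  "modulus_of_continuity \<omega> f \<longleftrightarrow>
     (\<forall>d\<ge>0. \<omega> d \<ge> 0) \<and> \<omega> 0 = 0 \<and> (\<omega> \<longlongrightarrow> 0) (at_right 0) \<and>
     (\<forall>x y. \<bar>f x - f y\<bar> \<le> \<omega> \<bar>x - y\<bar>)"

end

theory Submission imports Defs begin

text \<open>
  Let \<open>u\<close> be the upper half-relaxed limit of \<open>u\<^sub>n\<close> and \<open>w\<close> that of \<open>- u\<^sub>n\<close>, which is the step
  function of the flow with reversed charges.  At a point where a test function \<open>\<phi>\<close> touches the step
  function from above there is a charged particle, which moves at least as fast as the contact
  point; its velocity is a sum over the other particles, which up to an error vanishing with \<open>n\<close> is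
  the nonlocal term of the equation, because the step function lies below \<open>\<phi>\<close>.
  Hence \<open>u\<close> and \<open>w\<close> are subsolutions, and barriers control them at \<open>t = 0\<close>.  The comparison
  principle, in a form that includes a spatial shift \<open>h\<close>, yields \<open>u(t, y) + w(t, y + h) \<le> c\<close>
  whenever \<open>u0(y) - u0(y + h) \<le> c\<close>.  For \<open>h = 0\<close> this gives \<open>w = - u\<close>, hence continuity and locally
  uniform convergence; for general \<open>h\<close> it is the propagation of the modulus of continuity.
\<close>

subsection \<open>Particle flows and their upper step functions\<close>

text \<open>The obstacle is that the interaction 1/(x_i - x_j) is singular exactly where charges
  annihilate, so velocities cannot be controlled up to a collision. They are examined only at
  contacts, where the test function bounds the charges near the particle from one side; a collision
  enters only through conservation of charge at its site. The link with the equation is exact before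
  any estimate: a unit step at distance d, integrated against 1/z^2, gives 1/d, so a velocity is the
  nonlocal term of the step function of the other particles. What remains is the missing jump of the
  particle itself, of size 1/n, which the singular kernel would amplify near z = 0; integrality of
  the charges prevents this. Two features of the solution notion shape the rest. A vanishing
  gradient gives information only for exact quartics, so the test functions in the comparison
  argument are exact quartics in space. And the radius \<rho> is fixed, while the comparison needs
  arbitrarily small radii, so the inequality has to be transferred to all smaller ones.\<close>

definition velocity :: "nat \<Rightarrow> (nat \<Rightarrow> real) \<Rightarrow> (nat \<Rightarrow> real) \<Rightarrow> nat \<Rightarrow> real" where
  "velocity n x b i = (1 / real n) * (\<Sum>j\<in>{1..n} - {i}. b i * b j / (x i - x j))"

definition particle_flow :: "nat \<Rightarrow> (real \<Rightarrow> nat \<Rightarrow> real) \<Rightarrow> (real \<Rightarrow> nat \<Rightarrow> real) \<Rightarrow> bool" where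
  "particle_flow n x b \<longleftrightarrow>
     (\<forall>t\<ge>0. (x t, b t) \<in> configurations n) \<and>
     (\<forall>i\<in>{1..n}. continuous_on {0..} (\<lambda>t. x t i)) \<and>
     (\<forall>t\<ge>0. \<forall>i\<in>{1..n}. \<forall>\<^sub>F s in at_right t. b s i = b t i) \<and>
     (\<forall>t>0. \<exists>\<beta>. (\<forall>i\<in>{1..n}. \<forall>\<^sub>F s in at_left t. b s i = \<beta> i) \<and>
        (\<forall>y. (\<Sum>i | i \<in> {1..n} \<and> x t i = y. b t i - \<beta> i) = 0)) \<and>
     (\<forall>T>0. \<exists>S. finite S \<and> (\<forall>t\<in>{0<..<T} - S. \<forall>i\<in>{1..n}.
        (\<forall>\<^sub>F s in at_left t. b s i = b t i) \<and>
        ((\<lambda>s. x s i) has_real_derivative velocity n (x t) (b t) i) (at t)))"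

lemma charge_values_eq:
  assumes "u \<in> {-1, 0, 1::real}" "v \<in> {-1, 0, 1}" "\<bar>u - v\<bar> < 1" shows "u = v"
  using assms by auto

lemma charge_values_tendsto:
  fixes f :: "real \<Rightarrow> real"
  assumes "(f \<longlongrightarrow> f t) F" "f t \<in> {-1, 0, 1}" "\<forall>\<^sub>F s in F. f s \<in> {-1, 0, 1}"
  shows "\<forall>\<^sub>F s in F. f s = f t"
proof -
  have "\<forall>\<^sub>F s in F. dist (f s) (f t) < 1"
    using assms(1) by (rule tendstoD) simp
  with assms(3) show ?thesis
    by eventually_elim (rule charge_values_eq, use assms(2) in \<open>auto simp: dist_real_def\<close>)
qed

text \<open>The charges take three values, so one-sided continuity means being eventually constant
  on that side. Since S is finite, every t > 0 has an S-free interval to its left, on which all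
  charges are constant; their values there are the \<beta> of the flow.\<close>

lemma flow_of_solution:
  assumes "particle_solution n x0 b0 x b"
  shows "particle_flow n x b"
proof -
  have conf: "(x t, b t) \<in> configurations n" if "t \<ge> 0" for t
    using assms that unfolding particle_solution_def particle_solution_on_def
    by (auto dest!: spec[of _ "t + 1"])
  have val: "b t i \<in> {-1, 0, 1}" if "t \<ge> 0" "i \<in> {1..n}" for t i
    using conf[OF that(1)] that(2) unfolding configurations_def by auto
  have ex: "\<exists>S. finite S \<and> S \<subseteq> {0<..T} \<and>
       (\<forall>i\<in>{1..n}. continuous_on {0..T} (\<lambda>t. x t i) \<and> C1_within (\<lambda>t. x t i) ({0..T} - S)) \<and>
       (\<forall>i\<in>{1..n}. \<forall>t\<in>{0..<T}. continuous (at t within {t..T}) (\<lambda>s. b s i)) \<and>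
       (\<forall>i\<in>{1..n}. \<forall>t. jumps_at T (\<lambda>r. b r i) t \<longrightarrow>
          t \<in> S \<and> \<bar>Lim (at_left t) (\<lambda>s. b s i)\<bar> = 1 \<and> b t i = 0) \<and>
       (\<forall>\<tau>\<in>S. \<forall>y. (\<Sum>i | i \<in> {1..n} \<and> x \<tau> i = y. b \<tau> i - Lim (at_left \<tau>) (\<lambda>s. b s i)) = 0) \<and>
       (\<forall>t\<in>{0<..<T} - S. \<forall>i\<in>{1..n}.
          ((\<lambda>s. x s i) has_real_derivative velocity n (x t) (b t) i) (at t))" if "T > 0" for T
  proof -
    have "particle_solution_on n T x0 b0 x b"
      using assms that unfolding particle_solution_def by simp
    then show ?thesis
      unfolding particle_solution_on_def velocity_def
      apply (elim conjE exE)
      subgoal for S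
        by (rule exI[of _ S], intro conjI; assumption)
      done
  qed
  have cont: "isCont (\<lambda>s. b s i) t"
    if "0 < t" "t < T" "i \<in> {1..n}" "\<not> jumps_at T (\<lambda>r. b r i) t" for t T i
  proof -
    have "continuous (at t within {0..T}) (\<lambda>s. b s i)"
      using that unfolding jumps_at_def by auto
    moreover have "at t within {0..T} = at t"
      using that by (intro at_within_interior) auto
    ultimately show ?thesis by simp
  qed
  have loc: "\<forall>\<^sub>F s in at t. b s i = b t i"
    if "0 < t" "t < T" "i \<in> {1..n}" "\<not> jumps_at T (\<lambda>r. b r i) t" for t T i
  proof (rule charge_values_tendsto)
    show "((\<lambda>s. b s i) \<longlongrightarrow> b t i) (at t)"
      using cont[OF that] by (simp add: isCont_def)
    show "b t i \<in> {-1, 0, 1}" using val that by auto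
    have "\<forall>\<^sub>F s in at t. 0 < s"
      using that(1) by (rule order_tendstoD(1)[OF tendsto_ident_at])
    then show "\<forall>\<^sub>F s in at t. b s i \<in> {-1, 0, 1}"
      by eventually_elim (rule val, use that in auto)
  qed
  have 1: "continuous_on {0..} (\<lambda>t. x t i)" if i: "i \<in> {1..n}" for i
    unfolding continuous_on_eq_continuous_within
  proof
    fix t :: real assume t: "t \<in> {0..}"
    have "continuous_on {0..t+1} (\<lambda>t. x t i)"
      using ex[of "t + 1"] t i by auto
    then have "continuous (at t within {0..t+1}) (\<lambda>t. x t i)"
      using t by (auto simp: continuous_on_eq_continuous_within)
    moreover have "at t within {0..} = at t within {0..t+1}"
      by (rule at_within_nhd[where S = "{..<t+1}"]) auto
    ultimately show "continuous (at t within {0..}) (\<lambda>t. x t i)" by simp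
  qed
  have 2: "\<forall>\<^sub>F s in at_right t. b s i = b t i" if t: "t \<ge> 0" and i: "i \<in> {1..n}" for t i
  proof (rule charge_values_tendsto)
    have "continuous (at t within {t..t+1}) (\<lambda>s. b s i)"
    proof -
      have "0 < t + 1" "t \<in> {0..<t+1}" using t by auto
      with ex[OF this(1)] i show ?thesis by (elim exE conjE) (drule bspec, assumption)+
    qed
    moreover have "at t within {t..t+1} = at_right t"
      using at_within_Icc_at_right[of t "t + 1"] by simp
    ultimately show "((\<lambda>s. b s i) \<longlongrightarrow> b t i) (at_right t)"
      by (simp add: continuous_within)
    show "b t i \<in> {-1, 0, 1}" using val t i by auto
    show "\<forall>\<^sub>F s in at_right t. b s i \<in> {-1, 0, 1}"
      using eventually_at_right_less[of t] by eventually_elim (rule val, use t i in auto)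
  qed
  have 3: "\<exists>S. finite S \<and> (\<forall>t\<in>{0<..<T} - S. \<forall>i\<in>{1..n}.
        (\<forall>\<^sub>F s in at_left t. b s i = b t i) \<and>
        ((\<lambda>s. x s i) has_real_derivative velocity n (x t) (b t) i) (at t))" if T: "T > 0" for T
  proof -
    obtain S where S: "finite S" "\<forall>i\<in>{1..n}. \<forall>t. jumps_at T (\<lambda>r. b r i) t \<longrightarrow>
          t \<in> S \<and> \<bar>Lim (at_left t) (\<lambda>s. b s i)\<bar> = 1 \<and> b t i = 0"
      "\<forall>t\<in>{0<..<T} - S. \<forall>i\<in>{1..n}.
          ((\<lambda>s. x s i) has_real_derivative velocity n (x t) (b t) i) (at t)"
      using ex[OF T] by (elim exE conjE) (rule that, assumption+)
    have "\<forall>\<^sub>F s in at_left t. b s i = b t i" if "t \<in> {0<..<T} - S" "i \<in> {1..n}" for t i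
    proof (rule filter_leD[OF at_le loc[of t T i]])
      show "\<not> jumps_at T (\<lambda>r. b r i) t"
        using bspec[OF S(2) that(2)] that(1) by (metis DiffE)
    qed (use that in auto)
    then show ?thesis using S(1,3) by (intro exI[of _ S] conjI ballI) simp_all
  qed
  have 4: "\<exists>\<beta>. (\<forall>i\<in>{1..n}. \<forall>\<^sub>F s in at_left t. b s i = \<beta> i) \<and>
        (\<forall>y. (\<Sum>i | i \<in> {1..n} \<and> x t i = y. b t i - \<beta> i) = 0)" if t: "t > 0" for t
  proof -
    obtain S where S: "finite S" "S \<subseteq> {0<..t+1}" "\<forall>i\<in>{1..n}. \<forall>s. jumps_at (t+1) (\<lambda>r. b r i) s \<longrightarrow>
          s \<in> S \<and> \<bar>Lim (at_left s) (\<lambda>s. b s i)\<bar> = 1 \<and> b s i = 0"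
      "\<forall>\<tau>\<in>S. \<forall>y. (\<Sum>i | i \<in> {1..n} \<and> x \<tau> i = y. b \<tau> i - Lim (at_left \<tau>) (\<lambda>s. b s i)) = 0"
    proof -
      have "0 < t + 1" using t by simp
      from ex[OF this] show ?thesis by (elim exE conjE) (rule that, assumption+)
    qed
    have "\<forall>\<^sub>F s in at t. s \<notin> S - {t}"
      using S(1) by (metis finite_Diff islimpt_finite islimpt_iff_eventually)
    then have "\<forall>\<^sub>F s in at_left t. s \<notin> S - {t}"
      by (simp add: eventually_at_split)
    then obtain a where a: "a < t" "\<forall>s. a < s \<longrightarrow> s < t \<longrightarrow> s \<notin> S - {t}"
      unfolding eventually_at_left_field by auto
    define c where "c = max a 0"
    have c: "c < t" "0 \<le> c" using a t by (auto simp: c_def)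
    have noS: "s \<notin> S" if "s \<in> {c<..<t}" for s
      using a(2) that by (auto simp: c_def)
    have "\<exists>\<beta>. \<forall>s\<in>{c<..<t}. b s i = \<beta>" if i: "i \<in> {1..n}" for i
    proof -
      have "continuous_on {c<..<t} (\<lambda>s. b s i)"
      proof (intro continuous_at_imp_continuous_on ballI)
        fix s assume s: "s \<in> {c<..<t}"
        have "\<not> jumps_at (t+1) (\<lambda>r. b r i) s"
          using bspec[OF S(3) i] noS[OF s] by metis
        with s c i show "isCont (\<lambda>s. b s i) s"
          by (intro cont[of s "t+1"]) simp_all
      qed
      moreover have "(\<lambda>s. b s i) ` {c<..<t} \<subseteq> {-1, 0, 1}"
      proof (rule image_subsetI)
        fix s assume "s \<in> {c<..<t}"
        with c have "0 \<le> s" by simp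
        then show "b s i \<in> {-1, 0, 1}" by (rule val) (rule i)
      qed
      then have "finite ((\<lambda>s. b s i) ` {c<..<t})"
        by (rule finite_subset) simp
      ultimately have "(\<lambda>s. b s i) constant_on {c<..<t}"
        by (intro continuous_finite_range_constant) auto
      then show ?thesis by (auto simp: constant_on_def)
    qed
    then obtain \<beta> where \<beta>: "\<And>i s. i \<in> {1..n} \<Longrightarrow> s \<in> {c<..<t} \<Longrightarrow> b s i = \<beta> i"
      by metis
    have ev: "\<forall>\<^sub>F s in at_left t. b s i = \<beta> i" if i: "i \<in> {1..n}" for i
      using eventually_at_left_real[OF c(1)] by eventually_elim (use \<beta> i in auto)
    \<comment> \<open>At times in S the sum rule is given in terms of \<open>Lim\<close>, which
      equals \<beta>; at other times no charge jumps and every summand vanishes.\<close>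
    have "(\<Sum>i | i \<in> {1..n} \<and> x t i = y. b t i - \<beta> i) = 0" for y
    proof (cases "t \<in> S")
      case True
      have "Lim (at_left t) (\<lambda>s. b s i) = \<beta> i" if "i \<in> {1..n}" for i
        by (intro tendsto_Lim tendsto_eventually ev that) simp
      then have "(\<Sum>i | i \<in> {1..n} \<and> x t i = y. b t i - \<beta> i) =
          (\<Sum>i | i \<in> {1..n} \<and> x t i = y. b t i - Lim (at_left t) (\<lambda>s. b s i))"
        by (intro sum.cong) auto
      also have "\<dots> = 0" using S(4) True by blast
      finally show ?thesis .
    next
      case False
      have "b t i = \<beta> i" if i: "i \<in> {1..n}" for i
      proof -
        have "\<forall>\<^sub>F s in at_left t. b s i = b t i"
        proof (rule filter_leD[OF at_le loc[of t "t+1" i]])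
          show "\<not> jumps_at (t+1) (\<lambda>r. b r i) t"
            using bspec[OF S(3) i] False by metis
        qed (use t i in auto)
        with ev[OF i] have "\<forall>\<^sub>F s in at_left t. b t i = \<beta> i"
          by eventually_elim auto
        then show ?thesis by simp
      qed
      then show ?thesis by (intro sum.neutral) auto
    qed
    with ev show ?thesis by (intro exI[of _ \<beta>]) simp
  qed
  show ?thesis
    unfolding particle_flow_def
    by (intro conjI allI impI ballI) (assumption | rule conf 1 2 3 4)+
qed

lemma configurations_neg:
  "(x, b) \<in> configurations n \<Longrightarrow> (x, \<lambda>i. - b i) \<in> configurations n"
  unfolding configurations_def by auto

text \<open>The velocity is quadratic in the charges, hence unchanged when all of them change
  sign.\<close>

lemma particle_flow_neg:
  assumes "particle_flow n x b"
  shows "particle_flow n x (\<lambda>t i. - b t i)"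
proof -
  have v: "velocity n y (\<lambda>i. - c i) = velocity n y c" for y c
    by (simp add: velocity_def fun_eq_iff)
  have 4: "\<exists>\<beta>. (\<forall>i\<in>{1..n}. \<forall>\<^sub>F s in at_left t. - b s i = \<beta> i) \<and>
        (\<forall>y. (\<Sum>i | i \<in> {1..n} \<and> x t i = y. - b t i - \<beta> i) = 0)" if t: "t > 0" for t
  proof -
    obtain \<beta> where \<beta>: "\<forall>i\<in>{1..n}. \<forall>\<^sub>F s in at_left t. b s i = \<beta> i"
        "\<forall>y. (\<Sum>i | i \<in> {1..n} \<and> x t i = y. b t i - \<beta> i) = 0"
      using assms t unfolding particle_flow_def by blast
    have "(\<Sum>i | i \<in> {1..n} \<and> x t i = y. - b t i - - \<beta> i) = - (\<Sum>i | i \<in> {1..n} \<and> x t i = y. b t i - \<beta> i)" for y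
      by (simp add: sum_negf[symmetric])
    with \<beta> show ?thesis by (intro exI[of _ "\<lambda>i. - \<beta> i"]) simp
  qed
  have "\<exists>S. finite S \<and> (\<forall>t\<in>{0<..<T} - S. \<forall>i\<in>{1..n}.
        (\<forall>\<^sub>F s in at_left t. - b s i = - b t i) \<and>
        ((\<lambda>s. x s i) has_real_derivative velocity n (x t) (\<lambda>i. - b t i) i) (at t))" if "T > 0" for T
  proof -
    have "\<forall>T>0. \<exists>S. finite S \<and> (\<forall>t\<in>{0<..<T} - S. \<forall>i\<in>{1..n}.
        (\<forall>\<^sub>F s in at_left t. b s i = b t i) \<and>
        ((\<lambda>s. x s i) has_real_derivative velocity n (x t) (b t) i) (at t))"
      using assms unfolding particle_flow_def by (elim conjE)
    with that show ?thesis unfolding v neg_equal_iff_equal by simp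
  qed
  moreover have "\<forall>t\<ge>0. (x t, \<lambda>i. - b t i) \<in> configurations n"
    using assms configurations_neg unfolding particle_flow_def by blast
  moreover have "\<forall>i\<in>{1..n}. continuous_on {0..} (\<lambda>t. x t i)"
    using assms unfolding particle_flow_def by (elim conjE)
  moreover have "\<forall>t\<ge>0. \<forall>i\<in>{1..n}. \<forall>\<^sub>F s in at_right t. - b s i = - b t i"
    using assms unfolding particle_flow_def neg_equal_iff_equal by (elim conjE)
  ultimately show ?thesis
    using 4 unfolding particle_flow_def by (intro conjI allI impI) simp_all
qed

section \<open>The upper semicontinuous version of the step function\<close>

text \<open>The step function is right-continuous and its left limit is the first sum, so this is
  the larger of left limit and value: the upper semicontinuous envelope in y. Maxima of the envelope
  minus a continuous function are therefore attained on compact intervals.\<close>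

definition upper_step :: "nat \<Rightarrow> (nat \<Rightarrow> real) \<Rightarrow> (nat \<Rightarrow> real) \<Rightarrow> real \<Rightarrow> real" where
  "upper_step n x b y =
     ((\<Sum>j=1..n. b j * of_bool (x j < y)) + max 0 (\<Sum>j=1..n. b j * of_bool (x j = y))) / real n"

lemma step_function_split:
  "step_function n x b y =
     ((\<Sum>j=1..n. b j * of_bool (x j < y)) + (\<Sum>j=1..n. b j * of_bool (x j = y))) / real n"
  unfolding step_function_def heaviside_def sum.distrib[symmetric]
  unfolding mult.commute[of "1 / real n"] times_divide_eq_right mult_1_right
  by (intro arg_cong[of _ _ "\<lambda>s. s / real n"] sum.cong) auto

lemma step_le_upper_step: "step_function n x b y \<le> upper_step n x b y"
  unfolding step_function_split upper_step_def by (intro divide_right_mono add_left_mono) auto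

lemma upper_step_cases:
  "upper_step n x b y = step_function n x b y \<or>
   upper_step n x b y = (\<Sum>j=1..n. b j * of_bool (x j < y)) / real n"
  unfolding step_function_split upper_step_def by (auto simp: max_def)

lemma charge_sum_bound:
  assumes "(x, b) \<in> configurations n" "\<And>j. \<bar>c j\<bar> \<le> 1"
  shows "\<bar>\<Sum>j=1..n. b j * c j\<bar> / real n \<le> 1"
proof -
  have "\<bar>b j * c j\<bar> \<le> 1" if "j \<in> {1..n}" for j
  proof -
    have "\<bar>b j\<bar> \<le> 1" using assms(1) that unfolding configurations_def by fastforce
    then show ?thesis using mult_mono[of "\<bar>b j\<bar>" 1 "\<bar>c j\<bar>" 1] assms(2)[of j] by (simp add: abs_mult)
  qed
  note * = this
  have "\<bar>\<Sum>j=1..n. b j * c j\<bar> \<le> (\<Sum>j=1..n. \<bar>b j * c j\<bar>)" by (rule sum_abs)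
  also have "\<dots> \<le> (\<Sum>j=1..n. 1)"
    using * by (intro sum_mono) auto
  finally show ?thesis by (cases "n = 0") (auto simp: divide_simps)
qed

lemma step_function_bound:
  assumes "(x, b) \<in> configurations n" shows "\<bar>step_function n x b y\<bar> \<le> 1"
  using charge_sum_bound[OF assms, of "\<lambda>j. heaviside (y - x j)"]
  by (simp add: step_function_def heaviside_def abs_mult)

lemma upper_step_bound:
  assumes "(x, b) \<in> configurations n" shows "\<bar>upper_step n x b y\<bar> \<le> 1"
  using upper_step_cases[of n x b y] step_function_bound[OF assms, of y]
    charge_sum_bound[OF assms, of "\<lambda>j. of_bool (x j < y)"]
  by (auto simp: abs_mult)

text \<open>Points slightly to the left see the lower sum, so that suprema over open sets agree.\<close>

lemma upper_step_attained:
  assumes "\<delta> > 0"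
  shows "\<exists>y'. \<bar>y' - y\<bar> < \<delta> \<and> step_function n x b y' = upper_step n x b y"
proof (cases "upper_step n x b y = step_function n x b y")
  case True
  with assms show ?thesis by (intro exI[of _ y]) auto
next
  case False
  then have *: "upper_step n x b y = (\<Sum>j=1..n. b j * of_bool (x j < y)) / real n"
    using upper_step_cases by blast
  have "\<forall>\<^sub>F y' in at_left y. \<forall>j\<in>{1..n}. x j < y \<longrightarrow> x j < y'"
  proof (intro eventually_ball_finite finite_atLeastAtMost ballI)
    fix j assume "j \<in> {1..n}"
    show "\<forall>\<^sub>F y' in at_left y. x j < y \<longrightarrow> x j < y'"
      by (cases "x j < y") (auto intro: order_tendstoD(1)[OF tendsto_ident_at])
  qed
  moreover have "\<forall>\<^sub>F y' in at_left y. y' > y - \<delta>"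
    using assms by (intro order_tendstoD(1)[OF tendsto_ident_at]) auto
  moreover have "\<forall>\<^sub>F y' in at_left y. y' < y"
    by (simp add: eventually_at_filter)
  ultimately have "\<forall>\<^sub>F y' in at_left y. \<bar>y' - y\<bar> < \<delta> \<and> y' < y \<and> (\<forall>j\<in>{1..n}. x j < y \<longrightarrow> x j < y')"
    by eventually_elim auto
  then obtain y' where y': "\<bar>y' - y\<bar> < \<delta>" "y' < y" "\<forall>j\<in>{1..n}. x j < y \<longrightarrow> x j < y'"
    using eventually_happens'[OF trivial_limit_at_left_real] by blast
  have "step_function n x b y' = upper_step n x b y"
    unfolding * step_function_def heaviside_def mult.commute[of "1 / real n"] times_divide_eq_right mult_1_right
    by (intro arg_cong[of _ _ "\<lambda>s. s / real n"] sum.cong) (use y' in fastforce)+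
  with y' show ?thesis by blast
qed

text \<open>Only charged particles count, and only through the side of the evaluation point on which
  they lie. Hence moving the evaluation point along with a charged particle leaves the value
  unchanged as long as the order of the charges is kept.\<close>

lemma upper_step_cong:
  assumes "\<And>j. j \<in> {1..n} \<Longrightarrow> b' j = b j"
    and "\<And>j. j \<in> {1..n} \<Longrightarrow> b j \<noteq> 0 \<Longrightarrow> (x' j < y' \<longleftrightarrow> x j < y) \<and> (x' j = y' \<longleftrightarrow> x j = y)"
  shows "upper_step n x' b' y' = upper_step n x b y"
proof -
  have "(\<Sum>j=1..n. b' j * of_bool (x' j < y')) = (\<Sum>j=1..n. b j * of_bool (x j < y))"
  proof (intro sum.cong refl)
    fix j assume "j \<in> {1..n}"
    then show "b' j * of_bool (x' j < y') = b j * of_bool (x j < y)"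
      using assms(1)[of j] assms(2)[of j] by (cases "b j = 0") auto
  qed
  moreover have "(\<Sum>j=1..n. b' j * of_bool (x' j = y')) = (\<Sum>j=1..n. b j * of_bool (x j = y))"
  proof (intro sum.cong refl)
    fix j assume "j \<in> {1..n}"
    then show "b' j * of_bool (x' j = y') = b j * of_bool (x j = y)"
      using assms(1)[of j] assms(2)[of j] by (cases "b j = 0") auto
  qed
  ultimately show ?thesis unfolding upper_step_def by simp
qed

lemma charged_order:
  assumes "(x, b) \<in> configurations n" "i \<in> {1..n}" "j \<in> {1..n}" "b i \<noteq> 0" "b j \<noteq> 0"
  shows "x i < x j \<longleftrightarrow> i < j" "x i = x j \<longleftrightarrow> i = j"
proof -
  have *: "x k < x l" if "k < l" "k \<in> {1..n}" "l \<in> {1..n}" "b k \<noteq> 0" "b l \<noteq> 0" for k l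
    using assms(1) that unfolding configurations_def by auto
  show "x i < x j \<longleftrightarrow> i < j" "x i = x j \<longleftrightarrow> i = j"
    using *[of i j] *[of j i] assms by (cases i j rule: linorder_cases; force)+
qed

lemma separation:
  fixes x :: "nat \<Rightarrow> real"
  obtains \<delta> where "\<delta> > 0" "\<And>x' y' j. \<lbrakk>j \<in> {1..n}; x j \<noteq> y; \<bar>x' j - x j\<bar> < \<delta>; \<bar>y' - y\<bar> < \<delta>\<rbrakk>
    \<Longrightarrow> (x' j < y' \<longleftrightarrow> x j < y) \<and> x' j \<noteq> y'"
proof -
  \<comment> \<open>Half the distance, so that particle and evaluation point may both move without
    meeting; the 1 keeps the set nonempty.\<close>
  define \<delta> where "\<delta> = Min (insert 1 ((\<lambda>j. \<bar>x j - y\<bar> / 2) ` {j\<in>{1..n}. x j \<noteq> y}))"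
  have "\<delta> > 0" unfolding \<delta>_def by (subst Min_gr_iff) auto
  moreover have "(x' j < y' \<longleftrightarrow> x j < y) \<and> x' j \<noteq> y'"
    if "j \<in> {1..n}" "x j \<noteq> y" "\<bar>x' j - x j\<bar> < \<delta>" "\<bar>y' - y\<bar> < \<delta>" for x' y' j
  proof -
    have "\<delta> \<le> \<bar>x j - y\<bar> / 2" unfolding \<delta>_def using that by (intro Min_le) auto
    with that(3,4) have a: "\<bar>x' j - x j\<bar> < \<bar>x j - y\<bar> / 2" "\<bar>y' - y\<bar> < \<bar>x j - y\<bar> / 2" by auto
    have "x j < y \<or> x j > y" using that(2) by linarith
    then show ?thesis using a by (elim disjE) (simp_all add: abs_if split: if_splits)
  qed
  ultimately show ?thesis using that by blast
qed

lemma upper_step_near_uncharged: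
  assumes "\<And>i. i \<in> {1..n} \<Longrightarrow> x i = y \<Longrightarrow> b i = 0"
  obtains \<delta> where "\<delta> > 0"
    "\<And>x' y'. (\<And>i. i \<in> {1..n} \<Longrightarrow> \<bar>x' i - x i\<bar> < \<delta>) \<Longrightarrow> \<bar>y' - y\<bar> < \<delta> \<Longrightarrow>
       upper_step n x' b y' = upper_step n x b y"
proof -
  obtain \<delta> where \<delta>: "\<delta> > 0" "\<And>x' y' j. \<lbrakk>j \<in> {1..n}; x j \<noteq> y; \<bar>x' j - x j\<bar> < \<delta>; \<bar>y' - y\<bar> < \<delta>\<rbrakk>
    \<Longrightarrow> (x' j < y' \<longleftrightarrow> x j < y) \<and> x' j \<noteq> y'"
    using separation[of n x y] by metis
  have "upper_step n x' b y' = upper_step n x b y"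
    if "\<And>i. i \<in> {1..n} \<Longrightarrow> \<bar>x' i - x i\<bar> < \<delta>" "\<bar>y' - y\<bar> < \<delta>" for x' y'
  proof (rule upper_step_cong)
    fix j assume "j \<in> {1..n}" "b j \<noteq> 0"
    then show "(x' j < y' \<longleftrightarrow> x j < y) \<and> (x' j = y' \<longleftrightarrow> x j = y)"
      using \<delta>(2)[of j x' y'] that assms[of j] by metis
  qed simp
  with \<delta>(1) show ?thesis using that by blast
qed

text \<open>At most one charged particle sits at y. All other charged ones lie on a definite side
  and contribute a constant L under small perturbations; only the side of particle i varies.\<close>

lemma upper_step_near_charged:
  assumes "(x, b) \<in> configurations n" "i \<in> {1..n}" "x i = y" "b i \<noteq> 0"
  obtains L \<delta> where "\<delta> > 0"
    "\<And>x' y'. (\<And>i. i \<in> {1..n} \<Longrightarrow> \<bar>x' i - x i\<bar> < \<delta>) \<Longrightarrow> \<bar>y' - y\<bar> < \<delta> \<Longrightarrow>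
       upper_step n x' b y' = (L + b i * of_bool (x' i < y') + max 0 (b i * of_bool (x' i = y'))) / real n"
proof -
  obtain \<delta> where \<delta>: "\<delta> > 0" "\<And>x' y' j. \<lbrakk>j \<in> {1..n}; x j \<noteq> y; \<bar>x' j - x j\<bar> < \<delta>; \<bar>y' - y\<bar> < \<delta>\<rbrakk>
    \<Longrightarrow> (x' j < y' \<longleftrightarrow> x j < y) \<and> x' j \<noteq> y'"
    using separation[of n x y] by metis
  define L where "L = (\<Sum>j\<in>{1..n}-{i}. b j * of_bool (x j < y))"
  have "upper_step n x' b y' = (L + b i * of_bool (x' i < y') + max 0 (b i * of_bool (x' i = y'))) / real n"
    if "\<And>i. i \<in> {1..n} \<Longrightarrow> \<bar>x' i - x i\<bar> < \<delta>" "\<bar>y' - y\<bar> < \<delta>" for x' y'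
  proof -
    have *: "b j \<noteq> 0 \<Longrightarrow> (x' j < y' \<longleftrightarrow> x j < y) \<and> x' j \<noteq> y'" if "j \<in> {1..n} - {i}" for j
    proof -
      assume "b j \<noteq> 0"
      then have "x j \<noteq> y" using charged_order(2)[OF assms(1), of j i] assms that by auto
      then show ?thesis using \<delta>(2)[of j x' y'] that \<open>\<And>i. i \<in> {1..n} \<Longrightarrow> \<bar>x' i - x i\<bar> < \<delta>\<close> \<open>\<bar>y' - y\<bar> < \<delta>\<close> by auto
    qed
    have "(\<Sum>j\<in>{1..n}-{i}. b j * of_bool (x' j < y')) = L"
      unfolding L_def
    proof (intro sum.cong refl)
      fix j assume "j \<in> {1..n} - {i}"
      then show "b j * of_bool (x' j < y') = b j * of_bool (x j < y)"
        using *[of j] by (cases "b j = 0") auto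
    qed
    then have 1: "(\<Sum>j=1..n. b j * of_bool (x' j < y')) = b i * of_bool (x' i < y') + L"
      using assms(2) by (subst sum.remove[of _ i]) auto
    have "(\<Sum>j\<in>{1..n}-{i}. b j * of_bool (x' j = y')) = 0"
      using * by (intro sum.neutral ballI) force
    then have 2: "(\<Sum>j=1..n. b j * of_bool (x' j = y')) = b i * of_bool (x' i = y')"
      using assms(2) by (subst sum.remove[of _ i]) auto
    show ?thesis unfolding upper_step_def 1 2 by (simp add: add.commute)
  qed
  with \<delta>(1) show ?thesis using that by blast
qed

text \<open>With the charges frozen, the local formula never exceeds
  \<open>(L + max 0 (b i)) / n\<close>, its value when particle i is at the evaluation
  point.\<close>

lemma upper_step_usc:
  assumes "(x, b) \<in> configurations n"
  obtains \<delta> where "\<delta> > 0"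
    "\<And>x' y'. (\<And>i. i \<in> {1..n} \<Longrightarrow> \<bar>x' i - x i\<bar> < \<delta>) \<Longrightarrow> \<bar>y' - y\<bar> < \<delta> \<Longrightarrow>
       upper_step n x' b y' \<le> upper_step n x b y"
proof (cases "\<exists>i\<in>{1..n}. x i = y \<and> b i \<noteq> 0")
  case True
  then obtain i where i: "i \<in> {1..n}" "x i = y" "b i \<noteq> 0" by blast
  obtain L \<delta> where \<delta>: "\<delta> > 0"
    "\<And>x' y'. (\<And>i. i \<in> {1..n} \<Longrightarrow> \<bar>x' i - x i\<bar> < \<delta>) \<Longrightarrow> \<bar>y' - y\<bar> < \<delta> \<Longrightarrow>
       upper_step n x' b y' = (L + b i * of_bool (x' i < y') + max 0 (b i * of_bool (x' i = y'))) / real n"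
    using upper_step_near_charged[OF assms i] by metis
  have eq: "upper_step n x b y = (L + max 0 (b i)) / real n"
    using \<delta>(2)[of x y] \<delta>(1) i by simp
  show ?thesis
  proof (rule that[OF \<delta>(1)])
    fix x' y' assume "\<And>i. i \<in> {1..n} \<Longrightarrow> \<bar>x' i - x i\<bar> < \<delta>" "\<bar>y' - y\<bar> < \<delta>"
    from \<delta>(2)[OF this] show "upper_step n x' b y' \<le> upper_step n x b y"
      unfolding eq by (simp add: divide_right_mono)
  qed
next
  case False
  then show ?thesis
    using upper_step_near_uncharged[of n x y b] that by (metis order_refl)
qed

text \<open>Away from charged particles the envelope is locally constant, which a nonzero slope p
  forbids. A particle with b_i p < 0 is excluded too: the envelope keeps its value on one side of y,
  namely the side on which \<phi> strictly decreases away from y.\<close>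

lemma spatial_contact:
  assumes conf: "(x, b) \<in> configurations n"
    and der: "(\<phi> has_real_derivative p) (at y)" and p: "p \<noteq> 0"
    and d: "d > 0" "\<And>y'. \<bar>y' - y\<bar> < d \<Longrightarrow> upper_step n x b y' - upper_step n x b y \<le> \<phi> y' - \<phi> y"
  shows "\<exists>i\<in>{1..n}. x i = y \<and> b i * p > 0"
proof (cases "\<exists>i\<in>{1..n}. x i = y \<and> b i \<noteq> 0")
  case True
  then obtain i where i: "i \<in> {1..n}" "x i = y" "b i \<noteq> 0" by blast
  obtain L \<delta> where \<delta>: "\<delta> > 0"
    "\<And>x' y'. (\<And>i. i \<in> {1..n} \<Longrightarrow> \<bar>x' i - x i\<bar> < \<delta>) \<Longrightarrow> \<bar>y' - y\<bar> < \<delta> \<Longrightarrow>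
       upper_step n x' b y' = (L + b i * of_bool (x' i < y') + max 0 (b i * of_bool (x' i = y'))) / real n"
    using upper_step_near_charged[OF conf i] by metis
  have U: "upper_step n x b y' = (L + b i * of_bool (y < y') + max 0 (b i * of_bool (y = y'))) / real n"
    if "\<bar>y' - y\<bar> < \<delta>" for y'
    using \<delta>(2)[of x y'] \<delta>(1) i that by simp
  have "\<not> b i * p < 0"
  proof
    assume neg: "b i * p < 0"
    consider "b i < 0" "p > 0" | "b i > 0" "p < 0"
      using neg by (auto simp: mult_less_0_iff)
    then show False
    proof cases
      case 1
      obtain e where e: "e > 0" "\<And>h. 0 < h \<Longrightarrow> h < e \<Longrightarrow> \<phi> (y - h) < \<phi> y"
        using DERIV_pos_inc_left[OF der 1(2)] by auto
      define h where "h = min e (min d \<delta>) / 2"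
      have h: "0 < h" "h < e" "h < d" "h < \<delta>"
        using e d \<delta> by (auto simp: h_def)
      have "upper_step n x b (y - h) = upper_step n x b y"
        using U[of "y - h"] U[of y] h \<delta>(1) 1 by simp
      then show False using d(2)[of "y - h"] e(2)[of h] h by simp
    next
      case 2
      obtain e where e: "e > 0" "\<And>h. 0 < h \<Longrightarrow> h < e \<Longrightarrow> \<phi> (y + h) < \<phi> y"
        using DERIV_neg_dec_right[OF der 2(2)] by auto
      define h where "h = min e (min d \<delta>) / 2"
      have h: "0 < h" "h < e" "h < d" "h < \<delta>"
        using e d \<delta> by (auto simp: h_def)
      have "upper_step n x b (y + h) = upper_step n x b y"
        using U[of "y + h"] U[of y] h \<delta>(1) 2 by simp
      then show False using d(2)[of "y + h"] e(2)[of h] h by simp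
    qed
  qed
  moreover have "b i * p \<noteq> 0" using i p by simp
  ultimately have "b i * p > 0" by linarith
  with i show ?thesis by blast
next
  case False
  then obtain \<delta> where \<delta>: "\<delta> > 0"
    "\<And>x' y'. (\<And>i. i \<in> {1..n} \<Longrightarrow> \<bar>x' i - x i\<bar> < \<delta>) \<Longrightarrow> \<bar>y' - y\<bar> < \<delta> \<Longrightarrow>
       upper_step n x' b y' = upper_step n x b y"
    using upper_step_near_uncharged[of n x y b] by metis
  have "\<phi> y \<le> \<phi> y'" if "\<bar>y - y'\<bar> < min d \<delta>" for y'
    using \<delta>(2)[of x y'] d(2)[of y'] \<delta>(1) that by (simp add: abs_minus_commute)
  then have "p = 0"
    using DERIV_local_min[OF der, of "min d \<delta>"] d \<delta>(1) by auto
  with p show ?thesis by simp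
qed

lemma flow_position_tendsto:
  assumes "particle_flow n x b" "i \<in> {1..n}" "t \<ge> 0" "(f \<longlongrightarrow> t) F" "\<forall>\<^sub>F k in F. f k \<ge> 0"
  shows "((\<lambda>k. x (f k) i) \<longlongrightarrow> x t i) F"
proof -
  have "continuous_on {0..} (\<lambda>t. x t i)"
    using assms unfolding particle_flow_def by blast
  then show ?thesis
    by (rule continuous_on_tendsto_compose) (use assms in auto)
qed

lemma flow_close:
  assumes "particle_flow n x b" "t \<ge> 0" "(f \<longlongrightarrow> t) F" "\<forall>\<^sub>F k in F. f k \<ge> 0" "\<delta> > 0"
  shows "\<forall>\<^sub>F k in F. \<forall>i\<in>{1..n}. \<bar>x (f k) i - x t i\<bar> < \<delta>"
proof (intro eventually_ball_finite ballI finite_atLeastAtMost)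
  fix i assume "i \<in> {1..n}"
  from flow_position_tendsto[OF assms(1) this assms(2-4)] assms(5)
  have "\<forall>\<^sub>F k in F. dist (x (f k) i) (x t i) < \<delta>" by (rule tendstoD)
  then show "\<forall>\<^sub>F k in F. \<bar>x (f k) i - x t i\<bar> < \<delta>" by (simp add: dist_real_def)
qed

lemma at_left_nonneg: "t > 0 \<Longrightarrow> \<forall>\<^sub>F s in at_left (t::real). s \<ge> 0"
  using eventually_at_left_real[of 0 t] by (auto elim: eventually_mono)

text \<open>A contact is traced backwards in time. Following a charged particle at y keeps the
  envelope constant, since charged particles keep their order, while \<phi> along the path has the
  positive derivative \<phi>t + \<phi>x * velocity; so the difference was no smaller just before.
  Without a charged particle at y the slope \<phi>x vanishes, and y itself can be kept
  fixed.\<close>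

lemma flow_regular_time:
  assumes flow: "particle_flow n x b" and t: "t > 0"
    and reg: "\<And>i. i \<in> {1..n} \<Longrightarrow> \<forall>\<^sub>F s in at_left t. b s i = b t i"
      "\<And>i. i \<in> {1..n} \<Longrightarrow> ((\<lambda>s. x s i) has_real_derivative velocity n (x t) (b t) i) (at t)"
    and der: "((\<lambda>(s, y). \<phi> s y) has_derivative (\<lambda>(h, k). \<phi>t * h + \<phi>x * k)) (at (t, y))"
    and d: "d > 0" "\<And>y'. \<bar>y' - y\<bar> < d \<Longrightarrow>
      upper_step n (x t) (b t) y' - \<phi> t y' \<le> upper_step n (x t) (b t) y - \<phi> t y"
    and contact: "\<phi>x = 0 \<Longrightarrow> \<phi>t > 0"
      "\<And>i. i \<in> {1..n} \<Longrightarrow> x t i = y \<Longrightarrow> b t i * \<phi>x > 0 \<Longrightarrow> \<phi>t + \<phi>x * velocity n (x t) (b t) i > 0"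
  shows "\<forall>\<^sub>F s in at_left t. \<exists>y'. \<bar>y' - y\<bar> < d \<and>
    upper_step n (x t) (b t) y - \<phi> t y \<le> upper_step n (x s) (b s) y' - \<phi> s y'"
proof -
  have conf: "(x s, b s) \<in> configurations n" if "s \<ge> 0" for s
    using flow that unfolding particle_flow_def by blast
  have bs: "\<forall>\<^sub>F s in at_left t. \<forall>i\<in>{1..n}. b s i = b t i"
    using reg(1) by (intro eventually_ball_finite ballI) auto
  have xder: "((\<lambda>y'. \<phi> t y') has_real_derivative \<phi>x) (at y)"
  proof -
    have "((\<lambda>y'. (t, y')) has_derivative (\<lambda>k. (0, k))) (at y)"
      by (auto intro!: derivative_eq_intros)
    from has_derivative_compose[OF this, of "\<lambda>(s, y). \<phi> s y" "\<lambda>(h, k). \<phi>t * h + \<phi>x * k"] der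
    show ?thesis by (simp add: has_field_derivative_def)
  qed
  have tder: "((\<lambda>s. \<phi> s y) has_real_derivative \<phi>t) (at t)"
  proof -
    have "((\<lambda>s. (s, y)) has_derivative (\<lambda>k. (k, 0))) (at t)"
      by (auto intro!: derivative_eq_intros)
    from has_derivative_compose[OF this, of "\<lambda>(s, y). \<phi> s y" "\<lambda>(h, k). \<phi>t * h + \<phi>x * k"] der
    show ?thesis by (simp add: has_field_derivative_def)
  qed
  have sp: "\<exists>i\<in>{1..n}. x t i = y \<and> b t i * \<phi>x > 0" if nz: "\<phi>x \<noteq> 0"
  proof -
    show ?thesis
    proof (rule spatial_contact[OF conf xder nz d(1)])
      show "upper_step n (x t) (b t) y' - upper_step n (x t) (b t) y \<le> \<phi> t y' - \<phi> t y"
        if "\<bar>y' - y\<bar> < d" for y'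
        using d(2)[OF that] by linarith
    qed (use t in simp)
  qed
  show ?thesis
  proof (cases "\<exists>i\<in>{1..n}. x t i = y \<and> b t i \<noteq> 0")
    case False
    then have 0: "\<phi>x = 0" using sp by force
    then have pos: "\<phi>t > 0" by (rule contact)
    obtain e where e: "e > 0" "\<And>h. 0 < h \<Longrightarrow> h < e \<Longrightarrow> \<phi> (t - h) y < \<phi> t y"
      using DERIV_pos_inc_left[OF tder pos] by auto
    obtain \<delta> where \<delta>: "\<delta> > 0"
      "\<And>x' y'. (\<And>i. i \<in> {1..n} \<Longrightarrow> \<bar>x' i - x t i\<bar> < \<delta>) \<Longrightarrow> \<bar>y' - y\<bar> < \<delta> \<Longrightarrow>
         upper_step n x' (b t) y' = upper_step n (x t) (b t) y"
      using upper_step_near_uncharged[of n "x t" y "b t"] False by metis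
    have "\<forall>\<^sub>F s in at_left t. \<forall>i\<in>{1..n}. \<bar>x s i - x t i\<bar> < \<delta>"
      by (rule flow_close[OF flow _ tendsto_ident_at at_left_nonneg]) (use t \<delta> in auto)
    moreover have "\<forall>\<^sub>F s in at_left t. s \<in> {t - e<..<t}"
      using e by (intro eventually_at_left_real) auto
    ultimately show ?thesis using bs
    proof eventually_elim
      case (elim s)
      have "upper_step n (x s) (b s) y = upper_step n (x s) (b t) y"
        using elim by (intro upper_step_cong) auto
      also have "\<dots> = upper_step n (x t) (b t) y"
        using elim \<delta> by (intro \<delta>(2)) auto
      finally show ?case using e(2)[of "t - s"] elim d(1) by (intro exI[of _ y]) auto
    qed
  next
    case True
    \<comment> \<open>If \<phi>x = 0, any charged particle at y will do, because then the derivative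
      along its path is \<phi>t.\<close>
    obtain i where i: "i \<in> {1..n}" "x t i = y" "b t i \<noteq> 0"
      and pos: "\<phi>t + \<phi>x * velocity n (x t) (b t) i > 0"
    proof (cases "\<phi>x = 0")
      case True
      with \<open>\<exists>i\<in>{1..n}. x t i = y \<and> b t i \<noteq> 0\<close> contact(1) that show ?thesis by auto
    next
      case False
      with sp contact(2) that show ?thesis by force
    qed
    have "((\<lambda>s. (s, x s i)) has_derivative (\<lambda>h. (h, velocity n (x t) (b t) i * h))) (at t)"
      using reg(2)[OF i(1)] by (auto intro!: derivative_eq_intros simp: has_field_derivative_def)
    from has_derivative_compose[OF this, of "\<lambda>(s, y). \<phi> s y" "\<lambda>(h, k). \<phi>t * h + \<phi>x * k"] der i(2)
    have "((\<lambda>s. \<phi> s (x s i)) has_derivative (\<lambda>h. \<phi>t * h + \<phi>x * (velocity n (x t) (b t) i * h))) (at t)"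
      by simp
    moreover have "(\<lambda>h. \<phi>t * h + \<phi>x * (velocity n (x t) (b t) i * h)) =
        times (\<phi>t + \<phi>x * velocity n (x t) (b t) i)"
      by (auto simp: fun_eq_iff algebra_simps)
    ultimately have "((\<lambda>s. \<phi> s (x s i)) has_real_derivative \<phi>t + \<phi>x * velocity n (x t) (b t) i) (at t)"
      by (simp add: has_field_derivative_def)
    from DERIV_pos_inc_left[OF this pos]
    obtain e where e: "e > 0" "\<And>h. 0 < h \<Longrightarrow> h < e \<Longrightarrow> \<phi> (t - h) (x (t - h) i) < \<phi> t y"
      using i(2) by auto
    have "\<forall>\<^sub>F s in at_left t. \<forall>i\<in>{1..n}. \<bar>x s i - x t i\<bar> < d"
      by (rule flow_close[OF flow _ tendsto_ident_at at_left_nonneg]) (use t d in auto)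
    moreover have "\<forall>\<^sub>F s in at_left t. s \<in> {t - e<..<t}"
      using e by (intro eventually_at_left_real) auto
    ultimately show ?thesis using bs at_left_nonneg[OF t]
    proof eventually_elim
      case (elim s)
      have c: "(x s, b s) \<in> configurations n" "(x t, b t) \<in> configurations n"
        using conf elim t by auto
      have "upper_step n (x s) (b s) (x s i) = upper_step n (x t) (b t) (x t i)"
      proof (rule upper_step_cong)
        fix j assume j: "j \<in> {1..n}" "b t j \<noteq> 0"
        have "b s j \<noteq> 0" "b s i \<noteq> 0" using elim j i by auto
        then show "(x s j < x s i) = (x t j < x t i) \<and> (x s j = x s i) = (x t j = x t i)"
          using charged_order[OF c(1) j(1) i(1)] charged_order[OF c(2) j(1) i(1)] j i by simp
      qed (use elim in auto)
      then show ?case using e(2)[of "t - s"] elim i by (intro exI[of _ "x s i"]) auto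
    qed
  qed
qed

subsection \<open>Comparison of the particle system with smooth functions\<close>

text \<open>Without a maximum every x is beaten by some g x, and semicontinuity extends this to a
  ball around x. Finitely many balls cover K, and the best of the corresponding g x lies in one of
  them, so it would be beaten by another.\<close>

lemma usc_attains_max:
  fixes f :: "'a::metric_space \<Rightarrow> real"
  assumes K: "compact K" "K \<noteq> {}"
    and usc: "\<And>x e. x \<in> K \<Longrightarrow> e > 0 \<Longrightarrow> \<exists>d>0. \<forall>y\<in>K. dist x y < d \<longrightarrow> f y < f x + e"
  shows "\<exists>x\<in>K. \<forall>y\<in>K. f y \<le> f x"
proof (rule ccontr)
  assume "\<not> ?thesis"
  then have "\<forall>x\<in>K. \<exists>y\<in>K. f x < f y" by (meson not_le)
  then obtain g where g: "\<And>x. x \<in> K \<Longrightarrow> g x \<in> K" "\<And>x. x \<in> K \<Longrightarrow> f x < f (g x)"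
    by metis
  have "\<exists>d>0. \<forall>y\<in>K. dist x y < d \<longrightarrow> f y < f (g x)" if "x \<in> K" for x
    using usc[OF that, of "f (g x) - f x"] g(2)[OF that] by simp
  then obtain d where d: "\<And>x. x \<in> K \<Longrightarrow> d x > 0"
      "\<And>x y. x \<in> K \<Longrightarrow> y \<in> K \<Longrightarrow> dist x y < d x \<Longrightarrow> f y < f (g x)"
    by metis
  obtain C where C: "finite C" "C \<subseteq> K" "K \<subseteq> (\<Union>x\<in>C. ball x (d x))"
    using compactE_image[OF K(1), of K "\<lambda>x. ball x (d x)"] d(1) by force
  have "C \<noteq> {}" using C(3) K(2) by auto
  then have "Max ((\<lambda>x. f (g x)) ` C) \<in> (\<lambda>x. f (g x)) ` C"
    using C(1) by (intro Max_in) auto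
  then obtain x0 where x0': "x0 \<in> C" "f (g x0) = Max ((\<lambda>x. f (g x)) ` C)" by auto
  have x0: "x0 \<in> C" "\<And>x. x \<in> C \<Longrightarrow> f (g x) \<le> f (g x0)"
    using x0' C(1) by auto
  obtain xl where "xl \<in> C" "dist xl (g x0) < d xl"
    using C g(1)[of x0] x0(1) by fastforce
  then have "f (g x0) < f (g xl)" using d(2)[of xl "g x0"] g(1)[of x0] C(2) x0(1) by auto
  with x0(2)[OF \<open>xl \<in> C\<close>] show False by simp
qed

text \<open>Charges are conserved at every collision site, so at a point off the sites the step function
  has the same value just before and at the collision time.\<close>

lemma flow_collision_time:
  assumes flow: "particle_flow n x b" and t: "t > 0" and d: "d > 0"
  shows "\<exists>y'. \<bar>y' - y\<bar> < d \<and> (\<forall>\<^sub>F s in at_left t.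
    upper_step n (x t) (b t) y \<le> upper_step n (x s) (b s) y')"
proof -
  obtain \<beta> where \<beta>: "\<And>i. i \<in> {1..n} \<Longrightarrow> \<forall>\<^sub>F s in at_left t. b s i = \<beta> i"
      "\<And>z. (\<Sum>i | i \<in> {1..n} \<and> x t i = z. b t i - \<beta> i) = 0"
  proof -
    have "\<forall>t>0. \<exists>\<beta>. (\<forall>i\<in>{1..n}. \<forall>\<^sub>F s in at_left t. b s i = \<beta> i) \<and>
        (\<forall>y. (\<Sum>i | i \<in> {1..n} \<and> x t i = y. b t i - \<beta> i) = 0)"
      using flow unfolding particle_flow_def by (elim conjE)
    from this[rule_format, OF t] show ?thesis using that by metis
  qed
  have bs: "\<forall>\<^sub>F s in at_left t. \<forall>i\<in>{1..n}. b s i = \<beta> i"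
    using \<beta>(1) by (intro eventually_ball_finite ballI) auto
  \<comment> \<open>Conservation at every single site adds up to conservation of any sum weighted by
    a function of the position.\<close>
  have cons: "(\<Sum>j=1..n. \<beta> j * of_bool (P (x t j))) = (\<Sum>j=1..n. b t j * of_bool (P (x t j)))"
    for P :: "real \<Rightarrow> bool"
  proof -
    have "(\<Sum>j=1..n. (b t j - \<beta> j) * of_bool (P (x t j))) =
        (\<Sum>z\<in>x t ` {1..n}. \<Sum>j | j \<in> {1..n} \<and> x t j = z. (b t j - \<beta> j) * of_bool (P (x t j)))"
      by (rule sum.image_gen) simp
    also have "\<dots> = (\<Sum>z\<in>x t ` {1..n}. of_bool (P z) * (\<Sum>j | j \<in> {1..n} \<and> x t j = z. b t j - \<beta> j))"
      unfolding sum_distrib_left by (intro sum.cong refl) auto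
    also have "\<dots> = 0" using \<beta>(2) by simp
    finally show ?thesis by (simp add: left_diff_distrib sum_subtractf)
  qed
  obtain \<delta> where \<delta>: "\<delta> > 0" "\<And>x' y' j. \<lbrakk>j \<in> {1..n}; x t j \<noteq> y; \<bar>x' j - x t j\<bar> < \<delta>; \<bar>y' - y\<bar> < \<delta>\<rbrakk>
    \<Longrightarrow> (x' j < y' \<longleftrightarrow> x t j < y) \<and> x' j \<noteq> y'"
    using separation[of n "x t" y] by metis
  define h where "h = min d \<delta> / 2"
  have h: "0 < h" "h < d" "h < \<delta>" using d \<delta>(1) by (auto simp: h_def)
  have close: "\<forall>\<^sub>F s in at_left t. \<forall>i\<in>{1..n}. \<bar>x s i - x t i\<bar> < h"
    by (rule flow_close[OF flow _ tendsto_ident_at at_left_nonneg]) (use t h in auto)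
  \<comment> \<open>P decides whether a limit position z counts as lying to the left of y'; for the
    site y itself this depends on the side of y on which y' is chosen. Particles ending at y stay
    closer to y than y' is, and all others are kept on their side by the separation
    \<delta>.\<close>
  have key: "\<forall>\<^sub>F s in at_left t. (\<Sum>j=1..n. b t j * of_bool (P (x t j))) / real n \<le> upper_step n (x s) (b s) y'"
    if y': "\<bar>y' - y\<bar> = h" and P: "\<And>z. P z \<longleftrightarrow> (if z = y then y < y' else z < y)" for y' P
    using close bs
  proof eventually_elim
    case (elim s)
    have *: "x s j \<le> y' \<longleftrightarrow> P (x t j)" if j: "j \<in> {1..n}" for j
    proof (cases "x t j = y")
      case True
      then have "\<bar>x s j - y\<bar> < h" using bspec[OF elim(1) j] by simp
      with True show ?thesis using y' P[of "x t j"] by (auto simp: abs_if split: if_splits)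
    next
      case False
      then have "(x s j < y' \<longleftrightarrow> x t j < y) \<and> x s j \<noteq> y'"
        using bspec[OF elim(1) j] j h y' by (intro \<delta>(2)) simp_all
      with False P[of "x t j"] show ?thesis by auto
    qed
    have "(\<Sum>j=1..n. b t j * of_bool (P (x t j))) / real n = (\<Sum>j=1..n. \<beta> j * of_bool (P (x t j))) / real n"
      using cons[of P] by simp
    also have "\<dots> = step_function n (x s) (b s) y'"
      unfolding step_function_def heaviside_def mult.commute[of "1 / real n"] times_divide_eq_right mult_1_right
      using elim * by (intro arg_cong[of _ _ "\<lambda>s. s / real n"] sum.cong) auto
    also have "\<dots> \<le> upper_step n (x s) (b s) y'" by (rule step_le_upper_step)
    finally show ?case .
  qed
  show ?thesis
  \<comment> \<open>The value at y is seen from the right of the site, the left limit from its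
    left.\<close>
  proof (cases "upper_step n (x t) (b t) y = step_function n (x t) (b t) y")
    case True
    have "\<forall>\<^sub>F s in at_left t. upper_step n (x t) (b t) y \<le> upper_step n (x s) (b s) (y + h)"
    proof -
      have "step_function n (x t) (b t) y = (\<Sum>j=1..n. b t j * of_bool (x t j \<le> y)) / real n"
        unfolding step_function_def heaviside_def mult.commute[of "1 / real n"] times_divide_eq_right mult_1_right
        by (intro arg_cong[of _ _ "\<lambda>s. s / real n"] sum.cong) auto
      then show ?thesis
        unfolding True using h by (simp only:) (rule key, auto)
    qed
    then show ?thesis using h by (intro exI[of _ "y + h"]) auto
  next
    case False
    then have eq: "upper_step n (x t) (b t) y = (\<Sum>j=1..n. b t j * of_bool (x t j < y)) / real n"
      using upper_step_cases by blast
    have "\<forall>\<^sub>F s in at_left t. upper_step n (x t) (b t) y \<le> upper_step n (x s) (b s) (y - h)"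
      unfolding eq using h by (intro key) auto
    then show ?thesis using h by (intro exI[of _ "y - h"]) auto
  qed
qed

text \<open>A violation at (t, y) is pushed back in time. The set A contains the times at which w
  still reaches its value at (t, y), up to a loss \<epsilon> for every exceptional time in between.
  Its infimum s0 belongs to A by semicontinuity, and a maximum point at time s0 lies neither on the
  initial nor on the lateral boundary; so the contact can be continued to a smaller time in A, which
  is absurd.\<close>

lemma particle_comparison:
  assumes flow: "particle_flow n x b"
    and a: "0 \<le> a" "a \<le> T" and xlr: "xl < xr"
    and cont: "continuous_on ({a..T} \<times> {xl..xr}) (\<lambda>(t, y). \<phi> t y)"
    and der: "\<And>t y. t \<in> {a<..T} \<Longrightarrow> y \<in> {xl<..<xr} \<Longrightarrow>
      ((\<lambda>(s, y). \<phi> s y) has_derivative (\<lambda>(h, k). \<phi>t t y * h + \<phi>x t y * k)) (at (t, y))"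
    and init: "\<And>y. y \<in> {xl..xr} \<Longrightarrow> upper_step n (x a) (b a) y - \<phi> a y \<le> m"
    and lat: "\<And>t y. t \<in> {a..T} \<Longrightarrow> y \<in> {xl, xr} \<Longrightarrow> upper_step n (x t) (b t) y - \<phi> t y \<le> m"
    and contact: "\<And>t y. t \<in> {a<..T} \<Longrightarrow> y \<in> {xl<..<xr} \<Longrightarrow> upper_step n (x t) (b t) y - \<phi> t y > m \<Longrightarrow>
      (\<And>y'. y' \<in> {xl..xr} \<Longrightarrow> upper_step n (x t) (b t) y' - \<phi> t y' \<le> upper_step n (x t) (b t) y - \<phi> t y) \<Longrightarrow>
      (\<phi>x t y = 0 \<longrightarrow> \<phi>t t y > 0) \<and>
      (\<forall>i\<in>{1..n}. x t i = y \<and> b t i * \<phi>x t y > 0 \<longrightarrow> \<phi>t t y + \<phi>x t y * velocity n (x t) (b t) i > 0)"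
    and t: "t \<in> {a..T}" and y: "y \<in> {xl..xr}"
  shows "upper_step n (x t) (b t) y - \<phi> t y \<le> m"
proof (rule ccontr)
  define w where "w s y = upper_step n (x s) (b s) y - \<phi> s y" for s y
  assume "\<not> ?thesis"
  then have c: "m < w t y" by (simp add: w_def)
  have conf: "(x s, b s) \<in> configurations n" if "s \<ge> 0" for s
    using flow that unfolding particle_flow_def by blast
  obtain S where S: "finite S"
      "\<And>s i. s \<in> {0<..<T+1} - S \<Longrightarrow> i \<in> {1..n} \<Longrightarrow> \<forall>\<^sub>F r in at_left s. b r i = b s i"
      "\<And>s i. s \<in> {0<..<T+1} - S \<Longrightarrow> i \<in> {1..n} \<Longrightarrow>
        ((\<lambda>r. x r i) has_real_derivative velocity n (x s) (b s) i) (at s)"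
  proof -
    have "\<forall>T>0. \<exists>S. finite S \<and> (\<forall>t\<in>{0<..<T} - S. \<forall>i\<in>{1..n}.
        (\<forall>\<^sub>F s in at_left t. b s i = b t i) \<and>
        ((\<lambda>s. x s i) has_real_derivative velocity n (x t) (b t) i) (at t))"
      using flow unfolding particle_flow_def by (elim conjE)
    moreover have "T + 1 > 0" using a by simp
    ultimately obtain S where "finite S" "\<forall>t\<in>{0<..<T+1} - S. \<forall>i\<in>{1..n}.
        (\<forall>\<^sub>F s in at_left t. b s i = b t i) \<and>
        ((\<lambda>s. x s i) has_real_derivative velocity n (x t) (b t) i) (at t)" by blast
    then show ?thesis by (intro that[of S]) blast+
  qed
  \<comment> \<open>With at most \<open>card S\<close> losses of \<epsilon>, the level stays above
    the midpoint of m and w t y.\<close>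
  define \<epsilon> where "\<epsilon> = (w t y - m) / (2 * (1 + real (card S)))"
  have \<epsilon>: "\<epsilon> > 0" using c by (simp add: \<epsilon>_def)
  define N where "N s = real (card (S \<inter> {s<..t}))" for s
  have N: "m < w t y - \<epsilon> * N s" for s
  proof -
    have "N s \<le> real (card S)" unfolding N_def using S(1) by (auto intro: card_mono)
    then have "\<epsilon> * N s \<le> \<epsilon> * (1 + real (card S))" using \<epsilon> by (intro mult_left_mono) auto
    also have "\<dots> = (w t y - m) / 2" unfolding \<epsilon>_def by (simp add: field_simps)
    also have "\<dots> < w t y - m" using c by simp
    finally show ?thesis by simp
  qed
  define A where "A = {s\<in>{a..t}. \<exists>y'\<in>{xl..xr}. w t y - \<epsilon> * N s \<le> w s y'}"
  have "t \<in> A" using t y by (auto simp: A_def N_def)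
  have bdd: "bdd_below A" by (auto simp: A_def)
  define s0 where "s0 = Inf A"
  have s0le: "s0 \<le> s" if "s \<in> A" for s unfolding s0_def by (rule cInf_lower[OF that bdd])
  have s0: "s0 \<in> {a..t}"
  proof -
    have "a \<le> s0" unfolding s0_def using \<open>t \<in> A\<close> by (intro cInf_greatest) (auto simp: A_def)
    with s0le[OF \<open>t \<in> A\<close>] show ?thesis by simp
  qed
  have conf0: "(x s0, b s0) \<in> configurations n" using conf s0 a by simp
  \<comment> \<open>Approach s0 from the right by times in A: right continuity fixes the charges,
    compactness yields a limit contact y0, and N is eventually equal to N s0 because the interval in
    which it counts is open on the left.\<close>
  have "s0 \<in> A"
  proof (rule ccontr)
    assume notA: "s0 \<notin> A"
    have "s0 \<in> closure A" unfolding s0_def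
      by (rule closure_contains_Inf[OF _ bdd]) (use \<open>t \<in> A\<close> in auto)
    then obtain \<sigma> where \<sigma>: "\<And>k. \<sigma> k \<in> A" "\<sigma> \<longlonglongrightarrow> s0"
      unfolding closure_sequential by blast
    have gt: "\<sigma> k > s0" for k 
    proof -
      have "\<sigma> k \<noteq> s0" using \<sigma>(1)[of k] notA by auto
      with s0le[OF \<sigma>(1)[of k]] show ?thesis by simp
    qed
    obtain \<eta> where \<eta>: "\<And>k. \<eta> k \<in> {xl..xr}" "\<And>k. w t y - \<epsilon> * N (\<sigma> k) \<le> w (\<sigma> k) (\<eta> k)"
    proof -
      have "\<forall>k. \<exists>y'. y' \<in> {xl..xr} \<and> w t y - \<epsilon> * N (\<sigma> k) \<le> w (\<sigma> k) y'"
        using \<sigma>(1) unfolding A_def by blast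
      from choice[OF this] show ?thesis using that by blast
    qed
    obtain y0 r where r: "y0 \<in> {xl..xr}" "strict_mono r" "(\<eta> \<circ> r) \<longlonglongrightarrow> y0"
      using \<eta>(1) seq_compactE[OF compact_imp_seq_compact[OF compact_Icc[of xl xr]], of \<eta>] by blast
    define \<tau> where "\<tau> = \<sigma> \<circ> r"
    have \<tau>: "\<tau> \<longlonglongrightarrow> s0" "\<And>k. \<tau> k > s0" "\<And>k. \<tau> k \<in> A"
      using LIMSEQ_subseq_LIMSEQ[OF \<sigma>(2) r(2)] gt \<sigma>(1) by (auto simp: \<tau>_def)
    have \<tau>r: "filterlim \<tau> (at_right s0) sequentially"
    proof -
      have "\<forall>k. \<tau> k \<in> {s0<..} \<and> \<tau> k \<noteq> s0" using \<tau>(2) by (auto simp: less_le)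
      with \<tau>(1) show ?thesis unfolding filterlim_at by simp
    qed
    obtain \<delta> where \<delta>: "\<delta> > 0"
      "\<And>x' y'. (\<And>i. i \<in> {1..n} \<Longrightarrow> \<bar>x' i - x s0 i\<bar> < \<delta>) \<Longrightarrow> \<bar>y' - y0\<bar> < \<delta> \<Longrightarrow>
         upper_step n x' (b s0) y' \<le> upper_step n (x s0) (b s0) y0"
      using upper_step_usc[OF conf0, of y0] by metis
    have e1: "\<forall>\<^sub>F k in sequentially. \<forall>i\<in>{1..n}. b (\<tau> k) i = b s0 i"
    proof (intro eventually_ball_finite ballI finite_atLeastAtMost)
      fix i assume i: "i \<in> {1..n}"
      have "\<forall>\<^sub>F s in at_right s0. b s i = b s0 i"
      proof -
        have "\<forall>t\<ge>0. \<forall>i\<in>{1..n}. \<forall>\<^sub>F s in at_right t. b s i = b t i"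
          using flow unfolding particle_flow_def by (elim conjE)
        then show ?thesis using i s0 a by simp
      qed
      then show "\<forall>\<^sub>F k in sequentially. b (\<tau> k) i = b s0 i"
        using \<tau>r by (rule eventually_compose_filterlim)
    qed
    have \<tau>nn: "\<forall>\<^sub>F k in sequentially. 0 \<le> \<tau> k"
    proof (intro always_eventually allI)
      fix k show "0 \<le> \<tau> k" using \<tau>(2)[of k] s0 a by auto
    qed
    have e2: "\<forall>\<^sub>F k in sequentially. \<forall>i\<in>{1..n}. \<bar>x (\<tau> k) i - x s0 i\<bar> < \<delta>"
      by (rule flow_close[OF flow _ \<tau>(1)]) (use s0 a \<tau>nn \<delta>(1) in auto)
    have e3: "\<forall>\<^sub>F k in sequentially. \<bar>\<eta> (r k) - y0\<bar> < \<delta>"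
      using tendstoD[OF r(3) \<delta>(1)] by (simp add: dist_real_def)
    have e4: "\<forall>\<^sub>F k in sequentially. \<forall>q\<in>S. s0 < q \<longrightarrow> \<tau> k < q"
    proof (intro eventually_ball_finite ballI S(1))
      fix q
      show "\<forall>\<^sub>F k in sequentially. s0 < q \<longrightarrow> \<tau> k < q"
        by (cases "s0 < q") (auto intro: order_tendstoD(2)[OF \<tau>(1)])
    qed
    have "\<forall>\<^sub>F k in sequentially. \<phi> (\<tau> k) (\<eta> (r k)) \<le> upper_step n (x s0) (b s0) y0 - (w t y - \<epsilon> * N s0)"
      using e1 e2 e3 e4
    proof eventually_elim
      case (elim k)
      have "upper_step n (x (\<tau> k)) (b (\<tau> k)) (\<eta> (r k)) = upper_step n (x (\<tau> k)) (b s0) (\<eta> (r k))"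
        using elim by (intro upper_step_cong) auto
      also have "\<dots> \<le> upper_step n (x s0) (b s0) y0"
        using elim by (intro \<delta>(2)) auto
      finally have 1: "upper_step n (x (\<tau> k)) (b (\<tau> k)) (\<eta> (r k)) \<le> upper_step n (x s0) (b s0) y0" .
      have "S \<inter> {\<tau> k<..t} = S \<inter> {s0<..t}" using elim(4) \<tau>(2)[of k] by auto
      then have "N (\<tau> k) = N s0" by (simp add: N_def)
      with 1 \<eta>(2)[of "r k"] show ?case by (simp add: w_def \<tau>_def)
    qed
    moreover have "(\<lambda>k. \<phi> (\<tau> k) (\<eta> (r k))) \<longlonglongrightarrow> \<phi> s0 y0"
    proof -
      have "(\<lambda>k. (\<tau> k, \<eta> (r k))) \<longlonglongrightarrow> (s0, y0)"
        using \<tau>(1) r(3) by (intro tendsto_Pair) (auto simp: comp_def)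
      moreover have "(s0, y0) \<in> {a..T} \<times> {xl..xr}" using s0 t r(1) by auto
      moreover have "\<forall>\<^sub>F k in sequentially. (\<tau> k, \<eta> (r k)) \<in> {a..T} \<times> {xl..xr}"
      proof (intro always_eventually allI)
        fix k
        have "\<tau> k \<in> {a..t}" using \<tau>(3)[of k] unfolding A_def by blast
        then show "(\<tau> k, \<eta> (r k)) \<in> {a..T} \<times> {xl..xr}" using \<eta>(1)[of "r k"] t by auto
      qed
      ultimately show ?thesis using continuous_on_tendsto_compose[OF cont] by force
    qed
    ultimately have "\<phi> s0 y0 \<le> upper_step n (x s0) (b s0) y0 - (w t y - \<epsilon> * N s0)"
      by (intro tendsto_upperbound) auto
    then have "w t y - \<epsilon> * N s0 \<le> w s0 y0" unfolding w_def by linarith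
    then have "s0 \<in> A" using s0 r(1) unfolding A_def by blast
    with notA show False by simp
  qed
  have contw: "\<exists>d>0. \<forall>s\<in>{a..T}. \<forall>y'\<in>{xl..xr}. \<bar>s - s0\<bar> < d \<longrightarrow> \<bar>y' - y0\<bar> < d \<longrightarrow> \<bar>\<phi> s y' - \<phi> s0 y0\<bar> < e"
    if "y0 \<in> {xl..xr}" "e > 0" for y0 e
  proof -
    have "(s0, y0) \<in> {a..T} \<times> {xl..xr}" using s0 t that by auto
    from cont[unfolded continuous_on_iff, rule_format, OF this that(2)] obtain d where d: "d > 0"
      "\<forall>z\<in>{a..T} \<times> {xl..xr}. dist z (s0, y0) < d \<longrightarrow>
        dist (case z of (t, y) \<Rightarrow> \<phi> t y) (case (s0, y0) of (t, y) \<Rightarrow> \<phi> t y) < e"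
      by blast
    have "\<bar>\<phi> s y' - \<phi> s0 y0\<bar> < e" if "s \<in> {a..T}" "y' \<in> {xl..xr}" "\<bar>s - s0\<bar> < d/2" "\<bar>y' - y0\<bar> < d/2" for s y'
    proof -
      have "dist (s, y') (s0, y0) \<le> \<bar>s - s0\<bar> + \<bar>y' - y0\<bar>"
        unfolding dist_Pair_Pair dist_real_def using sqrt_sum_squares_le_sum_abs by simp
      then have "dist (s, y') (s0, y0) < d" using that by linarith
      with bspec[OF d(2), of "(s, y')"] that show ?thesis by (simp add: dist_real_def)
    qed
    with d(1) show ?thesis by (intro exI[of _ "d/2"]) auto
  qed
  have "\<exists>y0\<in>{xl..xr}. \<forall>y'\<in>{xl..xr}. w s0 y' \<le> w s0 y0"
  proof (rule usc_attains_max)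
    fix y0 e :: real assume y0: "y0 \<in> {xl..xr}" and e: "e > 0"
    obtain \<delta> where \<delta>: "\<delta> > 0"
      "\<And>x' y'. (\<And>i. i \<in> {1..n} \<Longrightarrow> \<bar>x' i - x s0 i\<bar> < \<delta>) \<Longrightarrow> \<bar>y' - y0\<bar> < \<delta> \<Longrightarrow>
         upper_step n x' (b s0) y' \<le> upper_step n (x s0) (b s0) y0"
      using upper_step_usc[OF conf0, of y0] by metis
    obtain d where d: "d > 0" "\<forall>s\<in>{a..T}. \<forall>y'\<in>{xl..xr}. \<bar>s - s0\<bar> < d \<longrightarrow> \<bar>y' - y0\<bar> < d \<longrightarrow> \<bar>\<phi> s y' - \<phi> s0 y0\<bar> < e"
      using contw[OF y0 e] by blast
    have "w s0 y' < w s0 y0 + e" if y': "y' \<in> {xl..xr}" "dist y0 y' < min d \<delta>" for y'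
    proof -
      have "upper_step n (x s0) (b s0) y' \<le> upper_step n (x s0) (b s0) y0"
        using \<delta>(2)[of "x s0" y'] \<delta>(1) y' by (simp add: dist_real_def abs_minus_commute)
      moreover have "\<bar>\<phi> s0 y' - \<phi> s0 y0\<bar> < e"
        using d y' s0 t by (auto simp: dist_real_def abs_minus_commute)
      ultimately show ?thesis unfolding w_def by linarith
    qed
    then show "\<exists>d>0. \<forall>y'\<in>{xl..xr}. dist y0 y' < d \<longrightarrow> w s0 y' < w s0 y0 + e"
      using d(1) \<delta>(1) by (intro exI[of _ "min d \<delta>"]) auto
  qed (use xlr in auto)
  then obtain y0 where y0: "y0 \<in> {xl..xr}" "\<And>y'. y' \<in> {xl..xr} \<Longrightarrow> w s0 y' \<le> w s0 y0" by blast
  have big: "w t y - \<epsilon> * N s0 \<le> w s0 y0"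
    using \<open>s0 \<in> A\<close> y0(2) unfolding A_def by (force intro: order_trans)
  then have gtm: "w s0 y0 > m" using N[of s0] by linarith
  have "s0 \<noteq> a" using init[OF y0(1)] gtm by (auto simp: w_def)
  then have s0a: "s0 > a" "s0 > 0" using s0 a by auto
  have y0i: "y0 \<in> {xl<..<xr}"
  proof -
    have "y0 \<notin> {xl, xr}" using lat[of s0 y0] gtm s0 t by (auto simp: w_def)
    with y0(1) show ?thesis by auto
  qed
  define D where "D = min (y0 - xl) (xr - y0)"
  have D: "D > 0" "\<And>y'. \<bar>y' - y0\<bar> < D \<Longrightarrow> y' \<in> {xl..xr}"
    using y0i by (auto simp: D_def)
  have near: "\<forall>\<^sub>F s in at_left s0. s \<in> {a<..<s0}"
    by (rule eventually_at_left_real[OF s0a(1)])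
  have "\<exists>s\<in>A. s < s0"
  proof (cases "s0 \<in> S")
    case False
    have c: "(\<phi>x s0 y0 = 0 \<longrightarrow> \<phi>t s0 y0 > 0) \<and>
      (\<forall>i\<in>{1..n}. x s0 i = y0 \<and> b s0 i * \<phi>x s0 y0 > 0 \<longrightarrow> \<phi>t s0 y0 + \<phi>x s0 y0 * velocity n (x s0) (b s0) i > 0)"
      using s0 s0a t y0i gtm y0(2) by (intro contact) (auto simp: w_def)
    have "\<forall>\<^sub>F s in at_left s0. \<exists>y'. \<bar>y' - y0\<bar> < D \<and>
        upper_step n (x s0) (b s0) y0 - \<phi> s0 y0 \<le> upper_step n (x s) (b s) y' - \<phi> s y'"
    proof (rule flow_regular_time[OF flow s0a(2)])
      show "((\<lambda>(s, y). \<phi> s y) has_derivative (\<lambda>(h, k). \<phi>t s0 y0 * h + \<phi>x s0 y0 * k)) (at (s0, y0))"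
        using s0 s0a t y0i by (intro der) auto
      show "upper_step n (x s0) (b s0) y' - \<phi> s0 y' \<le> upper_step n (x s0) (b s0) y0 - \<phi> s0 y0"
        if "\<bar>y' - y0\<bar> < D" for y'
        using y0(2)[OF D(2)[OF that]] by (simp add: w_def)
    qed (use S(2,3) False s0a s0 t D(1) c in auto)
    then have "\<forall>\<^sub>F s in at_left s0. s < s0 \<and> s \<in> A"
      using near
    proof eventually_elim
      case (elim s)
      then obtain y' where y': "y' \<in> {xl..xr}" "w s0 y0 \<le> w s y'" using D(2) by (auto simp: w_def)
      have "N s0 \<le> N s" unfolding N_def using elim(2) S(1) by (auto intro!: card_mono)
      then have "\<epsilon> * N s0 \<le> \<epsilon> * N s" using \<epsilon> by (intro mult_left_mono) auto
      with big y' elim(2) s0 show ?case unfolding A_def by (auto intro!: bexI[of _ y'])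
    qed
    then show ?thesis using eventually_happens'[OF trivial_limit_at_left_real] by blast
  next
    case True
    \<comment> \<open>An exceptional time s0 is counted by N at earlier times but not at s0 itself,
      so at this point a loss \<epsilon> is available. It pays for moving to the nearby point y'
      supplied by \<open>flow_collision_time\<close>.\<close>
    obtain d where d: "d > 0" "\<forall>s\<in>{a..T}. \<forall>y'\<in>{xl..xr}. \<bar>s - s0\<bar> < d \<longrightarrow> \<bar>y' - y0\<bar> < d \<longrightarrow> \<bar>\<phi> s y' - \<phi> s0 y0\<bar> < \<epsilon>"
      using contw[OF y0(1) \<epsilon>] by blast
    obtain y' where y': "\<bar>y' - y0\<bar> < min d D" "\<forall>\<^sub>F s in at_left s0.
       upper_step n (x s0) (b s0) y0 \<le> upper_step n (x s) (b s) y'"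
      using flow_collision_time[OF flow s0a(2), of "min d D" y0] d(1) D(1) by auto
    have "\<forall>\<^sub>F s in at_left s0. s \<in> {s0 - d<..<s0}"
      using d(1) by (intro eventually_at_left_real) auto
    with y'(2) near have "\<forall>\<^sub>F s in at_left s0. s < s0 \<and> s \<in> A"
    proof eventually_elim
      case (elim s)
      have y'2: "y' \<in> {xl..xr}" using D(2) y'(1) by auto
      then have "\<bar>\<phi> s y' - \<phi> s0 y0\<bar> < \<epsilon>" using d(2) y'(1) elim s0 t by auto
      with elim(1) have 1: "w s0 y0 - \<epsilon> \<le> w s y'" unfolding w_def by linarith
      have "insert s0 (S \<inter> {s0<..t}) \<subseteq> S \<inter> {s<..t}" using elim True s0 by auto
      then have "card (insert s0 (S \<inter> {s0<..t})) \<le> card (S \<inter> {s<..t})" using S(1) by (intro card_mono) auto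
      then have "N s0 + 1 \<le> N s" unfolding N_def using S(1) by auto
      then have "\<epsilon> * (N s0 + 1) \<le> \<epsilon> * N s" using \<epsilon> by (intro mult_left_mono) auto
      with 1 big have "w t y - \<epsilon> * N s \<le> w s y'" by (simp add: algebra_simps)
      with y'2 elim s0 show ?case unfolding A_def by auto
    qed
    then show ?thesis using eventually_happens'[OF trivial_limit_at_left_real] by blast
  qed
  with s0le show False by fastforce
qed

subsection \<open>The contact estimate\<close>

abbreviation far :: "real \<Rightarrow> real set" where "far r \<equiv> - {-r<..<r}"

section \<open>Integrals against the kernel 1/z^2\<close>

lemma has_bochner_integral_halfline:
  assumes d: "d > (0::real)"
  shows "has_bochner_integral lborel (\<lambda>z. of_bool (d \<le> z) / z\<^sup>2) (1 / d)"
proof (rule has_bochner_integral_nn_integral)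
  have "(\<integral>\<^sup>+z. ennreal (1 / z\<^sup>2) * indicator {d..} z \<partial>lborel) = ennreal (0 - (- 1 / d))"
  proof (rule nn_integral_FTC_atLeast)
    show "DERIV (\<lambda>z. - 1 / z) z :> 1 / z\<^sup>2" if "d \<le> z" for z
      using that d by (auto intro!: derivative_eq_intros simp: power2_eq_square)
    show "((\<lambda>z::real. - 1 / z) \<longlongrightarrow> 0) at_top"
      by (rule tendsto_divide_0[OF tendsto_const filterlim_at_top_imp_at_infinity[OF filterlim_ident]])
  qed auto
  moreover have "ennreal (of_bool (d \<le> z) / z\<^sup>2) = ennreal (1 / z\<^sup>2) * indicator {d..} z" for z :: real
    by (auto simp: indicator_def)
  ultimately show "(\<integral>\<^sup>+z. ennreal (of_bool (d \<le> z) / z\<^sup>2) \<partial>lborel) = ennreal (1 / d)" by simp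
  have "(\<lambda>z. of_bool (d \<le> z) / z\<^sup>2) = (\<lambda>z. indicator {d..} z / z\<^sup>2 :: real)"
    by (auto simp: fun_eq_iff indicator_def)
  then show "(\<lambda>z. of_bool (d \<le> z) / z\<^sup>2) \<in> borel_measurable lborel" by simp
qed (use d in auto)

lemma has_bochner_integral_reflect:
  fixes f :: "real \<Rightarrow> real"
  assumes "has_bochner_integral lborel f I"
  shows "has_bochner_integral lborel (\<lambda>z. f (- z)) I"
  using assms lborel_integrable_real_affine[of f "-1" 0] lborel_integral_real_affine[of "-1" f 0]
  by (simp add: has_bochner_integral_iff)

text \<open>This is how each interaction 1/(x_j - y) becomes a nonlocal term. For d < 0 the
  integrand is minus the kernel on z < d, that is, the reflected half line up to the null point z =
  d.\<close>

lemma has_bochner_integral_jump: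
  assumes d: "d \<noteq> (0::real)"
  shows "has_bochner_integral lborel (\<lambda>z. (of_bool (d \<le> z) - of_bool (d \<le> 0)) / z\<^sup>2) (1 / d)"
proof (cases "d > 0")
  case True
  with has_bochner_integral_halfline[OF True] show ?thesis by simp
next
  case False
  then have d: "- d > 0" using d by simp
  have meas: "(\<lambda>z. of_bool (d \<le> z) / z\<^sup>2 :: real) \<in> borel_measurable lborel" for d :: real
  proof -
    have "(\<lambda>z. of_bool (d \<le> z) / z\<^sup>2) = (\<lambda>z. indicator {d..} z / z\<^sup>2 :: real)"
      by (auto simp: fun_eq_iff indicator_def)
    then show ?thesis by simp
  qed
  have "has_bochner_integral lborel (\<lambda>z. - (of_bool (- d \<le> - z) / (- z)\<^sup>2)) (- (1 / (- d)))"
    by (intro has_bochner_integral_minus has_bochner_integral_reflect has_bochner_integral_halfline d)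
  moreover have "has_bochner_integral lborel (\<lambda>z. - (of_bool (- d \<le> - z) / (- z)\<^sup>2)) (- (1 / (- d))) \<longleftrightarrow>
     has_bochner_integral lborel (\<lambda>z. (of_bool (d \<le> z) - of_bool (d \<le> 0)) / z\<^sup>2) (- (1 / (- d)))"
  proof (rule has_bochner_integral_cong_AE)
    have "(\<lambda>z. - (of_bool (- d \<le> - z) / (- z)\<^sup>2)) = (\<lambda>z. - (indicator {..d} z / z\<^sup>2 :: real))"
      by (auto simp: fun_eq_iff indicator_def)
    then show "(\<lambda>z. - (of_bool (- d \<le> - z) / (- z)\<^sup>2) :: real) \<in> borel_measurable lborel" by simp
    show "(\<lambda>z. (of_bool (d \<le> z) - of_bool (d \<le> 0)) / z\<^sup>2 :: real) \<in> borel_measurable lborel"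
      unfolding diff_divide_distrib using meas[of d] by measurable
    show "AE z in lborel. - (of_bool (- d \<le> - z) / (- z)\<^sup>2) = (of_bool (d \<le> z) - of_bool (d \<le> 0)) / z\<^sup>2"
      using AE_lborel_singleton[of d] by eventually_elim (use d in auto)
  qed
  ultimately show ?thesis by simp
qed

lemma far_inverse_square:
  assumes "r > 0"
  shows "set_integrable lborel (far r) (\<lambda>z. c / z\<^sup>2)" "(LINT z:far r|lborel. c / z\<^sup>2) = c * (2 / r)"
proof -
  have *: "indicator (far r) z * (1 / z\<^sup>2) = of_bool (r \<le> z) / z\<^sup>2 + of_bool (r \<le> - z) / (- z)\<^sup>2" for z :: real
    using assms by (auto simp: indicator_def)
  have "has_bochner_integral lborel (\<lambda>z. indicator (far r) z * (1 / z\<^sup>2)) (1 / r + 1 / r)"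
    unfolding * by (intro has_bochner_integral_add has_bochner_integral_halfline has_bochner_integral_reflect assms)
  from has_bochner_integral_mult_right[OF this, of c]
  have "has_bochner_integral lborel (\<lambda>z. indicator (far r) z * (c / z\<^sup>2)) (c * (2 / r))"
    by (simp add: mult_ac)
  then show "set_integrable lborel (far r) (\<lambda>z. c / z\<^sup>2)" "(LINT z:far r|lborel. c / z\<^sup>2) = c * (2 / r)"
    by (auto simp: set_integrable_def set_lebesgue_integral_def has_bochner_integral_iff)
qed

lemma far_integrable:
  assumes "r > 0" "w \<in> borel_measurable borel" "\<And>z. \<bar>w z\<bar> \<le> B"
  shows "set_integrable lborel (far r) (\<lambda>z. w z / z\<^sup>2)"
proof (rule set_integrable_bound[OF far_inverse_square(1)[OF assms(1), of B]])
  show "set_borel_measurable lborel (far r) (\<lambda>z. w z / z\<^sup>2)"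
    unfolding set_borel_measurable_def using assms(2) by measurable
  show "AE z in lborel. z \<in> far r \<longrightarrow> norm (w z / z\<^sup>2) \<le> norm (B / z\<^sup>2)"
  proof (intro AE_I2 impI)
    fix z show "norm (w z / z\<^sup>2) \<le> norm (B / z\<^sup>2)"
      using assms(3)[of z] by (auto intro!: divide_right_mono)
  qed
qed

lemma far_integral_bound:
  assumes "r > 0" "w \<in> borel_measurable borel" "\<And>z. \<bar>w z\<bar> \<le> B"
  shows "\<bar>LINT z:far r|lborel. w z / z\<^sup>2\<bar> \<le> B * (2 / r)"
proof -
  note i = far_integrable[OF assms]
  have "(LINT z:far r|lborel. w z / z\<^sup>2) \<le> (LINT z:far r|lborel. B / z\<^sup>2)"
    using assms(3) by (intro set_integral_mono i far_inverse_square assms(1) divide_right_mono) (auto simp: abs_le_iff)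
  moreover have "(LINT z:far r|lborel. - B / z\<^sup>2) \<le> (LINT z:far r|lborel. w z / z\<^sup>2)"
    using assms(3) by (intro set_integral_mono i far_inverse_square assms(1) divide_right_mono) (auto simp: abs_le_iff minus_le_iff)
  ultimately show ?thesis
    unfolding far_inverse_square(2)[OF assms(1)] by linarith
qed

text \<open>The integers from 1 - b to a are a + b in number, or none, and the bounds place all of
  them in the window [B, A], where they are positive because B > 0.\<close>

lemma integer_window_count:
  fixes a b :: int and A B X :: real
  assumes "of_int a \<le> A" "of_int b \<le> 1 - B" "0 < B" "A \<le> X"
  shows "of_int (a + b) \<le> (\<Sum>k=1..nat \<lfloor>X\<rfloor>. of_bool (B \<le> real k \<and> real k \<le> A) :: real)"
proof -
  have "nat ` {1 - b..a} \<subseteq> {k\<in>{1..nat \<lfloor>X\<rfloor>}. B \<le> real k \<and> real k \<le> A}"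
  proof (rule image_subsetI)
    fix k assume k: "k \<in> {1 - b..a}"
    have "real_of_int (1 - b) \<le> of_int k" "real_of_int k \<le> of_int a" using k by (auto simp del: of_int_diff)
    then have 1: "B \<le> of_int k" "of_int k \<le> A" using assms by auto
    then have "k \<ge> 1" using assms(3) by linarith
    moreover have "k \<le> \<lfloor>X\<rfloor>" using 1 assms(4) by linarith
    ultimately show "nat k \<in> {k\<in>{1..nat \<lfloor>X\<rfloor>}. B \<le> real k \<and> real k \<le> A}"
      using 1 by (auto simp: le_nat_iff nat_le_eq_zle)
  qed
  then have "card (nat ` {1 - b..a}) \<le> card {k\<in>{1..nat \<lfloor>X\<rfloor>}. B \<le> real k \<and> real k \<le> A}"
    by (intro card_mono) auto
  moreover have "inj_on nat {1 - b..a}"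
  proof (rule inj_onI)
    fix k l assume "k \<in> {1 - b..a}" "l \<in> {1 - b..a}" "nat k = nat l"
    moreover have "1 - b \<ge> 1" using assms(2,3) by linarith
    ultimately show "k = l" by (auto simp: nat_eq_iff)
  qed
  then have "card (nat ` {1 - b..a}) = nat (a + b)" by (simp add: card_image)
  moreover have "(\<Sum>k=1..nat \<lfloor>X\<rfloor>. of_bool (B \<le> real k \<and> real k \<le> A) :: real) =
      real (card {k\<in>{1..nat \<lfloor>X\<rfloor>}. B \<le> real k \<and> real k \<le> A})"
    by (simp add: sum_of_bool_eq Int_def)
  ultimately show ?thesis by linarith
qed

text \<open>
  The two one-sided bounds alone would leave a contribution \<open>1/n\<close> at every distance \<open>\<ge> 1/(nq)\<close>,
  whose integral against \<open>1/z\<^sup>2\<close> does not vanish.  Since \<open>n h\<close> is integer valued,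
  \<open>n (h(z) + h(-z))\<close> is positive only if an integer lies between \<open>n (q z - C z\<^sup>2)\<close> and
  \<open>n (q z + C z\<^sup>2)\<close>, which confines \<open>z\<close> to short intervals around the points \<open>k / (n q)\<close>.
\<close>

lemma near_integral_bound:
  fixes h :: "real \<Rightarrow> real"
  assumes int: "integrable lborel (\<lambda>z. h z / z\<^sup>2)" and n: "n > 0"
    and q: "q > 0" and C: "C \<ge> 0" and r: "r > 0" and Cr: "C * r \<le> q / 2"
    and \<sigma>: "\<sigma> = 1 \<or> \<sigma> = (-1::real)"
    and Z: "\<And>z. real n * h z \<in> \<int>"
    and up: "\<And>z. 0 < z \<Longrightarrow> z < r \<Longrightarrow> h (\<sigma> * z) \<le> q * z + C * z\<^sup>2"
    and down: "\<And>z. 0 < z \<Longrightarrow> z < r \<Longrightarrow> h (- \<sigma> * z) \<le> - q * z + C * z\<^sup>2 + 1 / real n"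
  shows "(LINT z:{-r<..<r}|lborel. h z / z\<^sup>2) \<le> 27 * C * r"
proof -
  \<comment> \<open>On the ball C z^2 \<le> q z / 2. An integer k between n (q z - C z^2) and n (q z
    + C z^2) thus satisfies n q z / 2 \<le> k \<le> 3/2 n q z. The upper bound limits k by K and
    bounds 1 / (n z^2) by \<open>c k\<close>; the lower one turns |k - n q z| \<le> n C z^2 into a
    distance of at most \<open>\<rho> k\<close> between z and k / (n q).\<close>
  define K where "K = nat \<lfloor>3/2 * real n * q * r\<rfloor>"
  define c where "c k = 9 * (real n)\<^sup>2 * q\<^sup>2 / (4 * (real k)\<^sup>2) / real n" for k :: nat
  define \<rho> where "\<rho> k = 4 * C * (real k)\<^sup>2 / ((real n)\<^sup>2 * q^3)" for k :: nat
  define J where "J k = {real k / (real n * q) - \<rho> k .. real k / (real n * q) + \<rho> k}" for k :: nat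
  define g where "g z = indicator {-r<..<r} z * (h z / z\<^sup>2)" for z
  have gint: "integrable lborel g"
    unfolding g_def using integrable_mult_indicator[OF _ int, of "{-r<..<r}"] by simp
  have \<rho>0: "\<rho> k \<ge> 0" for k unfolding \<rho>_def using C q by auto
  have c0: "c k \<ge> 0" for k unfolding c_def by auto
  have sum_le: "h z + h (- z) \<le> (\<Sum>k=1..K. c k * z\<^sup>2 * indicator (J k) z)" if z: "0 < z" "z < r" for z
  proof -
    define A where "A = real n * (q * z + C * z\<^sup>2)"
    define B where "B = real n * (q * z - C * z\<^sup>2)"
    have Cz: "C * z \<le> q / 2" using C Cr z mult_left_mono[of z r C] by linarith
    have Cz2: "C * z\<^sup>2 \<le> q / 2 * z" using mult_right_mono[OF Cz, of z] z by (simp add: power2_eq_square mult.assoc)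
    have "real n * (q / 2 * z) \<le> B" unfolding B_def using Cz2 by (intro mult_left_mono) auto
    moreover have "0 < real n * (q / 2 * z)" using n q z by auto
    ultimately have B: "B > 0" "real n * (q / 2 * z) \<le> B" by auto
    have A1: "A \<le> real n * (3/2 * q * z)" unfolding A_def using Cz2 by (intro mult_left_mono) auto
    also have "\<dots> \<le> real n * (3/2 * q * r)" using q z by (intro mult_left_mono) auto
    finally have A: "A \<le> 3/2 * real n * q * r" by (simp add: mult_ac)
    obtain a where a: "real n * h (\<sigma> * z) = of_int a" using Z[of "\<sigma> * z"] by (auto elim: Ints_cases)
    obtain b where b: "real n * h (- \<sigma> * z) = of_int b" using Z[of "- \<sigma> * z"] by (auto elim: Ints_cases)
    have "of_int a \<le> A" unfolding a[symmetric] A_def using up[OF z] by (intro mult_left_mono) auto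
    moreover have "of_int b \<le> 1 - B"
    proof -
      have "of_int b \<le> real n * (- q * z + C * z\<^sup>2 + 1 / real n)"
        unfolding b[symmetric] using down[OF z] by (intro mult_left_mono) auto
      also have "\<dots> = 1 - B" using n by (simp add: B_def field_simps)
      finally show ?thesis .
    qed
    ultimately have ab: "of_int (a + b) \<le> (\<Sum>k=1..K. of_bool (B \<le> real k \<and> real k \<le> A) :: real)"
      unfolding K_def using B(1) A by (rule integer_window_count)
    have "h z + h (- z) = h (\<sigma> * z) + h (- \<sigma> * z)" using \<sigma> by auto
    also have "\<dots> = of_int (a + b) / real n" using a b n by (simp add: field_simps)
    also have "\<dots> \<le> (\<Sum>k=1..K. of_bool (B \<le> real k \<and> real k \<le> A)) / real n"
      using ab by (rule divide_right_mono) simp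
    also have "\<dots> \<le> (\<Sum>k=1..K. c k * z\<^sup>2 * indicator (J k) z)"
      unfolding sum_divide_distrib
    proof (rule sum_mono)
      fix k assume k: "k \<in> {1..K}"
      show "of_bool (B \<le> real k \<and> real k \<le> A) / real n \<le> c k * z\<^sup>2 * indicator (J k) z"
      proof (cases "B \<le> real k \<and> real k \<le> A")
        case True
        have k0: "real k > 0" using k by auto
        have nq: "real n * q > 0" using n q by auto
        have z1: "2 * real k \<le> 3 * (real n * q) * z" using True A1 by (simp add: mult_ac)
        have z2: "real n * q * z \<le> 2 * real k" using True B(2) by (simp add: mult_ac)
        have "(2 * real k)\<^sup>2 \<le> (3 * (real n * q) * z)\<^sup>2" using z1 k0 by (intro power_mono) auto
        then have "1 \<le> 9 * (real n)\<^sup>2 * q\<^sup>2 / (4 * (real k)\<^sup>2) * z\<^sup>2"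
          using k0 by (simp add: power_mult_distrib field_simps)
        then have 1: "1 / real n \<le> c k * z\<^sup>2"
          unfolding c_def using divide_right_mono[of 1 "9 * (real n)\<^sup>2 * q\<^sup>2 / (4 * (real k)\<^sup>2) * z\<^sup>2" "real n"] by simp
        have "\<bar>real k - real n * q * z\<bar> \<le> real n * C * z\<^sup>2"
          using True unfolding A_def B_def by (simp add: algebra_simps abs_le_iff)
        then have "\<bar>real k - real n * q * z\<bar> * (real n * q)\<^sup>2 \<le> real n * C * z\<^sup>2 * (real n * q)\<^sup>2"
          by (rule mult_right_mono) simp
        also have "\<dots> = real n * C * (real n * q * z)\<^sup>2" by (simp add: power_mult_distrib)
        also have "\<dots> \<le> real n * C * (2 * real k)\<^sup>2"
          using z2 nq z C by (intro mult_left_mono power_mono) auto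
        finally have 2: "\<bar>real k - real n * q * z\<bar> * (real n * q)\<^sup>2 \<le> real n * C * (2 * real k)\<^sup>2" .
        have "\<bar>real k / (real n * q) - z\<bar> = \<bar>real k - real n * q * z\<bar> / (real n * q)"
        proof -
          have "real k / (real n * q) - z = (real k - real n * q * z) / (real n * q)"
            using n q by (simp add: field_simps)
          then show ?thesis using nq by (simp add: abs_divide)
        qed
        also have "\<dots> \<le> (real n * C * (2 * real k)\<^sup>2 / (real n * q)\<^sup>2) / (real n * q)"
        proof (rule divide_right_mono)
          show "\<bar>real k - real n * q * z\<bar> \<le> real n * C * (2 * real k)\<^sup>2 / (real n * q)\<^sup>2"
            using 2 nq n by (subst pos_le_divide_eq) auto
        qed (use nq in simp)
        also have "\<dots> = (real n * (4 * C * (real k)\<^sup>2)) / (real n * ((real n)\<^sup>2 * q^3))"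
          by (simp add: power2_eq_square power3_eq_cube mult_ac)
        also have "\<dots> = \<rho> k"
          unfolding \<rho>_def using n by simp
        finally have "z \<in> J k" unfolding J_def by (auto simp: abs_le_iff)
        with 1 True show ?thesis by simp
      qed (use c0 in \<open>auto intro!: mult_nonneg_nonneg\<close>)
    qed
    finally show ?thesis .
  qed
  \<comment> \<open>Only the even combination h(z) + h(-z) is controlled, so g is symmetrized; the
    intervals \<open>J k\<close> lie around positive centres and are reflected to cover negative
    z.\<close>
  have pw: "g z + g (- z) \<le> (\<Sum>k=1..K. c k * (indicator (J k) z + indicator (J k) (- z)))" for z
  proof -
    have nn: "(\<Sum>k=1..K. c k * (indicator (J k) z + indicator (J k) (- z))) \<ge> 0"
      using c0 by (intro sum_nonneg mult_nonneg_nonneg) auto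
    show ?thesis
    proof (cases "0 < \<bar>z\<bar> \<and> \<bar>z\<bar> < r")
      case True
      define y where "y = \<bar>z\<bar>"
      have y: "0 < y" "y < r" using True by (auto simp: y_def)
      have "g z + g (- z) = (h z + h (- z)) / z\<^sup>2"
        using True by (auto simp: g_def add_divide_distrib indicator_def)
      also have "\<dots> = (h y + h (- y)) / y\<^sup>2" unfolding y_def by (auto simp: abs_if add.commute)
      also have "\<dots> \<le> (\<Sum>k=1..K. c k * y\<^sup>2 * indicator (J k) y) / y\<^sup>2"
        using sum_le[OF y] by (rule divide_right_mono) simp
      also have "\<dots> = (\<Sum>k=1..K. c k * indicator (J k) y)"
        unfolding sum_divide_distrib using y by (intro sum.cong) auto
      also have "\<dots> \<le> (\<Sum>k=1..K. c k * (indicator (J k) z + indicator (J k) (- z)))"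
        using c0 by (intro sum_mono mult_left_mono) (auto simp: y_def abs_if)
      finally show ?thesis .
    next
      case False
      then have "g z + g (- z) = 0" using r by (auto simp: g_def indicator_def)
      with nn show ?thesis by simp
    qed
  qed
  have Jint: "has_bochner_integral lborel (indicator (J k)) (2 * \<rho> k)" for k
  proof -
    have "has_bochner_integral lborel (indicator (J k)) (measure lborel (J k))"
      unfolding J_def by (intro has_bochner_integral_real_indicator) (auto simp: emeasure_lborel_Icc_eq)
    moreover have "measure lborel (J k) = 2 * \<rho> k" unfolding J_def using \<rho>0[of k] by simp
    ultimately show ?thesis by simp
  qed
  have Sint: "has_bochner_integral lborel (\<lambda>z. \<Sum>k=1..K. c k * (indicator (J k) z + indicator (J k) (- z)))
      (\<Sum>k=1..K. c k * (2 * \<rho> k + 2 * \<rho> k))"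
    by (intro has_bochner_integral_sum has_bochner_integral_mult_right has_bochner_integral_add
        Jint has_bochner_integral_reflect)
  have gb: "has_bochner_integral lborel g (integral\<^sup>L lborel g)" using gint by (rule has_bochner_integral_integrable)
  from has_bochner_integral_add[OF this has_bochner_integral_reflect[OF this]]
  have gg: "integrable lborel (\<lambda>z. g z + g (- z))" "(LINT z|lborel. g z + g (- z)) = integral\<^sup>L lborel g + integral\<^sup>L lborel g"
    by (auto simp: has_bochner_integral_iff)
  have "2 * integral\<^sup>L lborel g = (LINT z|lborel. g z + g (- z))" using gg by simp
  also have "\<dots> \<le> (LINT z|lborel. (\<Sum>k=1..K. c k * (indicator (J k) z + indicator (J k) (- z))))"
    using gg(1) Sint pw by (intro integral_mono) (auto simp: has_bochner_integral_iff)
  also have "\<dots> = (\<Sum>k=1..K. c k * (2 * \<rho> k + 2 * \<rho> k))" using Sint by (simp add: has_bochner_integral_iff)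
  \<comment> \<open>Height \<open>c k\<close> and width of \<open>J k\<close> compensate: every k
    contributes 36 C / (n q), and the at most 3/2 n q r of them add up to 54 C r, twice the claimed
    bound.\<close>
  also have "\<dots> = (\<Sum>k=1..K. 36 * C / (real n * q))"
  proof (rule sum.cong[OF refl])
    fix k assume "k \<in> {1..K}"
    then have "real k > 0" by auto
    then show "c k * (2 * \<rho> k + 2 * \<rho> k) = 36 * C / (real n * q)"
      unfolding c_def \<rho>_def using n q by (simp add: field_simps power2_eq_square power3_eq_cube)
  qed
  also have "\<dots> = real K * (36 * C / (real n * q))" by simp
  also have "\<dots> \<le> (3/2 * real n * q * r) * (36 * C / (real n * q))"
  proof (rule mult_right_mono)
    show "real K \<le> 3/2 * real n * q * r"
      unfolding K_def by (rule of_nat_floor) (use n q r in auto)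
  qed (use n q C in auto)
  also have "\<dots> = 2 * (27 * C * r)" using n q by simp
  finally have "integral\<^sup>L lborel g \<le> 27 * C * r" by simp
  then show ?thesis by (simp add: set_lebesgue_integral_def g_def[abs_def])
qed

lemma upper_step_measurable: "upper_step n x b \<in> borel_measurable borel"
proof -
  have 1: "of_bool (x j < y) = (indicator {x j<..} y :: real)" for j y by (simp add: indicator_def)
  have 2: "of_bool (x j = y) = (indicator {x j} y :: real)" for j y by (auto simp: indicator_def)
  show ?thesis
    unfolding upper_step_def[abs_def] 1 2 by measurable
qed

text \<open>Let h be the increment of the step function of the particles other than i, and I its
  integral against 1/z^2. Then - p * velocity = |p| I, because b_i = sgn p. Replacing h by the
  increment of the full envelope costs 1/n on the side p z < 0: \<open>near_integral_bound\<close>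
  absorbs this on the ball, and outside the ball it gives the term 2 / (n r).\<close>

lemma contact_estimate:
  assumes conf: "(x, b) \<in> configurations n" and i: "i \<in> {1..n}" "x i = y" "b i * p > 0"
    and C: "C \<ge> 0" and r: "r > 0" and Cr: "C * r \<le> \<bar>p\<bar> / 2"
    and le: "\<And>z. \<bar>z\<bar> < r \<Longrightarrow> upper_step n x b (y + z) - upper_step n x b y \<le> p * z + C * z\<^sup>2"
  shows "- (p * velocity n x b i) \<le> \<bar>p\<bar> * (27 * C * r + 2 / (real n * r) +
    (LINT z:far r|lborel. (upper_step n x b (y + z) - upper_step n x b y) / z\<^sup>2))"
proof -
  define U where "U = upper_step n x b"
  have n: "n > 0" using i by auto
  have val: "b j \<in> {-1, 0, 1}" if "j \<in> {1..n}" for j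
    using conf that unfolding configurations_def by auto
  have uncharged: "b j = 0" if "j \<in> {1..n} - {i}" "x j = y" for j
  proof (rule ccontr)
    assume "b j \<noteq> 0"
    moreover have "b i \<noteq> 0" using i(3) by auto
    ultimately show False using charged_order(2)[OF conf, of j i] that i by auto
  qed
  have bi: "b i = sgn p" "p \<noteq> 0" using i(3) val[OF i(1)] by (auto simp: sgn_if zero_less_mult_iff)
  define h where "h z = (\<Sum>j\<in>{1..n}-{i}. b j / real n * (of_bool (x j - y \<le> z) - of_bool (x j - y \<le> 0)))" for z
  define I where "I = (\<Sum>j\<in>{1..n}-{i}. b j / real n * (1 / (x j - y)))"
  have "has_bochner_integral lborel (\<lambda>z. \<Sum>j\<in>{1..n}-{i}. b j / real n *
      ((of_bool (x j - y \<le> z) - of_bool (x j - y \<le> 0)) / z\<^sup>2)) I"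
    unfolding I_def
  proof (intro has_bochner_integral_sum)
    fix j assume j: "j \<in> {1..n} - {i}"
    show "has_bochner_integral lborel (\<lambda>z. b j / real n *
      ((of_bool (x j - y \<le> z) - of_bool (x j - y \<le> 0)) / z\<^sup>2)) (b j / real n * (1 / (x j - y)))"
    proof (cases "x j = y")
      case True
      with uncharged[OF j] show ?thesis by (auto intro: has_bochner_integral_zero)
    next
      case False
      then show ?thesis by (intro has_bochner_integral_mult_right has_bochner_integral_jump) simp
    qed
  qed
  then have hint: "has_bochner_integral lborel (\<lambda>z. h z / z\<^sup>2) I"
    unfolding h_def sum_divide_distrib by simp
  have Uy: "U y = ((\<Sum>j\<in>{1..n}-{i}. b j * of_bool (x j - y \<le> 0)) + max 0 (b i)) / real n"
  proof -
    have "(\<Sum>j=1..n. b j * of_bool (x j < y)) = (\<Sum>j\<in>{1..n}-{i}. b j * of_bool (x j < y))"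
      using i by (subst sum.remove[of _ i]) auto
    also have "\<dots> = (\<Sum>j\<in>{1..n}-{i}. b j * of_bool (x j - y \<le> 0))"
    proof (intro sum.cong refl)
      fix j assume "j \<in> {1..n} - {i}"
      then show "b j * of_bool (x j < y) = b j * of_bool (x j - y \<le> 0)"
        using uncharged[of j] by (cases "x j = y") auto
    qed
    finally have 1: "(\<Sum>j=1..n. b j * of_bool (x j < y)) = \<dots>" .
    have "(\<Sum>j\<in>{1..n}-{i}. b j * of_bool (x j = y)) = 0"
      using uncharged by (intro sum.neutral ballI) auto
    then have 2: "(\<Sum>j=1..n. b j * of_bool (x j = y)) = b i"
      using i by (subst sum.remove[of _ i]) auto
    show ?thesis unfolding U_def upper_step_def 1 2 ..
  qed
  have stepz: "step_function n x b (y + z) = ((\<Sum>j\<in>{1..n}-{i}. b j * of_bool (x j - y \<le> z)) + b i * of_bool (0 \<le> z)) / real n" for z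
  proof -
    have "step_function n x b (y + z) = (\<Sum>j=1..n. b j * of_bool (x j - y \<le> z)) / real n"
      unfolding step_function_def heaviside_def mult.commute[of "1 / real n"] times_divide_eq_right mult_1_right
      by (intro arg_cong[of _ _ "\<lambda>s. s / real n"] sum.cong) (auto simp: algebra_simps)
    then show ?thesis using i by (subst (asm) sum.remove[of _ i]) auto
  qed
  \<comment> \<open>Taking particle i out of both the step function at y + z and the envelope at y
    leaves the last term; for z \<noteq> 0 it is 1/n where p z < 0 and 0 elsewhere.\<close>
  have h_eq: "h z = step_function n x b (y + z) - U y + (max 0 (b i) - b i * of_bool (0 \<le> z)) / real n" for z
    unfolding Uy stepz h_def by (simp add: right_diff_distrib sum_subtractf sum_divide_distrib[symmetric] add_divide_distrib diff_divide_distrib)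
  have h_le: "h z \<le> U (y + z) - U y + of_bool (p * z < 0) / real n" if "z \<noteq> 0" for z
  proof -
    have "max 0 (b i) - b i * of_bool (0 \<le> z) = of_bool (p * z < 0)"
      using bi that by (auto simp: sgn_if mult_less_0_iff)
    then show ?thesis unfolding h_eq U_def using step_le_upper_step[of n x b "y + z"] by simp
  qed
  have le': "U (y + z) - U y \<le> p * z + C * z\<^sup>2" if "\<bar>z\<bar> < r" for z
    using le[OF that] by (simp add: U_def)
  have near: "(LINT z:{-r<..<r}|lborel. h z / z\<^sup>2) \<le> 27 * C * r"
  proof (rule near_integral_bound[where n = n and q = "\<bar>p\<bar>" and \<sigma> = "sgn p"])
    show "integrable lborel (\<lambda>z. h z / z\<^sup>2)" using hint by (simp add: has_bochner_integral_iff)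
    show "sgn p = 1 \<or> sgn p = -1" using bi by (auto simp: sgn_if)
    show "real n * h z \<in> \<int>" for z
    proof -
      have "real n * h z = (\<Sum>j\<in>{1..n}-{i}. b j * (of_bool (x j - y \<le> z) - of_bool (x j - y \<le> 0)))"
        unfolding h_def sum_distrib_left using n by (intro sum.cong) auto
      also have "\<dots> \<in> \<int>"
      proof (intro Ints_sum Ints_mult Ints_diff)
        fix j assume "j \<in> {1..n} - {i}"
        then show "b j \<in> \<int>" using val[of j] by auto
      qed (auto simp: of_bool_def)
      finally show ?thesis .
    qed
    fix z assume z: "0 < z" "z < r"
    have "\<bar>sgn p * z\<bar> < r" "\<bar>- sgn p * z\<bar> < r" using z bi by (auto simp: abs_mult sgn_if)
    note l = le'[OF this(1)] le'[OF this(2)]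
    show "h (sgn p * z) \<le> \<bar>p\<bar> * z + C * z\<^sup>2"
      using l(1) h_le[of "sgn p * z"] z bi by (auto simp: sgn_if power2_eq_square mult_less_0_iff split: if_splits)
    show "h (- sgn p * z) \<le> - \<bar>p\<bar> * z + C * z\<^sup>2 + 1 / real n"
      using l(2) h_le[of "- sgn p * z"] z bi by (auto simp: sgn_if power2_eq_square mult_less_0_iff split: if_splits)
  qed (use n bi C r Cr in auto)
  have mU: "(\<lambda>z. U (y + z) - U y) \<in> borel_measurable borel"
    unfolding U_def using upper_step_measurable by measurable
  have bU: "\<bar>U (y + z) - U y\<bar> \<le> 2" for z
    using upper_step_bound[OF conf, of "y + z"] upper_step_bound[OF conf, of y] unfolding U_def by linarith
  have "(LINT z:far r|lborel. h z / z\<^sup>2) \<le> (LINT z:far r|lborel. (U (y + z) - U y) / z\<^sup>2 + (1 / real n) / z\<^sup>2)"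
  proof (intro set_integral_mono set_integral_add far_inverse_square far_integrable[OF r mU bU] r)
    have "integrable lborel (\<lambda>z. indicator (far r) z *\<^sub>R (h z / z\<^sup>2))"
      using hint by (intro integrable_mult_indicator) (auto simp: has_bochner_integral_iff)
    then show "set_integrable lborel (far r) (\<lambda>z. h z / z\<^sup>2)" by (simp add: set_integrable_def)
    fix z assume "z \<in> far r"
    then have "z \<noteq> 0" using r by auto
    have "h z \<le> U (y + z) - U y + 1 / real n"
      using h_le[OF \<open>z \<noteq> 0\<close>] by (cases "p * z < 0") (auto intro: order_trans)
    then show "h z / z\<^sup>2 \<le> (U (y + z) - U y) / z\<^sup>2 + (1 / real n) / z\<^sup>2"
      unfolding add_divide_distrib[symmetric] by (rule divide_right_mono) simp
  qed
  also have "\<dots> = (LINT z:far r|lborel. (U (y + z) - U y) / z\<^sup>2) + 2 / (real n * r)"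
  proof -
    have "(LINT z:far r|lborel. (U (y + z) - U y) / z\<^sup>2 + (1 / real n) / z\<^sup>2) =
        (LINT z:far r|lborel. (U (y + z) - U y) / z\<^sup>2) + (LINT z:far r|lborel. (1 / real n) / z\<^sup>2)"
      by (rule set_integral_add(2)) (rule far_integrable[OF r mU bU], rule far_inverse_square(1)[OF r])
    then show ?thesis using far_inverse_square(2)[OF r, of "1 / real n"] by simp
  qed
  finally have far: "(LINT z:far r|lborel. h z / z\<^sup>2) \<le> \<dots>" .
  have "I = (LINT z:{-r<..<r}|lborel. h z / z\<^sup>2) + (LINT z:far r|lborel. h z / z\<^sup>2)"
  proof -
    have i: "integrable lborel (\<lambda>z. h z / z\<^sup>2)" "I = (LINT z|lborel. h z / z\<^sup>2)" using hint by (auto simp: has_bochner_integral_iff)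
    have "(LINT z:{-r<..<r} \<union> far r|lborel. h z / z\<^sup>2) = (LINT z:{-r<..<r}|lborel. h z / z\<^sup>2) + (LINT z:far r|lborel. h z / z\<^sup>2)"
    proof (rule set_integral_Un)
      show "set_integrable lborel {-r<..<r} (\<lambda>z. h z / z\<^sup>2)" "set_integrable lborel (far r) (\<lambda>z. h z / z\<^sup>2)"
        unfolding set_integrable_def by (rule integrable_mult_indicator[OF _ i(1)]; simp)+
    qed simp
    then show ?thesis using i(2) by (simp add: set_lebesgue_integral_def)
  qed
  with near far have Ile: "I \<le> 27 * C * r + 2 / (real n * r) + (LINT z:far r|lborel. (U (y + z) - U y) / z\<^sup>2)" by linarith
  have "- (p * velocity n x b i) = \<bar>p\<bar> * I"
  proof -
    have "velocity n x b i = - b i * I"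
      unfolding velocity_def I_def sum_distrib_left i(2)
    proof (intro sum.cong refl)
      fix j
      have "1 / (y - x j) = - (1 / (x j - y))" by (metis minus_diff_eq minus_divide_right)
      then have "b i * b j / real n * (1 / (y - x j)) = b i * b j / real n * - (1 / (x j - y))"
        by (simp only:)
      then show "1 / real n * (b i * b j / (y - x j)) = - b i * (b j / real n * (1 / (x j - y)))"
        by simp
    qed
    moreover have "p * b i = \<bar>p\<bar>" unfolding bi(1) by (rule abs_sgn[symmetric])
    ultimately show ?thesis by (simp add: mult.assoc[symmetric])
  qed
  also have "\<dots> \<le> \<bar>p\<bar> * (27 * C * r + 2 / (real n * r) + (LINT z:far r|lborel. (U (y + z) - U y) / z\<^sup>2))"
    using Ile by (intro mult_left_mono) auto
  finally show ?thesis unfolding U_def .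
qed

section \<open>Barriers that rise with bounded speed\<close>

text \<open>With s the root at u and 2 s e the increment of the radicand, (s + e)^2 exceeds the new
  radicand by e^2. So the new root is at most s + e, and the quadratic part z^2 / (2 s) of e is at
  most z^2 since s \<ge> 1.\<close>

lemma sqrt_one_plus_square_le:
  fixes u z :: real
  shows "sqrt (1 + (u + z)\<^sup>2) \<le> sqrt (1 + u\<^sup>2) + u / sqrt (1 + u\<^sup>2) * z + z\<^sup>2"
proof -
  define s where "s = sqrt (1 + u\<^sup>2)"
  have s: "s \<ge> 1" "s\<^sup>2 = 1 + u\<^sup>2" unfolding s_def by auto
  define e where "e = (2 * u * z + z\<^sup>2) / (2 * s)"
  have se: "2 * s * e = 2 * u * z + z\<^sup>2" unfolding e_def using s by simp
  have "2 * s * (s + e) = 1 + u\<^sup>2 + (1 + (u + z)\<^sup>2)"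
    using s(2) se by (simp add: power2_eq_square algebra_simps)
  then have "2 * s * (s + e) \<ge> 0" by simp
  then have "s + e \<ge> 0" using s(1) by (simp add: zero_le_mult_iff)
  moreover have "1 + (u + z)\<^sup>2 \<le> (s + e)\<^sup>2"
    using s(2) se zero_le_power2[of e] by (simp add: power2_eq_square algebra_simps)
  ultimately have "sqrt (1 + (u + z)\<^sup>2) \<le> s + e" by (rule real_le_lsqrt)
  also have "e = u / s * z + z\<^sup>2 / (2 * s)" unfolding e_def using s by (simp add: add_divide_distrib)
  also have "z\<^sup>2 / (2 * s) \<le> z\<^sup>2"
    using s(1) mult_left_mono[of 1 "2 * s" "z\<^sup>2"] by (simp add: divide_le_eq)
  finally show ?thesis by (simp add: s_def)
qed

text \<open>The contact estimate at radius |p| / (2 A) yields at most 27/2 A^2 + 12 A for slopes |p|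
  \<le> A; rounding up and adding 1 makes the inequality strict.\<close>

definition barrier_speed :: "real \<Rightarrow> real" where
  "barrier_speed A = 14 * A\<^sup>2 + 12 * A + 1"

text \<open>The barrier has slope at most A and lies below its tangent plus A z^2. The largest
  radius that \<open>contact_estimate\<close> allows for C = A is r = |p| / (2 A); it makes |p| / r
  the constant 2 A, so the speed is bounded uniformly in n and in the slope, however small the
  latter. Linear growth against the bound 1 of the step functions reduces the comparison to a
  bounded interval.\<close>

lemma barrier:
  assumes flow: "particle_flow n x b" and n: "n \<ge> 1" and a: "0 \<le> a" "a \<le> T" and A: "A > 0"
    and init: "\<And>y. upper_step n (x a) (b a) y \<le> c + A * (sqrt (1 + (y - x0)\<^sup>2) - 1)"
  shows "upper_step n (x T) (b T) y \<le> c + A * (sqrt (1 + (y - x0)\<^sup>2) - 1) + barrier_speed A * (T - a)"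
proof -
  define \<kappa> where "\<kappa> = barrier_speed A"
  have \<kappa>: "\<kappa> > 0" unfolding \<kappa>_def barrier_speed_def using A by (intro add_nonneg_pos) auto
  \<comment> \<open>At distance R from x0 the barrier exceeds 1, an upper bound of the step
    functions; the summand |y - x0| brings y into the interval.\<close>
  define R where "R = \<bar>y - x0\<bar> + 2 + \<bar>1 - c\<bar> / A"
  have R: "R > 0" "R \<ge> 2 + \<bar>1 - c\<bar> / A" "y \<in> {x0 - R..x0 + R}"
  proof -
    have "0 \<le> \<bar>1 - c\<bar> / A" using A by simp
    then show "R > 0" "R \<ge> 2 + \<bar>1 - c\<bar> / A" "y \<in> {x0 - R..x0 + R}"
      unfolding R_def atLeastAtMost_iff by (linarith | intro conjI)+
  qed
  define s where "s y = sqrt (1 + (y - x0)\<^sup>2)" for y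
  have s: "s y \<ge> 1" "\<bar>y - x0\<bar> \<le> s y" for y
    unfolding s_def by (rule real_le_rsqrt; simp)+
  have conf: "(x t, b t) \<in> configurations n" if "t \<ge> 0" for t
    using flow that unfolding particle_flow_def by blast
  have "upper_step n (x T) (b T) y - (A * s y + \<kappa> * (T - a)) \<le> c - A"
  proof (rule particle_comparison[OF flow a, where xl = "x0 - R" and xr = "x0 + R"
        and \<phi> = "\<lambda>t y. A * s y + \<kappa> * (t - a)" and \<phi>t = "\<lambda>t y. \<kappa>" and \<phi>x = "\<lambda>t y. A * ((y - x0) / s y)"])
    show "x0 - R < x0 + R" using R by simp
    show "continuous_on ({a..T} \<times> {x0 - R..x0 + R}) (\<lambda>(t, y). A * s y + \<kappa> * (t - a))"
      unfolding s_def case_prod_beta by (intro continuous_intros)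
    show "((\<lambda>(t, y). A * s y + \<kappa> * (t - a)) has_derivative (\<lambda>(h, k). \<kappa> * h + A * ((y - x0) / s y) * k)) (at (t, y))"
      for t y
    proof -
      have "1 + (y - x0)\<^sup>2 > 0" by (intro add_pos_nonneg) auto
      then show ?thesis
        unfolding s_def case_prod_beta
        by (auto intro!: derivative_eq_intros simp: fun_eq_iff field_simps)
    qed
    show "upper_step n (x a) (b a) y - (A * s y + \<kappa> * (a - a)) \<le> c - A" for y
      using init[of y] by (simp add: s_def algebra_simps)
    show "upper_step n (x t) (b t) y - (A * s y + \<kappa> * (t - a)) \<le> c - A"
      if "t \<in> {a..T}" "y \<in> {x0 - R, x0 + R}" for t y
    proof -
      have "A * (2 + \<bar>1 - c\<bar> / A) \<le> A * s y"
        using R(2) s(2)[of y] that(2) R(1) A by (intro mult_left_mono) auto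
      then have "2 * A + \<bar>1 - c\<bar> \<le> A * s y" using A by (simp add: algebra_simps)
      moreover have "upper_step n (x t) (b t) y \<le> 1"
        using upper_step_bound[OF conf[of t], of y] that a by auto
      moreover have "0 \<le> \<kappa> * (t - a)" using \<kappa> that by auto
      ultimately show ?thesis using A by linarith
    qed
    fix t y
    assume t: "t \<in> {a<..T}" and y: "y \<in> {x0 - R<..<x0 + R}"
    assume max: "\<And>y'. y' \<in> {x0 - R..x0 + R} \<Longrightarrow> upper_step n (x t) (b t) y' - (A * s y' + \<kappa> * (t - a))
      \<le> upper_step n (x t) (b t) y - (A * s y + \<kappa> * (t - a))"
    assume gt: "c - A < upper_step n (x t) (b t) y - (A * s y + \<kappa> * (t - a))"
    \<comment> \<open>Maximality is known on the interval only, whereas the contact estimate looks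
      at all y + z with |z| < r. Outside the interval the barrier wins by its size.\<close>
    have glob: "upper_step n (x t) (b t) y' - upper_step n (x t) (b t) y \<le> A * s y' - A * s y" for y'
    proof (cases "y' \<in> {x0 - R..x0 + R}")
      case True
      with max[OF True] show ?thesis by simp
    next
      case False
      then have "R \<le> \<bar>y' - x0\<bar>" by auto
      then have "A * (2 + \<bar>1 - c\<bar> / A) \<le> A * s y'"
        using R(2) s(2)[of y'] A by (intro mult_left_mono) auto
      then have "2 * A + \<bar>1 - c\<bar> \<le> A * s y'" using A by (simp add: algebra_simps)
      moreover have "upper_step n (x t) (b t) y' \<le> 1"
        using upper_step_bound[OF conf[of t], of y'] t a by auto
      moreover have "0 \<le> \<kappa> * (t - a)" using \<kappa> t by auto
      ultimately show ?thesis using gt A by linarith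
    qed
    define p where "p = A * ((y - x0) / s y)"
    have pA: "\<bar>p\<bar> \<le> A"
    proof -
      have "\<bar>(y - x0) / s y\<bar> \<le> 1" using s[of y] by (simp add: abs_divide divide_le_eq)
      then show ?thesis unfolding p_def abs_mult using A mult_left_mono[of _ 1 A] by fastforce
    qed
    have "\<kappa> + p * velocity n (x t) (b t) i > 0"
      if i: "i \<in> {1..n}" "x t i = y" "b t i * p > 0" for i
    proof -
      define r where "r = \<bar>p\<bar> / (2 * A)"
      have p0: "p \<noteq> 0" using i by auto
      have r: "r > 0" "A * r \<le> \<bar>p\<bar> / 2" "\<bar>p\<bar> * (1 / r) = 2 * A" unfolding r_def using A p0 by auto
      have c: "(x t, b t) \<in> configurations n" using conf t a by auto
      have "- (p * velocity n (x t) (b t) i) \<le> \<bar>p\<bar> * (27 * A * r + 2 / (real n * r) +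
        (LINT z:far r|lborel. (upper_step n (x t) (b t) (y + z) - upper_step n (x t) (b t) y) / z\<^sup>2))"
      proof (rule contact_estimate[OF c i _ r(1,2)])
        fix z
        have "upper_step n (x t) (b t) (y + z) - upper_step n (x t) (b t) y \<le> A * (s (y + z) - s y)"
          using glob[of "y + z"] by (simp add: algebra_simps)
        also have "s (y + z) - s y \<le> (y - x0) / s y * z + z\<^sup>2"
          using sqrt_one_plus_square_le[of "y - x0" z] by (simp add: s_def algebra_simps)
        then have "A * (s (y + z) - s y) \<le> A * ((y - x0) / s y * z + z\<^sup>2)"
          using A by (intro mult_left_mono) auto
        also have "\<dots> = p * z + A * z\<^sup>2" by (simp add: p_def algebra_simps)
        finally show "upper_step n (x t) (b t) (y + z) - upper_step n (x t) (b t) y \<le> p * z + A * z\<^sup>2" .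
      qed (use A in auto)
      also have "\<dots> \<le> \<bar>p\<bar> * (27 * A * r + 2 * (1 / r) + 4 * (1 / r))"
      proof (intro mult_left_mono add_mono)
        have "2 / (real n * r) \<le> 2 / (1 * r)"
          using n r(1) by (intro divide_left_mono mult_right_mono mult_pos_pos) auto
        then show "2 / (real n * r) \<le> 2 * (1 / r)" by simp
        have "\<bar>LINT z:far r|lborel. (upper_step n (x t) (b t) (y + z) - upper_step n (x t) (b t) y) / z\<^sup>2\<bar> \<le> 2 * (2 / r)"
        proof (rule far_integral_bound[OF r(1)])
          show "(\<lambda>z. upper_step n (x t) (b t) (y + z) - upper_step n (x t) (b t) y) \<in> borel_measurable borel"
            using upper_step_measurable by measurable
          show "\<bar>upper_step n (x t) (b t) (y + z) - upper_step n (x t) (b t) y\<bar> \<le> 2" for z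
            using upper_step_bound[OF c, of "y + z"] upper_step_bound[OF c, of y] by linarith
        qed
        then show "(LINT z:far r|lborel. (upper_step n (x t) (b t) (y + z) - upper_step n (x t) (b t) y) / z\<^sup>2) \<le> 4 * (1 / r)"
          by (simp add: abs_le_iff)
      qed (use A in auto)
      also have "\<dots> = 27 * \<bar>p\<bar> * (A * r) + 6 * (\<bar>p\<bar> * (1 / r))"
      proof -
        have "P * (27 * A * r + 2 * q + 4 * q) = 27 * P * (A * r) + 6 * (P * q)" for P q :: real
          by (simp add: algebra_simps)
        then show ?thesis .
      qed
      also have "\<dots> \<le> 27 * A * (A / 2) + 6 * (2 * A)"
      proof (rule add_mono)
        have "A * r \<le> A / 2" using r(2) pA by linarith
        then show "27 * \<bar>p\<bar> * (A * r) \<le> 27 * A * (A / 2)"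
          using pA A r(1) by (intro mult_mono) simp_all
        show "6 * (\<bar>p\<bar> * (1 / r)) \<le> 6 * (2 * A)" unfolding r(3) by simp
      qed
      also have "\<dots> < \<kappa>"
      proof -
        have "27 * A * (A / 2) = 27 / 2 * A\<^sup>2" by (simp add: power2_eq_square)
        moreover have "0 \<le> A\<^sup>2" by simp
        ultimately show ?thesis unfolding \<kappa>_def barrier_speed_def by linarith
      qed
      finally show ?thesis by linarith
    qed
    then show "(A * ((y - x0) / s y) = 0 \<longrightarrow> 0 < \<kappa>) \<and> (\<forall>i\<in>{1..n}. x t i = y \<and> 0 < b t i * (A * ((y - x0) / s y)) \<longrightarrow>
      0 < \<kappa> + A * ((y - x0) / s y) * velocity n (x t) (b t) i)"
      using \<kappa> unfolding p_def by simp
  qed (use a R in auto)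
  then show ?thesis by (simp add: s_def \<kappa>_def algebra_simps)
qed

section \<open>Calculus of test functions on the open half plane\<close>

lemma C1_Q_DERIV:
  assumes "C1_Q f" "t > 0"
  shows "((\<lambda>s. f s x) has_real_derivative d_t f t x) (at t)"
    and "((\<lambda>y. f t y) has_real_derivative d_x f t x) (at x)"
proof -
  have "(t, x) \<in> Q" using assms(2) by (simp add: Q_def)
  then have "(\<lambda>s. f s x) field_differentiable (at t)" "(\<lambda>y. f t y) field_differentiable (at x)"
  proof -
    have "\<forall>(t, x)\<in>Q. (\<lambda>s. f s x) field_differentiable (at t) \<and> (\<lambda>y. f t y) field_differentiable (at x)"
      using assms(1) unfolding C1_Q_def by (elim conjE)
    from bspec[OF this \<open>(t, x) \<in> Q\<close>]
    show "(\<lambda>s. f s x) field_differentiable (at t)" "(\<lambda>y. f t y) field_differentiable (at x)" by simp_all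
  qed
  then show "((\<lambda>s. f s x) has_real_derivative d_t f t x) (at t)"
    "((\<lambda>y. f t y) has_real_derivative d_x f t x) (at x)"
    unfolding d_t_def d_x_def by (simp_all add: field_differentiable_derivI)
qed

lemma C1_Q_cont:
  assumes "C1_Q f"
  shows "continuous_on Q (\<lambda>(t, x). f t x)" "continuous_on Q (\<lambda>(t, x). d_t f t x)" "continuous_on Q (\<lambda>(t, x). d_x f t x)"
proof -
  note * = assms[unfolded C1_Q_def]
  show "continuous_on Q (\<lambda>(t, x). f t x)" using * by (elim conjE)
  show "continuous_on Q (\<lambda>(t, x). d_t f t x)" using * by (elim conjE)
  show "continuous_on Q (\<lambda>(t, x). d_x f t x)" using * by (elim conjE)
qed

lemma d_t_eqI: "((\<lambda>s. f s x) has_real_derivative D) (at t) \<Longrightarrow> d_t f t x = D"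
  unfolding d_t_def by (rule DERIV_imp_deriv)

lemma d_x_eqI: "((\<lambda>y. f t y) has_real_derivative D) (at x) \<Longrightarrow> d_x f t x = D"
  unfolding d_x_def by (rule DERIV_imp_deriv)

lemma continuous_on_Q_cong:
  assumes "\<And>t x. t > 0 \<Longrightarrow> f t x = g t x"
  shows "continuous_on Q (\<lambda>(t, x). f t x) \<longleftrightarrow> continuous_on Q (\<lambda>(t, x). g t (x::real))"
  using assms by (intro continuous_on_cong refl) (auto simp: Q_def)

lemma C1_QI:
  assumes t: "\<And>t x. t > 0 \<Longrightarrow> ((\<lambda>s. f s x) has_real_derivative ft t x) (at t)"
    and x: "\<And>t x. t > 0 \<Longrightarrow> ((\<lambda>y. f t y) has_real_derivative fx t x) (at x)"
    and c: "continuous_on Q (\<lambda>(t, x). f t x)" "continuous_on Q (\<lambda>(t, x). ft t x)" "continuous_on Q (\<lambda>(t, x). fx t x)"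
  shows "C1_Q f"
proof -
  have "continuous_on Q (\<lambda>(t, x). d_t f t x)"
    by (rule iffD2[OF continuous_on_Q_cong c(2)]) (rule d_t_eqI[OF t])
  moreover have "continuous_on Q (\<lambda>(t, x). d_x f t x)"
    by (rule iffD2[OF continuous_on_Q_cong c(3)]) (rule d_x_eqI[OF x])
  moreover have "\<forall>(t, x)\<in>Q. (\<lambda>s. f s x) field_differentiable (at t) \<and> (\<lambda>y. f t y) field_differentiable (at x)"
  proof (intro ballI, clarify)
    fix t x assume "(t, x) \<in> Q"
    then have "t > 0" by (simp add: Q_def)
    with t x show "(\<lambda>s. f s x) field_differentiable (at t) \<and> (\<lambda>y. f t y) field_differentiable (at x)"
      unfolding field_differentiable_def by blast
  qed
  ultimately show ?thesis using c(1) unfolding C1_Q_def by (intro conjI)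
qed

text \<open>At a point with t > 0, \<open>d_t\<close> and \<open>d_x\<close> depend only on values
  near that point, hence inside \<open>Q\<close>.\<close>

lemma C1_Q_cong:
  assumes "C1_Q f" "\<And>t x. t > 0 \<Longrightarrow> g t x = f t x"
  shows "C1_Q g"
proof -
  have t: "((\<lambda>s. g s x) has_real_derivative d_t f t x) (at t)" if "t > 0" for t x
    by (rule has_field_derivative_transform_within_open[OF C1_Q_DERIV(1)[OF assms(1) that], of "{0<..}"])
       (use assms(2) that in auto)
  have x: "((\<lambda>y. g t y) has_real_derivative d_x f t x) (at x)" if "t > 0" for t x
    by (rule has_field_derivative_transform_within_open[OF C1_Q_DERIV(2)[OF assms(1) that], of UNIV])
       (use assms(2) that in auto)
  have c: "continuous_on Q (\<lambda>(t, x). g t x)"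
    by (rule iffD2[OF continuous_on_Q_cong C1_Q_cont(1)[OF assms(1)]]) (rule assms(2))
  show "C1_Q g" by (rule C1_QI[OF t x c C1_Q_cont(2,3)[OF assms(1)]])
qed

lemma
  assumes f: "C1_Q f" and g: "C1_Q g"
  shows C1_Q_add: "C1_Q (\<lambda>t x. f t x + g t x)"
    and d_t_add: "t > 0 \<Longrightarrow> d_t (\<lambda>t x. f t x + g t x) t x = d_t f t x + d_t g t x"
    and d_x_add: "t > 0 \<Longrightarrow> d_x (\<lambda>t x. f t x + g t x) t x = d_x f t x + d_x g t x"
    and C1_Q_mult: "C1_Q (\<lambda>t x. f t x * g t x)"
    and d_t_mult: "t > 0 \<Longrightarrow> d_t (\<lambda>t x. f t x * g t x) t x = d_t f t x * g t x + d_t g t x * f t x"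
    and d_x_mult: "t > 0 \<Longrightarrow> d_x (\<lambda>t x. f t x * g t x) t x = d_x f t x * g t x + d_x g t x * f t x"
proof -
  note D = C1_Q_DERIV[OF f] C1_Q_DERIV[OF g]
  note c = C1_Q_cont[OF f, unfolded case_prod_beta] C1_Q_cont[OF g, unfolded case_prod_beta]
  have ta: "((\<lambda>s. f s x + g s x) has_real_derivative d_t f t x + d_t g t x) (at t)"
    and xa: "((\<lambda>y. f t y + g t y) has_real_derivative d_x f t x + d_x g t x) (at x)"
    and tm: "((\<lambda>s. f s x * g s x) has_real_derivative d_t f t x * g t x + d_t g t x * f t x) (at t)"
    and xm: "((\<lambda>y. f t y * g t y) has_real_derivative d_x f t x * g t x + d_x g t x * f t x) (at x)"
    if "t > 0" for t x
    using D that by (auto intro!: DERIV_add DERIV_mult)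
  show "C1_Q (\<lambda>t x. f t x + g t x)"
    by (rule C1_QI[OF ta xa]) (auto simp: case_prod_beta intro!: continuous_intros c)
  show "C1_Q (\<lambda>t x. f t x * g t x)"
    by (rule C1_QI[OF tm xm]) (auto simp: case_prod_beta intro!: continuous_intros c)
  show "t > 0 \<Longrightarrow> d_t (\<lambda>t x. f t x + g t x) t x = d_t f t x + d_t g t x" by (rule d_t_eqI[OF ta])
  show "t > 0 \<Longrightarrow> d_x (\<lambda>t x. f t x + g t x) t x = d_x f t x + d_x g t x" by (rule d_x_eqI[OF xa])
  show "t > 0 \<Longrightarrow> d_t (\<lambda>t x. f t x * g t x) t x = d_t f t x * g t x + d_t g t x * f t x" by (rule d_t_eqI[OF tm])
  show "t > 0 \<Longrightarrow> d_x (\<lambda>t x. f t x * g t x) t x = d_x f t x * g t x + d_x g t x * f t x" by (rule d_x_eqI[OF xm])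
qed

lemma C1_Q_space:
  assumes "\<And>x. (g has_real_derivative g' x) (at x)" "continuous_on UNIV g'"
  shows "C1_Q (\<lambda>t x. g x)"
proof (rule C1_QI[where ft = "\<lambda>t x. 0" and fx = "\<lambda>t x. g' x"])
  have "continuous_on UNIV g" by (intro continuous_at_imp_continuous_on ballI) (rule DERIV_isCont[OF assms(1)])
  then show "continuous_on Q (\<lambda>(t, x). g x)"
    unfolding case_prod_beta by (rule continuous_on_compose2) (auto intro: continuous_intros)
  show "continuous_on Q (\<lambda>(t, x). g' x)"
    unfolding case_prod_beta using assms(2) by (rule continuous_on_compose2) (auto intro: continuous_intros)
qed (use assms in \<open>auto intro: continuous_intros simp: case_prod_beta\<close>)

lemma C1_Q_time:
  assumes "\<And>t. (g has_real_derivative g' t) (at t)" "continuous_on UNIV g'"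
  shows "C1_Q (\<lambda>t x. g t)"
proof (rule C1_QI[where fx = "\<lambda>t x. 0" and ft = "\<lambda>t x. g' t"])
  have "continuous_on UNIV g" by (intro continuous_at_imp_continuous_on ballI) (rule DERIV_isCont[OF assms(1)])
  then show "continuous_on Q (\<lambda>(t, x). g t)"
    unfolding case_prod_beta by (rule continuous_on_compose2) (auto intro: continuous_intros)
  show "continuous_on Q (\<lambda>(t, x). g' t)"
    unfolding case_prod_beta using assms(2) by (rule continuous_on_compose2) (auto intro: continuous_intros)
qed (use assms in \<open>auto intro: continuous_intros simp: case_prod_beta\<close>)

text \<open>The functions \<open>d_t f\<close> and \<open>d_x f\<close> are known explicitly only
  for t > 0; this form lets closed expressions stand in for them when the second derivatives are
  checked.\<close>

lemma C2_QI:
  assumes "C1_Q f" "C1_Q ft" "C1_Q fx"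
    "\<And>t x. t > 0 \<Longrightarrow> d_t f t x = ft t x" "\<And>t x. t > 0 \<Longrightarrow> d_x f t x = fx t x"
  shows "C2_Q f"
  unfolding C2_Q_def
proof (intro conjI)
  show "C1_Q f" by (rule assms(1))
  show "C1_Q (d_t f)" by (rule C1_Q_cong[OF assms(2)]) (rule assms(4))
  show "C1_Q (d_x f)" by (rule C1_Q_cong[OF assms(3)]) (rule assms(5))
qed

lemma C2_Q_D: assumes "C2_Q f" shows "C1_Q f" "C1_Q (d_t f)" "C1_Q (d_x f)"
  using assms unfolding C2_Q_def by simp_all

lemma
  assumes f: "C2_Q f" and g: "C2_Q g"
  shows C2_Q_add: "C2_Q (\<lambda>t x. f t x + g t x)" and C2_Q_mult: "C2_Q (\<lambda>t x. f t x * g t x)"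
proof -
  note D = C2_Q_D[OF f] C2_Q_D[OF g]
  show "C2_Q (\<lambda>t x. f t x + g t x)"
    by (rule C2_QI[where ft = "\<lambda>t x. d_t f t x + d_t g t x" and fx = "\<lambda>t x. d_x f t x + d_x g t x"])
       (simp_all add: D C1_Q_add d_t_add d_x_add)
  show "C2_Q (\<lambda>t x. f t x * g t x)"
    by (rule C2_QI[where ft = "\<lambda>t x. d_t f t x * g t x + d_t g t x * f t x"
        and fx = "\<lambda>t x. d_x f t x * g t x + d_x g t x * f t x"])
       (simp_all add: D C1_Q_add C1_Q_mult d_t_mult d_x_mult)
qed

lemma C2_Q_space:
  assumes "\<And>x. (g has_real_derivative g' x) (at x)" "\<And>x. (g' has_real_derivative g'' x) (at x)"
    "continuous_on UNIV g''"
  shows "C2_Q (\<lambda>t x. g x)"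
proof (rule C2_QI[where ft = "\<lambda>t x. 0" and fx = "\<lambda>t x. g' x"])
  have "continuous_on UNIV g'" by (intro continuous_at_imp_continuous_on ballI) (rule DERIV_isCont[OF assms(2)])
  then show "C1_Q (\<lambda>t x. g x)" by (rule C1_Q_space[OF assms(1)])
  show "C1_Q (\<lambda>t x. g' x)" by (rule C1_Q_space[OF assms(2,3)])
  show "C1_Q (\<lambda>t x. 0)" by (rule C1_Q_space[of _ "\<lambda>x. 0"]) auto
qed (use assms in \<open>auto intro!: d_t_eqI d_x_eqI\<close>)

lemma C2_Q_time:
  assumes "\<And>t. (g has_real_derivative g' t) (at t)" "\<And>t. (g' has_real_derivative g'' t) (at t)"
    "continuous_on UNIV g''"
  shows "C2_Q (\<lambda>t x. g t)"
proof (rule C2_QI[where ft = "\<lambda>t x. g' t" and fx = "\<lambda>t x. 0"])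
  have "continuous_on UNIV g'" by (intro continuous_at_imp_continuous_on ballI) (rule DERIV_isCont[OF assms(2)])
  then show "C1_Q (\<lambda>t x. g t)" by (rule C1_Q_time[OF assms(1)])
  show "C1_Q (\<lambda>t x. g' t)" by (rule C1_Q_time[OF assms(2,3)])
  show "C1_Q (\<lambda>t x. 0)" by (rule C1_Q_space[of _ "\<lambda>x. 0"]) auto
qed (use assms in \<open>auto intro!: d_t_eqI d_x_eqI\<close>)

lemma C2_Q_const: "C2_Q (\<lambda>t x. c)"
  by (rule C2_Q_space[of _ "\<lambda>x. 0" "\<lambda>x. 0"]) auto

lemma C2_Q_uminus: "C2_Q f \<Longrightarrow> C2_Q (\<lambda>t x. - f t x)"
  using C2_Q_mult[OF C2_Q_const[of "-1"], of f] by simp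

lemma C2_Q_quartic: "C2_Q (\<lambda>t x. c * (x - z) ^ 4)"
  by (rule C2_Q_space[of _ "\<lambda>x. 4 * c * (x - z) ^ 3" "\<lambda>x. 12 * c * (x - z) ^ 2"])
     (auto intro!: derivative_eq_intros continuous_intros)

lemma C2_Q_quadratic: "C2_Q (\<lambda>t x. c * (t - s)\<^sup>2 + d * t)"
  by (rule C2_Q_time[of _ "\<lambda>t. 2 * c * (t - s) + d" "\<lambda>t. 2 * c"])
     (auto intro!: derivative_eq_intros continuous_intros)

lemma open_Q: "open Q"
  unfolding Q_def by (intro open_Times) auto

text \<open>Along a particle path t and x change together, so joint differentiability is required;
  it follows from the partial derivatives because \<open>d_x f\<close> is continuous.\<close>

lemma C1_Q_has_derivative:
  assumes f: "C1_Q f" and t: "t > 0"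
  shows "((\<lambda>(s, y). f s y) has_derivative (\<lambda>(h, k). d_t f t x * h + d_x f t x * k)) (at (t, x))"
proof -
  have "((\<lambda>(s, y). f s y) has_derivative (\<lambda>(h, k). d_t f t x * h + blinfun_apply (blinfun_mult_right (d_x f t x)) k))
      (at (t, x) within {0<..} \<times> UNIV)"
  proof (rule has_derivative_partialsI)
    show "((\<lambda>s. f s x) has_derivative (\<lambda>h. d_t f t x * h)) (at t within {0<..})"
      using C1_Q_DERIV(1)[OF f t, of x] by (auto simp: has_field_derivative_def intro: has_derivative_at_withinI)
    show "((\<lambda>y. f s y) has_derivative blinfun_apply (blinfun_mult_right (d_x f s y))) (at y within UNIV)"
      if "s \<in> {0<..}" for s y
      using C1_Q_DERIV(2)[OF f, of s y] that by (simp add: has_field_derivative_def)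
    have c: "continuous_on Q (\<lambda>(s, y). blinfun_mult_right (d_x f s y))"
      using bounded_linear.continuous_on[OF bounded_linear_blinfun_mult_right C1_Q_cont(3)[OF f]]
      by (simp add: case_prod_beta)
    show "continuous (at (t, x) within {0<..} \<times> UNIV) (\<lambda>(s, y). blinfun_mult_right (d_x f s y))"
      using c t unfolding continuous_on_eq_continuous_within Q_def by simp
  qed (use t in auto)
  moreover have "at (t, x) within {0<..} \<times> UNIV = at (t, x)"
    using open_Q t by (intro at_within_open) (auto simp: Q_def)
  ultimately show ?thesis by simp
qed

subsection \<open>The upper half-relaxed limit\<close>

definition upper_lim :: "(nat \<Rightarrow> real \<Rightarrow> nat \<Rightarrow> real) \<Rightarrow> (nat \<Rightarrow> real \<Rightarrow> nat \<Rightarrow> real) \<Rightarrow> real \<Rightarrow> real \<Rightarrow> real" where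
  "upper_lim x b t y = Inf {c. \<exists>\<delta>>0. \<exists>N. \<forall>n\<ge>N. \<forall>s\<ge>0. \<forall>z. \<bar>s - t\<bar> < \<delta> \<longrightarrow> \<bar>z - y\<bar> < \<delta> \<longrightarrow>
     step_function n (x n s) (b n s) z \<le> c}"

lemma flow_conf: "particle_flow n x b \<Longrightarrow> t \<ge> 0 \<Longrightarrow> (x t, b t) \<in> configurations n"
  unfolding particle_flow_def by blast

context
  fixes x b :: "nat \<Rightarrow> real \<Rightarrow> nat \<Rightarrow> real"
  assumes flow: "\<And>n. n \<ge> 2 \<Longrightarrow> particle_flow n (x n) (b n)"
begin

lemma upper_lim_set:
  assumes "t \<ge> 0"
  shows "1 \<in> {c. \<exists>\<delta>>0. \<exists>N. \<forall>n\<ge>N. \<forall>s\<ge>0. \<forall>z. \<bar>s - t\<bar> < \<delta> \<longrightarrow> \<bar>z - y\<bar> < \<delta> \<longrightarrow>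
     step_function n (x n s) (b n s) z \<le> c}" (is "_ \<in> ?A")
    and "\<And>c. c \<in> {c. \<exists>\<delta>>0. \<exists>N. \<forall>n\<ge>N. \<forall>s\<ge>0. \<forall>z. \<bar>s - t\<bar> < \<delta> \<longrightarrow> \<bar>z - y\<bar> < \<delta> \<longrightarrow>
     step_function n (x n s) (b n s) z \<le> c} \<Longrightarrow> -1 \<le> c"
proof -
  have bd: "\<bar>step_function n (x n s) (b n s) z\<bar> \<le> 1" if "n \<ge> 2" "s \<ge> 0" for n s z
    using step_function_bound[OF flow_conf[OF flow[OF that(1)] that(2)]] .
  have "\<forall>n\<ge>2. \<forall>s\<ge>0. \<forall>z. \<bar>s - t\<bar> < 1 \<longrightarrow> \<bar>z - y\<bar> < 1 \<longrightarrow> step_function n (x n s) (b n s) z \<le> 1"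
    using bd by (auto simp: abs_le_iff)
  then show "1 \<in> ?A" using zero_less_one by blast
  fix c assume "c \<in> ?A"
  then obtain \<delta> N where "\<delta> > 0" "\<forall>n\<ge>N. \<forall>s\<ge>0. \<forall>z. \<bar>s - t\<bar> < \<delta> \<longrightarrow> \<bar>z - y\<bar> < \<delta> \<longrightarrow>
     step_function n (x n s) (b n s) z \<le> c" by blast
  then have "step_function (max N 2) (x (max N 2) t) (b (max N 2) t) y \<le> c" using assms by auto
  with bd[of "max N 2" t y] assms show "-1 \<le> c" by (auto simp: abs_le_iff)
qed

text \<open>By \<open>upper_step_attained\<close>, a bound for the step functions on an open
  neighbourhood is also one for their envelopes.\<close>

lemma upper_lim_upper_step:
  assumes t: "t \<ge> 0" and \<epsilon>: "\<epsilon> > 0"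
  obtains \<delta> N where "\<delta> > 0" "N \<ge> 2"
    "\<And>n s z. n \<ge> N \<Longrightarrow> s \<ge> 0 \<Longrightarrow> \<bar>s - t\<bar> < \<delta> \<Longrightarrow> \<bar>z - y\<bar> < \<delta> \<Longrightarrow>
       upper_step n (x n s) (b n s) z < upper_lim x b t y + \<epsilon>"
proof -
  let ?A = "{c. \<exists>\<delta>>0. \<exists>N. \<forall>n\<ge>N. \<forall>s\<ge>0. \<forall>z. \<bar>s - t\<bar> < \<delta> \<longrightarrow> \<bar>z - y\<bar> < \<delta> \<longrightarrow>
     step_function n (x n s) (b n s) z \<le> c}"
  have "Inf ?A < upper_lim x b t y + \<epsilon>" unfolding upper_lim_def using \<epsilon> by simp
  moreover have "?A \<noteq> {}"
  proof
    assume "?A = {}"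
    with upper_lim_set(1)[OF t, of y] show False by (simp only: empty_iff)
  qed
  ultimately obtain c where c: "c \<in> ?A" "c < upper_lim x b t y + \<epsilon>"
    by (metis (no_types, lifting) cInf_lessD)
  then obtain \<delta> N where \<delta>: "\<delta> > 0" "\<And>n s z. n \<ge> N \<Longrightarrow> s \<ge> 0 \<Longrightarrow> \<bar>s - t\<bar> < \<delta> \<Longrightarrow> \<bar>z - y\<bar> < \<delta> \<Longrightarrow>
     step_function n (x n s) (b n s) z \<le> c" by blast
  have "upper_step n (x n s) (b n s) z < upper_lim x b t y + \<epsilon>"
    if n: "n \<ge> max N 2" and s: "s \<ge> 0" "\<bar>s - t\<bar> < \<delta>" and z: "\<bar>z - y\<bar> < \<delta>" for n s z
  proof -
    obtain z' where z': "\<bar>z' - z\<bar> < \<delta> - \<bar>z - y\<bar>" "step_function n (x n s) (b n s) z' = upper_step n (x n s) (b n s) z"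
      using upper_step_attained[of "\<delta> - \<bar>z - y\<bar>" z n "x n s" "b n s"] z by auto
    have "\<bar>z' - y\<bar> < \<delta>" using z'(1) by linarith
    then have "step_function n (x n s) (b n s) z' \<le> c" using n s by (intro \<delta>(2)) auto
    with z'(2) c(2) show ?thesis by simp
  qed
  then show ?thesis using that[of \<delta> "max N 2"] \<delta>(1) by simp
qed

lemma upper_lim_approached:
  assumes t: "t \<ge> 0" and "\<epsilon> > 0" "\<delta> > 0"
  obtains n s z where "n \<ge> N" "s \<ge> 0" "\<bar>s - t\<bar> < \<delta>" "\<bar>z - y\<bar> < \<delta>"
    "step_function n (x n s) (b n s) z > upper_lim x b t y - \<epsilon>"
proof (rule ccontr)
  assume "\<not> thesis"
  with that have *: "step_function n (x n s) (b n s) z \<le> upper_lim x b t y - \<epsilon>"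
    if "n \<ge> N" "s \<ge> 0" "\<bar>s - t\<bar> < \<delta>" "\<bar>z - y\<bar> < \<delta>" for n s z
    using that by (meson not_le)
  let ?A = "{c. \<exists>\<delta>>0. \<exists>N. \<forall>n\<ge>N. \<forall>s\<ge>0. \<forall>z. \<bar>s - t\<bar> < \<delta> \<longrightarrow> \<bar>z - y\<bar> < \<delta> \<longrightarrow>
     step_function n (x n s) (b n s) z \<le> c}"
  have "upper_lim x b t y - \<epsilon> \<in> ?A" using * \<open>\<delta> > 0\<close> by blast
  moreover have "bdd_below ?A" by (rule bdd_belowI[of _ "-1"]) (rule upper_lim_set(2)[OF t])
  ultimately have "Inf ?A \<le> upper_lim x b t y - \<epsilon>" by (rule cInf_lower)
  then show False using \<open>\<epsilon> > 0\<close> unfolding upper_lim_def by simp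
qed

lemma upper_lim_bound:
  assumes t: "t \<ge> 0" shows "\<bar>upper_lim x b t y\<bar> \<le> 1"
proof -
  let ?A = "{c. \<exists>\<delta>>0. \<exists>N. \<forall>n\<ge>N. \<forall>s\<ge>0. \<forall>z. \<bar>s - t\<bar> < \<delta> \<longrightarrow> \<bar>z - y\<bar> < \<delta> \<longrightarrow>
     step_function n (x n s) (b n s) z \<le> c}"
  have "bdd_below ?A" by (rule bdd_belowI[of _ "-1"]) (rule upper_lim_set(2)[OF t])
  then have "Inf ?A \<le> 1" by (intro cInf_lower upper_lim_set(1)[OF t])
  moreover have "-1 \<le> Inf ?A"
  proof (rule cInf_greatest)
    show "?A \<noteq> {}"
    proof
      assume "?A = {}"
      with upper_lim_set(1)[OF t, of y] show False by (simp only: empty_iff)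
    qed
  qed (rule upper_lim_set(2)[OF t])
  ultimately show ?thesis unfolding upper_lim_def by (simp add: abs_le_iff)
qed

lemma upper_lim_usc:
  assumes t: "t \<ge> 0" and \<epsilon>: "\<epsilon> > 0"
  obtains \<delta> where "\<delta> > 0"
    "\<And>s z. s \<ge> 0 \<Longrightarrow> \<bar>s - t\<bar> < \<delta> \<Longrightarrow> \<bar>z - y\<bar> < \<delta> \<Longrightarrow> upper_lim x b s z < upper_lim x b t y + \<epsilon>"
proof -
  obtain \<delta> N where \<delta>: "\<delta> > 0" "N \<ge> 2"
    "\<And>n s z. n \<ge> N \<Longrightarrow> s \<ge> 0 \<Longrightarrow> \<bar>s - t\<bar> < \<delta> \<Longrightarrow> \<bar>z - y\<bar> < \<delta> \<Longrightarrow>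
       upper_step n (x n s) (b n s) z < upper_lim x b t y + \<epsilon> / 2"
    using upper_lim_upper_step[OF t, of "\<epsilon> / 2" y] \<epsilon> by auto
  have "upper_lim x b s z < upper_lim x b t y + \<epsilon>"
    if s: "s \<ge> 0" "\<bar>s - t\<bar> < \<delta> / 2" "\<bar>z - y\<bar> < \<delta> / 2" for s z
  proof -
    obtain n s' z' where n: "n \<ge> N" "s' \<ge> 0" "\<bar>s' - s\<bar> < \<delta> / 2" "\<bar>z' - z\<bar> < \<delta> / 2"
      "step_function n (x n s') (b n s') z' > upper_lim x b s z - \<epsilon> / 2"
      using upper_lim_approached[OF s(1), of "\<epsilon> / 2" "\<delta> / 2" N z] \<epsilon> \<delta>(1) by auto
    have "\<bar>s' - t\<bar> < \<delta>" "\<bar>z' - y\<bar> < \<delta>" using n s by linarith+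
    then have "upper_step n (x n s') (b n s') z' < upper_lim x b t y + \<epsilon> / 2"
      using n by (intro \<delta>(3)) auto
    with n(5) step_le_upper_step[of n "x n s'" "b n s'" z'] show ?thesis by linarith
  qed
  then show ?thesis using that[of "\<delta> / 2"] \<delta>(1) by simp
qed

text \<open>Each point comes with its own neighbourhood and its own N; compactness leaves finitely
  many, whose maximum serves all of K. Once the limit is known to be continuous, taking it for f
  gives one half of locally uniform convergence.\<close>

lemma upper_lim_compact:
  assumes K: "compact K" "K \<subseteq> {0..} \<times> UNIV" and cont: "continuous_on K (\<lambda>(t, y). f t y)"
    and le: "\<And>t y. (t, y) \<in> K \<Longrightarrow> upper_lim x b t y - f t y \<le> c" and \<epsilon>: "\<epsilon> > 0"
  obtains N where "N \<ge> 2" "\<And>n t y. n \<ge> N \<Longrightarrow> (t, y) \<in> K \<Longrightarrow> upper_step n (x n t) (b n t) y - f t y < c + \<epsilon>"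
proof -
  have "\<exists>d>0. \<exists>N\<ge>2. \<forall>q\<in>K. dist p q < d \<longrightarrow> (\<forall>n\<ge>N. upper_step n (x n (fst q)) (b n (fst q)) (snd q) - f (fst q) (snd q) < c + \<epsilon>)"
    if p: "p \<in> K" for p
  proof -
    obtain t y where ty: "p = (t, y)" by (cases p)
    have t: "t \<ge> 0" using K(2) p ty by auto
    obtain \<delta> N where \<delta>: "\<delta> > 0" "N \<ge> 2"
      "\<And>n s z. n \<ge> N \<Longrightarrow> s \<ge> 0 \<Longrightarrow> \<bar>s - t\<bar> < \<delta> \<Longrightarrow> \<bar>z - y\<bar> < \<delta> \<Longrightarrow>
         upper_step n (x n s) (b n s) z < upper_lim x b t y + \<epsilon> / 2"
      using upper_lim_upper_step[OF t, of "\<epsilon> / 2" y] \<epsilon> by auto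
    obtain d where d: "d > 0" "\<forall>q\<in>K. dist q p < d \<longrightarrow> dist (case q of (t, y) \<Rightarrow> f t y) (case p of (t, y) \<Rightarrow> f t y) < \<epsilon> / 2"
      using cont[unfolded continuous_on_iff, rule_format, OF p, of "\<epsilon> / 2"] \<epsilon> by auto
    have "upper_step n (x n (fst q)) (b n (fst q)) (snd q) - f (fst q) (snd q) < c + \<epsilon>"
      if q: "q \<in> K" "dist p q < min d \<delta>" and n: "n \<ge> N" for q n
    proof -
      have "\<bar>f (fst q) (snd q) - f t y\<bar> < \<epsilon> / 2"
        using bspec[OF d(2) q(1)] q(2) ty by (simp add: dist_real_def dist_commute case_prod_beta)
      moreover have "dist (fst q) t < \<delta>" "dist (snd q) y < \<delta>"
        using q(2) ty dist_fst_le[of q p] dist_snd_le[of q p] by (auto simp: dist_commute)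
      then have "upper_step n (x n (fst q)) (b n (fst q)) (snd q) < upper_lim x b t y + \<epsilon> / 2"
        using n q K(2) by (intro \<delta>(3)) (auto simp: dist_real_def)
      moreover have "upper_lim x b t y - f t y \<le> c" using le p ty by auto
      ultimately show ?thesis by linarith
    qed
    then show ?thesis using d(1) \<delta>(1,2) by (intro exI[of _ "min d \<delta>"]) auto
  qed
  then obtain d N where dN: "\<And>p. p \<in> K \<Longrightarrow> d p > 0" "\<And>p. p \<in> K \<Longrightarrow> N p \<ge> (2::nat)"
    "\<And>p q n. p \<in> K \<Longrightarrow> q \<in> K \<Longrightarrow> dist p q < d p \<Longrightarrow> n \<ge> N p \<Longrightarrow>
      upper_step n (x n (fst q)) (b n (fst q)) (snd q) - f (fst q) (snd q) < c + \<epsilon>"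
    by metis
  obtain C where C: "finite C" "C \<subseteq> K" "K \<subseteq> (\<Union>p\<in>C. ball p (d p))"
    using compactE_image[OF K(1), of K "\<lambda>p. ball p (d p)"] dN(1) by force
  define M where "M = Max (insert 2 (N ` C))"
  have M: "M \<ge> 2" "\<And>p. p \<in> C \<Longrightarrow> N p \<le> M" unfolding M_def using C(1) by auto
  have "upper_step n (x n t) (b n t) y - f t y < c + \<epsilon>" if "n \<ge> M" "(t, y) \<in> K" for n t y
  proof -
    obtain p where p: "p \<in> C" "dist p (t, y) < d p" using C(3) \<open>(t, y) \<in> K\<close> by auto
    have "N p \<le> n" using M(2)[OF p(1)] \<open>n \<ge> M\<close> by simp
    with dN(3)[of p "(t, y)" n] p C(2) \<open>(t, y) \<in> K\<close> show ?thesis by auto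
  qed
  with M(1) that show ?thesis by blast
qed

text \<open>If the final inequality failed at every such contact near (t0, x0),
  \<open>particle_comparison\<close> on a box would keep the envelopes minus \<Phi> below c0 -
  \<mu>, although values approaching c0 occur arbitrarily close to (t0, x0). The range R stays fixed
  while \<delta> shrinks, so that maximality of the contact can be used on a neighbourhood of fixed
  size.\<close>

lemma strict_contact:
  assumes \<Phi>: "C1_Q \<Phi>" and t0: "t0 > 0"
    and strict: "\<And>s y. s > 0 \<Longrightarrow> upper_lim x b s y - \<Phi> s y \<le>
      upper_lim x b t0 x0 - \<Phi> t0 x0 - (y - x0) ^ 4 - (s - t0)\<^sup>2"
    and R: "0 < R" and \<delta>: "\<delta> > 0"
  shows "\<exists>n t y. n \<ge> N \<and> n \<ge> 2 \<and> t > 0 \<and> \<bar>t - t0\<bar> < \<delta> \<and> \<bar>y - x0\<bar> < \<delta> \<and>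
    upper_step n (x n t) (b n t) y > upper_lim x b t0 x0 - \<delta> \<and>
    (\<forall>y'\<in>{x0-R..x0+R}. upper_step n (x n t) (b n t) y' - \<Phi> t y' \<le> upper_step n (x n t) (b n t) y - \<Phi> t y) \<and>
    (if d_x \<Phi> t y = 0 then d_t \<Phi> t y \<le> 0 else
      (\<exists>i\<in>{1..n}. x n t i = y \<and> b n t i * d_x \<Phi> t y > 0 \<and> d_t \<Phi> t y + d_x \<Phi> t y * velocity n (x n t) (b n t) i \<le> 0))"
proof (rule ccontr)
  assume contra: "\<not> ?thesis"
  define c0 where "c0 = upper_lim x b t0 x0 - \<Phi> t0 x0"
  have isC: "isCont (\<lambda>(t, y). \<Phi> t y) (t0, x0)"
    using C1_Q_cont(1)[OF \<Phi>] open_Q t0 by (simp add: continuous_on_eq_continuous_at Q_def)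
  have near: "\<exists>d>0. \<forall>s y. \<bar>s - t0\<bar> < d \<longrightarrow> \<bar>y - x0\<bar> < d \<longrightarrow> \<bar>\<Phi> s y - \<Phi> t0 x0\<bar> < e" if e: "e > 0" for e
  proof -
    obtain d where d: "d > 0" "\<And>q. dist q (t0, x0) < d \<Longrightarrow> dist (case q of (t, y) \<Rightarrow> \<Phi> t y) (\<Phi> t0 x0) < e"
      using isC e unfolding continuous_at_eps_delta by force
    have "\<bar>\<Phi> s y - \<Phi> t0 x0\<bar> < e" if "\<bar>s - t0\<bar> < d / 2" "\<bar>y - x0\<bar> < d / 2" for s y
    proof -
      have "dist (s, y) (t0, x0) \<le> \<bar>s - t0\<bar> + \<bar>y - x0\<bar>"
        unfolding dist_Pair_Pair dist_real_def using sqrt_sum_squares_le_sum_abs by simp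
      then have "dist (s, y) (t0, x0) < d" using that by linarith
      with d(2)[of "(s, y)"] show ?thesis by (simp add: dist_real_def)
    qed
    with d(1) show ?thesis by (intro exI[of _ "d / 2"]) auto
  qed
  obtain d1 where d1: "d1 > 0" "\<forall>s y. \<bar>s - t0\<bar> < d1 \<longrightarrow> \<bar>y - x0\<bar> < d1 \<longrightarrow> \<bar>\<Phi> s y - \<Phi> t0 x0\<bar> < \<delta> / 2"
    using near[of "\<delta> / 2"] \<delta> by auto
  define d where "d = min (min d1 \<delta>) (min R t0)"
  have d: "d > 0" "d \<le> d1" "d \<le> \<delta>" "d \<le> R" "d \<le> t0" unfolding d_def using d1(1) \<delta> R t0 by auto
  define \<rho> where "\<rho> = d / 2"
  have \<rho>: "\<rho> > 0" "\<rho> < d" "\<rho> < t0" using d t0 unfolding \<rho>_def by auto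
  \<comment> \<open>The strictness terms give a gap of 2 \<mu> on K. Half of it is spent on passing
    from the limit to large n, and \<mu> \<le> \<delta> / 2 keeps the contact value near the limit
    value.\<close>
  define \<mu> where "\<mu> = min (min (d ^ 4) (\<rho>\<^sup>2)) \<delta> / 4"
  have \<mu>: "\<mu> > 0" "2 * \<mu> \<le> d ^ 4" "2 * \<mu> \<le> \<rho>\<^sup>2" "\<mu> \<le> \<delta> / 2"
  proof -
    have "0 < d ^ 4" "0 < \<rho>\<^sup>2" using d \<rho> by auto
    then show "\<mu> > 0" "2 * \<mu> \<le> d ^ 4" "2 * \<mu> \<le> \<rho>\<^sup>2" "\<mu> \<le> \<delta> / 2" unfolding \<mu>_def using \<delta> by linarith+
  qed
  define box where "box = {t0 - \<rho>..t0 + \<rho>} \<times> {x0 - R..x0 + R}"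
  \<comment> \<open>The initial face together with two thick lateral strips: a contact in the box
    but outside K is already within distance d of x0.\<close>
  define K where "K = {t0 - \<rho>} \<times> {x0 - R..x0 + R} \<union> {t0 - \<rho>..t0 + \<rho>} \<times> ({x0 - R..x0 - d} \<union> {x0 + d..x0 + R})"
  have boxQ: "box \<subseteq> Q" "K \<subseteq> Q" unfolding box_def K_def Q_def using \<rho> by auto
  have Kc: "compact K" unfolding K_def by (intro compact_Un compact_Times) auto
  have KK: "upper_lim x b t y - \<Phi> t y \<le> c0 - 2 * \<mu>" if "(t, y) \<in> K" for t y
  proof -
    have t: "t > 0" using that boxQ(2) by (auto simp: Q_def)
    have "t = t0 - \<rho> \<or> d \<le> \<bar>y - x0\<bar>" using that unfolding K_def by auto
    then have "2 * \<mu> \<le> (y - x0) ^ 4 + (t - t0)\<^sup>2"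
    proof
      assume "t = t0 - \<rho>"
      then have "(t - t0)\<^sup>2 = \<rho>\<^sup>2" by simp
      moreover have "0 \<le> (y - x0) ^ 4" by simp
      ultimately show ?thesis using \<mu>(3) by linarith
    next
      assume "d \<le> \<bar>y - x0\<bar>"
      then have "d ^ 4 \<le> \<bar>y - x0\<bar> ^ 4" using d(1) by (intro power_mono) auto
      then have "d ^ 4 \<le> (y - x0) ^ 4" by simp
      moreover have "0 \<le> (t - t0)\<^sup>2" by simp
      ultimately show ?thesis using \<mu>(2) by linarith
    qed
    with strict[OF t, of y] show ?thesis unfolding c0_def by linarith
  qed
  have K0: "K \<subseteq> {0..} \<times> UNIV" using boxQ(2) by (auto simp: Q_def)
  obtain N1 where N1: "N1 \<ge> 2" "\<And>n t y. n \<ge> N1 \<Longrightarrow> (t, y) \<in> K \<Longrightarrow> upper_step n (x n t) (b n t) y - \<Phi> t y < (c0 - 2 * \<mu>) + \<mu>"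
    using upper_lim_compact[OF Kc K0 continuous_on_subset[OF C1_Q_cont(1)[OF \<Phi>] boxQ(2)] KK \<mu>(1)] by metis
  define m where "m = c0 - \<mu>"
  have main: "upper_step n (x n t) (b n t) y - \<Phi> t y \<le> m"
    if n: "n \<ge> max N N1" and t: "t \<in> {t0 - \<rho>..t0 + \<rho>}" and y: "y \<in> {x0 - R..x0 + R}" for n t y
  proof (rule particle_comparison[of n "x n" "b n" "t0 - \<rho>" "t0 + \<rho>" "x0 - R" "x0 + R" \<Phi> "d_t \<Phi>" "d_x \<Phi>"])
    have n2: "n \<ge> 2" using n N1(1) by simp
    show "particle_flow n (x n) (b n)" by (rule flow[OF n2])
    show "continuous_on ({t0 - \<rho>..t0 + \<rho>} \<times> {x0 - R..x0 + R}) (\<lambda>(t, y). \<Phi> t y)"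
      using continuous_on_subset[OF C1_Q_cont(1)[OF \<Phi>] boxQ(1)] unfolding box_def .
    show "((\<lambda>(s, y). \<Phi> s y) has_derivative (\<lambda>(h, k). d_t \<Phi> t y * h + d_x \<Phi> t y * k)) (at (t, y))"
      if "t \<in> {t0 - \<rho><..t0 + \<rho>}" for t y
      using that \<rho> by (intro C1_Q_has_derivative[OF \<Phi>]) auto
    show "upper_step n (x n (t0 - \<rho>)) (b n (t0 - \<rho>)) y - \<Phi> (t0 - \<rho>) y \<le> m" if "y \<in> {x0 - R..x0 + R}" for y
      using N1(2)[of n "t0 - \<rho>" y] n that by (auto simp: K_def m_def)
    show "upper_step n (x n t) (b n t) y - \<Phi> t y \<le> m" if "t \<in> {t0 - \<rho>..t0 + \<rho>}" "y \<in> {x0 - R, x0 + R}" for t y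
    proof -
      have "(t, y) \<in> K" using that d R unfolding K_def by auto
      with N1(2)[of n t y] n show ?thesis by (simp add: m_def)
    qed
    fix t y assume t: "t \<in> {t0 - \<rho><..t0 + \<rho>}" and y: "y \<in> {x0 - R<..<x0 + R}"
      and gt: "m < upper_step n (x n t) (b n t) y - \<Phi> t y"
      and max: "\<And>y'. y' \<in> {x0 - R..x0 + R} \<Longrightarrow> upper_step n (x n t) (b n t) y' - \<Phi> t y' \<le> upper_step n (x n t) (b n t) y - \<Phi> t y"
    have yd: "\<bar>y - x0\<bar> < d"
    proof (rule ccontr)
      assume "\<not> ?thesis"
      then have "(t, y) \<in> K" using t y unfolding K_def by auto
      with N1(2)[of n t y] n gt show False by (simp add: m_def)
    qed
    have td: "\<bar>t - t0\<bar> < d" "t > 0" using t \<rho> by auto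
    have "\<bar>\<Phi> t y - \<Phi> t0 x0\<bar> < \<delta> / 2" using d1(2) d(2) td yd by auto
    then have big: "upper_step n (x n t) (b n t) y > upper_lim x b t0 x0 - \<delta>"
      using gt \<mu>(4) unfolding m_def c0_def by linarith
    have "\<not> (if d_x \<Phi> t y = 0 then d_t \<Phi> t y \<le> 0 else
      (\<exists>i\<in>{1..n}. x n t i = y \<and> b n t i * d_x \<Phi> t y > 0 \<and> d_t \<Phi> t y + d_x \<Phi> t y * velocity n (x n t) (b n t) i \<le> 0))"
    proof
      assume *: "if d_x \<Phi> t y = 0 then d_t \<Phi> t y \<le> 0 else
        (\<exists>i\<in>{1..n}. x n t i = y \<and> b n t i * d_x \<Phi> t y > 0 \<and> d_t \<Phi> t y + d_x \<Phi> t y * velocity n (x n t) (b n t) i \<le> 0)"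
      have "\<bar>t - t0\<bar> < \<delta>" "\<bar>y - x0\<bar> < \<delta>" "n \<ge> N" using td yd d n by auto
      moreover have "\<forall>y'\<in>{x0-R..x0+R}. upper_step n (x n t) (b n t) y' - \<Phi> t y' \<le> upper_step n (x n t) (b n t) y - \<Phi> t y"
        using max by blast
      ultimately show False using contra n2 td(2) big * by blast
    qed
    then show "(d_x \<Phi> t y = 0 \<longrightarrow> 0 < d_t \<Phi> t y) \<and>
      (\<forall>i\<in>{1..n}. x n t i = y \<and> 0 < b n t i * d_x \<Phi> t y \<longrightarrow> 0 < d_t \<Phi> t y + d_x \<Phi> t y * velocity n (x n t) (b n t) i)"
      by (auto simp: not_le split: if_splits)
  qed (use \<rho> R t y in auto)
  \<comment> \<open>Inside the box there is a value above c0 - \<mu>, half of \<mu> being allowed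
    for the step function and half for \<Phi>.\<close>
  obtain d2 where d2: "d2 > 0" "\<forall>s y. \<bar>s - t0\<bar> < d2 \<longrightarrow> \<bar>y - x0\<bar> < d2 \<longrightarrow> \<bar>\<Phi> s y - \<Phi> t0 x0\<bar> < \<mu> / 2"
    using near[of "\<mu> / 2"] \<mu>(1) by auto
  define d3 where "d3 = min d2 (min \<rho> R)"
  have d3: "d3 > 0" "d3 \<le> d2" "d3 \<le> \<rho>" "d3 \<le> R" unfolding d3_def using d2 \<rho> R by auto
  obtain n s z where n: "n \<ge> max N N1" "s \<ge> 0" "\<bar>s - t0\<bar> < d3" "\<bar>z - x0\<bar> < d3"
    "step_function n (x n s) (b n s) z > upper_lim x b t0 x0 - \<mu> / 2"
    using upper_lim_approached[of t0 "\<mu> / 2" d3 "max N N1" x0] t0 \<mu>(1) d3(1) by auto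
  have "\<bar>\<Phi> s z - \<Phi> t0 x0\<bar> < \<mu> / 2" using d2(2) n d3 by auto
  moreover have "upper_step n (x n s) (b n s) z - \<Phi> s z \<le> m"
    using n d3 by (intro main) auto
  ultimately show False
    using n(5) step_le_upper_step[of n "x n s" "b n s" z] unfolding m_def c0_def by linarith
qed

end

section \<open>Passage to the limit in the nonlocal term\<close>

text \<open>Reverse Fatou lemma: the suprema \<open>V k\<close> of the tails decrease to a limit
  below H, and after division by z^2 they are dominated by B / z^2, which is integrable away from
  the origin.\<close>

lemma far_reverse_fatou:
  fixes h :: "nat \<Rightarrow> real \<Rightarrow> real"
  assumes r: "r > 0" and h: "\<And>k. h k \<in> borel_measurable borel" "\<And>k z. \<bar>h k z\<bar> \<le> B"
    and H: "H \<in> borel_measurable borel" "\<And>z. \<bar>H z\<bar> \<le> B"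
    and lim: "\<And>z e. e > 0 \<Longrightarrow> \<forall>\<^sub>F k in sequentially. h k z \<le> H z + e" and e: "e > 0"
  shows "\<forall>\<^sub>F k in sequentially. (LINT z:far r|lborel. h k z / z\<^sup>2) < (LINT z:far r|lborel. H z / z\<^sup>2) + e"
proof -
  define V where "V k z = (SUP j\<in>{k..}. h j z)" for k z
  define L where "L z = (INF k. V k z)" for z
  have bdd: "bdd_above ((\<lambda>j. h j z) ` J)" for J z
    using h(2) by (intro bdd_aboveI[of _ B]) (auto simp: abs_le_iff)
  have hV: "h j z \<le> V k z" if "j \<ge> k" for j k z
    unfolding V_def using that by (intro cSUP_upper bdd) auto
  have VB: "\<bar>V k z\<bar> \<le> B" for k z
  proof -
    have "V k z \<le> B" unfolding V_def using h(2) by (intro cSUP_least) (auto simp: abs_le_iff)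
    moreover have "- B \<le> V k z" using hV[of k k z] h(2)[of k z] by (simp add: abs_le_iff)
    ultimately show ?thesis by (simp add: abs_le_iff)
  qed
  have Vdec: "decseq (\<lambda>k. V k z)" for z
    unfolding decseq_def V_def by (intro allI impI cSUP_subset_mono bdd) auto
  have bV: "bdd_below (range (\<lambda>k. V k z))" for z
  proof (rule bdd_belowI2)
    fix k show "- B \<le> V k z" using VB[of k z] by linarith
  qed
  have VL: "(\<lambda>k. V k z) \<longlonglongrightarrow> L z" for z
    unfolding L_def by (rule LIMSEQ_decseq_INF[OF bV Vdec])
  have mV: "V k \<in> borel_measurable borel" for k
    unfolding V_def using h(1) bdd by (intro borel_measurable_cSUP) auto
  have mL: "L \<in> borel_measurable borel"
    by (rule borel_measurable_LIMSEQ_real[OF VL mV])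
  have LB: "\<bar>L z\<bar> \<le> B" for z
    using tendsto_upperbound[OF tendsto_rabs[OF VL[of z]], of B] VB by auto
  have LH: "L z \<le> H z" for z
  proof (rule field_le_epsilon)
    fix e :: real assume "e > 0"
    from lim[OF this, of z] obtain k where k: "\<And>j. j \<ge> k \<Longrightarrow> h j z \<le> H z + e"
      unfolding eventually_sequentially by auto
    have "L z \<le> V k z" unfolding L_def by (rule cINF_lower[OF bV]) simp
    also have "\<dots> \<le> H z + e" unfolding V_def using k by (intro cSUP_least) auto
    finally show "L z \<le> H z + e" .
  qed
  have "(\<lambda>k. LINT z|lborel. indicator (far r) z *\<^sub>R (V k z / z\<^sup>2)) \<longlonglongrightarrow> (LINT z|lborel. indicator (far r) z *\<^sub>R (L z / z\<^sup>2))"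
  proof (rule integral_dominated_convergence[where w = "\<lambda>z. indicator (far r) z *\<^sub>R (B / z\<^sup>2)"])
    show "integrable lborel (\<lambda>z. indicator (far r) z *\<^sub>R (B / z\<^sup>2))"
      using far_inverse_square(1)[OF r, of B] by (simp add: set_integrable_def)
    show "AE z in lborel. (\<lambda>k. indicator (far r) z *\<^sub>R (V k z / z\<^sup>2)) \<longlonglongrightarrow> indicator (far r) z *\<^sub>R (L z / z\<^sup>2)"
      by (intro AE_I2 tendsto_scaleR tendsto_const)
         (auto simp: divide_inverse intro!: tendsto_mult VL)
    show "AE z in lborel. norm (indicator (far r) z *\<^sub>R (V k z / z\<^sup>2)) \<le> indicator (far r) z *\<^sub>R (B / z\<^sup>2)" for k
      using VB by (intro AE_I2) (auto simp: indicator_def abs_divide intro!: divide_right_mono)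
    show "(\<lambda>z. indicator (far r) z *\<^sub>R (V k z / z\<^sup>2)) \<in> borel_measurable lborel" for k
      using mV[of k] by measurable
    show "(\<lambda>z. indicator (far r) z *\<^sub>R (L z / z\<^sup>2)) \<in> borel_measurable lborel"
      using mL by measurable
  qed
  then have conv: "(\<lambda>k. LINT z:far r|lborel. V k z / z\<^sup>2) \<longlonglongrightarrow> (LINT z:far r|lborel. L z / z\<^sup>2)"
    by (simp add: set_lebesgue_integral_def)
  have "(LINT z:far r|lborel. L z / z\<^sup>2) \<le> (LINT z:far r|lborel. H z / z\<^sup>2)"
    using LH by (intro set_integral_mono far_integrable[OF r mL LB] far_integrable[OF r H] divide_right_mono) auto
  then have "(LINT z:far r|lborel. L z / z\<^sup>2) < (LINT z:far r|lborel. H z / z\<^sup>2) + e" using e by simp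
  from order_tendstoD(2)[OF conv this] show ?thesis
  proof eventually_elim
    case (elim k)
    have "(LINT z:far r|lborel. h k z / z\<^sup>2) \<le> (LINT z:far r|lborel. V k z / z\<^sup>2)"
      using hV by (intro set_integral_mono far_integrable[OF r h] far_integrable[OF r mV VB] divide_right_mono) auto
    with elim show ?case by simp
  qed
qed

lemma usc_measurable:
  fixes f :: "real \<Rightarrow> real"
  assumes "\<And>y e. e > 0 \<Longrightarrow> \<exists>\<delta>>0. \<forall>z. \<bar>z - y\<bar> < \<delta> \<longrightarrow> f z < f y + e"
  shows "f \<in> borel_measurable borel"
proof -
  have "open {w. f w < a}" for a
    unfolding open_dist
  proof clarsimp
    fix y assume "f y < a"
    then obtain \<delta> where "\<delta> > 0" "\<forall>z. \<bar>z - y\<bar> < \<delta> \<longrightarrow> f z < f y + (a - f y)"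
      using assms[of "a - f y" y] by auto
    then show "\<exists>e>0. \<forall>z. dist z y < e \<longrightarrow> f z < a" by (auto simp: dist_real_def)
  qed
  then show ?thesis unfolding borel_measurable_iff_less by auto
qed

lemma mvt_two_sided:
  fixes f :: "real \<Rightarrow> real"
  assumes "\<And>y. (f has_real_derivative f' y) (at y)"
  shows "\<exists>\<xi>. \<bar>\<xi> - x\<bar> \<le> \<bar>z\<bar> \<and> f (x + z) - f x = z * f' \<xi>"
proof (cases z "0::real" rule: linorder_cases)
  case less
  obtain \<xi> where "x + z < \<xi>" "\<xi> < x" "f x - f (x + z) = (x - (x + z)) * f' \<xi>"
    using MVT2[of "x + z" x f f'] assms less by auto
  then show ?thesis using less by (intro exI[of _ \<xi>]) (auto simp: algebra_simps)
next
  case greater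
  obtain \<xi> where "x < \<xi>" "\<xi> < x + z" "f (x + z) - f x = (x + z - x) * f' \<xi>"
    using MVT2[of x "x + z" f f'] assms greater by auto
  then show ?thesis using greater by (intro exI[of _ \<xi>]) auto
qed auto

text \<open>The mean value theorem is applied twice. The constant is uniform near (t0, x0), because
  the contacts at which it is used vary with n.\<close>

lemma C2_Q_taylor:
  assumes \<Phi>: "C2_Q \<Phi>" and t0: "t0 > 0"
  obtains C d where "C \<ge> 0" "d > 0" "\<And>t y z. \<bar>t - t0\<bar> \<le> d \<Longrightarrow> \<bar>y - x0\<bar> \<le> 1 \<Longrightarrow> \<bar>z\<bar> \<le> 1 \<Longrightarrow>
    \<bar>\<Phi> t (y + z) - \<Phi> t y - d_x \<Phi> t y * z\<bar> \<le> C * z\<^sup>2"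
proof -
  note D = C2_Q_D[OF \<Phi>]
  define K where "K = {t0 / 2..3 * t0 / 2} \<times> {x0 - 2..x0 + 2}"
  have "compact ((\<lambda>(t, y). d_x (d_x \<Phi>) t y) ` K)"
    using C1_Q_cont(3)[OF D(3)] t0 unfolding K_def
    by (intro compact_continuous_image compact_Times compact_Icc) (auto elim!: continuous_on_subset simp: Q_def)
  then obtain C where C: "\<And>q. q \<in> K \<Longrightarrow> norm (case q of (t, y) \<Rightarrow> d_x (d_x \<Phi>) t y) \<le> C" "C > 0"
    using compact_imp_bounded bounded_pos by (metis (mono_tags, lifting) image_eqI)
  have "\<bar>\<Phi> t (y + z) - \<Phi> t y - d_x \<Phi> t y * z\<bar> \<le> C * z\<^sup>2"
    if t: "\<bar>t - t0\<bar> \<le> t0 / 2" and y: "\<bar>y - x0\<bar> \<le> 1" and z: "\<bar>z\<bar> \<le> 1" for t y z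
  proof -
    have tp: "t > 0" using t t0 by linarith
    obtain \<xi> where \<xi>: "\<bar>\<xi> - y\<bar> \<le> \<bar>z\<bar>" "\<Phi> t (y + z) - \<Phi> t y = z * d_x \<Phi> t \<xi>"
      using mvt_two_sided[of "\<lambda>y. \<Phi> t y" "\<lambda>y. d_x \<Phi> t y" y z] C1_Q_DERIV(2)[OF D(1) tp] by auto
    obtain \<eta> where \<eta>: "\<bar>\<eta> - y\<bar> \<le> \<bar>\<xi> - y\<bar>" "d_x \<Phi> t (y + (\<xi> - y)) - d_x \<Phi> t y = (\<xi> - y) * d_x (d_x \<Phi>) t \<eta>"
      using mvt_two_sided[of "\<lambda>y. d_x \<Phi> t y" "\<lambda>y. d_x (d_x \<Phi>) t y" y "\<xi> - y"] C1_Q_DERIV(2)[OF D(3) tp] by auto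
    have "\<bar>\<eta> - x0\<bar> \<le> 2" using \<eta>(1) \<xi>(1) y z by linarith
    moreover have "t0 / 2 \<le> t" "t \<le> 3 * t0 / 2" using t by linarith+
    ultimately have "(t, \<eta>) \<in> K" by (auto simp: K_def abs_le_iff)
    from C(1)[OF this] have C': "\<bar>d_x (d_x \<Phi>) t \<eta>\<bar> \<le> C" by simp
    have "\<Phi> t (y + z) - \<Phi> t y - d_x \<Phi> t y * z = z * (d_x \<Phi> t \<xi> - d_x \<Phi> t y)"
      unfolding \<xi>(2) by (simp add: algebra_simps)
    also have "\<dots> = z * ((\<xi> - y) * d_x (d_x \<Phi>) t \<eta>)"
      using \<eta>(2) by simp
    finally have "\<Phi> t (y + z) - \<Phi> t y - d_x \<Phi> t y * z = z * ((\<xi> - y) * d_x (d_x \<Phi>) t \<eta>)" .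
    then have "\<bar>\<Phi> t (y + z) - \<Phi> t y - d_x \<Phi> t y * z\<bar> = \<bar>z\<bar> * (\<bar>\<xi> - y\<bar> * \<bar>d_x (d_x \<Phi>) t \<eta>\<bar>)"
      by (simp add: abs_mult)
    also have "\<dots> \<le> \<bar>z\<bar> * (\<bar>z\<bar> * C)" using \<xi>(1) C' by (intro mult_left_mono mult_mono) auto
    also have "\<dots> = C * z\<^sup>2" by (simp add: power2_eq_square)
    finally show ?thesis .
  qed
  with C(2) t0 that[of C "t0 / 2"] show ?thesis by simp
qed

lemma odd_integral_zero:
  fixes f :: "real \<Rightarrow> real"
  assumes "\<And>z. f (- z) = - f z"
  shows "(LINT z|lborel. f z) = 0"
  using lborel_integral_real_affine[of "-1" f 0] assms by simp

text \<open>The integrand is odd and the annulus symmetric; the linear part of a test function can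
  thus be inserted or dropped between the radii r and \<rho>.\<close>

lemma annulus_linear:
  assumes r: "0 < r" "r \<le> \<rho>"
  shows "set_integrable lborel ({-\<rho><..<\<rho>} \<inter> far r) (\<lambda>z. p * z / z\<^sup>2)"
    and "(LINT z:{-\<rho><..<\<rho>} \<inter> far r|lborel. p * z / z\<^sup>2) = 0"
proof -
  define A where "A = {-\<rho><..<\<rho>} \<inter> far r"
  have sets: "A \<in> sets lborel" unfolding A_def by auto
  have "set_integrable lborel A (\<lambda>z. p * z / z\<^sup>2)"
  proof (rule set_integrable_bound[where f = "\<lambda>z. \<bar>p\<bar> * \<rho> / z\<^sup>2"])
    show "set_integrable lborel A (\<lambda>z. \<bar>p\<bar> * \<rho> / z\<^sup>2)"
      by (rule set_integrable_subset[OF far_inverse_square(1)[OF r(1)] sets]) (auto simp: A_def)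
    show "set_borel_measurable lborel A (\<lambda>z. p * z / z\<^sup>2)"
      unfolding set_borel_measurable_def A_def by measurable
    show "AE z in lborel. z \<in> A \<longrightarrow> norm (p * z / z\<^sup>2) \<le> norm (\<bar>p\<bar> * \<rho> / z\<^sup>2)"
      using r by (intro AE_I2 impI) (auto simp: A_def abs_mult abs_divide intro!: divide_right_mono mult_left_mono)
  qed
  moreover have "(LINT z:A|lborel. p * z / z\<^sup>2) = 0"
    unfolding set_lebesgue_integral_def
    by (rule odd_integral_zero) (auto simp: A_def indicator_def)
  ultimately show "set_integrable lborel ({-\<rho><..<\<rho>} \<inter> far r) (\<lambda>z. p * z / z\<^sup>2)"
    "(LINT z:{-\<rho><..<\<rho>} \<inter> far r|lborel. p * z / z\<^sup>2) = 0" by (simp_all add: A_def)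
qed

text \<open>The test function lies above \<open>u\<close>, so enlarging the region in which it replaces \<open>u\<close>
  increases the nonlocal operator; the linear part integrates to zero over the annulus.\<close>

lemma far_le_near_plus_far:
  fixes v g :: "real \<Rightarrow> real"
  assumes r: "0 < r" "r \<le> \<rho>" "r \<le> R" and v: "v \<in> borel_measurable borel" "\<And>z. \<bar>v z\<bar> \<le> B"
    and g: "continuous_on UNIV g" "\<And>z. \<bar>z\<bar> \<le> R \<Longrightarrow> \<bar>g z\<bar> \<le> C * z\<^sup>2"
    and vg: "\<And>z. v z \<le> g z + p * z"
  shows "(LINT z:far r|lborel. v z / z\<^sup>2) \<le>
    (LINT z:{-\<rho><..<\<rho>}|lborel. g z / z\<^sup>2) + (LINT z:far \<rho>|lborel. v z / z\<^sup>2) + 2 * C * r"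
proof -
  define A where "A = {-\<rho><..<\<rho>} \<inter> far r"
  have \<rho>: "\<rho> > 0" using r by simp
  have mg: "g \<in> borel_measurable borel" using g(1) by (rule borel_measurable_continuous_onI)
  have "0 \<le> C * R\<^sup>2" using g(2)[of R] r by simp
  then have C: "C \<ge> 0" using r by (simp add: zero_le_mult_iff)
  have "compact (g ` {-\<rho>..\<rho>})" using g(1) by (intro compact_continuous_image compact_Icc) (auto elim: continuous_on_subset)
  then obtain M where M: "\<And>z. z \<in> {-\<rho>..\<rho>} \<Longrightarrow> \<bar>g z\<bar> \<le> M" 
    using compact_imp_bounded bounded_iff by (metis (no_types, opaque_lifting) image_eqI real_norm_def)
  \<comment> \<open>Near the origin the quadratic bound applies, elsewhere the bound M of g on a
    compact interval together with z^2 \<ge> r^2.\<close>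
  have ig: "set_integrable lborel {-\<rho><..<\<rho>} (\<lambda>z. g z / z\<^sup>2)"
  proof (rule set_integrable_bound[where f = "\<lambda>z. C + M / r\<^sup>2"])
    show "set_integrable lborel {-\<rho><..<\<rho>} (\<lambda>z. C + M / r\<^sup>2)"
      unfolding set_integrable_def
      by (intro integrable_scaleR_left integrable_real_indicator) (use r in auto)
    show "set_borel_measurable lborel {-\<rho><..<\<rho>} (\<lambda>z. g z / z\<^sup>2)"
      unfolding set_borel_measurable_def using mg by measurable
    show "AE z in lborel. z \<in> {-\<rho><..<\<rho>} \<longrightarrow> norm (g z / z\<^sup>2) \<le> norm (C + M / r\<^sup>2)"
    proof (intro AE_I2 impI)
      fix z assume z: "z \<in> {-\<rho><..<\<rho>}"
      have M0: "M \<ge> 0" using M[of 0] \<rho> by (auto intro: order_trans[OF abs_ge_zero])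
      have "\<bar>g z\<bar> / z\<^sup>2 \<le> C + M / r\<^sup>2"
      proof (cases "\<bar>z\<bar> \<le> r")
        case True
        then have "\<bar>g z\<bar> \<le> C * z\<^sup>2" using g(2) r by auto
        then have "\<bar>g z\<bar> / z\<^sup>2 \<le> C" using C by (cases "z = 0") (auto simp: divide_le_eq)
        moreover have "0 \<le> M / r\<^sup>2" using M0 by simp
        ultimately show ?thesis by linarith
      next
        case False
        then have "r\<^sup>2 \<le> z\<^sup>2" using r abs_le_square_iff[of r z] by auto
        have "\<bar>g z\<bar> / z\<^sup>2 \<le> M / r\<^sup>2"
          using M[of z] z \<open>r\<^sup>2 \<le> z\<^sup>2\<close> M0 r by (intro frac_le) auto
        with C show ?thesis by linarith
      qed
      then show "norm (g z / z\<^sup>2) \<le> norm (C + M / r\<^sup>2)" by (simp add: abs_divide)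
    qed
  qed
  have iv: "set_integrable lborel (far r) (\<lambda>z. v z / z\<^sup>2)" by (rule far_integrable[OF r(1) v])
  have sets: "A \<in> sets lborel" "far \<rho> \<in> sets lborel" "{-r<..<r} \<in> sets lborel" unfolding A_def by auto
  have ivA: "set_integrable lborel A (\<lambda>z. v z / z\<^sup>2)" "set_integrable lborel (far \<rho>) (\<lambda>z. v z / z\<^sup>2)"
  proof -
    have "A \<subseteq> far r" "far \<rho> \<subseteq> far r" using r by (auto simp: A_def)
    then show "set_integrable lborel A (\<lambda>z. v z / z\<^sup>2)" "set_integrable lborel (far \<rho>) (\<lambda>z. v z / z\<^sup>2)"
      using set_integrable_subset[OF iv sets(1)] set_integrable_subset[OF iv sets(2)] by blast+
  qed
  have igA: "set_integrable lborel A (\<lambda>z. g z / z\<^sup>2)" "set_integrable lborel {-r<..<r} (\<lambda>z. g z / z\<^sup>2)"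
  proof -
    have "A \<subseteq> {-\<rho><..<\<rho>}" "{-r<..<r} \<subseteq> {-\<rho><..<\<rho>}" using r by (auto simp: A_def)
    then show "set_integrable lborel A (\<lambda>z. g z / z\<^sup>2)" "set_integrable lborel {-r<..<r} (\<lambda>z. g z / z\<^sup>2)"
      using set_integrable_subset[OF ig sets(1)] set_integrable_subset[OF ig sets(3)] by blast+
  qed
  note ip = annulus_linear[OF r(1,2), of p, folded A_def]
  note p0 = ip(2) and ip = ip(1)
  have U1: "far r = A \<union> far \<rho>" and U2: "{-\<rho><..<\<rho>} = {-r<..<r} \<union> A" using r by (auto simp: A_def)
  have "(LINT z:far r|lborel. v z / z\<^sup>2) = (LINT z:A|lborel. v z / z\<^sup>2) + (LINT z:far \<rho>|lborel. v z / z\<^sup>2)"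
    unfolding U1 by (rule set_integral_Un) (use ivA in \<open>auto simp: A_def\<close>)
  moreover have "(LINT z:A|lborel. v z / z\<^sup>2) \<le> (LINT z:A|lborel. g z / z\<^sup>2 + p * z / z\<^sup>2)"
  proof (rule set_integral_mono[OF ivA(1) set_integral_add(1)[OF igA(1) ip]])
    fix z show "v z / z\<^sup>2 \<le> g z / z\<^sup>2 + p * z / z\<^sup>2"
      unfolding add_divide_distrib[symmetric] using vg by (rule divide_right_mono) simp
  qed
  moreover have "(LINT z:A|lborel. g z / z\<^sup>2 + p * z / z\<^sup>2) = (LINT z:A|lborel. g z / z\<^sup>2)"
    using set_integral_add(2)[OF igA(1) ip] p0 by simp
  moreover have "(LINT z:{-\<rho><..<\<rho>}|lborel. g z / z\<^sup>2) = (LINT z:{-r<..<r}|lborel. g z / z\<^sup>2) + (LINT z:A|lborel. g z / z\<^sup>2)"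
    unfolding U2 by (rule set_integral_Un) (use igA in \<open>auto simp: A_def\<close>)
  \<comment> \<open>The part of the near integral on the small ball has no counterpart on the left
    side; as |g| \<le> C z^2, discarding it costs at most 2 C r, which vanishes with r.\<close>
  moreover have "- C * (2 * r) \<le> (LINT z:{-r<..<r}|lborel. g z / z\<^sup>2)"
  proof -
    have c: "set_integrable lborel {-r<..<r} (\<lambda>z. - C)"
      unfolding set_integrable_def
      by (intro integrable_scaleR_left integrable_real_indicator) (use r in auto)
    have "(LINT z:{-r<..<r}|lborel. - C) \<le> (LINT z:{-r<..<r}|lborel. g z / z\<^sup>2)"
    proof (rule set_integral_mono[OF c igA(2)])
      fix z assume "z \<in> {-r<..<r}"
      then have "\<bar>g z\<bar> \<le> C * z\<^sup>2" using g(2) r by auto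
      then have "- C * z\<^sup>2 \<le> g z" by (simp add: abs_le_iff)
      then show "- C \<le> g z / z\<^sup>2" using C by (cases "z = 0") (auto simp: le_divide_eq)
    qed
    then show ?thesis using r by (simp add: set_lebesgue_integral_def mult_ac)
  qed
  ultimately show ?thesis by linarith
qed

text \<open>The factors 1 and 0 give the perturbation the shape of \<open>C2_Q_quartic\<close> and
  \<open>C2_Q_quadratic\<close>. It makes the maximum strict and has vanishing first derivatives at
  (t0, x0).\<close>

lemma C1_Q_test_perturbed:
  assumes "C1_Q \<phi>" "t > 0"
  shows "d_t (\<lambda>t y. \<phi> t y + (1 * (y - x0) ^ 4 + (1 * (t - t0)\<^sup>2 + 0 * t))) t y = d_t \<phi> t y + 2 * (t - t0)"
    and "d_x (\<lambda>t y. \<phi> t y + (1 * (y - x0) ^ 4 + (1 * (t - t0)\<^sup>2 + 0 * t))) t y = d_x \<phi> t y + 4 * (y - x0) ^ 3"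
  using C1_Q_DERIV[OF assms] by (auto intro!: d_t_eqI d_x_eqI derivative_eq_intros)

lemma continuous_Q_tendsto:
  assumes "continuous_on Q (\<lambda>(t, y). f t y)" "t0 > 0" "\<tau> \<longlonglongrightarrow> t0" "\<eta> \<longlonglongrightarrow> x0" "\<And>k. \<tau> k > 0"
  shows "(\<lambda>k. f (\<tau> k) (\<eta> k)) \<longlonglongrightarrow> f t0 x0"
  using continuous_on_tendsto_compose[OF assms(1) tendsto_Pair[OF assms(3,4)]] assms(2,5)
  by (simp add: Q_def)

context
  fixes x b :: "nat \<Rightarrow> real \<Rightarrow> nat \<Rightarrow> real"
  assumes flow: "\<And>n. n \<ge> 2 \<Longrightarrow> particle_flow n (x n) (b n)"
begin

lemma upper_lim_measurable:
  assumes "t \<ge> 0" shows "upper_lim x b t \<in> borel_measurable borel"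
proof (rule usc_measurable)
  fix y e :: real assume "e > 0"
  from upper_lim_usc[OF flow assms this, of y] obtain \<delta> where "\<delta> > 0"
    "\<And>s z. s \<ge> 0 \<Longrightarrow> \<bar>s - t\<bar> < \<delta> \<Longrightarrow> \<bar>z - y\<bar> < \<delta> \<Longrightarrow> upper_lim x b s z < upper_lim x b t y + e" by blast
  with assms show "\<exists>\<delta>>0. \<forall>z. \<bar>z - y\<bar> < \<delta> \<longrightarrow> upper_lim x b t z < upper_lim x b t y + e"
    by (intro exI[of _ \<delta>]) auto
qed

lemma upper_lim_diff:
  assumes "t \<ge> 0"
  shows "(\<lambda>z. upper_lim x b t (y + z) - upper_lim x b t y) \<in> borel_measurable borel"
    and "\<bar>upper_lim x b t (y + z) - upper_lim x b t y\<bar> \<le> 2"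
proof -
  show "(\<lambda>z. upper_lim x b t (y + z) - upper_lim x b t y) \<in> borel_measurable borel"
    using upper_lim_measurable[OF assms] by measurable
  show "\<bar>upper_lim x b t (y + z) - upper_lim x b t y\<bar> \<le> 2"
    using upper_lim_bound[OF flow assms, of "y + z"] upper_lim_bound[OF flow assms, of y] by linarith
qed

lemma upper_step_diff:
  assumes "n \<ge> 2" "t \<ge> 0"
  shows "(\<lambda>z. upper_step n (x n t) (b n t) (y + z) - upper_step n (x n t) (b n t) y) \<in> borel_measurable borel"
    and "\<bar>upper_step n (x n t) (b n t) (y + z) - upper_step n (x n t) (b n t) y\<bar> \<le> 2"
proof -
  show "(\<lambda>z. upper_step n (x n t) (b n t) (y + z) - upper_step n (x n t) (b n t) y) \<in> borel_measurable borel"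
    using upper_step_measurable by measurable
  note c = flow_conf[OF flow[OF assms(1)] assms(2)]
  show "\<bar>upper_step n (x n t) (b n t) (y + z) - upper_step n (x n t) (b n t) y\<bar> \<le> 2"
    using upper_step_bound[OF c, of "y + z"] upper_step_bound[OF c, of y] by linarith
qed

text \<open>Contacts with the strictly perturbed test function converge to (t0, x0), and their
  gradients to a nonzero limit. So \<open>contact_estimate\<close> applies with one constant C and
  one radius r, and its error 2 / (n r) vanishes. In the far integral the value at the contact is
  subtracted; the lower bound on contact values from \<open>strict_contact\<close> is what reverse
  Fatou requires there.\<close>

lemma upper_lim_test_nondegenerate:
  assumes \<phi>: "C2_Q \<phi>" and t0: "t0 > 0"
    and max: "\<And>s y. s > 0 \<Longrightarrow> upper_lim x b s y - \<phi> s y \<le> upper_lim x b t0 x0 - \<phi> t0 x0"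
    and p: "d_x \<phi> t0 x0 \<noteq> 0"
  obtains C r1 where "C \<ge> 0" "r1 > 0" "\<And>r. 0 < r \<Longrightarrow> r < r1 \<Longrightarrow> d_t \<phi> t0 x0 \<le> \<bar>d_x \<phi> t0 x0\<bar> *
    (27 * C * r + (LINT z:far r|lborel. (upper_lim x b t0 (x0 + z) - upper_lim x b t0 x0) / z\<^sup>2))"
proof -
  define \<Phi> where "\<Phi> = (\<lambda>t y. \<phi> t y + (1 * (y - x0) ^ 4 + (1 * (t - t0)\<^sup>2 + 0 * t)))"
  have \<Phi>2: "C2_Q \<Phi>" unfolding \<Phi>_def by (intro C2_Q_add \<phi> C2_Q_quartic C2_Q_quadratic)
  note \<Phi>1 = C2_Q_D(1)[OF \<Phi>2]
  have d\<Phi>: "d_t \<Phi> t0 x0 = d_t \<phi> t0 x0" "d_x \<Phi> t0 x0 = d_x \<phi> t0 x0"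
    unfolding \<Phi>_def using C1_Q_test_perturbed[OF C2_Q_D(1)[OF \<phi>] t0] by simp_all
  obtain C d where C: "C \<ge> 0" "d > 0" "\<And>t y z. \<bar>t - t0\<bar> \<le> d \<Longrightarrow> \<bar>y - x0\<bar> \<le> 1 \<Longrightarrow> \<bar>z\<bar> \<le> 1 \<Longrightarrow>
    \<bar>\<Phi> t (y + z) - \<Phi> t y - d_x \<Phi> t y * z\<bar> \<le> C * z\<^sup>2"
    using C2_Q_taylor[OF \<Phi>2 t0, of x0] by metis
  define q where "q = \<bar>d_x \<phi> t0 x0\<bar>"
  have q: "q > 0" using p by (simp add: q_def)
  \<comment> \<open>For r < r1, C r \<le> q / 4, which is below |P| / 2 as soon as |P| > q / 2; and
    r \<le> 1/2 keeps y + z within distance 1 of x0.\<close>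
  define r1 where "r1 = min (1/2) (q / (4 * (C + 1)))"
  have r1: "r1 > 0" unfolding r1_def using q C(1) by auto
  have strict: "upper_lim x b s y - \<Phi> s y \<le> upper_lim x b t0 x0 - \<Phi> t0 x0 - (y - x0) ^ 4 - (s - t0)\<^sup>2" if "s > 0" for s y
    using max[OF that, of y] unfolding \<Phi>_def by simp
  have "\<forall>k::nat. \<exists>n t y. n \<ge> k \<and> n \<ge> 2 \<and> t > 0 \<and> \<bar>t - t0\<bar> < 1 / (real k + 1) \<and> \<bar>y - x0\<bar> < 1 / (real k + 1) \<and>
    upper_step n (x n t) (b n t) y > upper_lim x b t0 x0 - 1 / (real k + 1) \<and>
    (\<forall>y'\<in>{x0-1..x0+1}. upper_step n (x n t) (b n t) y' - \<Phi> t y' \<le> upper_step n (x n t) (b n t) y - \<Phi> t y) \<and>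
    (if d_x \<Phi> t y = 0 then d_t \<Phi> t y \<le> 0 else
      (\<exists>i\<in>{1..n}. x n t i = y \<and> b n t i * d_x \<Phi> t y > 0 \<and> d_t \<Phi> t y + d_x \<Phi> t y * velocity n (x n t) (b n t) i \<le> 0))"
    by (intro allI strict_contact[OF flow \<Phi>1 t0 strict]) auto
  then obtain n \<tau> \<eta> where
    n: "\<And>k. n k \<ge> k" "\<And>k. n k \<ge> 2" and
    \<tau>: "\<And>k. \<tau> k > 0" "\<And>k. \<bar>\<tau> k - t0\<bar> < 1 / (real k + 1)" and
    \<eta>: "\<And>k. \<bar>\<eta> k - x0\<bar> < 1 / (real k + 1)" and
    big: "\<And>k. upper_step (n k) (x (n k) (\<tau> k)) (b (n k) (\<tau> k)) (\<eta> k) > upper_lim x b t0 x0 - 1 / (real k + 1)" and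
    mx: "\<And>k y'. y' \<in> {x0-1..x0+1} \<Longrightarrow> upper_step (n k) (x (n k) (\<tau> k)) (b (n k) (\<tau> k)) y' - \<Phi> (\<tau> k) y' \<le>
      upper_step (n k) (x (n k) (\<tau> k)) (b (n k) (\<tau> k)) (\<eta> k) - \<Phi> (\<tau> k) (\<eta> k)" and
    con: "\<And>k. if d_x \<Phi> (\<tau> k) (\<eta> k) = 0 then d_t \<Phi> (\<tau> k) (\<eta> k) \<le> 0 else
      (\<exists>i\<in>{1..n k}. x (n k) (\<tau> k) i = \<eta> k \<and> b (n k) (\<tau> k) i * d_x \<Phi> (\<tau> k) (\<eta> k) > 0 \<and>
        d_t \<Phi> (\<tau> k) (\<eta> k) + d_x \<Phi> (\<tau> k) (\<eta> k) * velocity (n k) (x (n k) (\<tau> k)) (b (n k) (\<tau> k)) i \<le> 0)"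
    by metis
  define U where "U k = upper_step (n k) (x (n k) (\<tau> k)) (b (n k) (\<tau> k))" for k
  have one: "(\<lambda>k. 1 / (real k + 1)) \<longlonglongrightarrow> 0"
    using LIMSEQ_inverse_real_of_nat by (simp add: inverse_eq_divide add.commute)
  have \<tau>t: "\<tau> \<longlonglongrightarrow> t0"
    by (rule LIM_zero_cancel, rule Lim_null_comparison[OF _ one]) (use \<tau>(2) in \<open>auto intro!: always_eventually intro: less_imp_le\<close>)
  have \<eta>t: "\<eta> \<longlonglongrightarrow> x0"
    by (rule LIM_zero_cancel, rule Lim_null_comparison[OF _ one]) (use \<eta> in \<open>auto intro!: always_eventually intro: less_imp_le\<close>)
  have pt: "(\<lambda>k. d_x \<Phi> (\<tau> k) (\<eta> k)) \<longlonglongrightarrow> d_x \<phi> t0 x0"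
    unfolding d\<Phi>[symmetric] by (rule continuous_Q_tendsto[OF C1_Q_cont(3)[OF \<Phi>1] t0 \<tau>t \<eta>t \<tau>(1)])
  have tt: "(\<lambda>k. d_t \<Phi> (\<tau> k) (\<eta> k)) \<longlonglongrightarrow> d_t \<phi> t0 x0"
    unfolding d\<Phi>[symmetric] by (rule continuous_Q_tendsto[OF C1_Q_cont(2)[OF \<Phi>1] t0 \<tau>t \<eta>t \<tau>(1)])
  show ?thesis
  proof (rule that[OF C(1) r1])
    fix r assume r: "0 < r" "r < r1"
    have r2: "r \<le> 1 / 2" "C * r \<le> q / 4"
    proof -
      show "r \<le> 1 / 2" using r by (simp add: r1_def)
      have "C * r \<le> (C + 1) * (q / (4 * (C + 1)))" using r C(1) q by (intro mult_mono) (auto simp: r1_def)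
      also have "\<dots> = ((C + 1) * q) / ((C + 1) * 4)" by (simp add: mult.commute)
      also have "\<dots> = q / 4" using C(1) by (intro mult_divide_mult_cancel_left) simp
      finally show "C * r \<le> q / 4" .
    qed
    define H where "H z = upper_lim x b t0 (x0 + z) - upper_lim x b t0 x0" for z
    define I where "I = (LINT z:far r|lborel. H z / z\<^sup>2)"
    have key: "d_t \<phi> t0 x0 \<le> q * (27 * C * r + I + 2 * e)" if e: "e > 0" for e
    proof -
      have E1: "\<forall>\<^sub>F k in sequentially. q / 2 < \<bar>d_x \<Phi> (\<tau> k) (\<eta> k)\<bar>"
        using order_tendstoD(1)[OF tendsto_rabs[OF pt], of "q / 2"] q by (simp add: q_def)
      have E2: "\<forall>\<^sub>F k in sequentially. 1 / (real k + 1) < min (1/2) d"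
        by (rule order_tendstoD(2)[OF one]) (use C(2) in auto)
      have E3: "\<forall>\<^sub>F k in sequentially. (LINT z:far r|lborel. (U k (\<eta> k + z) - U k (\<eta> k)) / z\<^sup>2) < I + e"
        unfolding I_def
      proof (rule far_reverse_fatou[where B = 2, OF r(1) _ _ _ _ _ e])
        show "(\<lambda>z. U k (\<eta> k + z) - U k (\<eta> k)) \<in> borel_measurable borel" for k
          unfolding U_def using \<tau>(1)[of k] by (intro upper_step_diff n(2)) simp
        show "\<bar>U k (\<eta> k + z) - U k (\<eta> k)\<bar> \<le> 2" for k z
          unfolding U_def using \<tau>(1)[of k] by (intro upper_step_diff n(2)) simp
        show "H \<in> borel_measurable borel" "\<bar>H z\<bar> \<le> 2" for z
          unfolding H_def[abs_def] using t0 by (auto intro!: upper_lim_diff)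
        fix z e' :: real assume e': "e' > 0"
        obtain \<delta> N where \<delta>: "\<delta> > 0" "N \<ge> 2"
          "\<And>n s y. n \<ge> N \<Longrightarrow> s \<ge> 0 \<Longrightarrow> \<bar>s - t0\<bar> < \<delta> \<Longrightarrow> \<bar>y - (x0 + z)\<bar> < \<delta> \<Longrightarrow>
             upper_step n (x n s) (b n s) y < upper_lim x b t0 (x0 + z) + e' / 2"
          using upper_lim_upper_step[OF flow, of t0 "e' / 2" "x0 + z"] t0 e' by auto
        have "\<forall>\<^sub>F k in sequentially. 1 / (real k + 1) < min \<delta> (e' / 2)"
          by (rule order_tendstoD(2)[OF one]) (use \<delta>(1) e' in auto)
        then show "\<forall>\<^sub>F k in sequentially. U k (\<eta> k + z) - U k (\<eta> k) \<le> H z + e'"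
          using eventually_ge_at_top[of N]
        proof eventually_elim
          case (elim k)
          have "U k (\<eta> k + z) < upper_lim x b t0 (x0 + z) + e' / 2"
            unfolding U_def using elim n(1)[of k] \<tau>[of k] \<eta>[of k] by (intro \<delta>(3)) auto
          with big[of k] elim show ?case unfolding U_def H_def by auto
        qed
      qed
      obtain M :: nat where M: "2 / (r * e) < real M" using reals_Archimedean2 by blast
      have "\<forall>\<^sub>F k in sequentially. d_t \<Phi> (\<tau> k) (\<eta> k) \<le> \<bar>d_x \<Phi> (\<tau> k) (\<eta> k)\<bar> * (27 * C * r + I + 2 * e)"
        using E1 E2 E3 eventually_ge_at_top[of M]
      proof eventually_elim
        case (elim k)
        define P where "P = d_x \<Phi> (\<tau> k) (\<eta> k)"
        have P: "P \<noteq> 0" "q / 2 < \<bar>P\<bar>" using elim(1) q by (auto simp: P_def)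
        then obtain i where i: "i \<in> {1..n k}" "x (n k) (\<tau> k) i = \<eta> k" "b (n k) (\<tau> k) i * P > 0"
          "d_t \<Phi> (\<tau> k) (\<eta> k) + P * velocity (n k) (x (n k) (\<tau> k)) (b (n k) (\<tau> k)) i \<le> 0"
          using con[of k] by (auto simp: P_def)
        have conf: "(x (n k) (\<tau> k), b (n k) (\<tau> k)) \<in> configurations (n k)"
          using \<tau>(1)[of k] by (intro flow_conf[OF flow[OF n(2)]]) simp
        have "- (P * velocity (n k) (x (n k) (\<tau> k)) (b (n k) (\<tau> k)) i) \<le> \<bar>P\<bar> * (27 * C * r + 2 / (real (n k) * r) +
          (LINT z:far r|lborel. (upper_step (n k) (x (n k) (\<tau> k)) (b (n k) (\<tau> k)) (\<eta> k + z) -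
             upper_step (n k) (x (n k) (\<tau> k)) (b (n k) (\<tau> k)) (\<eta> k)) / z\<^sup>2))"
        proof (rule contact_estimate[OF conf i(1-3) C(1) r(1)])
          show "C * r \<le> \<bar>P\<bar> / 2" using r2 P by simp
          fix z assume z: "\<bar>z\<bar> < r"
          have "1 / (real k + 1) < 1 / 2" "1 / (real k + 1) < d" using elim(2) by (simp_all only: min_less_iff_conj)
          then have "\<bar>\<eta> k - x0\<bar> < 1 / 2" "\<bar>\<tau> k - t0\<bar> \<le> d" using \<eta>[of k] \<tau>(2)[of k] by linarith+
          then have "\<bar>\<eta> k + z - x0\<bar> \<le> 1" "\<bar>\<eta> k - x0\<bar> \<le> 1" "\<bar>z\<bar> \<le> 1"
            using z r2(1) by linarith+
          then have "\<eta> k + z \<in> {x0 - 1..x0 + 1}" by (simp add: abs_le_iff)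
          note * = this \<open>\<bar>\<tau> k - t0\<bar> \<le> d\<close> \<open>\<bar>\<eta> k - x0\<bar> \<le> 1\<close> \<open>\<bar>z\<bar> \<le> 1\<close>
          from mx[OF *(1), of k] C(3)[OF *(2-4)]
          show "upper_step (n k) (x (n k) (\<tau> k)) (b (n k) (\<tau> k)) (\<eta> k + z) -
             upper_step (n k) (x (n k) (\<tau> k)) (b (n k) (\<tau> k)) (\<eta> k) \<le> P * z + C * z\<^sup>2"
            unfolding P_def abs_le_iff by linarith
        qed
        also have "\<dots> \<le> \<bar>P\<bar> * (27 * C * r + e + (I + e))"
        proof (intro mult_left_mono add_mono order_refl)
          have "2 / (r * e) < real (n k)" using M elim(4) n(1)[of k] by linarith
          then have "2 < real (n k) * (r * e)" using r(1) e by (simp add: pos_divide_less_eq)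
          moreover have "real (n k) * r > 0" using n(2)[of k] r(1) by simp
          ultimately show "2 / (real (n k) * r) \<le> e" by (simp add: divide_le_eq mult_ac)
        qed (use elim(3) C(1) in \<open>auto simp: U_def\<close>)
        finally show ?case using i(4) unfolding P_def by (simp add: add_ac)
      qed
      then have "d_t \<phi> t0 x0 \<le> \<bar>d_x \<phi> t0 x0\<bar> * (27 * C * r + I + 2 * e)"
        by (rule tendsto_le[OF trivial_limit_sequentially tendsto_mult[OF tendsto_rabs[OF pt] tendsto_const] tt])
      then show ?thesis by (simp add: q_def)
    qed
    have "d_t \<phi> t0 x0 \<le> q * (27 * C * r + I)"
    proof (rule field_le_epsilon)
      fix e :: real assume "e > 0"
      with key[of "e / (2 * q)"] q show "d_t \<phi> t0 x0 \<le> q * (27 * C * r + I) + e"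
        by (simp add: distrib_left)
    qed
    then show "d_t \<phi> t0 x0 \<le> \<bar>d_x \<phi> t0 x0\<bar> *
      (27 * C * r + (LINT z:far r|lborel. (upper_lim x b t0 (x0 + z) - upper_lim x b t0 x0) / z\<^sup>2))"
      unfolding q_def I_def H_def .
  qed
qed

text \<open>The gradients at the contacts tend to 0, which rules out a fixed radius in the contact
  estimate. For an exact quartic everything scales with a = |y - x0|: |P| is of order a^3 and the
  curvature of order a^2, so the radius may be a / 10. Then |P| times the far integral is of order
  a^3 / a = a^2 and the near term of order a^6, and both vanish as the contact tends to x0.\<close>

lemma upper_lim_test_quartic:
  assumes \<phi>: "C2_Q \<phi>" and t0: "t0 > 0"
    and max: "\<And>s y. s > 0 \<Longrightarrow> upper_lim x b s y - \<phi> s y \<le> upper_lim x b t0 x0 - \<phi> t0 x0"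
    and quartic: "quartic_test x0 \<phi>"
  shows "d_t \<phi> t0 x0 \<le> 0"
proof (rule ccontr)
  assume "\<not> ?thesis"
  then have pos: "d_t \<phi> t0 x0 > 0" by simp
  note D = C2_Q_D[OF \<phi>]
  obtain c g where cg: "\<And>t y. t > 0 \<Longrightarrow> \<phi> t y = c * \<bar>y - x0\<bar> ^ 4 + g t"
    using quartic unfolding quartic_test_def Q_def by auto
  \<comment> \<open>c' \<ge> c + 1 absorbs the quartic that makes the maximum strict, and the
    absolute value makes c' positive, so that |P| = 4 c' a^3.\<close>
  define c' where "c' = \<bar>c\<bar> + 1"
  have c': "c' > 0" "c + 1 \<le> c'" unfolding c'_def by auto
  \<comment> \<open>For t > 0 the function g of the quartic test is \<phi>(t, x0), which is known to
    be differentiable.\<close>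
  define \<Phi> where "\<Phi> t y = c' * (y - x0) ^ 4 + (\<phi> t x0 + (t - t0)\<^sup>2)" for t y
  have dt: "((\<lambda>s. \<Phi> s y) has_real_derivative d_t \<phi> t x0 + 2 * (t - t0)) (at t)"
    and dx: "((\<lambda>y. \<Phi> t y) has_real_derivative 4 * c' * (y - x0) ^ 3) (at y)" if "t > 0" for t y
    unfolding \<Phi>_def using C1_Q_DERIV(1)[OF D(1) that] by (auto intro!: derivative_eq_intros)
  have comp: "continuous_on Q (\<lambda>(t, y). f t x0)" if "continuous_on Q (\<lambda>(t, y). f t y)" for f :: "real \<Rightarrow> real \<Rightarrow> real"
  proof -
    have "continuous_on Q (\<lambda>q. case (fst q, x0) of (t, y) \<Rightarrow> f t y)"
      by (rule continuous_on_compose2[OF that]) (auto intro!: continuous_intros simp: Q_def)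
    then show ?thesis by (simp add: case_prod_beta)
  qed
  have \<Phi>1: "C1_Q \<Phi>"
  proof (rule C1_QI[OF dt dx])
    show "continuous_on Q (\<lambda>(t, x). \<Phi> t x)"
      using comp[OF C1_Q_cont(1)[OF D(1)]] unfolding \<Phi>_def case_prod_beta by (intro continuous_intros)
    show "continuous_on Q (\<lambda>(t, x). d_t \<phi> t x0 + 2 * (t - t0))"
      using comp[OF C1_Q_cont(2)[OF D(1)]] unfolding case_prod_beta by (intro continuous_intros)
    show "continuous_on Q (\<lambda>(t, y). 4 * c' * (y - x0) ^ 3)"
      unfolding case_prod_beta by (intro continuous_intros)
  qed auto
  have d\<Phi>: "d_t \<Phi> t y = d_t \<phi> t x0 + 2 * (t - t0)" "d_x \<Phi> t y = 4 * c' * (y - x0) ^ 3" if "t > 0" for t y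
    by (rule d_t_eqI[where f = \<Phi> and t = t and x = y, OF dt[OF that]], rule d_x_eqI[where f = \<Phi> and t = t and x = y, OF dx[OF that]])
  have strict: "upper_lim x b s y - \<Phi> s y \<le> upper_lim x b t0 x0 - \<Phi> t0 x0 - (y - x0) ^ 4 - (s - t0)\<^sup>2" if s: "s > 0" for s y
  proof -
    have "(c + 1) * (y - x0) ^ 4 \<le> c' * (y - x0) ^ 4" using c'(2) by (intro mult_right_mono) auto
    then show ?thesis using max[OF s, of y] unfolding \<Phi>_def cg[OF s] cg[OF t0] by (simp add: algebra_simps)
  qed
  define \<kappa> where "\<kappa> = d_t \<phi> t0 x0 / 2"
  have \<kappa>: "\<kappa> > 0" using pos by (simp add: \<kappa>_def)
  obtain d1 where d1: "d1 > 0" "\<And>t. t > 0 \<Longrightarrow> \<bar>t - t0\<bar> < d1 \<Longrightarrow> d_t \<phi> t x0 + 2 * (t - t0) > \<kappa>"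
  proof -
    have "continuous_on {0<..} (\<lambda>t. d_t \<phi> t x0 + 2 * (t - t0))"
    proof -
      have "continuous_on {0<..} ((\<lambda>(t, y). d_t \<phi> t y) \<circ> (\<lambda>t. (t, x0)))"
        by (rule continuous_on_compose) (auto intro!: continuous_intros continuous_on_subset[OF C1_Q_cont(2)[OF D(1)]] simp: Q_def)
      then show ?thesis by (auto intro!: continuous_intros simp: comp_def)
    qed
    from this[unfolded continuous_on_iff, rule_format, of t0 \<kappa>] t0 \<kappa>
    obtain d1 where "d1 > 0" "\<forall>t\<in>{0<..}. dist t t0 < d1 \<longrightarrow> dist (d_t \<phi> t x0 + 2 * (t - t0)) (d_t \<phi> t0 x0 + 2 * (t0 - t0)) < \<kappa>"
      by auto
    note d1 = this
    show ?thesis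
    proof (rule that[OF d1(1)])
      fix t assume "0 < t" "\<bar>t - t0\<bar> < d1"
      then have "\<bar>d_t \<phi> t x0 + 2 * (t - t0) - (d_t \<phi> t0 x0 + 2 * (t0 - t0))\<bar> < \<kappa>"
        using bspec[OF d1(2), of t] by (simp add: dist_real_def)
      then have "- (d_t \<phi> t x0 + 2 * (t - t0) - d_t \<phi> t0 x0) < \<kappa>" by (simp add: abs_less_iff)
      moreover have "d_t \<phi> t0 x0 = 2 * \<kappa>" by (simp add: \<kappa>_def)
      ultimately show "\<kappa> < d_t \<phi> t x0 + 2 * (t - t0)" by linarith
    qed
  qed
  \<comment> \<open>The numbers 19 and 60 come from the last estimate of the proof: 189/10 c' a^6 +
    60 a^2 \<le> (19 c' + 60) a for a < 1.\<close>
  define \<delta> where "\<delta> = min (min d1 (1/2)) (\<kappa> / (4 * c' * (19 * c' + 60)))"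
  have \<delta>: "\<delta> > 0" "\<delta> \<le> d1" "\<delta> \<le> 1/2" "4 * c' * (19 * c' + 60) * \<delta> \<le> \<kappa>"
  proof -
    have D: "4 * c' * (19 * c' + 60) > 0" using c' by auto
    then show "\<delta> > 0" "\<delta> \<le> d1" "\<delta> \<le> 1/2" using d1(1) \<kappa> unfolding \<delta>_def by auto
    have "\<delta> \<le> \<kappa> / (4 * c' * (19 * c' + 60))" unfolding \<delta>_def by simp
    then show "4 * c' * (19 * c' + 60) * \<delta> \<le> \<kappa>"
      unfolding pos_le_divide_eq[OF D] by (simp only: mult.commute)
  qed
  obtain n t y where n: "n \<ge> 2" and t: "t > 0" "\<bar>t - t0\<bar> < \<delta>" and y: "\<bar>y - x0\<bar> < \<delta>"
    and mx: "\<And>y'. y' \<in> {x0-1..x0+1} \<Longrightarrow> upper_step n (x n t) (b n t) y' - \<Phi> t y' \<le> upper_step n (x n t) (b n t) y - \<Phi> t y"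
    and con: "if d_x \<Phi> t y = 0 then d_t \<Phi> t y \<le> 0 else
      (\<exists>i\<in>{1..n}. x n t i = y \<and> b n t i * d_x \<Phi> t y > 0 \<and> d_t \<Phi> t y + d_x \<Phi> t y * velocity n (x n t) (b n t) i \<le> 0)"
    using strict_contact[OF flow \<Phi>1 t0 strict zero_less_one \<delta>(1)] by blast
  have dtk: "d_t \<Phi> t y > \<kappa>" unfolding d\<Phi>(1)[OF t(1)] using d1(2) t \<delta>(2) by simp
  define d where "d = y - x0"
  define P where "P = d_x \<Phi> t y"
  have P: "P = 4 * c' * d ^ 3" unfolding P_def d_def by (rule d\<Phi>(2)[OF t(1)])
  have "P \<noteq> 0" using con dtk \<kappa> unfolding P_def by (auto split: if_splits)
  then have d0: "d \<noteq> 0" using P by auto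
  obtain i where i: "i \<in> {1..n}" "x n t i = y" "b n t i * P > 0" "d_t \<Phi> t y + P * velocity n (x n t) (b n t) i \<le> 0"
    using con \<open>P \<noteq> 0\<close> unfolding P_def by auto
  define a where "a = \<bar>d\<bar>"
  have a: "a > 0" "a < \<delta>" "a < 1" using d0 y \<delta>(3) unfolding a_def d_def by auto
  have aP: "\<bar>P\<bar> = 4 * c' * a ^ 3" unfolding P a_def using c' by (simp add: abs_mult power_abs)
  \<comment> \<open>For |z| < a / 10 one has 6 d^2 + 4 d z + z^2 \<le> 641/100 a^2 \<le> 7 a^2,
    whence C = 7 c' a^2. Then C r = 7/10 c' a^3 is below |P| / 2 = 2 c' a^3.\<close>
  define r where "r = a / 10"
  define C where "C = 7 * c' * a\<^sup>2"
  have r: "r > 0" and C: "C \<ge> 0" unfolding r_def C_def using a c' by auto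
  have Cr: "C * r = 7 / 10 * c' * a ^ 3" unfolding C_def r_def by (simp add: power2_eq_square power3_eq_cube)
  have conf: "(x n t, b n t) \<in> configurations n" using flow_conf[OF flow[OF n]] t(1) by simp
  have "- (P * velocity n (x n t) (b n t) i) \<le> \<bar>P\<bar> * (27 * C * r + 2 / (real n * r) +
    (LINT z:far r|lborel. (upper_step n (x n t) (b n t) (y + z) - upper_step n (x n t) (b n t) y) / z\<^sup>2))"
  proof (rule contact_estimate[OF conf i(1-3) C r])
    show "C * r \<le> \<bar>P\<bar> / 2" unfolding Cr aP using c'(1) a(1) by simp
    fix z assume z: "\<bar>z\<bar> < r"
    have "y + z \<in> {x0 - 1..x0 + 1}" using z y \<delta>(3) a unfolding r_def by (auto simp: abs_less_iff)
    from mx[OF this] have "upper_step n (x n t) (b n t) (y + z) - upper_step n (x n t) (b n t) y \<le> c' * ((d + z) ^ 4 - d ^ 4)"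
      unfolding \<Phi>_def d_def by (simp add: algebra_simps)
    also have "(d + z) ^ 4 - d ^ 4 = 4 * d ^ 3 * z + z\<^sup>2 * (6 * d\<^sup>2 + 4 * d * z + z\<^sup>2)"
      by (simp add: power2_eq_square power3_eq_cube power4_eq_xxxx algebra_simps)
    also have "\<dots> \<le> 4 * d ^ 3 * z + z\<^sup>2 * (7 * a\<^sup>2)"
    proof (intro add_left_mono mult_left_mono)
      have z': "\<bar>z\<bar> \<le> a / 10" using z by (simp add: r_def)
      have "d * z \<le> a * (a / 10)"
        using mult_mono[OF order_refl z', of a] a abs_ge_self[of "d * z"] by (simp add: abs_mult a_def)
      moreover have "z\<^sup>2 \<le> (a / 10)\<^sup>2" using z' a by (simp add: abs_le_square_iff[symmetric])
      moreover have "d\<^sup>2 = a\<^sup>2" by (simp add: a_def)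
      moreover have "0 \<le> a\<^sup>2" by simp
      moreover have "a * (a / 10) = a\<^sup>2 / 10" "(a / 10)\<^sup>2 = a\<^sup>2 / 100" by (simp_all add: power2_eq_square)
      ultimately show "6 * d\<^sup>2 + 4 * d * z + z\<^sup>2 \<le> 7 * a\<^sup>2" by linarith
    qed simp
    then have "c' * (4 * d ^ 3 * z + z\<^sup>2 * (6 * d\<^sup>2 + 4 * d * z + z\<^sup>2)) \<le> c' * (4 * d ^ 3 * z + z\<^sup>2 * (7 * a\<^sup>2))"
      using c'(1) by (intro mult_left_mono) auto
    also have "\<dots> = P * z + C * z\<^sup>2" unfolding P C_def by (simp add: algebra_simps)
    finally show "upper_step n (x n t) (b n t) (y + z) - upper_step n (x n t) (b n t) y \<le> P * z + C * z\<^sup>2" .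
  qed
  also have "\<dots> \<le> \<bar>P\<bar> * (27 * C * r + 2 * (1 / r) + 4 * (1 / r))"
  proof (intro mult_left_mono add_mono order_refl)
    have "2 / (real n * r) \<le> 2 / (1 * r)"
      using n r by (intro divide_left_mono mult_right_mono mult_pos_pos) auto
    then show "2 / (real n * r) \<le> 2 * (1 / r)" by simp
    have "\<bar>LINT z:far r|lborel. (upper_step n (x n t) (b n t) (y + z) - upper_step n (x n t) (b n t) y) / z\<^sup>2\<bar> \<le> 2 * (2 / r)"
      using t(1) by (intro far_integral_bound[OF r] upper_step_diff n) auto
    then show "(LINT z:far r|lborel. (upper_step n (x n t) (b n t) (y + z) - upper_step n (x n t) (b n t) y) / z\<^sup>2) \<le> 4 * (1 / r)"
      by (simp add: abs_le_iff)
  qed (use C in simp_all)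
  also have "\<dots> = 4 * c' * (189 / 10 * c' * a ^ 6 + 60 * a\<^sup>2)"
  proof -
    have e1: "27 * C * r = 189 / 10 * c' * a ^ 3" using Cr by simp
    have e2: "a ^ 3 * (1 / r) = 10 * a\<^sup>2" using a(1) unfolding r_def by (simp add: power2_eq_square power3_eq_cube)
    have e3: "a ^ 6 = a ^ 3 * a ^ 3" by (simp add: power_add[symmetric])
    have "4 * c' * A3 * (189 / 10 * c' * A3 + 2 * q + 4 * q) = 4 * c' * (189 / 10 * c' * (A3 * A3) + 6 * (A3 * q))" for A3 q
      by (simp add: algebra_simps)
    then have "\<bar>P\<bar> * (27 * C * r + 2 * (1 / r) + 4 * (1 / r)) = 4 * c' * (189 / 10 * c' * (a ^ 3 * a ^ 3) + 6 * (a ^ 3 * (1 / r)))"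
      unfolding aP e1 .
    then show ?thesis unfolding e2 e3 by simp
  qed
  also have "\<dots> \<le> 4 * c' * ((19 * c' + 60) * a)"
  proof (intro mult_left_mono)
    have le: "a ^ 6 \<le> a" "a\<^sup>2 \<le> a"
      using power_decreasing[of 1 6 a] power_decreasing[of 1 2 a] a by simp_all
    have "189 / 10 * c' * a ^ 6 \<le> 19 * c' * a" using c' a le(1) by (intro mult_mono) auto
    with le(2) show "189 / 10 * c' * a ^ 6 + 60 * a\<^sup>2 \<le> (19 * c' + 60) * a" by (simp add: algebra_simps)
  qed (use c' in auto)
  also have "\<dots> \<le> 4 * c' * (19 * c' + 60) * \<delta>"
    unfolding mult.assoc using a c' by (intro mult_left_mono) auto
  finally have "- (P * velocity n (x n t) (b n t) i) \<le> \<kappa>" using \<delta>(4) by simp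
  with i(4) dtk show False by linarith
qed

text \<open>In the nondegenerate case d_t \<phi> is bounded with u itself outside a small ball, up
  to the error 27 C r. \<open>far_le_near_plus_far\<close> turns this into the Hamiltonian with
  radius \<rho> at the cost 2 C' r, and letting r tend to 0 removes both errors.\<close>

theorem upper_lim_subsolution:
  assumes \<rho>: "\<rho> > 0"
  shows "subsolution \<rho> (upper_lim x b)"
  unfolding subsolution_def
proof (intro conjI allI impI)
  show "bounded_Q (upper_lim x b)"
    unfolding bounded_Q_def bounded_iff using upper_lim_bound[OF flow] by (intro exI[of _ 1]) (auto simp: Q_def)
  show "usc_on Q (upper_lim x b)"
    unfolding usc_on_def
  proof (clarify)
    fix t y e :: real assume "(t, y) \<in> Q" "e > 0"
    then have t: "t \<ge> 0" by (simp add: Q_def)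
    from upper_lim_usc[OF flow t \<open>e > 0\<close>, of y] obtain \<delta> where \<delta>: "\<delta> > 0"
      "\<And>s z. s \<ge> 0 \<Longrightarrow> \<bar>s - t\<bar> < \<delta> \<Longrightarrow> \<bar>z - y\<bar> < \<delta> \<Longrightarrow> upper_lim x b s z < upper_lim x b t y + e" by blast
    show "\<forall>\<^sub>F (s, z) in at (t, y) within Q. upper_lim x b s z < upper_lim x b t y + e"
      unfolding eventually_at
    proof (intro exI[of _ \<delta>] conjI ballI impI \<delta>(1))
      fix q assume q: "q \<in> Q" "q \<noteq> (t, y) \<and> dist q (t, y) < \<delta>"
      then have "dist (fst q) t < \<delta>" "dist (snd q) y < \<delta>"
        using dist_fst_le[of q "(t, y)"] dist_snd_le[of q "(t, y)"] by auto
      then show "case q of (s, z) \<Rightarrow> upper_lim x b s z < upper_lim x b t y + e"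
        using \<delta>(2)[of "fst q" "snd q"] q(1) by (auto simp: Q_def dist_real_def)
    qed
  qed
  fix \<phi> t0 x0
  assume A: "C2_Q \<phi> \<and> (t0, x0) \<in> Q \<and> (\<forall>(s, y)\<in>Q. upper_lim x b s y - \<phi> s y \<le> upper_lim x b t0 x0 - \<phi> t0 x0)"
  then have \<phi>: "C2_Q \<phi>" and t0: "t0 > 0"
    and max: "\<And>s y. s > 0 \<Longrightarrow> upper_lim x b s y - \<phi> s y \<le> upper_lim x b t0 x0 - \<phi> t0 x0"
    by (auto simp: Q_def)
  show "d_t \<phi> t0 x0 \<le> 0" if "quartic_test x0 \<phi>"
    by (rule upper_lim_test_quartic[OF \<phi> t0 max that])
  assume p: "d_x \<phi> t0 x0 \<noteq> 0"
  obtain C r1 where C: "C \<ge> 0" "r1 > 0" "\<And>r. 0 < r \<Longrightarrow> r < r1 \<Longrightarrow> d_t \<phi> t0 x0 \<le> \<bar>d_x \<phi> t0 x0\<bar> *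
    (27 * C * r + (LINT z:far r|lborel. (upper_lim x b t0 (x0 + z) - upper_lim x b t0 x0) / z\<^sup>2))"
    using upper_lim_test_nondegenerate[OF \<phi> t0 max p] by blast
  obtain C' d where C': "C' \<ge> 0" "d > 0" "\<And>t y z. \<bar>t - t0\<bar> \<le> d \<Longrightarrow> \<bar>y - x0\<bar> \<le> 1 \<Longrightarrow> \<bar>z\<bar> \<le> 1 \<Longrightarrow>
    \<bar>\<phi> t (y + z) - \<phi> t y - d_x \<phi> t y * z\<bar> \<le> C' * z\<^sup>2"
    using C2_Q_taylor[OF \<phi> t0, of x0] by metis
  define E where "E = (LINT z:{-\<rho><..<\<rho>}|lborel. (\<phi> t0 (x0 + z) - \<phi> t0 x0 - d_x \<phi> t0 x0 * z) / z\<^sup>2) +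
    (LINT z:far \<rho>|lborel. (upper_lim x b t0 (x0 + z) - upper_lim x b t0 x0) / z\<^sup>2)"
  define q where "q = \<bar>d_x \<phi> t0 x0\<bar>"
  have key: "d_t \<phi> t0 x0 \<le> q * (27 * C * r + (E + 2 * C' * r))" if r: "0 < r" "r < min r1 (min \<rho> 1)" for r
  proof -
    have "(LINT z:far r|lborel. (upper_lim x b t0 (x0 + z) - upper_lim x b t0 x0) / z\<^sup>2) \<le> E + 2 * C' * r"
      unfolding E_def
    proof (rule far_le_near_plus_far[where R = 1 and B = 2 and p = "d_x \<phi> t0 x0"
          and v = "\<lambda>z. upper_lim x b t0 (x0 + z) - upper_lim x b t0 x0"
          and g = "\<lambda>z. \<phi> t0 (x0 + z) - \<phi> t0 x0 - d_x \<phi> t0 x0 * z"])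
      show "(\<lambda>z. upper_lim x b t0 (x0 + z) - upper_lim x b t0 x0) \<in> borel_measurable borel"
        "\<bar>upper_lim x b t0 (x0 + z) - upper_lim x b t0 x0\<bar> \<le> 2" for z
        using t0 by (auto intro!: upper_lim_diff)
      have "continuous_on UNIV (\<phi> t0)"
        by (intro continuous_at_imp_continuous_on ballI) (rule DERIV_isCont[OF C1_Q_DERIV(2)[OF C2_Q_D(1)[OF \<phi>] t0]])
      then show "continuous_on UNIV (\<lambda>z. \<phi> t0 (x0 + z) - \<phi> t0 x0 - d_x \<phi> t0 x0 * z)"
        by (intro continuous_intros continuous_on_compose2[of UNIV "\<phi> t0" UNIV "\<lambda>z. x0 + z"]) auto
      show "\<bar>\<phi> t0 (x0 + z) - \<phi> t0 x0 - d_x \<phi> t0 x0 * z\<bar> \<le> C' * z\<^sup>2" if "\<bar>z\<bar> \<le> 1" for z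
        using C'(2) that by (intro C'(3)) auto
      show "upper_lim x b t0 (x0 + z) - upper_lim x b t0 x0 \<le> \<phi> t0 (x0 + z) - \<phi> t0 x0 - d_x \<phi> t0 x0 * z + d_x \<phi> t0 x0 * z" for z
        using max[OF t0, of "x0 + z"] by simp
    qed (use r in auto)
    then have "q * (27 * C * r + (LINT z:far r|lborel. (upper_lim x b t0 (x0 + z) - upper_lim x b t0 x0) / z\<^sup>2))
      \<le> q * (27 * C * r + (E + 2 * C' * r))"
      unfolding q_def by (intro mult_left_mono add_left_mono) auto
    with C(3)[of r] r show ?thesis unfolding q_def by auto
  qed
  have "d_t \<phi> t0 x0 \<le> q * E"
  proof (rule field_le_epsilon)
    fix e :: real assume e: "e > 0"
    define M where "M = q * (27 * C + 2 * C') + 1"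
    have M: "M > 0" unfolding M_def q_def using C(1) C'(1) by (intro add_nonneg_pos mult_nonneg_nonneg) auto
    define r where "r = min (min r1 (min \<rho> 1) / 2) (e / M)"
    have r: "0 < r" "r < min r1 (min \<rho> 1)" "r \<le> e / M" unfolding r_def using C(2) \<rho> e M by auto
    have "q * (27 * C * r + (E + 2 * C' * r)) = q * E + (M - 1) * r" unfolding M_def by (simp add: algebra_simps)
    also have "(M - 1) * r \<le> M * r" using r by (intro mult_right_mono) auto
    also have "M * r \<le> e" using r(3) M by (simp add: pos_le_divide_eq mult.commute)
    finally show "d_t \<phi> t0 x0 \<le> q * E + e" using key[OF r(1,2)] by simp
  qed
  then show "d_t \<phi> t0 x0 \<le> hamiltonian \<rho> \<phi> (upper_lim x b) t0 x0"
    unfolding hamiltonian_def E_def q_def .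
qed

end

subsection \<open>Refined test functions\<close>

text \<open>Only s = 0 is delicate; there the difference quotient is at most |h|^k in modulus, which
  tends to 0 for k \<ge> 1.\<close>

lemma DERIV_max_power:
  assumes "k \<ge> 1"
  shows "((\<lambda>s::real. (max 0 s) ^ Suc k) has_real_derivative real (Suc k) * (max 0 s) ^ k) (at s)"
proof (cases s "0::real" rule: linorder_cases)
  case less
  have "((\<lambda>s::real. 0) has_real_derivative real (Suc k) * (max 0 s) ^ k) (at s)"
    using less assms by (auto simp: max_def power_0_left)
  then show ?thesis
    by (rule has_field_derivative_transform_within_open[of _ _ _ "{..<0}"]) (use less in auto)
next
  case greater
  have "((\<lambda>s::real. s ^ Suc k) has_real_derivative real (Suc k) * (max 0 s) ^ k) (at s)"
    using DERIV_pow[of "Suc k" s] greater by (simp add: max_def)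
  then show ?thesis
    by (rule has_field_derivative_transform_within_open[of _ _ _ "{0<..}"]) (use greater in auto)
next
  case equal
  have "((\<lambda>h::real. (max 0 h) ^ Suc k / h) \<longlongrightarrow> 0) (at 0)"
  proof (rule Lim_null_comparison)
    have "((\<lambda>h::real. \<bar>h\<bar> ^ k) \<longlongrightarrow> \<bar>0\<bar> ^ k) (at 0)"
      by (intro tendsto_intros)
    then show "((\<lambda>h::real. \<bar>h\<bar> ^ k) \<longlongrightarrow> 0) (at 0)" using assms by (simp add: power_0_left)
    have "norm ((max 0 h) ^ Suc k / h) \<le> \<bar>h\<bar> ^ k" for h :: real
      by (cases "h > 0") (auto simp: max_def)
    then show "\<forall>\<^sub>F h::real in at 0. norm ((max 0 h) ^ Suc k / h) \<le> \<bar>h\<bar> ^ k" by simp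
  qed
  then show ?thesis using equal assms by (simp add: DERIV_def power_0_left)
qed

text \<open>Averaging over [x, x + \<delta>] twice, each time as a difference quotient of an
  antiderivative, gains two derivatives. The result is the value of m at some point within 2
  \<delta>, so it is off by at most 2 K \<delta>; adding this amount puts g above m, and \<delta> =
  e / (4 K) keeps it below m + e.\<close>

lemma lipschitz_smoothing:
  fixes m :: "real \<Rightarrow> real"
  assumes K: "K > 0" and lip: "\<And>x y. \<bar>m x - m y\<bar> \<le> K * \<bar>x - y\<bar>" and e: "e > 0"
  obtains g where "C2_Q (\<lambda>t. g)" "\<And>x. m x \<le> g x" "\<And>x. g x \<le> m x + e"
proof -
  define \<delta> where "\<delta> = e / (4 * K)"
  have \<delta>: "\<delta> > 0" "4 * (K * \<delta>) = e" using e K by (auto simp: \<delta>_def)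
  define avg where "avg F x = (F (x + \<delta>) - F x) / \<delta>" for F :: "real \<Rightarrow> real" and x
  have anti: "\<exists>F. \<forall>x. (F has_real_derivative f x) (at x)" if "continuous_on UNIV f" for f :: "real \<Rightarrow> real"
  proof -
    have "\<And>x. isCont f x" using that by (simp add: continuous_on_eq_continuous_at)
    then show ?thesis
      using einterval_antiderivative[of "-\<infinity>" "\<infinity>" f] by (auto simp: has_real_derivative_iff_has_vector_derivative)
  qed
  have avg_der: "(avg F has_real_derivative (f (x + \<delta>) - f x) / \<delta>) (at x)"
    if "\<And>x. (F has_real_derivative f x) (at x)" for F f x
  proof -
    have "((\<lambda>x. F (x + \<delta>)) has_real_derivative f (x + \<delta>)) (at x)"
      using that[of "x + \<delta>"] by (simp add: DERIV_shift)
    then have "((\<lambda>x. (F (x + \<delta>) - F x) / \<delta>) has_real_derivative (f (x + \<delta>) - f x) / \<delta>) (at x)"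
      using that by (intro DERIV_cdivide DERIV_diff)
    then show ?thesis by (simp add: avg_def[abs_def])
  qed
  have avg_mean: "\<exists>\<xi>. x < \<xi> \<and> \<xi> < x + \<delta> \<and> avg F x = f \<xi>"
    if "\<And>x. (F has_real_derivative f x) (at x)" for F f x
  proof -
    have "\<exists>z>x. z < x + \<delta> \<and> F (x + \<delta>) - F x = (x + \<delta> - x) * f z"
      by (rule MVT2) (use that \<delta>(1) in auto)
    then show ?thesis using \<delta>(1) by (auto simp: avg_def)
  qed
  have mc: "continuous_on UNIV m"
    unfolding continuous_on_iff dist_real_def
  proof (intro ballI allI impI)
    fix x \<epsilon> :: real assume "\<epsilon> > 0"
    show "\<exists>d>0. \<forall>y\<in>UNIV. \<bar>y - x\<bar> < d \<longrightarrow> \<bar>m y - m x\<bar> < \<epsilon>"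
    proof (intro exI[of _ "\<epsilon> / K"] conjI ballI impI)
      fix y assume "\<bar>y - x\<bar> < \<epsilon> / K"
      then have "K * \<bar>y - x\<bar> < \<epsilon>" using K by (simp add: pos_less_divide_eq mult.commute)
      with lip[of y x] show "\<bar>m y - m x\<bar> < \<epsilon>" by linarith
    qed (use \<open>\<epsilon> > 0\<close> K in auto)
  qed
  obtain F where F: "\<And>x. (F has_real_derivative m x) (at x)" using anti[OF mc] by blast
  have ac: "continuous_on UNIV (avg F)"
    by (intro continuous_at_imp_continuous_on ballI) (rule DERIV_isCont[OF avg_der[OF F]])
  obtain G where G: "\<And>x. (G has_real_derivative avg F x) (at x)" using anti[OF ac] by blast
  define g where "g x = avg G x + 2 * (K * \<delta>)" for x
  define g' where "g' x = (avg F (x + \<delta>) - avg F x) / \<delta>" for x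
  define g'' where "g'' x = ((m (x + \<delta> + \<delta>) - m (x + \<delta>)) / \<delta> - (m (x + \<delta>) - m x) / \<delta>) / \<delta>" for x
  have "C2_Q (\<lambda>t. g)"
  proof (rule C2_Q_space)
    show "(g has_real_derivative g' x) (at x)" for x
      unfolding g_def[abs_def] g'_def using DERIV_add[OF avg_der[OF G, of x] DERIV_const[of "2 * (K * \<delta>)"]] by simp
    show "(g' has_real_derivative g'' x) (at x)" for x
    proof -
      have "((\<lambda>x. avg F (x + \<delta>)) has_real_derivative (m (x + \<delta> + \<delta>) - m (x + \<delta>)) / \<delta>) (at x)"
        using avg_der[OF F, of "x + \<delta>"] by (simp add: DERIV_shift)
      then show ?thesis
        unfolding g'_def[abs_def] g''_def using avg_der[OF F, of x] by (intro DERIV_cdivide DERIV_diff)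
    qed
    show "continuous_on UNIV g''"
      unfolding g''_def by (intro continuous_intros continuous_on_compose2[OF mc]) (use \<delta> in auto)
  qed
  moreover have "m x \<le> g x \<and> g x \<le> m x + e" for x
  proof -
    obtain \<xi> where \<xi>: "x < \<xi>" "\<xi> < x + \<delta>" "avg G x = avg F \<xi>" using avg_mean[OF G] by blast
    obtain \<eta> where \<eta>: "\<xi> < \<eta>" "\<eta> < \<xi> + \<delta>" "avg F \<xi> = m \<eta>" using avg_mean[OF F] by blast
    have "\<bar>m \<eta> - m x\<bar> \<le> K * (2 * \<delta>)"
    proof (rule order_trans[OF lip])
      show "K * \<bar>\<eta> - x\<bar> \<le> K * (2 * \<delta>)" using \<xi> \<eta> K by (intro mult_left_mono) auto
    qed
    then have "\<bar>m \<eta> - m x\<bar> \<le> 2 * (K * \<delta>)" by simp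
    then show ?thesis unfolding g_def \<xi>(3) \<eta>(3) \<delta>(2)[symmetric] by linarith
  qed
  ultimately show ?thesis using that by blast
qed

lemma usc_on_Q_iff:
  "usc_on Q u \<longleftrightarrow> (\<forall>t>0. \<forall>y. \<forall>e>0. \<exists>\<delta>>0. \<forall>s>0. \<forall>z. \<bar>s - t\<bar> < \<delta> \<longrightarrow> \<bar>z - y\<bar> < \<delta> \<longrightarrow> u s z < u t y + e)"
proof -
  have "(\<forall>\<^sub>F (s, z) in at (t, y) within Q. u s z < u t y + e) \<longleftrightarrow>
    (\<exists>\<delta>>0. \<forall>s>0. \<forall>z. \<bar>s - t\<bar> < \<delta> \<longrightarrow> \<bar>z - y\<bar> < \<delta> \<longrightarrow> u s z < u t y + e)" (is "?L \<longleftrightarrow> ?R")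
    if "t > 0" "e > 0" for t y e
  proof
    assume ?L
    then obtain d where d: "d > 0" "\<And>q. q \<in> Q \<Longrightarrow> q \<noteq> (t, y) \<Longrightarrow> dist q (t, y) < d \<Longrightarrow> u (fst q) (snd q) < u t y + e"
      unfolding eventually_at case_prod_beta by auto
    show ?R
    proof (intro exI[of _ "d / 2"] conjI allI impI)
      fix s z assume s: "s > 0" "\<bar>s - t\<bar> < d / 2" "\<bar>z - y\<bar> < d / 2"
      have "dist (s, z) (t, y) \<le> \<bar>s - t\<bar> + \<bar>z - y\<bar>"
        unfolding dist_Pair_Pair dist_real_def using sqrt_sum_squares_le_sum_abs by simp
      then have "dist (s, z) (t, y) < d" using s by linarith
      with d(2)[of "(s, z)"] s \<open>e > 0\<close> show "u s z < u t y + e" by (cases "(s, z) = (t, y)") (auto simp: Q_def)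
    qed (use d in simp)
  next
    assume ?R
    then obtain \<delta> where \<delta>: "\<delta> > 0" "\<And>s z. s > 0 \<Longrightarrow> \<bar>s - t\<bar> < \<delta> \<Longrightarrow> \<bar>z - y\<bar> < \<delta> \<Longrightarrow> u s z < u t y + e" by blast
    show ?L
      unfolding eventually_at
    proof (intro exI[of _ \<delta>] conjI ballI impI \<delta>(1))
      fix q assume q: "q \<in> Q" "q \<noteq> (t, y) \<and> dist q (t, y) < \<delta>"
      then have "dist (fst q) t < \<delta>" "dist (snd q) y < \<delta>"
        using dist_fst_le[of q "(t, y)"] dist_snd_le[of q "(t, y)"] by auto
      then show "case q of (s, z) \<Rightarrow> u s z < u t y + e"
        using \<delta>(2)[of "fst q" "snd q"] q(1) by (auto simp: Q_def dist_real_def)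
    qed
  qed
  then show ?thesis unfolding usc_on_def Q_def by auto
qed

text \<open>Smooth functions above \<open>u\<close> whose time slices at \<open>t\<^sub>0\<close> decrease to that of \<open>u\<close>:
  smoothed sup-convolutions, with \<open>K |t - t\<^sub>0|\<close> dominated by a parabola.\<close>

lemma smooth_upper_approximation:
  assumes B: "\<And>t y. t > 0 \<Longrightarrow> \<bar>u t y\<bar> \<le> B" and usc: "usc_on Q u" and t0: "t0 > 0"
  obtains w :: "nat \<Rightarrow> real \<Rightarrow> real \<Rightarrow> real"
  where "\<And>k. C2_Q (w k)" "\<And>k t y. t > 0 \<Longrightarrow> u t y \<le> w k t y"
    "\<And>k y. \<bar>w k t0 y\<bar> \<le> B + 2" "\<And>y. (\<lambda>k. w k t0 y) \<longlonglongrightarrow> u t0 y"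
proof -
  define X where "X K y = (\<lambda>(s, z). u s z - K * \<bar>y - z\<bar> - K * \<bar>s - t0\<bar>) ` Q" for K y :: real
  define m where "m K y = Sup (X K y)" for K y
  have bX: "bdd_above (X K y)" if "K > 0" for K y
  proof (rule bdd_aboveI[of _ B])
    fix v assume "v \<in> X K y"
    then obtain s z where s: "s > 0" "v = u s z - K * \<bar>y - z\<bar> - K * \<bar>s - t0\<bar>" unfolding X_def Q_def by auto
    have "0 \<le> K * \<bar>y - z\<bar>" "0 \<le> K * \<bar>s - t0\<bar>" using that by auto
    with s B[OF s(1), of z] show "v \<le> B" by linarith
  qed
  have upper: "u s z \<le> m K y + K * \<bar>y - z\<bar> + K * \<bar>s - t0\<bar>" if "K > 0" "s > 0" for K s y z
  proof -
    have "u s z - K * \<bar>y - z\<bar> - K * \<bar>s - t0\<bar> \<in> X K y" unfolding X_def Q_def using that by force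
    then have "u s z - K * \<bar>y - z\<bar> - K * \<bar>s - t0\<bar> \<le> m K y" unfolding m_def by (rule cSup_upper[OF _ bX[OF that(1)]])
    then show ?thesis by linarith
  qed
  have least: "m K y \<le> c" if le: "\<And>s z. s > 0 \<Longrightarrow> u s z - K * \<bar>y - z\<bar> - K * \<bar>s - t0\<bar> \<le> c" for K y c
    unfolding m_def
  proof (rule cSup_least)
    show "X K y \<noteq> {}" unfolding X_def Q_def by (auto intro: exI[of _ 1])
    show "v \<le> c" if "v \<in> X K y" for v using that le unfolding X_def Q_def by auto
  qed
  have lip: "\<bar>m K y - m K y'\<bar> \<le> K * \<bar>y - y'\<bar>" if K: "K > 0" for K y y'
  proof -
    have "m K y \<le> m K y' + K * \<bar>y - y'\<bar>" for y y'
    proof (rule least)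
      fix s z :: real assume "s > 0"
      have "K * \<bar>y' - z\<bar> \<le> K * (\<bar>y - y'\<bar> + \<bar>y - z\<bar>)" using K by (intro mult_left_mono) auto
      with upper[OF K \<open>s > 0\<close>, of z y'] show "u s z - K * \<bar>y - z\<bar> - K * \<bar>s - t0\<bar> \<le> m K y' + K * \<bar>y - y'\<bar>"
        by (simp add: distrib_left)
    qed
    from this[of y y'] this[of y' y] show ?thesis by (simp add: abs_minus_commute abs_le_iff)
  qed
  define K where "K k = real (Suc k)" for k
  have K: "K k > 0" for k by (simp add: K_def)
  have "\<exists>g. C2_Q (\<lambda>t. g) \<and> (\<forall>y. m (K k) y \<le> g y \<and> g y \<le> m (K k) y + 1 / K k)" for k
    using lipschitz_smoothing[OF K lip[OF K], of "1 / K k" k] K[of k] by (metis divide_pos_pos zero_less_one)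
  then obtain g where g: "\<And>k. C2_Q (\<lambda>t. g k)" "\<And>k y. m (K k) y \<le> g k y" "\<And>k y. g k y \<le> m (K k) y + 1 / K k"
    by metis
  \<comment> \<open>Expanding (2 - K^2 |t - t0|)^2 \<ge> 0 gives K |t - t0| \<le> 1/K + K^3/4 (t -
    t0)^2. The parabola is smooth in t and vanishes at t0, and 1/K tends to 0.\<close>
  define w where "w k t y = g k y + (1 / K k + ((K k)^3 / 4 * (t - t0)\<^sup>2 + 0 * t))" for k t y
  have "C2_Q (w k)" for k
    unfolding w_def[abs_def] by (intro C2_Q_add g C2_Q_const C2_Q_quadratic)
  moreover have "u t y \<le> w k t y" if t: "t > 0" for k t y
  proof -
    have "K k * \<bar>t - t0\<bar> \<le> 1 / K k + (K k)^3 / 4 * (t - t0)\<^sup>2"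
    proof -
      have "0 \<le> (2 - (K k)\<^sup>2 * \<bar>t - t0\<bar>)\<^sup>2" by simp
      then have "4 * ((K k)\<^sup>2 * \<bar>t - t0\<bar>) \<le> 4 + (K k)\<^sup>2 * ((K k)\<^sup>2 * (t - t0)\<^sup>2)"
        by (simp add: power2_diff power_mult_distrib power2_eq_square[of "(K k)\<^sup>2"])
      then have "(4 * ((K k)\<^sup>2 * \<bar>t - t0\<bar>)) / (4 * K k) \<le> (4 + (K k)\<^sup>2 * ((K k)\<^sup>2 * (t - t0)\<^sup>2)) / (4 * K k)"
        using K[of k] by (intro divide_right_mono) auto
      then show ?thesis using K[of k] by (simp add: add_divide_distrib power2_eq_square power3_eq_cube)
    qed
    with upper[OF K t, of y k y] g(2)[of k y] show ?thesis unfolding w_def by simp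
  qed
  moreover have wt0: "w k t0 y = g k y + 1 / K k" for k y by (simp add: w_def)
  have mu: "u t0 y \<le> m (K k) y" for k y using upper[OF K t0, of y k y] by simp
  have mB: "m (K k) y \<le> B" for k y
  proof (rule least)
    fix s z :: real assume s: "s > 0"
    have "0 \<le> K k * \<bar>y - z\<bar>" "0 \<le> K k * \<bar>s - t0\<bar>" using K[of k] by auto
    with B[OF s, of z] show "u s z - K k * \<bar>y - z\<bar> - K k * \<bar>s - t0\<bar> \<le> B" by linarith
  qed
  have "\<bar>w k t0 y\<bar> \<le> B + 2" for k y
  proof -
    have "1 / K k \<le> 1" "0 \<le> 1 / K k" by (auto simp: K_def)
    with mu[of y k] mB[of k y] B[OF t0, of y] g(2,3)[of k y] show ?thesis unfolding wt0 by (simp add: abs_le_iff)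
  qed
  moreover have "(\<lambda>k. w k t0 y) \<longlonglongrightarrow> u t0 y" for y
  proof (rule LIMSEQ_I)
    fix e :: real assume e: "e > 0"
    obtain \<delta> where \<delta>: "\<delta> > 0" "\<And>s z. s > 0 \<Longrightarrow> \<bar>s - t0\<bar> < \<delta> \<Longrightarrow> \<bar>z - y\<bar> < \<delta> \<Longrightarrow> u s z < u t0 y + e / 2"
      using usc[unfolded usc_on_Q_iff, rule_format, OF t0, of "e / 2" y] e by auto
    \<comment> \<open>For K above 2 B / \<delta> the penalty at points not \<delta>-close to (t0, y)
      exceeds the oscillation 2 B, so only close points matter. For K above 4 / e the two errors 1/K
      together stay below e / 2.\<close>
    obtain M where M: "max (2 * B / \<delta>) (4 / e) < real M" using reals_Archimedean2 by blast
    have "norm (w k t0 y - u t0 y) < e" if k: "k \<ge> M" for k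
    proof -
      have KM: "max (2 * B / \<delta>) (4 / e) < K k" using M k by (simp add: K_def)
      have "m (K k) y \<le> u t0 y + e / 2"
      proof (rule least)
        fix s z :: real assume s: "s > 0"
        have nn: "0 \<le> K k * \<bar>y - z\<bar>" "0 \<le> K k * \<bar>s - t0\<bar>" using K[of k] by auto
        show "u s z - K k * \<bar>y - z\<bar> - K k * \<bar>s - t0\<bar> \<le> u t0 y + e / 2"
        proof (cases "\<bar>s - t0\<bar> < \<delta> \<and> \<bar>z - y\<bar> < \<delta>")
          case True
          with \<delta>(2)[OF s, of z] nn show ?thesis by linarith
        next
          case False
          then have "\<delta> \<le> \<bar>y - z\<bar> + \<bar>s - t0\<bar>" by linarith
          then have "K k * \<delta> \<le> K k * (\<bar>y - z\<bar> + \<bar>s - t0\<bar>)" using K[of k] by (intro mult_left_mono) auto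
          moreover have "2 * B \<le> K k * \<delta>" using KM \<delta>(1) by (simp add: pos_divide_less_eq)
          ultimately show ?thesis using B[OF s, of z] B[OF t0, of y] e by (simp add: distrib_left abs_le_iff)
        qed
      qed
      moreover have "4 < K k * e" using KM e by (simp add: pos_divide_less_eq)
      then have "1 / K k < e / 4" using K[of k] e by (simp add: field_simps)
      ultimately show ?thesis using mu[of y k] g(2,3)[of k y] K[of k] unfolding wt0 by (simp add: abs_less_iff)
    qed
    then show "\<exists>M. \<forall>k\<ge>M. norm (w k t0 y - u t0 y) < e" by blast
  qed
  ultimately show ?thesis using that by blast
qed

text \<open>The third power makes the truncation at |y - x0| = r twice continuously
  differentiable.\<close>

definition cutoff :: "real \<Rightarrow> real \<Rightarrow> real \<Rightarrow> real" where
  "cutoff r x0 y = (max 0 (1 - ((y - x0) / r)\<^sup>2)) ^ 3"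

text \<open>The quadratic bound on 1 - \<open>cutoff\<close> near the centre is what makes its
  product with a bounded function integrable against 1/z^2.\<close>

lemma cutoff_properties:
  assumes r: "r > 0"
  shows "C2_Q (\<lambda>t. cutoff r x0)" and "d_x (\<lambda>t. cutoff r x0) t x0 = 0" and "cutoff r x0 x0 = 1"
    and "0 \<le> cutoff r x0 y" "cutoff r x0 y \<le> 1" "1 - cutoff r x0 (x0 + z) \<le> 3 * z\<^sup>2 / r\<^sup>2"
    and "r \<le> \<bar>z\<bar> \<Longrightarrow> cutoff r x0 (x0 + z) = 0"
proof -
  define s where "s y = 1 - ((y - x0) / r)\<^sup>2" for y
  define s' where "s' y = - 2 * (y - x0) / r\<^sup>2" for y
  have s: "(s has_real_derivative s' y) (at y)" for y
    unfolding s_def[abs_def] s'_def using r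
    by (auto intro!: derivative_eq_intros simp: power2_eq_square field_simps)
  have s1: "(s' has_real_derivative - 2 / r\<^sup>2) (at y)" for y
    unfolding s'_def[abs_def] by (rule DERIV_cdivide) (auto intro!: derivative_eq_intros)
  have c: "cutoff r x0 = (\<lambda>y. (max 0 (s y)) ^ 3)" by (simp add: cutoff_def[abs_def] s_def)
  have d3: "((\<lambda>y. (max 0 (s y)) ^ 3) has_real_derivative 3 * (max 0 (s y)) ^ 2 * s' y) (at y)" for y
    using DERIV_chain2[OF DERIV_max_power[of 2 "s y"] s] by (simp add: eval_nat_numeral)
  have d2: "((\<lambda>y. (max 0 (s y)) ^ 2) has_real_derivative 2 * max 0 (s y) * s' y) (at y)" for y
    using DERIV_chain2[OF DERIV_max_power[of 1 "s y"] s] by (simp add: eval_nat_numeral)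
  show "C2_Q (\<lambda>t. cutoff r x0)"
    unfolding c
  proof (rule C2_Q_space[OF d3])
    show "((\<lambda>y. 3 * (max 0 (s y)) ^ 2 * s' y) has_real_derivative
        3 * (2 * max 0 (s y) * s' y) * s' y + (- 2 / r\<^sup>2) * (3 * (max 0 (s y)) ^ 2)) (at y)" for y
      by (rule DERIV_mult[OF DERIV_cmult[OF d2] s1])
    have "continuous_on UNIV s" "continuous_on UNIV s'"
      by (intro continuous_at_imp_continuous_on ballI DERIV_isCont[OF s], intro continuous_at_imp_continuous_on ballI DERIV_isCont[OF s1])
    then show "continuous_on UNIV (\<lambda>y. 3 * (2 * max 0 (s y) * s' y) * s' y + (- 2 / r\<^sup>2) * (3 * (max 0 (s y)) ^ 2))"
      by (intro continuous_intros)
  qed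
  show "d_x (\<lambda>t. cutoff r x0) t x0 = 0"
    by (rule d_x_eqI) (use d3[of x0] in \<open>simp add: c s'_def\<close>)
  show "cutoff r x0 x0 = 1" by (simp add: cutoff_def)
  show "0 \<le> cutoff r x0 y" by (simp add: cutoff_def)
  have le1: "max 0 (1 - q\<^sup>2) \<le> 1" for q :: real by simp
  then show "cutoff r x0 y \<le> 1" unfolding cutoff_def by (intro power_le_one) auto
  have "1 - a ^ 3 \<le> 3 * (1 - a)" if "0 \<le> a" "a \<le> 1" for a :: real
  proof -
    have "1 - a ^ 3 = (1 - a) * (1 + a + a\<^sup>2)" by (simp add: power2_eq_square power3_eq_cube algebra_simps)
    also have "\<dots> \<le> (1 - a) * 3" using that power_le_one[of a 2] by (intro mult_left_mono) auto
    finally show ?thesis by simp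
  qed
  from this[OF _ le1, of "z / r"]
  have "1 - cutoff r x0 (x0 + z) \<le> 3 * (1 - max 0 (1 - (z / r)\<^sup>2))" unfolding cutoff_def by simp
  also have "\<dots> \<le> 3 * (z / r)\<^sup>2" by (auto simp: max_def)
  finally show "1 - cutoff r x0 (x0 + z) \<le> 3 * z\<^sup>2 / r\<^sup>2" by (simp add: power_divide)
  assume "r \<le> \<bar>z\<bar>"
  then have "r\<^sup>2 \<le> z\<^sup>2" using r abs_le_square_iff[of r z] by auto
  then have "1 \<le> (z / r)\<^sup>2" using r by (simp add: power_divide)
  then show "cutoff r x0 (x0 + z) = 0" unfolding cutoff_def by simp
qed

lemma usc_slice_measurable:
  assumes "usc_on Q u" "t > 0" shows "u t \<in> borel_measurable borel"
proof (rule usc_measurable)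
  fix y e :: real assume "e > 0"
  with assms(1)[unfolded usc_on_Q_iff, rule_format, OF assms(2), of e y] assms(2)
  show "\<exists>\<delta>>0. \<forall>z. \<bar>z - y\<bar> < \<delta> \<longrightarrow> u t z < u t y + e" by (metis abs_zero cancel_comm_monoid_add_class.diff_cancel)
qed

lemma bounded_Q_D:
  assumes "bounded_Q u" obtains B where "\<And>t y. t > 0 \<Longrightarrow> \<bar>u t y\<bar> \<le> B" "B > 0"
  using assms unfolding bounded_Q_def bounded_pos Q_def by force

text \<open>The test function is replaced by \<open>\<Phi> k\<close>, which is \<theta> \<phi>0 + (1
  - \<theta>) w_k: it is still above u, and it has the derivatives of \<phi> at the contact because
  there \<theta> = 1 with slope 0. As k grows, w_k tends to u on the slice t0. On the annulus
  between r and \<rho>, where \<theta> = 0, the values of \<phi> are thus replaced by those of u,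
  while inside the ball of radius r the limit lies below \<phi>0.\<close>

lemma subsolution_refined:
  assumes sub: "subsolution \<rho> u" and r: "0 < r" "r \<le> \<rho>" and \<phi>: "C2_Q \<phi>" and t0: "t0 > 0"
    and max: "\<And>s y. s > 0 \<Longrightarrow> u s y - \<phi> s y \<le> u t0 x0 - \<phi> t0 x0"
    and p: "d_x \<phi> t0 x0 \<noteq> 0"
  shows "d_t \<phi> t0 x0 \<le> hamiltonian r \<phi> u t0 x0"
proof -
  have usc: "usc_on Q u" and bQ: "bounded_Q u" using sub unfolding subsolution_def by simp_all
  obtain B where B: "\<And>t y. t > 0 \<Longrightarrow> \<bar>u t y\<bar> \<le> B" "B > 0" using bounded_Q_D[OF bQ] by blast
  obtain w where w: "\<And>k. C2_Q (w k)" "\<And>k t y. t > 0 \<Longrightarrow> u t y \<le> w k t y"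
    "\<And>k y. \<bar>w k t0 y\<bar> \<le> B + 2" "\<And>y. (\<lambda>k. w k t0 y) \<longlonglongrightarrow> u t0 y"
    using smooth_upper_approximation[OF B(1) usc t0] by blast
  define \<theta> where "\<theta> = cutoff r x0"
  note \<theta> = cutoff_properties[OF r(1), where ?x0.0 = x0, folded \<theta>_def]
  define u0 where "u0 = u t0 x0"
  define P where "P = d_x \<phi> t0 x0"
  \<comment> \<open>Shifted by a constant so as to touch u at the contact and to lie above it, as
    the convex combination requires.\<close>
  define \<phi>0 where "\<phi>0 t y = \<phi> t y + (u0 - \<phi> t0 x0)" for t y
  have \<phi>0: "C2_Q \<phi>0" unfolding \<phi>0_def[abs_def] by (intro C2_Q_add \<phi> C2_Q_const)
  have \<phi>0x: "d_x \<phi>0 t0 x0 = P" "d_t \<phi>0 t0 x0 = d_t \<phi> t0 x0"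
    unfolding \<phi>0_def P_def using C1_Q_DERIV[OF C2_Q_D(1)[OF \<phi>] t0]
    by (auto intro!: d_x_eqI d_t_eqI derivative_eq_intros)
  have u\<phi>0: "u s y \<le> \<phi>0 s y" if "s > 0" for s y using max[OF that, of y] by (simp add: \<phi>0_def u0_def)
  have \<phi>0u: "\<phi>0 t0 x0 = u0" by (simp add: \<phi>0_def)
  define \<Phi> where "\<Phi> k t y = \<theta> y * \<phi>0 t y + (1 + (-1) * \<theta> y) * w k t y" for k t y
  have c1: "C2_Q (\<lambda>t y. 1 + (-1) * \<theta> y)" by (intro C2_Q_add C2_Q_mult C2_Q_const \<theta>(1))
  have \<Phi>: "C2_Q (\<Phi> k)" for k
    unfolding \<Phi>_def[abs_def] by (intro C2_Q_add C2_Q_mult c1 \<theta>(1) \<phi>0 w)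
  have \<Phi>d: "d_x (\<Phi> k) t0 x0 = P" "d_t (\<Phi> k) t0 x0 = d_t \<phi> t0 x0" for k
  proof -
    note D1 = C1_Q_DERIV[OF C2_Q_D(1)[OF \<theta>(1)] t0, where x = x0] C1_Q_DERIV[OF C2_Q_D(1)[OF \<phi>0] t0, where x = x0] C1_Q_DERIV[OF C2_Q_D(1)[OF w(1)[of k]] t0, where x = x0]
    have x: "(\<theta> has_real_derivative 0) (at x0)" using D1(2) \<theta>(2) by simp
    have "((\<lambda>y. \<Phi> k t0 y) has_real_derivative 0 * \<phi>0 t0 x0 + d_x \<phi>0 t0 x0 * \<theta> x0 +
        ((0 + (-1) * 0) * w k t0 x0 + d_x (w k) t0 x0 * (1 + (-1) * \<theta> x0))) (at x0)"
      unfolding \<Phi>_def by (intro DERIV_add DERIV_mult DERIV_const DERIV_cmult x D1)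
    from d_x_eqI[where f = "\<Phi> k", OF this] show "d_x (\<Phi> k) t0 x0 = P" by (simp add: \<theta>(3) \<phi>0x)
    have "((\<lambda>s. \<Phi> k s x0) has_real_derivative \<theta> x0 * d_t \<phi>0 t0 x0 + (1 + (-1) * \<theta> x0) * d_t (w k) t0 x0) (at t0)"
      unfolding \<Phi>_def by (intro DERIV_add DERIV_cmult D1)
    from d_t_eqI[where f = "\<Phi> k", OF this] show "d_t (\<Phi> k) t0 x0 = d_t \<phi> t0 x0" by (simp add: \<theta>(3) \<phi>0x)
  qed
  have \<Phi>u: "u s y \<le> \<Phi> k s y" if "s > 0" for k s y
  proof -
    have "\<theta> y * u s y + (1 - \<theta> y) * u s y \<le> \<theta> y * \<phi>0 s y + (1 - \<theta> y) * w k s y"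
      using \<theta>(4,5)[of y] u\<phi>0[OF that, of y] w(2)[OF that, of y k] by (intro add_mono mult_left_mono) auto
    then show ?thesis by (simp add: \<Phi>_def algebra_simps)
  qed
  have \<Phi>0: "\<Phi> k t0 x0 = u0" for k by (simp add: \<Phi>_def \<theta>(3) \<phi>0u)
  define v where "v z = u t0 (x0 + z) - u0" for z
  have mu: "u t0 \<in> borel_measurable borel" by (rule usc_slice_measurable[OF usc t0])
  have v: "v \<in> borel_measurable borel" "\<And>z. \<bar>v z\<bar> \<le> 2 * B"
  proof -
    show "v \<in> borel_measurable borel" unfolding v_def[abs_def] using mu by measurable
    show "\<bar>v z\<bar> \<le> 2 * B" for z
      using B(1)[OF t0, of "x0 + z"] B(1)[OF t0, of x0] unfolding v_def u0_def by linarith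
  qed
  define g where "g z = \<phi> t0 (x0 + z) - \<phi> t0 x0 - P * z" for z
  define G where "G k z = \<Phi> k t0 (x0 + z) - u0 - P * z" for k z
  define L where "L z = \<theta> (x0 + z) * g z + (1 - \<theta> (x0 + z)) * (v z - P * z)" for z
  have \<rho>: "\<rho> > 0" using r by simp
  have Geq: "G k z = \<theta> (x0 + z) * g z + (1 - \<theta> (x0 + z)) * (w k t0 (x0 + z) - u0 - P * z)" for k z
    unfolding G_def \<Phi>_def g_def \<phi>0_def by (simp add: algebra_simps)
  have contx: "continuous_on UNIV (f t0)" if "C2_Q f" for f
    by (intro continuous_at_imp_continuous_on ballI) (rule DERIV_isCont[OF C1_Q_DERIV(2)[OF C2_Q_D(1)[OF that] t0]])
  have gc: "continuous_on UNIV g"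
    unfolding g_def by (intro continuous_intros continuous_on_compose2[OF contx[OF \<phi>]]) auto
  have mg: "g \<in> borel_measurable borel" using gc by (rule borel_measurable_continuous_onI)
  have m\<theta>: "(\<lambda>z. \<theta> (x0 + z)) \<in> borel_measurable borel"
    by (intro borel_measurable_continuous_onI, rule continuous_on_compose2[OF contx[OF \<theta>(1)]])
       (auto intro!: continuous_intros)
  have mG: "G k \<in> borel_measurable borel" for k
  proof (rule borel_measurable_continuous_onI)
    have "continuous_on UNIV (\<lambda>z. \<Phi> k t0 (x0 + z))"
      by (rule continuous_on_compose2[OF contx[OF \<Phi>[of k]]]) (auto intro!: continuous_intros)
    then show "continuous_on UNIV (G k)" unfolding G_def[abs_def] by (intro continuous_intros)
  qed
  have mL: "L \<in> borel_measurable borel" unfolding L_def[abs_def] using m\<theta> mg v(1) by measurable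
  \<comment> \<open>Taylor's formula covers |z| \<le> 1; for larger |z| up to \<rho> the bound M of
    |g| is at most M z^2.\<close>
  obtain C where C: "C \<ge> 0" "\<And>z. \<bar>z\<bar> \<le> \<rho> \<Longrightarrow> \<bar>g z\<bar> \<le> C * z\<^sup>2"
  proof -
    obtain C d where C: "C \<ge> 0" "d > 0" "\<And>t y z. \<bar>t - t0\<bar> \<le> d \<Longrightarrow> \<bar>y - x0\<bar> \<le> 1 \<Longrightarrow> \<bar>z\<bar> \<le> 1 \<Longrightarrow>
      \<bar>\<phi> t (y + z) - \<phi> t y - d_x \<phi> t y * z\<bar> \<le> C * z\<^sup>2"
      using C2_Q_taylor[OF \<phi> t0, of x0] by metis
    have "compact (g ` {-\<rho>..\<rho>})" using gc by (intro compact_continuous_image compact_Icc) (auto elim: continuous_on_subset)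
    then obtain M where M: "\<And>z. z \<in> {-\<rho>..\<rho>} \<Longrightarrow> \<bar>g z\<bar> \<le> M"
      using compact_imp_bounded bounded_iff by (metis (no_types, opaque_lifting) image_eqI real_norm_def)
    have M0: "M \<ge> 0" using M[of 0] \<rho> by (auto intro: order_trans[OF abs_ge_zero])
    show ?thesis
    proof (rule that[of "C + M"])
      fix z assume z: "\<bar>z\<bar> \<le> \<rho>"
      show "\<bar>g z\<bar> \<le> (C + M) * z\<^sup>2"
      proof (cases "\<bar>z\<bar> \<le> 1")
        case True
        then have "\<bar>g z\<bar> \<le> C * z\<^sup>2" using C(3)[of t0 x0 z] C(2) by (simp add: g_def P_def)
        moreover have "0 \<le> M * z\<^sup>2" using M0 by simp
        ultimately show ?thesis by (simp add: distrib_right)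
      next
        case False
        then have "1 \<le> z\<^sup>2" using abs_le_square_iff[of 1 z] by simp
        then have "M * 1 \<le> M * z\<^sup>2" using M0 by (intro mult_left_mono) auto
        moreover have "\<bar>g z\<bar> \<le> M" using M z by (simp add: abs_le_iff)
        moreover have "0 \<le> C * z\<^sup>2" using C by simp
        ultimately show ?thesis by (simp add: distrib_right)
      qed
    qed (use C M0 in simp)
  qed
  \<comment> \<open>C serves for \<theta> g, and the other summand is controlled by 1 - \<theta>
    \<le> 3 z^2 / r^2. After division by z^2 the constant D dominates, which allows k to tend to
    infinity in the singular integral.\<close>
  define D where "D = C + 3 / r\<^sup>2 * (2 * B + 2 + \<bar>P\<bar> * \<rho>)"
  have D0: "D \<ge> 0" unfolding D_def using C(1) B(2) \<rho> by (intro add_nonneg_nonneg mult_nonneg_nonneg) auto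
  have dom: "\<bar>\<theta> (x0 + z) * g z + (1 - \<theta> (x0 + z)) * q\<bar> \<le> D * z\<^sup>2"
    if z: "\<bar>z\<bar> \<le> \<rho>" and q: "\<bar>q\<bar> \<le> 2 * B + 2 + \<bar>P\<bar> * \<rho>" for z q
  proof -
    have "\<bar>\<theta> (x0 + z) * g z\<bar> \<le> 1 * (C * z\<^sup>2)"
      unfolding abs_mult using \<theta>(4,5)[of "x0 + z"] C(2)[OF z] by (intro mult_mono) auto
    moreover have "\<bar>(1 - \<theta> (x0 + z)) * q\<bar> \<le> (3 * z\<^sup>2 / r\<^sup>2) * (2 * B + 2 + \<bar>P\<bar> * \<rho>)"
      unfolding abs_mult using \<theta>(4,5)[of "x0 + z"] \<theta>(6)[of z] q by (intro mult_mono) auto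
    moreover have "D * z\<^sup>2 = C * z\<^sup>2 + (3 * z\<^sup>2 / r\<^sup>2) * (2 * B + 2 + \<bar>P\<bar> * \<rho>)"
    proof -
      have "(a + 3 / R * E) * Z = a * Z + (3 * Z / R) * E" for a R E Z :: real by (simp add: distrib_right)
      then show ?thesis unfolding D_def .
    qed
    ultimately show ?thesis by linarith
  qed
  have Pz: "\<bar>P * z\<bar> \<le> \<bar>P\<bar> * \<rho>" if "\<bar>z\<bar> \<le> \<rho>" for z unfolding abs_mult using that by (intro mult_left_mono) auto
  have GD: "\<bar>G k z\<bar> \<le> D * z\<^sup>2" if z: "\<bar>z\<bar> \<le> \<rho>" for k z
    unfolding Geq
  proof (rule dom[OF z])
    show "\<bar>w k t0 (x0 + z) - u0 - P * z\<bar> \<le> 2 * B + 2 + \<bar>P\<bar> * \<rho>"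
      using w(3)[of k "x0 + z"] B(1)[OF t0, of x0] Pz[OF z] unfolding u0_def by linarith
  qed
  have LD: "\<bar>L z\<bar> \<le> D * z\<^sup>2" if z: "\<bar>z\<bar> \<le> \<rho>" for z
    unfolding L_def
  proof (rule dom[OF z])
    show "\<bar>v z - P * z\<bar> \<le> 2 * B + 2 + \<bar>P\<bar> * \<rho>"
      using v(2)[of z] Pz[OF z] by linarith
  qed
  have quot: "\<bar>q / z\<^sup>2\<bar> \<le> E" if "\<bar>q\<bar> \<le> E * z\<^sup>2" "E \<ge> 0" for q z E :: real
    using that by (cases "z = 0") (auto simp: abs_divide divide_le_eq)
  have constint: "integrable lborel (\<lambda>z. indicator {-\<rho><..<\<rho>} z *\<^sub>R E)" for E :: real
    by (intro integrable_scaleR_left integrable_real_indicator) (use \<rho> in auto)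
  have near_int: "set_integrable lborel {-\<rho><..<\<rho>} (\<lambda>z. f z / z\<^sup>2)"
    if "f \<in> borel_measurable borel" "\<And>z. \<bar>z\<bar> \<le> \<rho> \<Longrightarrow> \<bar>f z\<bar> \<le> E * z\<^sup>2" "E \<ge> 0" for f E
  proof (rule set_integrable_bound[where f = "\<lambda>z. E"])
    show "set_integrable lborel {-\<rho><..<\<rho>} (\<lambda>z. E)" unfolding set_integrable_def by (rule constint)
    show "set_borel_measurable lborel {-\<rho><..<\<rho>} (\<lambda>z. f z / z\<^sup>2)"
      unfolding set_borel_measurable_def using that(1) by measurable
    show "AE z in lborel. z \<in> {-\<rho><..<\<rho>} \<longrightarrow> norm (f z / z\<^sup>2) \<le> norm E"
    proof (intro AE_I2 impI)
      fix z assume "z \<in> {-\<rho><..<\<rho>}"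
      then have "\<bar>f z / z\<^sup>2\<bar> \<le> E" using that(2)[of z] that(3) by (intro quot) auto
      then show "norm (f z / z\<^sup>2) \<le> norm E" by simp
    qed
  qed
  have conv: "(\<lambda>k. LINT z:{-\<rho><..<\<rho>}|lborel. G k z / z\<^sup>2) \<longlonglongrightarrow> (LINT z:{-\<rho><..<\<rho>}|lborel. L z / z\<^sup>2)"
    unfolding set_lebesgue_integral_def
  proof (rule integral_dominated_convergence[where w = "\<lambda>z. indicator {-\<rho><..<\<rho>} z *\<^sub>R D"])
    show "integrable lborel (\<lambda>z. indicator {-\<rho><..<\<rho>} z *\<^sub>R D)" by (rule constint)
    show "(\<lambda>z. indicator {-\<rho><..<\<rho>} z *\<^sub>R (L z / z\<^sup>2)) \<in> borel_measurable lborel"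
      "(\<lambda>z. indicator {-\<rho><..<\<rho>} z *\<^sub>R (G k z / z\<^sup>2)) \<in> borel_measurable lborel" for k
      using mL mG[of k] by measurable
    show "AE z in lborel. (\<lambda>k. indicator {-\<rho><..<\<rho>} z *\<^sub>R (G k z / z\<^sup>2)) \<longlonglongrightarrow> indicator {-\<rho><..<\<rho>} z *\<^sub>R (L z / z\<^sup>2)"
    proof (intro AE_I2 tendsto_scaleR tendsto_const)
      fix z
      have "(\<lambda>k. G k z) \<longlonglongrightarrow> L z"
        unfolding Geq L_def v_def by (intro tendsto_intros w(4))
      then show "(\<lambda>k. G k z / z\<^sup>2) \<longlonglongrightarrow> L z / z\<^sup>2"
        unfolding divide_inverse by (intro tendsto_mult tendsto_const)
    qed
    show "AE z in lborel. norm (indicator {-\<rho><..<\<rho>} z *\<^sub>R (G k z / z\<^sup>2)) \<le> indicator {-\<rho><..<\<rho>} z *\<^sub>R D" for k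
    proof (intro AE_I2)
      fix z show "norm (indicator {-\<rho><..<\<rho>} z *\<^sub>R (G k z / z\<^sup>2)) \<le> indicator {-\<rho><..<\<rho>} z *\<^sub>R D"
      proof (cases "z \<in> {-\<rho><..<\<rho>}")
        case True
        then have "\<bar>G k z / z\<^sup>2\<bar> \<le> D" by (intro quot GD D0) auto
        then show ?thesis by (auto simp: indicator_def)
      qed simp
    qed
  qed
  define O\<rho> where "O\<rho> = (LINT z:far \<rho>|lborel. v z / z\<^sup>2)"
  have ineq: "d_t \<phi> t0 x0 \<le> \<bar>P\<bar> * ((LINT z:{-\<rho><..<\<rho>}|lborel. G k z / z\<^sup>2) + O\<rho>)" for k
  proof -
    have "C2_Q (\<Phi> k) \<and> (t0, x0) \<in> Q \<and> (\<forall>(s, y)\<in>Q. u s y - \<Phi> k s y \<le> u t0 x0 - \<Phi> k t0 x0)"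
      using \<Phi> t0 \<Phi>u[where k = k] \<Phi>0[of k] by (auto simp: Q_def u0_def)
    moreover have "\<forall>\<phi> t x. C2_Q \<phi> \<and> (t, x) \<in> Q \<and> (\<forall>(s, y)\<in>Q. u s y - \<phi> s y \<le> u t x - \<phi> t x) \<longrightarrow>
        (d_x \<phi> t x \<noteq> 0 \<longrightarrow> d_t \<phi> t x \<le> hamiltonian \<rho> \<phi> u t x) \<and> (quartic_test x \<phi> \<longrightarrow> d_t \<phi> t x \<le> 0)"
      using sub unfolding subsolution_def by (elim conjE)
    ultimately have "d_x (\<Phi> k) t0 x0 \<noteq> 0 \<longrightarrow> d_t (\<Phi> k) t0 x0 \<le> hamiltonian \<rho> (\<Phi> k) u t0 x0"
      by blast
    with p have "d_t (\<Phi> k) t0 x0 \<le> hamiltonian \<rho> (\<Phi> k) u t0 x0" unfolding \<Phi>d(1) P_def by simp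
    then show ?thesis
      unfolding hamiltonian_def \<Phi>d \<Phi>0 G_def O\<rho>_def v_def u0_def .
  qed
  have "d_t \<phi> t0 x0 \<le> \<bar>P\<bar> * ((LINT z:{-\<rho><..<\<rho>}|lborel. L z / z\<^sup>2) + O\<rho>)"
    by (rule tendsto_lowerbound[OF tendsto_mult[OF tendsto_const tendsto_add[OF conv tendsto_const]]]) (use ineq in auto)
  also have "\<dots> \<le> \<bar>P\<bar> * ((LINT z:{-r<..<r}|lborel. g z / z\<^sup>2) + (LINT z:far r|lborel. v z / z\<^sup>2))"
  proof (rule mult_left_mono)
    define A where "A = {-\<rho><..<\<rho>} \<inter> far r"
    have sets: "A \<in> sets lborel" "far \<rho> \<in> sets lborel" "{-r<..<r} \<in> sets lborel" unfolding A_def by auto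
    have sub1: "A \<subseteq> far r" "far \<rho> \<subseteq> far r" "A \<subseteq> {-\<rho><..<\<rho>}" "{-r<..<r} \<subseteq> {-\<rho><..<\<rho>}" using r by (auto simp: A_def)
    note iv = far_integrable[OF r(1) v]
    have iL: "set_integrable lborel {-\<rho><..<\<rho>} (\<lambda>z. L z / z\<^sup>2)" by (rule near_int[OF mL LD D0])
    have ig: "set_integrable lborel {-\<rho><..<\<rho>} (\<lambda>z. g z / z\<^sup>2)" by (rule near_int[OF mg C(2) C(1)])
    note ivA = set_integrable_subset[OF iv sets(1) sub1(1)] set_integrable_subset[OF iv sets(2) sub1(2)]
    note iLA = set_integrable_subset[OF iL sets(1) sub1(3)] set_integrable_subset[OF iL sets(3) sub1(4)]
    note igr = set_integrable_subset[OF ig sets(3) sub1(4)]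
    have U1: "far r = A \<union> far \<rho>" and U2: "{-\<rho><..<\<rho>} = {-r<..<r} \<union> A" using r by (auto simp: A_def)
    have "(LINT z:far r|lborel. v z / z\<^sup>2) = (LINT z:A|lborel. v z / z\<^sup>2) + O\<rho>"
      unfolding U1 O\<rho>_def by (rule set_integral_Un) (use ivA in \<open>auto simp: A_def\<close>)
    moreover have "(LINT z:{-\<rho><..<\<rho>}|lborel. L z / z\<^sup>2) = (LINT z:{-r<..<r}|lborel. L z / z\<^sup>2) + (LINT z:A|lborel. L z / z\<^sup>2)"
      unfolding U2 by (rule set_integral_Un) (use iLA in \<open>auto simp: A_def\<close>)
    moreover have "(LINT z:{-r<..<r}|lborel. L z / z\<^sup>2) \<le> (LINT z:{-r<..<r}|lborel. g z / z\<^sup>2)"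
    proof (intro set_integral_mono iLA igr divide_right_mono)
      fix z
      have "v z \<le> g z + P * z" using max[OF t0, of "x0 + z"] unfolding v_def g_def u0_def by simp
      then have "(1 - \<theta> (x0 + z)) * (v z - P * z) \<le> (1 - \<theta> (x0 + z)) * g z"
        using \<theta>(5)[of "x0 + z"] by (intro mult_left_mono) auto
      then show "L z \<le> g z" unfolding L_def by (simp add: algebra_simps)
    qed simp
    moreover have "(LINT z:A|lborel. L z / z\<^sup>2) = (LINT z:A|lborel. v z / z\<^sup>2)"
    proof -
      note ip = annulus_linear[OF r, of P, folded A_def]
      have "(LINT z:A|lborel. L z / z\<^sup>2) = (LINT z:A|lborel. v z / z\<^sup>2 - P * z / z\<^sup>2)"
      proof (rule set_lebesgue_integral_cong[OF sets(1)], intro allI impI)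
        fix z assume "z \<in> A"
        then have "r \<le> \<bar>z\<bar>" by (auto simp: A_def)
        from \<theta>(7)[OF this] show "L z / z\<^sup>2 = v z / z\<^sup>2 - P * z / z\<^sup>2" unfolding L_def by (simp add: diff_divide_distrib)
      qed
      also have "\<dots> = (LINT z:A|lborel. v z / z\<^sup>2)" using set_integral_diff(2)[OF ivA(1) ip(1)] ip(2) by simp
      finally show ?thesis .
    qed
    ultimately show "(LINT z:{-\<rho><..<\<rho>}|lborel. L z / z\<^sup>2) + O\<rho> \<le>
      (LINT z:{-r<..<r}|lborel. g z / z\<^sup>2) + (LINT z:far r|lborel. v z / z\<^sup>2)" by linarith
  qed simp
  finally show ?thesis unfolding hamiltonian_def g_def v_def P_def u0_def .
qed

subsection \<open>The comparison principle\<close>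

text \<open>In contrast to \<open>usc_on Q\<close> this includes t = 0: the maximum in the
  comparison argument is taken over closed time intervals, and the initial data enter there.\<close>

definition usc_closed :: "(real \<Rightarrow> real \<Rightarrow> real) \<Rightarrow> bool" where
  "usc_closed u \<longleftrightarrow> (\<forall>t\<ge>0. \<forall>y. \<forall>e>0. \<exists>\<delta>>0. \<forall>s\<ge>0. \<forall>z. \<bar>s - t\<bar> < \<delta> \<longrightarrow> \<bar>z - y\<bar> < \<delta> \<longrightarrow> u s z < u t y + e)"

text \<open>One inequality covers both clauses of the definition: for x = z the gradient and hence
  the right side vanish, which is the quartic clause; otherwise \<open>subsolution_refined\<close>
  applies. With b = x - z the near integrand is exactly c (6 b^2 + 4 b \<zeta> + \<zeta>^2), so the
  near integral is of order r uniformly for bounded b.\<close>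

lemma subsolution_quartic_bound:
  assumes sub: "subsolution \<rho> u" and r: "0 < r" "r \<le> \<rho>" and c: "c > 0" and t: "t > 0"
    and max: "\<And>s' y'. s' > 0 \<Longrightarrow> u s' y' - (c * (y' - z) ^ 4 + (a * (s' - s)\<^sup>2 + d * s')) \<le>
      u t x - (c * (x - z) ^ 4 + (a * (t - s)\<^sup>2 + d * t))"
  shows "2 * a * (t - s) + d \<le> \<bar>4 * c * (x - z) ^ 3\<bar> *
    (2 * r * (c * (6 * (x - z)\<^sup>2 + 4 * \<bar>x - z\<bar> * r + r\<^sup>2)) + (LINT \<zeta>:far r|lborel. (u t (x + \<zeta>) - u t x) / \<zeta>\<^sup>2))"
proof -
  define \<phi> where "\<phi> t y = c * (y - z) ^ 4 + (a * (t - s)\<^sup>2 + d * t)" for t y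
  have \<phi>: "C2_Q \<phi>" unfolding \<phi>_def[abs_def] by (intro C2_Q_add C2_Q_quartic C2_Q_quadratic)
  have dt: "d_t \<phi> t x = 2 * a * (t - s) + d"
    unfolding \<phi>_def by (rule d_t_eqI) (auto intro!: derivative_eq_intros)
  have dx: "d_x \<phi> t x = 4 * c * (x - z) ^ 3"
    unfolding \<phi>_def by (rule d_x_eqI) (auto intro!: derivative_eq_intros)
  have max': "u s' y' - \<phi> s' y' \<le> u t x - \<phi> t x" if "s' > 0" for s' y'
    using max[OF that] unfolding \<phi>_def .
  show ?thesis
  proof (cases "x = z")
    case True
    have "quartic_test x \<phi>"
      unfolding quartic_test_def \<phi>_def True by (intro exI[of _ c] exI[of _ "\<lambda>t. a * (t - s)\<^sup>2 + d * t"]) auto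
    moreover have "C2_Q \<phi> \<and> (t, x) \<in> Q \<and> (\<forall>(s', y')\<in>Q. u s' y' - \<phi> s' y' \<le> u t x - \<phi> t x)"
      using \<phi> t max' by (auto simp: Q_def)
    ultimately have "d_t \<phi> t x \<le> 0" using sub unfolding subsolution_def by blast
    then show ?thesis using True dt by simp
  next
    case False
    define E where "E = c * (6 * (x - z)\<^sup>2 + 4 * \<bar>x - z\<bar> * r + r\<^sup>2)"
    have E0: "E \<ge> 0" unfolding E_def using c r by (intro mult_nonneg_nonneg add_nonneg_nonneg) auto
    have "d_x \<phi> t x \<noteq> 0" using False c dx by simp
    then have "d_t \<phi> t x \<le> hamiltonian r \<phi> u t x"
      by (intro subsolution_refined[OF sub r \<phi> t] max')
    also have "\<dots> \<le> \<bar>4 * c * (x - z) ^ 3\<bar> * (2 * r * E + (LINT \<zeta>:far r|lborel. (u t (x + \<zeta>) - u t x) / \<zeta>\<^sup>2))"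
      unfolding hamiltonian_def dx
    proof (intro mult_left_mono add_right_mono)
      have "(LINT \<zeta>:{-r<..<r}|lborel. (\<phi> t (x + \<zeta>) - \<phi> t x - 4 * c * (x - z) ^ 3 * \<zeta>) / \<zeta>\<^sup>2) \<le> (LINT \<zeta>:{-r<..<r}|lborel. E)"
        unfolding set_lebesgue_integral_def
      proof (rule integral_mono')
        show "integrable lborel (\<lambda>\<zeta>. indicator {-r<..<r} \<zeta> *\<^sub>R E)"
          by (intro integrable_scaleR_left integrable_real_indicator) (use r in auto)
        fix \<zeta> :: real
        show "0 \<le> indicator {-r<..<r} \<zeta> *\<^sub>R E" using E0 by simp
        have "(\<phi> t (x + \<zeta>) - \<phi> t x - 4 * c * (x - z) ^ 3 * \<zeta>) / \<zeta>\<^sup>2 \<le> E" if \<zeta>: "\<bar>\<zeta>\<bar> < r"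
        proof (cases "\<zeta> = 0")
          case True with E0 show ?thesis by simp
        next
          case False
          define b where "b = x - z"
          have "\<phi> t (x + \<zeta>) - \<phi> t x - 4 * c * (x - z) ^ 3 * \<zeta> = c * ((b + \<zeta>) ^ 4 - b ^ 4 - 4 * b ^ 3 * \<zeta>)"
            unfolding \<phi>_def b_def by (simp add: algebra_simps)
          also have "(b + \<zeta>) ^ 4 - b ^ 4 - 4 * b ^ 3 * \<zeta> = (6 * b\<^sup>2 + 4 * b * \<zeta> + \<zeta>\<^sup>2) * \<zeta>\<^sup>2"
            by (simp add: power2_eq_square power3_eq_cube power4_eq_xxxx algebra_simps)
          finally have "(\<phi> t (x + \<zeta>) - \<phi> t x - 4 * c * (x - z) ^ 3 * \<zeta>) / \<zeta>\<^sup>2 = c * (6 * b\<^sup>2 + 4 * b * \<zeta> + \<zeta>\<^sup>2)"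
            using False by simp
          also have "\<dots> \<le> E"
            unfolding E_def b_def[symmetric]
          proof (intro mult_left_mono add_mono order_refl)
            have "b * \<zeta> \<le> \<bar>b\<bar> * \<bar>\<zeta>\<bar>" unfolding abs_mult[symmetric] by (rule abs_ge_self)
            also have "\<dots> \<le> \<bar>b\<bar> * r" using \<zeta> by (intro mult_left_mono) auto
            finally show "4 * b * \<zeta> \<le> 4 * \<bar>b\<bar> * r" by simp
            show "\<zeta>\<^sup>2 \<le> r\<^sup>2" using \<zeta> by (simp add: abs_le_square_iff[symmetric])
          qed (use c in simp_all)
          finally show ?thesis .
        qed
        then show "indicator {-r<..<r} \<zeta> *\<^sub>R ((\<phi> t (x + \<zeta>) - \<phi> t x - 4 * c * (x - z) ^ 3 * \<zeta>) / \<zeta>\<^sup>2) \<le> indicator {-r<..<r} \<zeta> *\<^sub>R E"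
          by (auto simp: indicator_def)
      qed
      also have "(LINT \<zeta>:{-r<..<r}|lborel. E) = 2 * r * E" using r by (simp add: set_lebesgue_integral_def)
      finally show "(LINT \<zeta>:{-r<..<r}|lborel. (\<phi> t (x + \<zeta>) - \<phi> t x - 4 * c * (x - z) ^ 3 * \<zeta>) / \<zeta>\<^sup>2) \<le> 2 * r * E" .
    qed simp
    finally show ?thesis unfolding dt E_def .
  qed
qed

text \<open>A spatial penalty with Lipschitz constant \<alpha> changes by up to \<alpha> |z| under a
  shift by z, and this is not integrable against 1/z^2 at infinity. Truncated at a constant B it is,
  and dominated convergence makes the integral small with \<alpha>.\<close>

lemma truncated_linear_integral_small:
  assumes r: "r > 0" and B: "B \<ge> 0" and e: "e > 0" and a0: "a0 > 0"
  obtains \<alpha> where "0 < \<alpha>" "\<alpha> \<le> a0" "(LINT z:far r|lborel. min B (\<alpha> * \<bar>z\<bar>) / z\<^sup>2) < e"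
proof -
  have one: "(\<lambda>k. 1 / (real k + 1)) \<longlonglongrightarrow> 0"
    using LIMSEQ_inverse_real_of_nat by (simp add: inverse_eq_divide add.commute)
  have "(\<lambda>k. LINT z:far r|lborel. min B (1 / (real k + 1) * \<bar>z\<bar>) / z\<^sup>2) \<longlonglongrightarrow> (LINT z:far r|lborel. 0)"
    unfolding set_lebesgue_integral_def
  proof (rule integral_dominated_convergence[where w = "\<lambda>z. indicator (far r) z *\<^sub>R (B / z\<^sup>2)"])
    show "integrable lborel (\<lambda>z. indicator (far r) z *\<^sub>R (B / z\<^sup>2))"
      using far_inverse_square(1)[OF r, of B] by (simp add: set_integrable_def)
    show "AE z in lborel. (\<lambda>k. indicator (far r) z *\<^sub>R (min B (1 / (real k + 1) * \<bar>z\<bar>) / z\<^sup>2)) \<longlonglongrightarrow> indicator (far r) z *\<^sub>R 0"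
    proof (intro AE_I2 tendsto_scaleR tendsto_const)
      fix z :: real
      have "(\<lambda>k. min B (1 / (real k + 1) * \<bar>z\<bar>) * inverse (z\<^sup>2)) \<longlonglongrightarrow> min B (0 * \<bar>z\<bar>) * inverse (z\<^sup>2)"
        by (intro tendsto_mult tendsto_min one tendsto_const)
      then show "(\<lambda>k. min B (1 / (real k + 1) * \<bar>z\<bar>) / z\<^sup>2) \<longlonglongrightarrow> 0" using B by (simp add: divide_inverse)
    qed
    show "AE z in lborel. norm (indicator (far r) z *\<^sub>R (min B (1 / (real k + 1) * \<bar>z\<bar>) / z\<^sup>2)) \<le> indicator (far r) z *\<^sub>R (B / z\<^sup>2)" for k
      using B by (intro AE_I2) (auto simp: indicator_def abs_divide intro!: divide_right_mono)
  qed measurable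
  then have "\<forall>\<^sub>F k in sequentially. (LINT z:far r|lborel. min B (1 / (real k + 1) * \<bar>z\<bar>) / z\<^sup>2) < e"
    using e by (intro order_tendstoD(2)) (auto simp: set_lebesgue_integral_def)
  moreover have "\<forall>\<^sub>F k in sequentially. 1 / (real k + 1) < a0" by (rule order_tendstoD(2)[OF one a0])
  ultimately have "\<forall>\<^sub>F k in sequentially. (LINT z:far r|lborel. min B (1 / (real k + 1) * \<bar>z\<bar>) / z\<^sup>2) < e \<and> 1 / (real k + 1) < a0"
    by eventually_elim simp
  then obtain k where "(LINT z:far r|lborel. min B (1 / (real k + 1) * \<bar>z\<bar>) / z\<^sup>2) < e" "1 / (real k + 1) < a0"
    using eventually_happens'[OF trivial_limit_sequentially] by blast
  then show ?thesis by (intro that[of "1 / (real k + 1)"]) auto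
qed

lemma sqrt_one_plus_square_deriv:
  "((\<lambda>u. sqrt (1 + u\<^sup>2)) has_real_derivative y / sqrt (1 + y\<^sup>2)) (at y)" for y :: real
proof -
  have "1 + y\<^sup>2 > 0" by (intro add_pos_nonneg) auto
  then have r: "(sqrt has_real_derivative inverse (sqrt (1 + y\<^sup>2)) / 2) (at (1 + y\<^sup>2))" by (rule DERIV_real_sqrt)
  have "((\<lambda>u. 1 + u\<^sup>2) has_real_derivative 2 * y) (at y)" by (auto intro!: derivative_eq_intros)
  from DERIV_chain2[OF r this] show ?thesis by (simp add: field_simps)
qed

lemma sqrt_one_plus_square_lipschitz:
  fixes u z :: real shows "\<bar>sqrt (1 + (u + z)\<^sup>2) - sqrt (1 + u\<^sup>2)\<bar> \<le> \<bar>z\<bar>"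
proof -
  obtain \<xi> where \<xi>: "sqrt (1 + (u + z)\<^sup>2) - sqrt (1 + u\<^sup>2) = z * (\<xi> / sqrt (1 + \<xi>\<^sup>2))"
    using mvt_two_sided[OF sqrt_one_plus_square_deriv, of u z] by blast
  have "\<bar>\<xi>\<bar> \<le> sqrt (1 + \<xi>\<^sup>2)" by (rule real_le_rsqrt) simp
  moreover have "sqrt (1 + \<xi>\<^sup>2) > 0" by (simp add: add_pos_nonneg)
  ultimately have "\<bar>\<xi> / sqrt (1 + \<xi>\<^sup>2)\<bar> \<le> 1" by (simp add: abs_divide divide_le_eq)
  then have "\<bar>z\<bar> * \<bar>\<xi> / sqrt (1 + \<xi>\<^sup>2)\<bar> \<le> \<bar>z\<bar> * 1" by (intro mult_left_mono) auto
  then show ?thesis unfolding \<xi> abs_mult by simp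
qed

lemma power4_le_imp_abs_le:
  fixes a D :: real assumes "a ^ 4 \<le> D ^ 4" "D \<ge> 0" shows "\<bar>a\<bar> \<le> D"
proof (rule ccontr)
  assume "\<not> ?thesis"
  then have "D ^ 4 < \<bar>a\<bar> ^ 4" using assms(2) by (intro power_strict_mono) auto
  with assms(1) show False by simp
qed

text \<open>
  The penalization of the spatial variables at infinity acts on a third variable \<open>z\<close> that is
  linked to \<open>x\<close> and \<open>y\<close> by quartic terms.  In this way the test functions for \<open>u\<close> and for \<open>w\<close>
  are exact quartics in space, so that the degenerate case of the definition always applies
  when the gradient vanishes, while stationarity in \<open>z\<close> makes the two gradients nearly opposite.
\<close>

lemma comparison:
  assumes \<rho>: "\<rho> > 0" and su: "subsolution \<rho> u" and sw: "subsolution \<rho> w"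
    and bu: "\<And>t y. t \<ge> 0 \<Longrightarrow> \<bar>u t y\<bar> \<le> B" and bw: "\<And>t y. t \<ge> 0 \<Longrightarrow> \<bar>w t y\<bar> \<le> B"
    and uu: "usc_closed u" and uw: "usc_closed w"
    and gu: "\<And>y. u 0 y \<le> g y" and gw: "\<And>y. w 0 (y + h) \<le> c - g y"
    and g: "uniformly_continuous_on UNIV g" and t0: "t0 > 0"
  shows "u t0 x0 + w t0 (x0 + h) \<le> c"
proof (rule ccontr)
  assume contra: "\<not> ?thesis"
  \<comment> \<open>The excess 4 \<sigma> pays for \<eta> t0 and for \<alpha> \<psi>(x0), one
    \<sigma> each. The remaining level c + 2 \<sigma> is contradicted at the initial time, where
    semicontinuity of u and w and the modulus of g cost one \<sigma> each.\<close>
  define \<sigma> where "\<sigma> = (u t0 x0 + w t0 (x0 + h) - c) / 4"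
  have "4 * \<sigma> = u t0 x0 + w t0 (x0 + h) - c" by (simp add: \<sigma>_def)
  then have \<sigma>: "\<sigma> > 0" "u t0 x0 + w t0 (x0 + h) = c + 4 * \<sigma>" using contra by linarith+
  have B: "B \<ge> 0" using bu[of 0 0] by (auto intro: order_trans[OF abs_ge_zero])
  \<comment> \<open>An upper bound for the penalty at every point above the level c + 2
    \<sigma>.\<close>
  define M where "M = 2 * B + \<bar>c\<bar> + 1"
  have M: "M > 0" using B by (simp add: M_def)
  obtain d where d: "d > 0" "\<And>y y'. \<bar>y' - y\<bar> < d \<Longrightarrow> \<bar>g y' - g y\<bar> < \<sigma>"
    using g[unfolded uniformly_continuous_on_def, rule_format, OF \<sigma>(1)] by (auto simp: dist_real_def)
  define D where "D = d / 4"
  have D: "D > 0" using d(1) by (simp add: D_def)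
  \<comment> \<open>With this choice (x - z)^4 / \<epsilon> \<le> M means |x - z| \<le> D, and D = d
    / 4 leaves |x - (y - h)| \<le> 2 D < d.\<close>
  define \<epsilon> where "\<epsilon> = D ^ 4 / M"
  have \<epsilon>: "\<epsilon> > 0" "M * \<epsilon> = D ^ 4" using D M by (auto simp: \<epsilon>_def)
  \<comment> \<open>The largest gradient of the quartic terms for arguments up to D.
    \<open>E1\<close> bounds the near-field coefficient there, and r makes all near-field
    contributions together at most \<eta> / 4.\<close>
  define Pm where "Pm = 4 * (1 / \<epsilon>) * D ^ 3"
  have Pm: "Pm > 0" unfolding Pm_def using \<epsilon> D by simp
  define \<eta> where "\<eta> = \<sigma> / t0"
  have \<eta>: "\<eta> > 0" "\<eta> * t0 = \<sigma>" using \<sigma>(1) t0 by (auto simp: \<eta>_def)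
  define E1 where "E1 = 1 / \<epsilon> * (6 * D\<^sup>2 + 4 * D + 1)"
  have E1: "E1 > 0" unfolding E1_def using \<epsilon> D by (intro mult_pos_pos add_nonneg_pos) auto
  define r where "r = min (min \<rho> 1) (\<eta> / (16 * Pm * E1))"
  have r: "r > 0" "r \<le> \<rho>" "r \<le> 1" "Pm * (2 * (2 * r * E1)) \<le> \<eta> / 4"
  proof -
    have pos: "16 * Pm * E1 > 0" using Pm E1 by simp
    show "r > 0" "r \<le> \<rho>" "r \<le> 1" unfolding r_def using \<rho> \<eta> pos by auto
    have "r \<le> \<eta> / (16 * Pm * E1)" by (simp add: r_def)
    then have "r * (16 * Pm * E1) \<le> \<eta>" using pos by (simp add: pos_le_divide_eq)
    then show "Pm * (2 * (2 * r * E1)) \<le> \<eta> / 4" by (simp add: mult_ac)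
  qed
  define \<psi> where "\<psi> z = sqrt (1 + z\<^sup>2)" for z :: real
  have \<psi>: "\<psi> z \<ge> 1" "\<bar>z\<bar> \<le> \<psi> z" for z
    unfolding \<psi>_def by (rule real_le_rsqrt; simp)+
  \<comment> \<open>The parameters \<epsilon>, \<eta> and r are fixed before \<alpha>. The bounds on
    \<alpha> are for the penalty at x0, for the mismatch of the two gradients times a single
    nonlocal term (at most 4 B / r), and for the sum of the two nonlocal terms.\<close>
  obtain \<alpha> where \<alpha>: "0 < \<alpha>" "\<alpha> \<le> min (\<sigma> / \<psi> x0) (\<eta> / (4 * (4 * B / r + 1)))"
    "(LINT z:far r|lborel. min (4 * B) (\<alpha> * \<bar>z\<bar>) / z\<^sup>2) < \<eta> / (4 * Pm)"
  proof (rule truncated_linear_integral_small[OF r(1), of "4 * B" "\<eta> / (4 * Pm)" "min (\<sigma> / \<psi> x0) (\<eta> / (4 * (4 * B / r + 1)))"])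
    have "4 * B / r + 1 > 0" using B r(1) by (intro add_nonneg_pos) auto
    then show "min (\<sigma> / \<psi> x0) (\<eta> / (4 * (4 * B / r + 1))) > 0"
      using \<sigma>(1) \<eta>(1) \<psi>(1)[of x0] by (auto intro!: divide_pos_pos)
  qed (use B \<eta> Pm that in auto)
  have \<alpha>2: "\<alpha> * \<psi> x0 \<le> \<sigma>" "\<alpha> * (4 * B / r) \<le> \<eta> / 4"
  proof -
    have "\<alpha> \<le> \<sigma> / \<psi> x0" using \<alpha>(2) by simp
    moreover have "\<psi> x0 > 0" using \<psi>(1)[of x0] by linarith
    ultimately show "\<alpha> * \<psi> x0 \<le> \<sigma>" by (simp add: pos_le_divide_eq)
    have p: "4 * B / r + 1 > 0" using B r(1) by (intro add_nonneg_pos) auto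
    have "\<alpha> \<le> \<eta> / (4 * (4 * B / r + 1))" using \<alpha>(2) by simp
    then have "\<alpha> * (4 * (4 * B / r + 1)) \<le> \<eta>" using p by (subst (asm) pos_le_divide_eq) auto
    then have "4 * (\<alpha> * (4 * B / r)) + 4 * \<alpha> \<le> \<eta>" by (simp add: algebra_simps)
    then show "\<alpha> * (4 * B / r) \<le> \<eta> / 4" using \<alpha>(1) by linarith
  qed
  \<comment> \<open>u is evaluated at (t, x) and w at (s, y); x is tied to z and y to z + h. The
    term \<eta> t supplies the strict inequality that is contradicted at the end.\<close>
  define pen where "pen \<nu> t x s y z = 1 / \<epsilon> * (x - z) ^ 4 + 1 / \<epsilon> * (y - (z + h)) ^ 4 + 1 / \<nu> * (t - s)\<^sup>2 + \<eta> * t + \<alpha> * \<psi> z" for \<nu> t x s y z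
  define T where "T = M / \<eta> + M + 1"
  define Z where "Z = M / \<alpha>"
  define X where "X = Z + D + \<bar>h\<bar>"
  define K where "K = {0..T} \<times> {-X..X} \<times> {0..T} \<times> {-X..X} \<times> {-Z..Z}"
  \<comment> \<open>Above the level the penalty is bounded, hence so is each of its nonnegative
    terms; this confines all five variables to the compact set K, where the maximum is
    attained.\<close>
  have loc: "\<bar>x - z\<bar> \<le> D \<and> \<bar>y - (z + h)\<bar> \<le> D \<and> (t - s)\<^sup>2 \<le> M * \<nu> \<and> (t, x, s, y, z) \<in> K"
    if ts: "t \<ge> 0" "s \<ge> 0" and \<nu>: "0 < \<nu>" "\<nu> \<le> 1"
    and big: "c + 2 * \<sigma> \<le> u t x + w s y - pen \<nu> t x s y z" for \<nu> t x s y z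
  proof -
    have "u t x + w s y \<le> 2 * B" using bu[OF ts(1), of x] bw[OF ts(2), of y] by (simp add: abs_le_iff)
    then have le: "pen \<nu> t x s y z \<le> M" using big \<sigma>(1) unfolding M_def by linarith
    have nn: "0 \<le> 1 / \<epsilon> * (x - z) ^ 4" "0 \<le> 1 / \<epsilon> * (y - (z + h)) ^ 4" "0 \<le> 1 / \<nu> * (t - s)\<^sup>2" "0 \<le> \<eta> * t" "0 \<le> \<alpha> * \<psi> z"
      using \<epsilon>(1) \<nu> \<eta>(1) ts \<alpha>(1) \<psi>(1)[of z] by auto
    have a: "1 / \<epsilon> * (x - z) ^ 4 \<le> M" "1 / \<epsilon> * (y - (z + h)) ^ 4 \<le> M" "1 / \<nu> * (t - s)\<^sup>2 \<le> M" "\<eta> * t \<le> M" "\<alpha> * \<psi> z \<le> M"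
      using le nn unfolding pen_def by linarith+
    have x: "\<bar>x - z\<bar> \<le> D"
      using a(1) \<epsilon> D by (intro power4_le_imp_abs_le) (auto simp: pos_divide_le_eq)
    have y: "\<bar>y - (z + h)\<bar> \<le> D"
      using a(2) \<epsilon> D by (intro power4_le_imp_abs_le) (auto simp: pos_divide_le_eq)
    have ts2: "(t - s)\<^sup>2 \<le> M * \<nu>" using a(3) \<nu>(1) by (simp add: pos_divide_le_eq)
    also have "\<dots> \<le> M * 1" using M \<nu> by (intro mult_left_mono) auto
    also have "\<dots> \<le> (M + 1)\<^sup>2" using M by (simp add: power2_eq_square algebra_simps)
    finally have "\<bar>t - s\<bar> \<le> M + 1" using M by (simp add: abs_le_square_iff[symmetric])
    moreover have "t \<le> M / \<eta>" using a(4) \<eta>(1) by (simp add: pos_le_divide_eq mult.commute)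
    ultimately have tT: "t \<le> T" "s \<le> T" unfolding T_def using M by linarith+
    have "\<alpha> * \<bar>z\<bar> \<le> M" using a(5) mult_left_mono[OF \<psi>(2)[of z], of \<alpha>] \<alpha>(1) by linarith
    then have z: "\<bar>z\<bar> \<le> Z" unfolding Z_def using \<alpha>(1) by (simp add: pos_le_divide_eq mult.commute)
    have "\<bar>x\<bar> \<le> X" "\<bar>y\<bar> \<le> X" using x y z unfolding X_def by linarith+
    with x y ts2 tT z ts show ?thesis unfolding K_def by (auto simp: abs_le_iff)
  qed
  have Kc: "compact K" unfolding K_def by (intro compact_Times compact_Icc)
  have base: "c + 2 * \<sigma> \<le> u t0 x0 + w t0 (x0 + h) - pen \<nu> t0 x0 t0 (x0 + h) x0" for \<nu>
    unfolding pen_def using \<sigma> \<eta>(2) \<alpha>2(1) by simp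
  have ex: "\<exists>q. c + 2 * \<sigma> \<le> u (fst q) (fst (snd q)) + w (fst (snd (snd q))) (fst (snd (snd (snd q)))) -
        pen \<nu> (fst q) (fst (snd q)) (fst (snd (snd q))) (fst (snd (snd (snd q)))) (snd (snd (snd (snd q)))) \<and>
      q \<in> K \<and> (\<forall>t x s y z. t \<ge> 0 \<longrightarrow> s \<ge> 0 \<longrightarrow> u t x + w s y - pen \<nu> t x s y z \<le>
        u (fst q) (fst (snd q)) + w (fst (snd (snd q))) (fst (snd (snd (snd q)))) -
        pen \<nu> (fst q) (fst (snd q)) (fst (snd (snd q))) (fst (snd (snd (snd q)))) (snd (snd (snd (snd q)))))"
    if \<nu>: "0 < \<nu>" "\<nu> \<le> 1" for \<nu>
  proof -
    define F where "F q = u (fst q) (fst (snd q)) + w (fst (snd (snd q))) (fst (snd (snd (snd q)))) -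
        pen \<nu> (fst q) (fst (snd q)) (fst (snd (snd q))) (fst (snd (snd (snd q)))) (snd (snd (snd (snd q))))" for q
    have bK: "(t0, x0, t0, x0 + h, x0) \<in> K" using loc[OF _ _ \<nu> base] t0 by auto
    have "\<exists>q\<in>K. \<forall>q'\<in>K. F q' \<le> F q"
    proof (rule usc_attains_max[OF Kc])
      show "K \<noteq> {}" using bK by auto
      fix q e assume q: "q \<in> K" and e: "(e::real) > 0"
      obtain t x s y z where qe: "q = (t, x, s, y, z)" by (metis prod_cases5)
      have ts: "t \<ge> 0" "s \<ge> 0" using q unfolding qe K_def by auto
      have e3: "e / 3 > 0" using e by simp
      obtain d1 where d1: "d1 > 0" "\<And>t' x'. t' \<ge> 0 \<Longrightarrow> \<bar>t' - t\<bar> < d1 \<Longrightarrow> \<bar>x' - x\<bar> < d1 \<Longrightarrow> u t' x' < u t x + e / 3"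
        using uu[unfolded usc_closed_def, rule_format, OF ts(1) e3] by blast
      obtain d2 where d2: "d2 > 0" "\<And>t' x'. t' \<ge> 0 \<Longrightarrow> \<bar>t' - s\<bar> < d2 \<Longrightarrow> \<bar>x' - y\<bar> < d2 \<Longrightarrow> w t' x' < w s y + e / 3"
        using uw[unfolded usc_closed_def, rule_format, OF ts(2) e3] by blast
      define p where "p q = pen \<nu> (fst q) (fst (snd q)) (fst (snd (snd q))) (fst (snd (snd (snd q)))) (snd (snd (snd (snd q))))" for q
      have "continuous_on UNIV p" unfolding p_def pen_def \<psi>_def by (intro continuous_intros)
      then obtain d3 where d3: "d3 > 0" "\<And>q'. dist q' q < d3 \<Longrightarrow> dist (p q') (p q) < e / 3"
        using e3 unfolding continuous_on_iff by (metis UNIV_I)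
      show "\<exists>d>0. \<forall>q'\<in>K. dist q q' < d \<longrightarrow> F q' < F q + e"
      proof (intro exI[of _ "min d1 (min d2 d3)"] conjI ballI impI)
        fix q' assume q': "q' \<in> K" "dist q q' < min d1 (min d2 d3)"
        obtain t' x' s' y' z' where q'e: "q' = (t', x', s', y', z')" by (metis prod_cases5)
        have s1: "dist (snd q) (snd q') \<le> dist q q'" by (rule dist_snd_le)
        have s2: "dist (snd (snd q)) (snd (snd q')) \<le> dist (snd q) (snd q')" by (rule dist_snd_le)
        have s3: "dist (snd (snd (snd q))) (snd (snd (snd q'))) \<le> dist (snd (snd q)) (snd (snd q'))" by (rule dist_snd_le)
        have dd: "dist t t' \<le> dist q q'" "dist x x' \<le> dist q q'" "dist s s' \<le> dist q q'" "dist y y' \<le> dist q q'"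
          using dist_fst_le[of q q'] dist_fst_le[of "snd q" "snd q'"] dist_fst_le[of "snd (snd q)" "snd (snd q')"]
            dist_fst_le[of "snd (snd (snd q))" "snd (snd (snd q'))"] s1 s2 s3 unfolding qe q'e by auto
        have ts': "t' \<ge> 0" "s' \<ge> 0" using q'(1) unfolding q'e K_def by auto
        have "u t' x' < u t x + e / 3"
          using dd(1,2) q'(2) by (intro d1(2) ts') (auto simp: dist_real_def abs_minus_commute)
        moreover have "w s' y' < w s y + e / 3"
          using dd(3,4) q'(2) by (intro d2(2) ts') (auto simp: dist_real_def abs_minus_commute)
        moreover have "\<bar>p q' - p q\<bar> < e / 3" using d3(2)[of q'] q'(2) by (simp add: dist_commute dist_real_def)
        moreover have "F q' = u t' x' + w s' y' - p q'" "F q = u t x + w s y - p q" by (simp_all add: F_def p_def qe q'e)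
        ultimately show "F q' < F q + e" by linarith
      qed (use d1 d2 d3 in auto)
    qed
    then obtain q where q: "q \<in> K" "\<And>q'. q' \<in> K \<Longrightarrow> F q' \<le> F q" by blast
    have Fb: "c + 2 * \<sigma> \<le> F q" using q(2)[OF bK] base[of \<nu>] by (simp add: F_def)
    have "u t x + w s y - pen \<nu> t x s y z \<le> F q" if "t \<ge> 0" "s \<ge> 0" for t x s y z
    proof (cases "c + 2 * \<sigma> \<le> u t x + w s y - pen \<nu> t x s y z")
      case True
      with loc[OF that \<nu>] have "(t, x, s, y, z) \<in> K" by blast
      from q(2)[OF this] show ?thesis by (simp add: F_def)
    qed (use Fb in simp)
    with q(1) Fb show ?thesis unfolding F_def by blast
  qed
  \<comment> \<open>For some \<nu> the maximum has positive times. Otherwise the maxima for \<nu> =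
    1 / (k + 1) accumulate at a point with t = s and t s = 0, hence at the initial time, where the
    hypotheses on g bound u + w below the level.\<close>
  have "\<exists>\<nu> t x s y z. 0 < \<nu> \<and> \<nu> \<le> 1 \<and> t > 0 \<and> s > 0 \<and> c + 2 * \<sigma> \<le> u t x + w s y - pen \<nu> t x s y z \<and>
    (\<forall>t' x' s' y' z'. t' \<ge> 0 \<longrightarrow> s' \<ge> 0 \<longrightarrow> u t' x' + w s' y' - pen \<nu> t' x' s' y' z' \<le> u t x + w s y - pen \<nu> t x s y z)"
  proof (rule ccontr)
    assume no: "\<not> ?thesis"
    have "\<exists>q. c + 2 * \<sigma> \<le> u (fst q) (fst (snd q)) + w (fst (snd (snd q))) (fst (snd (snd (snd q)))) -
        pen (1 / (real k + 1)) (fst q) (fst (snd q)) (fst (snd (snd q))) (fst (snd (snd (snd q)))) (snd (snd (snd (snd q)))) \<and>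
      q \<in> K \<and> fst q * fst (snd (snd q)) = 0" for k :: nat
    proof -
      have \<nu>: "0 < 1 / (real k + 1)" "1 / (real k + 1) \<le> 1" by auto
      from ex[OF \<nu>] obtain q where q: "c + 2 * \<sigma> \<le> u (fst q) (fst (snd q)) + w (fst (snd (snd q))) (fst (snd (snd (snd q)))) -
        pen (1 / (real k + 1)) (fst q) (fst (snd q)) (fst (snd (snd q))) (fst (snd (snd (snd q)))) (snd (snd (snd (snd q))))"
        "q \<in> K" "\<forall>t x s y z. t \<ge> 0 \<longrightarrow> s \<ge> 0 \<longrightarrow> u t x + w s y - pen (1 / (real k + 1)) t x s y z \<le>
        u (fst q) (fst (snd q)) + w (fst (snd (snd q))) (fst (snd (snd (snd q)))) -
        pen (1 / (real k + 1)) (fst q) (fst (snd q)) (fst (snd (snd q))) (fst (snd (snd (snd q)))) (snd (snd (snd (snd q))))"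
        by blast
      have "\<not> (fst q > 0 \<and> fst (snd (snd q)) > 0)" using no \<nu> q(1,3) by blast
      moreover have "fst q \<ge> 0" "fst (snd (snd q)) \<ge> 0" using q(2) unfolding K_def by auto
      ultimately have "fst q * fst (snd (snd q)) = 0" by auto
      with q show ?thesis by blast
    qed
    then obtain q where q: "\<And>k::nat. c + 2 * \<sigma> \<le> u (fst (q k)) (fst (snd (q k))) + w (fst (snd (snd (q k)))) (fst (snd (snd (snd (q k))))) -
        pen (1 / (real k + 1)) (fst (q k)) (fst (snd (q k))) (fst (snd (snd (q k)))) (fst (snd (snd (snd (q k))))) (snd (snd (snd (snd (q k)))))"
      "\<And>k. q k \<in> K" "\<And>k. fst (q k) * fst (snd (snd (q k))) = 0"
      by metis
    obtain l \<kappa> where l: "l \<in> K" "strict_mono \<kappa>" "(q \<circ> \<kappa>) \<longlonglongrightarrow> l"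
      using q(2) seq_compactE[OF compact_imp_seq_compact[OF Kc], of q] by blast
    obtain t x s y z where le: "l = (t, x, s, y, z)" by (metis prod_cases5)
    define a where "a k = q (\<kappa> k)" for k
    have al: "a \<longlonglongrightarrow> l" using l(3) by (simp add: a_def[abs_def] comp_def)
    have lim: "(\<lambda>k. fst (a k)) \<longlonglongrightarrow> t" "(\<lambda>k. fst (snd (a k))) \<longlonglongrightarrow> x" "(\<lambda>k. fst (snd (snd (a k)))) \<longlonglongrightarrow> s"
      "(\<lambda>k. fst (snd (snd (snd (a k))))) \<longlonglongrightarrow> y"
      using tendsto_fst[OF al] tendsto_fst[OF tendsto_snd[OF al]] tendsto_fst[OF tendsto_snd[OF tendsto_snd[OF al]]]
        tendsto_fst[OF tendsto_snd[OF tendsto_snd[OF tendsto_snd[OF al]]]] unfolding le by simp_all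
    have an: "fst (a k) \<ge> 0" "fst (snd (snd (a k))) \<ge> 0" for k
      using q(2)[of "\<kappa> k"] unfolding a_def K_def by auto
    have al2: "\<bar>fst (snd (a k)) - (fst (snd (snd (snd (a k)))) - h)\<bar> \<le> 2 * D \<and>
      (fst (a k) - fst (snd (snd (a k))))\<^sup>2 \<le> M * (1 / (real (\<kappa> k) + 1)) \<and>
      c + 2 * \<sigma> \<le> u (fst (a k)) (fst (snd (a k))) + w (fst (snd (snd (a k)))) (fst (snd (snd (snd (a k)))))" for k
    proof -
      have \<nu>: "0 < 1 / (real (\<kappa> k) + 1)" "1 / (real (\<kappa> k) + 1) \<le> 1" by auto
      note L = loc[OF an(1)[of k] an(2)[of k] \<nu> q(1)[of "\<kappa> k", folded a_def]]
      then have "\<bar>fst (snd (a k)) - (fst (snd (snd (snd (a k)))) - h)\<bar> \<le> 2 * D" by linarith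
      moreover have "0 \<le> pen (1 / (real (\<kappa> k) + 1)) (fst (a k)) (fst (snd (a k))) (fst (snd (snd (a k)))) (fst (snd (snd (snd (a k))))) (snd (snd (snd (snd (a k)))))"
        unfolding pen_def using \<epsilon>(1) \<eta>(1) \<alpha>(1) an[of k] \<psi>(1) by (intro add_nonneg_nonneg mult_nonneg_nonneg) (auto intro: order_trans[OF zero_le_one])
      ultimately show ?thesis using L q(1)[of "\<kappa> k", folded a_def] by linarith
    qed
    have "(\<lambda>k. M * (1 / (real (\<kappa> k) + 1))) \<longlonglongrightarrow> M * 0"
    proof (intro tendsto_mult tendsto_const)
      have "(\<lambda>k. 1 / (real k + 1)) \<longlonglongrightarrow> 0"
        using LIMSEQ_inverse_real_of_nat by (simp add: inverse_eq_divide add.commute)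
      from LIMSEQ_subseq_LIMSEQ[OF this l(2)] show "(\<lambda>k. 1 / (real (\<kappa> k) + 1)) \<longlonglongrightarrow> 0" by (simp add: comp_def)
    qed
    moreover have "(\<lambda>k. (fst (a k) - fst (snd (snd (a k))))\<^sup>2) \<longlonglongrightarrow> (t - s)\<^sup>2" by (intro tendsto_intros lim)
    ultimately have "(t - s)\<^sup>2 \<le> M * 0" by (intro LIMSEQ_le) (use al2 in blast)+
    then have ts: "t = s" by simp
    have "(\<lambda>k. fst (a k) * fst (snd (snd (a k)))) \<longlonglongrightarrow> t * s" by (intro tendsto_intros lim)
    then have "(\<lambda>k. 0) \<longlonglongrightarrow> t * s" unfolding a_def q(3) .
    from LIMSEQ_unique[OF this tendsto_const] have "t * s = 0" .
    with ts have t: "t = 0" "s = 0" by auto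
    have "(\<lambda>k. \<bar>fst (snd (a k)) - (fst (snd (snd (snd (a k)))) - h)\<bar>) \<longlonglongrightarrow> \<bar>x - (y - h)\<bar>" by (intro tendsto_intros lim)
    then have "\<bar>x - (y - h)\<bar> \<le> 2 * D" by (rule tendsto_upperbound) (use al2 in auto)
    then have "\<bar>x - (y - h)\<bar> < d" using D unfolding D_def by linarith
    from d(2)[OF this] have gd: "g x < g (y - h) + \<sigma>" by (simp add: abs_less_iff)
    have s2: "\<sigma> / 2 > 0" using \<sigma>(1) by simp
    obtain d1 where d1: "d1 > 0" "\<And>t' x'. t' \<ge> 0 \<Longrightarrow> \<bar>t' - 0\<bar> < d1 \<Longrightarrow> \<bar>x' - x\<bar> < d1 \<Longrightarrow> u t' x' < u 0 x + \<sigma> / 2"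
      using uu[unfolded usc_closed_def, rule_format, OF order_refl s2] by blast
    obtain d2 where d2: "d2 > 0" "\<And>t' x'. t' \<ge> 0 \<Longrightarrow> \<bar>t' - 0\<bar> < d2 \<Longrightarrow> \<bar>x' - y\<bar> < d2 \<Longrightarrow> w t' x' < w 0 y + \<sigma> / 2"
      using uw[unfolded usc_closed_def, rule_format, OF order_refl s2] by blast
    have "\<forall>\<^sub>F k in sequentially. dist (fst (a k)) 0 < d1 \<and> dist (fst (snd (a k))) x < d1 \<and>
        dist (fst (snd (snd (a k)))) 0 < d2 \<and> dist (fst (snd (snd (snd (a k))))) y < d2"
      using lim d1(1) d2(1) unfolding t by (intro eventually_conj tendstoD)
    then obtain k where k: "dist (fst (a k)) 0 < d1" "dist (fst (snd (a k))) x < d1"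
        "dist (fst (snd (snd (a k)))) 0 < d2" "dist (fst (snd (snd (snd (a k))))) y < d2"
      using eventually_happens'[OF trivial_limit_sequentially] by blast
    have "u (fst (a k)) (fst (snd (a k))) < u 0 x + \<sigma> / 2" using k(1,2) by (intro d1(2) an) (auto simp: dist_real_def)
    moreover have "w (fst (snd (snd (a k)))) (fst (snd (snd (snd (a k))))) < w 0 y + \<sigma> / 2"
      using k(3,4) by (intro d2(2) an) (auto simp: dist_real_def)
    moreover have "u 0 x \<le> g x" "w 0 y \<le> c - g (y - h)" using gu[of x] gw[of "y - h"] by auto
    ultimately show False using al2[of k] gd by linarith
  qed
  then obtain \<nu> t x s y z where \<nu>: "0 < \<nu>" "\<nu> \<le> 1" and ts: "t > 0" "s > 0"
    and big: "c + 2 * \<sigma> \<le> u t x + w s y - pen \<nu> t x s y z"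
    and mx: "\<And>t' x' s' y' z'. t' \<ge> 0 \<Longrightarrow> s' \<ge> 0 \<Longrightarrow> u t' x' + w s' y' - pen \<nu> t' x' s' y' z' \<le> u t x + w s y - pen \<nu> t x s y z"
    by blast
  have xz: "\<bar>x - z\<bar> \<le> D" and yz: "\<bar>y - (z + h)\<bar> \<le> D" using loc[OF _ _ \<nu> big] ts by auto
  define p1 where "p1 = 4 * (1 / \<epsilon>) * (x - z) ^ 3"
  define p2 where "p2 = 4 * (1 / \<epsilon>) * (y - (z + h)) ^ 3"
  define K1 where "K1 = (LINT \<zeta>:far r|lborel. (u t (x + \<zeta>) - u t x) / \<zeta>\<^sup>2)"
  define K2 where "K2 = (LINT \<zeta>:far r|lborel. (w s (y + \<zeta>) - w s y) / \<zeta>\<^sup>2)"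
  have i1: "2 * (1 / \<nu>) * (t - s) + \<eta> \<le> \<bar>p1\<bar> * (2 * r * (1 / \<epsilon> * (6 * (x - z)\<^sup>2 + 4 * \<bar>x - z\<bar> * r + r\<^sup>2)) + K1)"
    unfolding p1_def K1_def
  proof (rule subsolution_quartic_bound[OF su r(1,2) _ ts(1)])
    fix s' y' :: real assume "s' > 0"
    with mx[of s' s y' y z] ts show "u s' y' - (1 / \<epsilon> * (y' - z) ^ 4 + (1 / \<nu> * (s' - s)\<^sup>2 + \<eta> * s')) \<le>
      u t x - (1 / \<epsilon> * (x - z) ^ 4 + (1 / \<nu> * (t - s)\<^sup>2 + \<eta> * t))" unfolding pen_def by simp
  qed (use \<epsilon> in simp)
  have i2: "2 * (1 / \<nu>) * (s - t) + 0 \<le> \<bar>p2\<bar> * (2 * r * (1 / \<epsilon> * (6 * (y - (z + h))\<^sup>2 + 4 * \<bar>y - (z + h)\<bar> * r + r\<^sup>2)) + K2)"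
    unfolding p2_def K2_def
  proof (rule subsolution_quartic_bound[OF sw r(1,2) _ ts(2)])
    fix s' y' :: real assume "s' > 0"
    with mx[of t s' x y' z] ts show "w s' y' - (1 / \<epsilon> * (y' - (z + h)) ^ 4 + (1 / \<nu> * (s' - t)\<^sup>2 + 0 * s')) \<le>
      w s y - (1 / \<epsilon> * (y - (z + h)) ^ 4 + (1 / \<nu> * (s - t)\<^sup>2 + 0 * s))" unfolding pen_def by (simp add: power2_commute)
  qed (use \<epsilon> in simp)
  have E: "2 * r * (1 / \<epsilon> * (6 * b\<^sup>2 + 4 * \<bar>b\<bar> * r + r\<^sup>2)) \<le> 2 * r * E1" if "\<bar>b\<bar> \<le> D" for b
    unfolding E1_def
  proof (intro mult_left_mono add_mono)
    show "b\<^sup>2 \<le> D\<^sup>2" using that D by (simp add: abs_le_square_iff[symmetric])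
    show "4 * \<bar>b\<bar> * r \<le> 4 * D" using mult_mono[OF that r(3)] r D by simp
    show "r\<^sup>2 \<le> 1" using r by (simp add: power_le_one)
  qed (use r \<epsilon> in auto)
  have Pb: "\<bar>4 * (1 / \<epsilon>) * b ^ 3\<bar> \<le> Pm" if "\<bar>b\<bar> \<le> D" for b
  proof -
    have "\<bar>b\<bar> ^ 3 \<le> D ^ 3" using that by (intro power_mono) auto
    then show ?thesis unfolding Pm_def abs_mult power_abs using \<epsilon> by (simp add: divide_right_mono)
  qed
  have p1: "\<bar>p1\<bar> \<le> Pm" and p2: "\<bar>p2\<bar> \<le> Pm" unfolding p1_def p2_def by (rule Pb[OF xz], rule Pb[OF yz])
  have "p1 + p2 = \<alpha> * (z / \<psi> z)"
  proof -
    have "((\<lambda>z. 1 / \<epsilon> * (x - z) ^ 4 + 1 / \<epsilon> * (y - (z + h)) ^ 4) has_real_derivative - p1 - p2) (at z)"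
      unfolding p1_def p2_def using \<epsilon>(1) by (auto intro!: derivative_eq_intros)
    from DERIV_add[OF this DERIV_cmult[OF sqrt_one_plus_square_deriv, of \<alpha> z]]
    have "((\<lambda>z. 1 / \<epsilon> * (x - z) ^ 4 + 1 / \<epsilon> * (y - (z + h)) ^ 4 + \<alpha> * \<psi> z) has_real_derivative
      - p1 - p2 + \<alpha> * (z / \<psi> z)) (at z)" unfolding \<psi>_def .
    then have "- p1 - p2 + \<alpha> * (z / \<psi> z) = 0"
    proof (rule DERIV_local_min[OF _ zero_less_one], intro allI impI)
      fix z' assume "\<bar>z - z'\<bar> < 1"
      show "1 / \<epsilon> * (x - z) ^ 4 + 1 / \<epsilon> * (y - (z + h)) ^ 4 + \<alpha> * \<psi> z \<le> 1 / \<epsilon> * (x - z') ^ 4 + 1 / \<epsilon> * (y - (z' + h)) ^ 4 + \<alpha> * \<psi> z'"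
        using mx[of t s x y z'] ts unfolding pen_def by simp
    qed
    then show ?thesis by simp
  qed
  moreover have "\<bar>\<alpha> * (z / \<psi> z)\<bar> \<le> \<alpha>"
  proof -
    have "\<psi> z > 0" using \<psi>(1)[of z] by linarith
    then have "\<bar>z / \<psi> z\<bar> \<le> 1" using \<psi>(2)[of z] by (simp add: abs_divide)
    then show ?thesis unfolding abs_mult using \<alpha>(1) mult_left_mono[of "\<bar>z / \<psi> z\<bar>" 1 \<alpha>] by simp
  qed
  ultimately have pp: "\<bar>\<bar>p2\<bar> - \<bar>p1\<bar>\<bar> \<le> \<alpha>" by linarith
  have usc: "usc_on Q u" "usc_on Q w" using su sw unfolding subsolution_def by simp_all
  have m1: "(\<lambda>\<zeta>. u t (x + \<zeta>) - u t x) \<in> borel_measurable borel"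
    using usc_slice_measurable[OF usc(1) ts(1)] by measurable
  have m2: "(\<lambda>\<zeta>. w s (y + \<zeta>) - w s y) \<in> borel_measurable borel"
    using usc_slice_measurable[OF usc(2) ts(2)] by measurable
  have b1: "\<bar>u t (x + \<zeta>) - u t x\<bar> \<le> 2 * B" for \<zeta> using bu[of t "x + \<zeta>"] bu[of t x] ts by linarith
  have b2: "\<bar>w s (y + \<zeta>) - w s y\<bar> \<le> 2 * B" for \<zeta> using bw[of s "y + \<zeta>"] bw[of s y] ts by linarith
  have K2b: "\<bar>K2\<bar> \<le> 4 * B / r"
    unfolding K2_def using far_integral_bound[OF r(1) m2 b2] by simp
  \<comment> \<open>Shifting x, y and z together by \<zeta> leaves the quartic terms unchanged. So
    maximality bounds the two increments jointly by the change of \<alpha> \<psi>, at most \<alpha>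
    |\<zeta>|; boundedness of u and w gives the truncation at 4 B.\<close>
  have KK: "K1 + K2 \<le> (LINT z:far r|lborel. min (4 * B) (\<alpha> * \<bar>z\<bar>) / z\<^sup>2)"
  proof -
    note f1 = far_integrable[OF r(1) m1 b1] and f2 = far_integrable[OF r(1) m2 b2]
    have "K1 + K2 = (LINT \<zeta>:far r|lborel. (u t (x + \<zeta>) - u t x) / \<zeta>\<^sup>2 + (w s (y + \<zeta>) - w s y) / \<zeta>\<^sup>2)"
      unfolding K1_def K2_def by (rule set_integral_add(2)[OF f1 f2, symmetric])
    also have "\<dots> \<le> (LINT z:far r|lborel. min (4 * B) (\<alpha> * \<bar>z\<bar>) / z\<^sup>2)"
    proof (rule set_integral_mono[OF set_integral_add(1)[OF f1 f2]])
      show "set_integrable lborel (far r) (\<lambda>z. min (4 * B) (\<alpha> * \<bar>z\<bar>) / z\<^sup>2)"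
        by (rule far_integrable[OF r(1), where B = "4 * B"]) (use B \<alpha> in auto)
      fix \<zeta>
      have ps: "\<alpha> * (\<psi> (z + \<zeta>) - \<psi> z) \<le> \<alpha> * \<bar>\<zeta>\<bar>"
        using sqrt_one_plus_square_lipschitz[of z \<zeta>] \<alpha>(1) unfolding \<psi>_def by (intro mult_left_mono) auto
      have xs: "x + \<zeta> - (z + \<zeta>) = x - z" "y + \<zeta> - (z + \<zeta> + h) = y - (z + h)" by simp_all
      have "u t (x + \<zeta>) + w s (y + \<zeta>) - pen \<nu> t (x + \<zeta>) s (y + \<zeta>) (z + \<zeta>) \<le> u t x + w s y - pen \<nu> t x s y z"
        using mx[of t s "x + \<zeta>" "y + \<zeta>" "z + \<zeta>"] ts by simp
      then have "(u t (x + \<zeta>) - u t x) + (w s (y + \<zeta>) - w s y) \<le> \<alpha> * \<bar>\<zeta>\<bar>"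
        using ps
        unfolding pen_def right_diff_distrib xs by linarith
      then have "(u t (x + \<zeta>) - u t x) + (w s (y + \<zeta>) - w s y) \<le> min (4 * B) (\<alpha> * \<bar>\<zeta>\<bar>)"
        using b1[of \<zeta>] b2[of \<zeta>] by (simp add: abs_le_iff)
      then show "(u t (x + \<zeta>) - u t x) / \<zeta>\<^sup>2 + (w s (y + \<zeta>) - w s y) / \<zeta>\<^sup>2 \<le> min (4 * B) (\<alpha> * \<bar>\<zeta>\<bar>) / \<zeta>\<^sup>2"
        unfolding add_divide_distrib[symmetric] by (rule divide_right_mono) simp
    qed
    finally show ?thesis .
  qed
  have "\<eta> \<le> \<bar>p1\<bar> * (2 * r * E1 + K1) + \<bar>p2\<bar> * (2 * r * E1 + K2)"
  proof -
    have "\<bar>p1\<bar> * (2 * r * (1 / \<epsilon> * (6 * (x - z)\<^sup>2 + 4 * \<bar>x - z\<bar> * r + r\<^sup>2)) + K1) \<le> \<bar>p1\<bar> * (2 * r * E1 + K1)"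
      using E[OF xz] by (intro mult_left_mono) auto
    moreover have "\<bar>p2\<bar> * (2 * r * (1 / \<epsilon> * (6 * (y - (z + h))\<^sup>2 + 4 * \<bar>y - (z + h)\<bar> * r + r\<^sup>2)) + K2) \<le> \<bar>p2\<bar> * (2 * r * E1 + K2)"
      using E[OF yz] by (intro mult_left_mono) auto
    moreover have "2 * (1 / \<nu>) * (t - s) + 2 * (1 / \<nu>) * (s - t) = 0" unfolding distrib_left[symmetric] by simp
    ultimately show ?thesis using i1 i2 by linarith
  qed
  \<comment> \<open>Only the sum K1 + K2 has a small upper bound. Hence |p2| K2 is split into |p1|
    K2, which completes that sum, and a remainder whose factor |p2| - |p1| has size at most
    \<alpha>.\<close>
  also have "\<dots> = (\<bar>p1\<bar> + \<bar>p2\<bar>) * (2 * r * E1) + \<bar>p1\<bar> * (K1 + K2) + (\<bar>p2\<bar> - \<bar>p1\<bar>) * K2"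
    by (simp add: algebra_simps)
  also have "\<dots> \<le> (Pm + Pm) * (2 * r * E1) + \<eta> / 4 + \<alpha> * (4 * B / r)"
  proof (intro add_mono)
    show "(\<bar>p1\<bar> + \<bar>p2\<bar>) * (2 * r * E1) \<le> (Pm + Pm) * (2 * r * E1)"
      using p1 p2 r E1 by (intro mult_right_mono) auto
    have "\<bar>p1\<bar> * (K1 + K2) \<le> \<bar>p1\<bar> * (\<eta> / (4 * Pm))"
      using KK \<alpha>(3) by (intro mult_left_mono) auto
    also have "\<dots> \<le> Pm * (\<eta> / (4 * Pm))" using p1 \<eta> Pm by (intro mult_right_mono) auto
    finally show "\<bar>p1\<bar> * (K1 + K2) \<le> \<eta> / 4" using Pm by simp
    have "(\<bar>p2\<bar> - \<bar>p1\<bar>) * K2 \<le> \<bar>\<bar>p2\<bar> - \<bar>p1\<bar>\<bar> * \<bar>K2\<bar>" unfolding abs_mult[symmetric] by (rule abs_ge_self)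
    also have "\<dots> \<le> \<alpha> * (4 * B / r)" using pp K2b \<alpha>(1) by (intro mult_mono) auto
    finally show "(\<bar>p2\<bar> - \<bar>p1\<bar>) * K2 \<le> \<alpha> * (4 * B / r)" .
  qed
  also have "\<dots> \<le> \<eta> / 4 + \<eta> / 4 + \<eta> / 4"
    using r(4) \<alpha>2(2) by (intro add_mono) (auto simp: algebra_simps)
  finally show False using \<eta>(1) by linarith
qed

subsection \<open>Convergence\<close>

lemma dist_pair_le: "dist (s, y) (t, x) \<le> \<bar>s - t\<bar> + \<bar>y - x\<bar>" for s t y x :: real
  unfolding dist_Pair_Pair dist_real_def using sqrt_sum_squares_le_sum_abs by simp

text \<open>From distance \<delta> on the bump exceeds 2 F, the largest possible oscillation of f.
  The constant A is chosen before f and the points, so a single barrier speed serves all points and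
  all times.\<close>

lemma uniform_modulus_barrier:
  assumes F: "F \<ge> 0" and \<delta>: "\<delta> > 0" and e: "e \<ge> 0"
  obtains A where "A > 0"
    "\<And>f y y'. (\<And>y. \<bar>f y\<bar> \<le> F) \<Longrightarrow> (\<And>y y'. \<bar>y' - y\<bar> < \<delta> \<Longrightarrow> f y' \<le> f y + e) \<Longrightarrow>
       f y' \<le> f y + e + A * (sqrt (1 + (y' - y)\<^sup>2) - 1)"
proof -
  define g where "g = sqrt (1 + \<delta>\<^sup>2) - 1"
  have g: "g > 0" using \<delta> unfolding g_def by simp
  define A where "A = (2 * F + 1) / g"
  have A: "A > 0" "A * g = 2 * F + 1" unfolding A_def using g F by auto
  have "f y' \<le> f y + e + A * (sqrt (1 + (y' - y)\<^sup>2) - 1)"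
    if f: "\<And>y. \<bar>f y\<bar> \<le> F" "\<And>y y'. \<bar>y' - y\<bar> < \<delta> \<Longrightarrow> f y' \<le> f y + e" for f y y'
  proof (cases "\<bar>y' - y\<bar> < \<delta>")
    case True
    have "0 \<le> A * (sqrt (1 + (y' - y)\<^sup>2) - 1)" using A(1) by (intro mult_nonneg_nonneg) auto
    with f(2)[OF True] show ?thesis by simp
  next
    case False
    then have "\<delta>\<^sup>2 \<le> (y' - y)\<^sup>2" using \<delta> by (simp add: abs_le_square_iff[symmetric])
    then have "A * g \<le> A * (sqrt (1 + (y' - y)\<^sup>2) - 1)" unfolding g_def using A(1) by (intro mult_left_mono) auto
    with A(2) f(1)[of y] f(1)[of y'] e show ?thesis by linarith
  qed
  with A(1) that show ?thesis by blast
qed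

context
  fixes x b :: "nat \<Rightarrow> real \<Rightarrow> nat \<Rightarrow> real"
  assumes flow: "\<And>n. n \<ge> 2 \<Longrightarrow> particle_flow n (x n) (b n)"
begin

lemma upper_lim_usc_closed: "usc_closed (upper_lim x b)"
  unfolding usc_closed_def
proof (intro allI impI)
  fix t y e :: real assume te: "t \<ge> 0" "e > 0"
  obtain \<delta> where "\<delta> > 0"
    "\<And>s z. s \<ge> 0 \<Longrightarrow> \<bar>s - t\<bar> < \<delta> \<Longrightarrow> \<bar>z - y\<bar> < \<delta> \<Longrightarrow> upper_lim x b s z < upper_lim x b t y + e"
    by (rule upper_lim_usc[where y = y, OF flow te]) (assumption | rule that)+
  then show "\<exists>\<delta>>0. \<forall>s\<ge>0. \<forall>z. \<bar>s - t\<bar> < \<delta> \<longrightarrow> \<bar>z - y\<bar> < \<delta> \<longrightarrow> upper_lim x b s z < upper_lim x b t y + e"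
    by blast
qed

text \<open>The barrier is centred at the very point z where the step function is evaluated, so that
  its bump vanishes there and f z is exceeded by at most 3 e + \<kappa> s. The 3 e are the initial
  error, the passage from the envelope to a nearby value of the step function, and the modulus of
  f.\<close>

lemma upper_lim_initial:
  assumes f: "uniformly_continuous_on UNIV f" "\<And>y. \<bar>f y\<bar> \<le> F"
    and init: "\<And>e. e > 0 \<Longrightarrow> \<exists>N. \<forall>n\<ge>N. \<forall>y. step_function n (x n 0) (b n 0) y \<le> f y + e"
  shows "upper_lim x b 0 y \<le> f y"
proof (rule field_le_epsilon)
  fix e' :: real assume "e' > 0"
  \<comment> \<open>Six errors: 3 e at the initial time, e for \<kappa> s, e from f z to f y, and e
    for approaching the limit.\<close>
  define e where "e = e' / 6"
  have e: "e > 0" using \<open>e' > 0\<close> by (simp add: e_def)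
  obtain \<delta> where \<delta>: "\<delta> > 0" "\<And>y y'. \<bar>y' - y\<bar> < \<delta> \<Longrightarrow> \<bar>f y' - f y\<bar> < e"
    using f(1)[unfolded uniformly_continuous_on_def, rule_format, OF e] by (auto simp: dist_real_def)
  have F: "F \<ge> 0" using f(2)[of 0] by linarith
  obtain A where A: "A > 0" "\<And>f y y'. (\<And>y. \<bar>f y\<bar> \<le> F) \<Longrightarrow> (\<And>y y'. \<bar>y' - y\<bar> < \<delta> \<Longrightarrow> f y' \<le> f y + e) \<Longrightarrow>
       f y' \<le> f y + e + A * (sqrt (1 + (y' - y)\<^sup>2) - 1)"
    using uniform_modulus_barrier[OF F \<delta>(1) less_imp_le[OF e]] by metis
  have fe: "f y' \<le> f y + e" if "\<bar>y' - y\<bar> < \<delta>" for y y' using \<delta>(2)[OF that] by (simp add: abs_less_iff)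
  obtain N where N: "\<And>n y. n \<ge> N \<Longrightarrow> step_function n (x n 0) (b n 0) y \<le> f y + e" using init[OF e] by blast
  have U0: "upper_step n (x n 0) (b n 0) y' \<le> (f z + 3 * e) + A * (sqrt (1 + (y' - z)\<^sup>2) - 1)" if "n \<ge> N" for n y' z
  proof -
    obtain y'' where y'': "\<bar>y'' - y'\<bar> < \<delta>" "step_function n (x n 0) (b n 0) y'' = upper_step n (x n 0) (b n 0) y'"
      using upper_step_attained[OF \<delta>(1)] by blast
    have "f y' \<le> f z + e + A * (sqrt (1 + (y' - z)\<^sup>2) - 1)" by (rule A(2)[OF f(2) fe])
    with N[OF that, of y''] fe[OF y''(1)] y''(2) show ?thesis by linarith
  qed
  define \<kappa> where "\<kappa> = barrier_speed A"
  have \<kappa>: "\<kappa> > 0" unfolding \<kappa>_def barrier_speed_def using A(1) by (intro add_nonneg_pos) auto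
  define d where "d = min \<delta> (e / \<kappa>)"
  have d: "d > 0" "d \<le> \<delta>" "d \<le> e / \<kappa>" unfolding d_def using \<delta> e \<kappa> by auto
  obtain n s z where n: "n \<ge> max N 2" "s \<ge> 0" "\<bar>s - 0\<bar> < d" "\<bar>z - y\<bar> < d"
    "step_function n (x n s) (b n s) z > upper_lim x b 0 y - e"
    using upper_lim_approached[OF flow order_refl e d(1), of "max N 2" y] by blast
  have "step_function n (x n s) (b n s) z \<le> upper_step n (x n s) (b n s) z" by (rule step_le_upper_step)
  also have "\<dots> \<le> (f z + 3 * e) + A * (sqrt (1 + (z - z)\<^sup>2) - 1) + barrier_speed A * (s - 0)"
    using n(1,2) by (intro barrier[OF flow] U0 A(1)) auto
  also have "\<dots> = f z + 3 * e + \<kappa> * s" by (simp add: \<kappa>_def)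
  also have "\<kappa> * s \<le> \<kappa> * (e / \<kappa>)" using n(2,3) d(3) \<kappa> by (intro mult_left_mono) auto
  finally have "step_function n (x n s) (b n s) z \<le> f z + 3 * e + e" using \<kappa> by simp
  moreover have "f z \<le> f y + e" using n(4) d(2) by (intro fe) auto
  ultimately show "upper_lim x b 0 y \<le> f y + e'" using n(5) unfolding e_def by linarith
qed

text \<open>The barrier is started at time a above the limit itself, which the envelopes exceed by
  less than e on a compact part of the slice for large n. Outside that part the bump is at least 3,
  more than the gap between the bounds -1 and 1. Convergence at (T, y) carries the estimate over to
  the limit.\<close>

lemma upper_lim_time_modulus:
  assumes a: "0 \<le> a" "a \<le> T" and e: "e > 0" and A: "A > 0"
    and mod: "\<And>y'. upper_lim x b a y' \<le> upper_lim x b a y + e + A * (sqrt (1 + (y' - y)\<^sup>2) - 1)"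
    and cont: "continuous_on UNIV (upper_lim x b a)"
    and conv: "(\<lambda>n. step_function n (x n T) (b n T) y) \<longlonglongrightarrow> upper_lim x b T y"
  shows "upper_lim x b T y \<le> upper_lim x b a y + 2 * e + barrier_speed A * (T - a)"
proof -
  define R where "R = 1 + 3 / A"
  have R: "R > 0" "A * R = A + 3" unfolding R_def using A by (auto simp: add_pos_pos distrib_left)
  define K where "K = {a} \<times> {y - R..y + R}"
  have K: "compact K" "K \<subseteq> {0..} \<times> UNIV" unfolding K_def using a by (auto intro!: compact_Times)
  have "continuous_on K (\<lambda>(t, z). upper_lim x b t z)"
  proof -
    have "continuous_on K (\<lambda>q. upper_lim x b a (snd q))"
      by (rule continuous_on_compose2[OF cont]) (auto intro: continuous_intros)
    then show ?thesis by (rule continuous_on_eq) (auto simp: K_def)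
  qed
  from upper_lim_compact[OF flow K this, of 0 e] e
  obtain N where N: "N \<ge> 2" "\<And>n t y. n \<ge> N \<Longrightarrow> (t, y) \<in> K \<Longrightarrow> upper_step n (x n t) (b n t) y - upper_lim x b t y < 0 + e"
    by (metis diff_self order_refl)
  have "step_function n (x n T) (b n T) y \<le> upper_lim x b a y + 2 * e + barrier_speed A * (T - a)" if n: "n \<ge> N" for n
  proof -
    have n2: "n \<ge> 2" using n N(1) by simp
    have "upper_step n (x n T) (b n T) y \<le> (upper_lim x b a y + 2 * e) + A * (sqrt (1 + (y - y)\<^sup>2) - 1) + barrier_speed A * (T - a)"
    proof (rule barrier[OF flow[OF n2] _ a A])
      fix y'
      show "upper_step n (x n a) (b n a) y' \<le> (upper_lim x b a y + 2 * e) + A * (sqrt (1 + (y' - y)\<^sup>2) - 1)"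
      proof (cases "y' \<in> {y - R..y + R}")
        case True
        then have "(a, y') \<in> K" by (simp add: K_def)
        from N(2)[OF n this] mod[of y'] show ?thesis by simp
      next
        case False
        then have "R \<le> \<bar>y' - y\<bar>" by auto
        also have "\<dots> \<le> sqrt (1 + (y' - y)\<^sup>2)" by (rule real_le_rsqrt) simp
        finally have "A * R \<le> A * sqrt (1 + (y' - y)\<^sup>2)" using A by (intro mult_left_mono) auto
        then have "3 \<le> A * (sqrt (1 + (y' - y)\<^sup>2) - 1)" using R(2) by (simp add: right_diff_distrib)
        moreover have "upper_step n (x n a) (b n a) y' \<le> 1"
          using upper_step_bound[OF flow_conf[OF flow[OF n2] a(1)], of y'] by (simp add: abs_le_iff)
        moreover have "- 1 \<le> upper_lim x b a y" using upper_lim_bound[OF flow a(1), of y] by (simp add: abs_le_iff)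
        ultimately show ?thesis using e by linarith
      qed
    qed (use n2 in simp)
    then show ?thesis using step_le_upper_step[of n "x n T" "b n T" y] by simp
  qed
  then show ?thesis
    by (intro tendsto_upperbound[OF conv]) (auto simp: eventually_sequentially)
qed

end

section \<open>Sign symmetry and semicontinuous envelopes\<close>

lemma hamiltonian_cong:
  assumes "\<And>y. u t y = v t y" shows "hamiltonian \<rho> \<phi> u t x = hamiltonian \<rho> \<phi> v t x"
  unfolding hamiltonian_def using assms by simp

lemma subsolution_cong:
  assumes eq: "\<And>t y. t > 0 \<Longrightarrow> u t y = v t y" and sub: "subsolution \<rho> u"
  shows "subsolution \<rho> v"
proof -
  have bd: "bounded_Q v"
  proof -
    have "(\<lambda>(t, x). u t x) ` Q = (\<lambda>(t, x). v t x) ` Q" using eq by (intro image_cong) (auto simp: Q_def)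
    then show ?thesis using sub unfolding subsolution_def bounded_Q_def by simp
  qed
  have usc: "usc_on Q v"
  proof -
    have "usc_on Q u" using sub unfolding subsolution_def by simp
    then show ?thesis unfolding usc_on_Q_iff using eq by simp
  qed
  have main: "\<forall>\<phi> t x. C2_Q \<phi> \<and> (t, x) \<in> Q \<and> (\<forall>(s, y)\<in>Q. u s y - \<phi> s y \<le> u t x - \<phi> t x) \<longrightarrow>
        (d_x \<phi> t x \<noteq> 0 \<longrightarrow> d_t \<phi> t x \<le> hamiltonian \<rho> \<phi> u t x) \<and> (quartic_test x \<phi> \<longrightarrow> d_t \<phi> t x \<le> 0)"
    using sub unfolding subsolution_def by (elim conjE)
  show ?thesis
    unfolding subsolution_def
  proof (intro conjI bd usc allI impI)
    fix \<phi> t x assume A: "C2_Q \<phi> \<and> (t, x) \<in> Q \<and> (\<forall>(s, y)\<in>Q. v s y - \<phi> s y \<le> v t x - \<phi> t x)"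
    then have t: "t > 0" by (simp add: Q_def)
    have "\<forall>(s, y)\<in>Q. u s y - \<phi> s y \<le> u t x - \<phi> t x" using A eq t by (auto simp: Q_def)
    with A main have *: "(d_x \<phi> t x \<noteq> 0 \<longrightarrow> d_t \<phi> t x \<le> hamiltonian \<rho> \<phi> u t x) \<and> (quartic_test x \<phi> \<longrightarrow> d_t \<phi> t x \<le> 0)" by blast
    show "d_t \<phi> t x \<le> hamiltonian \<rho> \<phi> v t x" if "d_x \<phi> t x \<noteq> 0"
      using * that hamiltonian_cong[of u t v \<rho> \<phi> x] eq[OF t] by simp
    show "d_t \<phi> t x \<le> 0" if "quartic_test x \<phi>" using * that by simp
  qed
qed

text \<open>The integrals are linear in the pair of test function and solution, and the factor |d_x
  \<phi>| is even, so the equation is invariant under a change of sign.\<close>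

lemma hamiltonian_uminus:
  assumes "C2_Q \<phi>" "t > 0"
  shows "hamiltonian \<rho> (\<lambda>t x. - \<phi> t x) (\<lambda>t x. - u t x) t x = - hamiltonian \<rho> \<phi> u t x"
    and "d_t (\<lambda>t x. - \<phi> t x) t x = - d_t \<phi> t x" "d_x (\<lambda>t x. - \<phi> t x) t x = - d_x \<phi> t x"
proof -
  note D = C1_Q_DERIV[OF C2_Q_D(1)[OF assms(1)] assms(2)]
  show dt: "d_t (\<lambda>t x. - \<phi> t x) t x = - d_t \<phi> t x" by (rule d_t_eqI) (rule DERIV_minus[OF D(1)])
  show dx: "d_x (\<lambda>t x. - \<phi> t x) t x = - d_x \<phi> t x" by (rule d_x_eqI) (rule DERIV_minus[OF D(2)])
  have 1: "(- \<phi> t (x + z) - - \<phi> t x - - d_x \<phi> t x * z) / z\<^sup>2 = - ((\<phi> t (x + z) - \<phi> t x - d_x \<phi> t x * z) / z\<^sup>2)" for z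
    unfolding minus_divide_left by simp
  have 2: "(- u t (x + z) - - u t x) / z\<^sup>2 = - ((u t (x + z) - u t x) / z\<^sup>2)" for z
    unfolding minus_divide_left by simp
  have i: "(LINT z:S|lborel. - f z) = - (LINT z:S|lborel. f z)" for S and f :: "real \<Rightarrow> real"
    by (simp add: set_lebesgue_integral_def)
  show "hamiltonian \<rho> (\<lambda>t x. - \<phi> t x) (\<lambda>t x. - u t x) t x = - hamiltonian \<rho> \<phi> u t x"
    unfolding hamiltonian_def dx 1 2 i by (simp add: algebra_simps)
qed

lemma quartic_test_uminus: "quartic_test x (\<lambda>t y. - \<phi> t y) \<longleftrightarrow> quartic_test x \<phi>"
proof -
  have *: "quartic_test x (\<lambda>t y. - \<phi> t y)" if "quartic_test x \<phi>" for \<phi>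
  proof -
    from that obtain c g where "\<forall>(t, y)\<in>Q. \<phi> t y = c * \<bar>y - x\<bar> ^ 4 + g t" unfolding quartic_test_def by blast
    then have "\<forall>(t, y)\<in>Q. - \<phi> t y = (- c) * \<bar>y - x\<bar> ^ 4 + (- g t)" by auto
    then show ?thesis unfolding quartic_test_def by (intro exI[of _ "- c"] exI[of _ "\<lambda>t. - g t"])
  qed
  from *[of \<phi>] *[of "\<lambda>t y. - \<phi> t y"] show ?thesis by auto
qed

text \<open>Passing from \<psi> to - \<psi> exchanges the test functions of the two notions. The
  quartic clause is preserved because its coefficient c may have either sign.\<close>

lemma supersolution_iff: "supersolution \<rho> v \<longleftrightarrow> subsolution \<rho> (\<lambda>t x. - v t x)"
proof -
  have b: "bounded_Q (\<lambda>t x. - v t x) \<longleftrightarrow> bounded_Q v"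
    unfolding bounded_Q_def bounded_iff by (simp add: case_prod_beta)
  have s: "usc_on Q (\<lambda>t x. - v t x) \<longleftrightarrow> lsc_on Q v"
  proof -
    have "- v s y < - v t x + e \<longleftrightarrow> v s y > v t x - e" for s y t x e by auto
    then show ?thesis unfolding usc_on_def lsc_on_def by simp
  qed
  have m: "(\<forall>(s, y)\<in>Q. - v s y - \<phi> s y \<le> - v t x - \<phi> t x) \<longleftrightarrow> (\<forall>(s, y)\<in>Q. v s y - (- \<phi> s y) \<ge> v t x - (- \<phi> t x))" for \<phi> t x
    by (intro ball_cong) auto
  define P where "P \<psi> t x \<longleftrightarrow> (C2_Q \<psi> \<and> (t, x) \<in> Q \<and> (\<forall>(s, y)\<in>Q. v s y - \<psi> s y \<ge> v t x - \<psi> t x) \<longrightarrow>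
        (d_x \<psi> t x \<noteq> 0 \<longrightarrow> d_t \<psi> t x \<ge> hamiltonian \<rho> \<psi> v t x) \<and> (quartic_test x \<psi> \<longrightarrow> d_t \<psi> t x \<ge> 0))" for \<psi> t x
  define R where "R \<phi> t x \<longleftrightarrow> (C2_Q \<phi> \<and> (t, x) \<in> Q \<and> (\<forall>(s, y)\<in>Q. - v s y - \<phi> s y \<le> - v t x - \<phi> t x) \<longrightarrow>
        (d_x \<phi> t x \<noteq> 0 \<longrightarrow> d_t \<phi> t x \<le> hamiltonian \<rho> \<phi> (\<lambda>t x. - v t x) t x) \<and> (quartic_test x \<phi> \<longrightarrow> d_t \<phi> t x \<le> 0))" for \<phi> t x
  have R: "R \<phi> t x \<longleftrightarrow> P (\<lambda>t x. - \<phi> t x) t x" for \<phi> t x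
  proof (cases "C2_Q \<phi> \<and> (t, x) \<in> Q")
    case True
    then have c: "C2_Q \<phi>" "C2_Q (\<lambda>t x. - \<phi> t x)" "t > 0" "(t, x) \<in> Q" by (auto simp: Q_def intro: C2_Q_uminus)
    have h: "hamiltonian \<rho> \<phi> (\<lambda>t x. - v t x) t x = - hamiltonian \<rho> (\<lambda>t x. - \<phi> t x) v t x"
      using hamiltonian_uminus(1)[OF c(2,3), of \<rho> v x] by simp
    show ?thesis
      unfolding R_def P_def m h quartic_test_uminus hamiltonian_uminus(2,3)[OF c(1,3)] using c by (simp add: le_minus_iff[of "d_t \<phi> t x"])
  next
    case False
    moreover have "C2_Q (\<lambda>t x. - \<phi> t x) \<longleftrightarrow> C2_Q \<phi>"
      using C2_Q_uminus[of \<phi>] C2_Q_uminus[of "\<lambda>t x. - \<phi> t x"] by auto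
    ultimately show ?thesis unfolding R_def P_def by blast
  qed
  have "(\<forall>\<phi> t x. R \<phi> t x) \<longleftrightarrow> (\<forall>\<psi> t x. P \<psi> t x)"
  proof
    assume *: "\<forall>\<phi> t x. R \<phi> t x"
    show "\<forall>\<psi> t x. P \<psi> t x"
    proof (intro allI)
      fix \<psi> t x show "P \<psi> t x" using *[rule_format, of "\<lambda>t x. - \<psi> t x" t x] R[of "\<lambda>t x. - \<psi> t x"] by simp
    qed
  next
    assume "\<forall>\<psi> t x. P \<psi> t x" then show "\<forall>\<phi> t x. R \<phi> t x" using R by blast
  qed
  then show ?thesis unfolding supersolution_def subsolution_def b s P_def R_def by blast
qed

lemma lsc_envelope_eq: "lsc_envelope v t x = - usc_envelope (\<lambda>t x. - v t x) t x"
proof -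
  have neg: "(INF i\<in>I. f i) = - (SUP i\<in>I. - f i)" for I and f :: "'a \<Rightarrow> real"
    unfolding Inf_real_def image_image ..
  have "(INF (s, y)\<in>S. v s y) = - (SUP (s, y)\<in>S. - v s y)" for S
    using neg[of "\<lambda>(s, y). v s y" S] by (simp add: case_prod_beta)
  then show ?thesis
    unfolding lsc_envelope_def usc_envelope_def neg[of "\<lambda>r. SUP (s, y)\<in>ball (t, x) r \<inter> Q. - v s y"] by simp
qed

text \<open>Together with \<open>usc_envelope_approached\<close> this replaces the formula by INF
  and SUP in all later arguments. Only points with s > 0 are sampled, also for t = 0.\<close>

lemma usc_envelope_upper:
  assumes B: "\<And>t y. t > 0 \<Longrightarrow> \<bar>v t y\<bar> \<le> B" and t: "t \<ge> 0" and e: "e > 0"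
  obtains r where "r > 0" "\<And>s y. s > 0 \<Longrightarrow> dist (s, y) (t, x) < r \<Longrightarrow> v s y < usc_envelope v t x + e"
proof -
  let ?S = "\<lambda>r. SUP (s, y)\<in>ball (t, x) r \<inter> Q. v s y"
  have "(INF r\<in>{0<..}. ?S r) < usc_envelope v t x + e" unfolding usc_envelope_def using e by simp
  then obtain r where r: "r > 0" "?S r < usc_envelope v t x + e"
    using cInf_lessD[of "?S ` {0<..}"] by (metis (no_types, lifting) greaterThan_iff imageE image_is_empty greaterThan_non_empty)
  have bdd: "bdd_above ((\<lambda>(s, y). v s y) ` (ball (t, x) r \<inter> Q))"
    using B by (intro bdd_aboveI[of _ B]) (auto simp: Q_def abs_le_iff)
  have "v s y < usc_envelope v t x + e" if "s > 0" "dist (s, y) (t, x) < r" for s y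
  proof -
    have "(s, y) \<in> ball (t, x) r \<inter> Q" using that by (simp add: Q_def dist_commute)
    from cSUP_upper[OF this bdd] r(2) show ?thesis by simp
  qed
  with r(1) that show ?thesis by blast
qed

lemma usc_envelope_approached:
  assumes B: "\<And>t y. t > 0 \<Longrightarrow> \<bar>v t y\<bar> \<le> B" and t: "t \<ge> 0" and e: "e > 0" and r: "r > 0"
  obtains s y where "s > 0" "dist (s, y) (t, x) < r" "v s y > usc_envelope v t x - e"
proof -
  let ?S = "\<lambda>r. SUP (s, y)\<in>ball (t, x) r \<inter> Q. v s y"
  have ne: "ball (t, x) r \<inter> Q \<noteq> {}" if "r > 0" for r
  proof -
    have "dist (t, x) (t + r / 2, x) < r" using that dist_pair_le[of t x "t + r / 2" x] by simp
    then have "(t + r / 2, x) \<in> ball (t, x) r \<inter> Q" using that t by (simp add: Q_def)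
    then show ?thesis by blast
  qed
  have bdd: "bdd_above ((\<lambda>(s, y). v s y) ` (ball (t, x) r \<inter> Q))" for r
    using B by (intro bdd_aboveI[of _ B]) (auto simp: Q_def abs_le_iff)
  have SB: "- B \<le> ?S r" if r: "r > 0" for r
  proof -
    obtain q where q: "q \<in> ball (t, x) r \<inter> Q" using ne[OF r] by blast
    have "- B \<le> (case q of (s, y) \<Rightarrow> v s y)" using q B by (auto simp: Q_def abs_le_iff minus_le_iff split: prod.split)
    also have "\<dots> \<le> ?S r" by (rule cSUP_upper[OF q bdd])
    finally show ?thesis .
  qed
  have "usc_envelope v t x \<le> ?S r"
    unfolding usc_envelope_def using SB r by (intro cINF_lower bdd_belowI[of _ "- B"]) auto
  then have "usc_envelope v t x - e < ?S r" using e by simp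
  then obtain q where "q \<in> ball (t, x) r \<inter> Q" "usc_envelope v t x - e < (case q of (s, y) \<Rightarrow> v s y)"
    using less_cSUP_iff[OF ne[OF r] bdd] by blast
  then show ?thesis using that[of "fst q" "snd q"] by (auto simp: Q_def dist_commute split: prod.splits)
qed

lemma usc_envelope_bound:
  assumes B: "\<And>t y. t > 0 \<Longrightarrow> \<bar>v t y\<bar> \<le> B" and t: "t \<ge> 0"
  shows "\<bar>usc_envelope v t x\<bar> \<le> B"
proof -
  have "usc_envelope v t x \<le> B + e \<and> - B \<le> usc_envelope v t x + e" if e: "e > 0" for e
  proof -
    obtain r where r: "r > 0" "\<And>s y. s > 0 \<Longrightarrow> dist (s, y) (t, x) < r \<Longrightarrow> v s y < usc_envelope v t x + e"
      by (rule usc_envelope_upper[where v = v and x = x, OF B t e]) (assumption | rule that)+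
    obtain s y where s: "s > 0" "dist (s, y) (t, x) < r" "v s y > usc_envelope v t x - e"
      by (rule usc_envelope_approached[where v = v and x = x, OF B t e r(1)]) (assumption | rule that)+
    from r(2)[OF s(1,2)] s(3) B[OF s(1), of y] show ?thesis by linarith
  qed
  then have "usc_envelope v t x \<le> B" "- B \<le> usc_envelope v t x" by (auto intro: field_le_epsilon)
  then show ?thesis by (simp add: abs_le_iff)
qed

lemma usc_envelope_usc_closed:
  assumes B: "\<And>t y. t > 0 \<Longrightarrow> \<bar>v t y\<bar> \<le> B"
  shows "usc_closed (usc_envelope v)"
  unfolding usc_closed_def
proof (intro allI impI)
  fix t y e :: real assume t: "t \<ge> 0" and e: "e > 0"
  then have e2: "e / 2 > 0" by simp
  obtain r where r: "r > 0" "\<And>s z. s > 0 \<Longrightarrow> dist (s, z) (t, y) < r \<Longrightarrow> v s z < usc_envelope v t y + e / 2"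
    by (rule usc_envelope_upper[where v = v and x = y, OF B t e2]) (assumption | rule that)+
  show "\<exists>\<delta>>0. \<forall>s\<ge>0. \<forall>z. \<bar>s - t\<bar> < \<delta> \<longrightarrow> \<bar>z - y\<bar> < \<delta> \<longrightarrow> usc_envelope v s z < usc_envelope v t y + e"
  proof (intro exI[of _ "r / 4"] conjI allI impI)
    fix s z :: real assume s: "s \<ge> 0" "\<bar>s - t\<bar> < r / 4" "\<bar>z - y\<bar> < r / 4"
    have r2: "r / 2 > 0" using r(1) by simp
    obtain s' z' where s': "s' > 0" "dist (s', z') (s, z) < r / 2" "v s' z' > usc_envelope v s z - e / 2"
      by (rule usc_envelope_approached[where v = v and x = z, OF B s(1) e2 r2]) (assumption | rule that)+
    have "dist (s, z) (t, y) < r / 2" using dist_pair_le[of s z t y] s by linarith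
    then have "dist (s', z') (t, y) < r" using s'(2) dist_triangle[of "(s', z')" "(t, y)" "(s, z)"] by linarith
    from r(2)[OF s'(1) this] s'(3) show "usc_envelope v s z < usc_envelope v t y + e" by linarith
  qed (use r in simp)
qed

lemma usc_envelope_ge:
  assumes B: "\<And>t y. t > 0 \<Longrightarrow> \<bar>v t y\<bar> \<le> B" and t: "t > 0"
  shows "v t x \<le> usc_envelope v t x"
proof (rule field_le_epsilon)
  fix e :: real assume e: "e > 0"
  obtain r where "r > 0" "\<And>s y. s > 0 \<Longrightarrow> dist (s, y) (t, x) < r \<Longrightarrow> v s y < usc_envelope v t x + e"
    by (rule usc_envelope_upper[where v = v and x = x, OF B less_imp_le[OF t] e]) (assumption | rule that)+
  from this(2)[of t x] this(1) t show "v t x \<le> usc_envelope v t x + e" by simp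
qed

text \<open>At t = 0 the envelope is a limit from positive times, so continuity up to the initial
  time is what identifies it with the value there.\<close>

lemma usc_envelope_continuous:
  assumes B: "\<And>t y. t > 0 \<Longrightarrow> \<bar>v t y\<bar> \<le> B" and t: "t \<ge> 0"
    and cont: "continuous_on ({0..} \<times> UNIV) (\<lambda>(t, y). v t y)"
  shows "usc_envelope v t x = v t x"
proof -
  have tx: "(t, x) \<in> {0..} \<times> UNIV" using t by simp
  have "usc_envelope v t x \<le> v t x + e \<and> v t x \<le> usc_envelope v t x + e" if e: "e > 0" for e
  proof -
    have e2: "e / 2 > 0" using e by simp
    from cont[unfolded continuous_on_iff, rule_format, OF tx e2]
    obtain d where d: "d > 0" "\<forall>q\<in>{0..} \<times> UNIV. dist q (t, x) < d \<longrightarrow> dist (case q of (t, y) \<Rightarrow> v t y) (v t x) < e / 2" by auto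
    have dv: "\<bar>v s y - v t x\<bar> < e / 2" if "s > 0" "dist (s, y) (t, x) < d" for s y
      using bspec[OF d(2), of "(s, y)"] that by (simp add: dist_real_def)
    obtain r where r: "r > 0" "\<And>s y. s > 0 \<Longrightarrow> dist (s, y) (t, x) < r \<Longrightarrow> v s y < usc_envelope v t x + e / 2"
      by (rule usc_envelope_upper[where v = v and x = x, OF B t e2]) (assumption | rule that)+
    have rd: "min r d > 0" using r d by simp
    obtain s y where s: "s > 0" "dist (s, y) (t, x) < min r d" "v s y > usc_envelope v t x - e / 2"
      by (rule usc_envelope_approached[where v = v and x = x, OF B t e2 rd]) (assumption | rule that)+
    have "dist (s, y) (t, x) < r" "dist (s, y) (t, x) < d" using s(2) by simp_all
    from r(2)[OF s(1) this(1)] dv[OF s(1) this(2)] s(3) show ?thesis unfolding abs_less_iff by linarith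
  qed
  then show ?thesis by (intro antisym) (auto intro: field_le_epsilon)
qed

section \<open>Identification of the limit and its regularity\<close>

theorem theorem2:
  fixes x0 b0 :: "nat \<Rightarrow> nat \<Rightarrow> real"
    and x b :: "nat \<Rightarrow> real \<Rightarrow> nat \<Rightarrow> real"
    and u0 :: "real \<Rightarrow> real"
    and \<rho> :: real
  assumes "\<rho> > 0"
    and "\<And>n. n \<ge> 2 \<Longrightarrow> (x0 n, b0 n) \<in> configurations n"
    and "bounded (range u0)" and "uniformly_continuous_on UNIV u0"
    and "uniform_limit UNIV (\<lambda>n. step_function n (x0 n) (b0 n)) u0 sequentially"
    and "\<And>n. n \<ge> 2 \<Longrightarrow> particle_solution n (x0 n) (b0 n) (x n) (b n)"
  shows "\<exists>u. the_viscosity_solution \<rho> u0 u \<and>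
    (\<forall>K. compact K \<and> K \<subseteq> {0..} \<times> UNIV \<longrightarrow>
       uniform_limit K (\<lambda>n (t, y). step_function n (x n t) (b n t) y) (\<lambda>(t, y). u t y) sequentially) \<and>
    bounded ((\<lambda>(t, y). u t y) ` ({0..} \<times> UNIV)) \<and>
    uniformly_continuous_on ({0..} \<times> UNIV) (\<lambda>(t, y). u t y) \<and>
    (\<forall>t>0. \<forall>\<omega>. modulus_of_continuity \<omega> u0 \<longrightarrow> modulus_of_continuity \<omega> (u t))"
proof -
  define b' where "b' = (\<lambda>n t i. - b n t i)"
  have flow: "particle_flow n (x n) (b n)" if "n \<ge> 2" for n by (rule flow_of_solution[OF assms(6)[OF that]])
  have flow': "particle_flow n (x n) (b' n)" if "n \<ge> 2" for n
    unfolding b'_def by (rule particle_flow_neg[OF flow[OF that]])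
  define u where "u = upper_lim x b"
  define w where "w = upper_lim x b'"
  have su: "subsolution \<rho> u" unfolding u_def by (rule upper_lim_subsolution[OF flow assms(1)])
  have sw: "subsolution \<rho> w" unfolding w_def by (rule upper_lim_subsolution[OF flow' assms(1)])
  have bu: "\<bar>u t y\<bar> \<le> 1" if "t \<ge> 0" for t y unfolding u_def by (rule upper_lim_bound[OF flow that])
  have bw: "\<bar>w t y\<bar> \<le> 1" if "t \<ge> 0" for t y unfolding w_def by (rule upper_lim_bound[OF flow' that])
  have uu: "usc_closed u" unfolding u_def by (rule upper_lim_usc_closed[OF flow])
  have uw: "usc_closed w" unfolding w_def by (rule upper_lim_usc_closed[OF flow'])
  have step_neg: "step_function n (x n t) (b' n t) y = - step_function n (x n t) (b n t) y" for n t y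
    unfolding step_function_def b'_def by (simp add: sum_negf)
  obtain F where F: "\<And>y. \<bar>u0 y\<bar> \<le> F" using assms(3) unfolding bounded_iff by auto
  have step0: "step_function n (x n 0) (b n 0) y = step_function n (x0 n) (b0 n) y" if n: "n \<ge> 2" for n y
  proof -
    have "particle_solution_on n 1 (x0 n) (b0 n) (x n) (b n)"
      using assms(6)[OF n] unfolding particle_solution_def by simp
    then have "\<forall>i\<in>{1..n}. x n 0 i = x0 n i \<and> b n 0 i = b0 n i"
      unfolding particle_solution_on_def by (elim conjE exE)
    then show ?thesis unfolding step_function_def by (intro arg_cong2[of _ _ _ _ times] sum.cong refl) auto
  qed
  have init: "\<exists>N. \<forall>n\<ge>N. \<forall>y. \<bar>step_function n (x n 0) (b n 0) y - u0 y\<bar> < e" if e: "e > 0" for e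
  proof -
    from uniform_limitD[OF assms(5) e] obtain N where
      N: "\<And>n y. n \<ge> N \<Longrightarrow> dist (step_function n (x0 n) (b0 n) y) (u0 y) < e"
      unfolding eventually_sequentially by auto
    have "\<bar>step_function n (x n 0) (b n 0) y - u0 y\<bar> < e" if "n \<ge> max N 2" for n y
      using N[of n y] that step0[of n y] by (simp add: dist_real_def)
    then show ?thesis by blast
  qed
  have u0le: "u 0 y \<le> u0 y" for y
    unfolding u_def
  proof (rule upper_lim_initial[OF flow assms(4) F])
    fix e :: real assume "e > 0"
    from init[OF this] obtain N where N: "\<And>n y. n \<ge> N \<Longrightarrow> \<bar>step_function n (x n 0) (b n 0) y - u0 y\<bar> < e" by blast
    have "step_function n (x n 0) (b n 0) y \<le> u0 y + e" if "n \<ge> N" for n y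
      using N[OF that, of y] by (simp add: abs_less_iff)
    then show "\<exists>N. \<forall>n\<ge>N. \<forall>y. step_function n (x n 0) (b n 0) y \<le> u0 y + e" by blast
  qed
  have w0le: "w 0 y \<le> - u0 y" for y
    unfolding w_def
  proof (rule upper_lim_initial[OF flow'])
    show "uniformly_continuous_on UNIV (\<lambda>y. - u0 y)" by (rule uniformly_continuous_on_minus[OF assms(4)])
    show "\<bar>- u0 y\<bar> \<le> F" for y using F[of y] by simp
    fix e :: real assume "e > 0"
    from init[OF this] obtain N where N: "\<And>n y. n \<ge> N \<Longrightarrow> \<bar>step_function n (x n 0) (b n 0) y - u0 y\<bar> < e" by blast
    have "step_function n (x n 0) (b' n 0) y \<le> - u0 y + e" if "n \<ge> N" for n y
      using N[OF that, of y] unfolding step_neg by (simp add: abs_less_iff)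
    then show "\<exists>N. \<forall>n\<ge>N. \<forall>y. step_function n (x n 0) (b' n 0) y \<le> - u0 y + e" by blast
  qed
  \<comment> \<open>Given u 0 \<le> u0 and w 0 \<le> - u0, the hypothesis on c is exactly the
    initial inequality that \<open>comparison\<close> asks for; at t = 0 it already is the
    claim.\<close>
  have shift: "u t y + w t (y + h) \<le> c" if c: "\<And>y. u0 y \<le> u0 (y + h) + c" and t: "t \<ge> 0" for h c t y
  proof (cases "t = 0")
    case True
    with u0le[of y] w0le[of "y + h"] c[of y] show ?thesis by simp
  next
    case False
    have "w 0 (y + h) \<le> c - u0 y" for y using w0le[of "y + h"] c[of y] by linarith
    with False t show ?thesis
      by (intro comparison[OF assms(1) su sw bu bw uu uw u0le _ assms(4)]) auto
  qed
  have w_eq: "w t y = - u t y" if t: "t \<ge> 0" for t y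
  proof -
    have "u t y + w t y \<le> 0" using shift[of 0 0 t y] t by simp
    \<comment> \<open>At one and the same point the step functions of the two flows are opposite, so
      their upper bounds cannot have a negative sum.\<close>
    moreover have "0 \<le> u t y + w t y"
    proof (rule field_le_epsilon)
      fix e :: real assume "e > 0"
      then have e: "e / 2 > 0" by simp
      obtain d1 N1 where N1: "d1 > 0" "N1 \<ge> 2" "\<And>n s z. n \<ge> N1 \<Longrightarrow> s \<ge> 0 \<Longrightarrow> \<bar>s - t\<bar> < d1 \<Longrightarrow> \<bar>z - y\<bar> < d1 \<Longrightarrow>
         upper_step n (x n s) (b n s) z < u t y + e / 2"
        using upper_lim_upper_step[OF flow t e, of y] unfolding u_def by metis
      obtain d2 N2 where N2: "d2 > 0" "N2 \<ge> 2" "\<And>n s z. n \<ge> N2 \<Longrightarrow> s \<ge> 0 \<Longrightarrow> \<bar>s - t\<bar> < d2 \<Longrightarrow> \<bar>z - y\<bar> < d2 \<Longrightarrow>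
         upper_step n (x n s) (b' n s) z < w t y + e / 2"
        using upper_lim_upper_step[OF flow' t e, of y] unfolding w_def by metis
      define n where "n = max N1 N2"
      have "upper_step n (x n t) (b n t) y < u t y + e / 2" "upper_step n (x n t) (b' n t) y < w t y + e / 2"
        using N1(1) N2(1) t by (auto intro!: N1(3) N2(3) simp: n_def)
      with step_le_upper_step[of n "x n t" "b n t" y] step_le_upper_step[of n "x n t" "b' n t" y] step_neg[of n t y]
      show "0 \<le> u t y + w t y + e" by linarith
    qed
    ultimately show ?thesis by linarith
  qed
  \<comment> \<open>The initial bounds on u and on w are both one-sided; w = - u at t = 0 combines
    them into an equality.\<close>
  have u00: "u 0 y = u0 y" for y using u0le[of y] w0le[of y] w_eq[of 0 y] by simp
  \<comment> \<open>Both u and - u = w are upper semicontinuous up to t = 0.\<close>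
  have cont: "continuous_on ({0..} \<times> UNIV) (\<lambda>(t, y). u t y)"
    unfolding continuous_on_iff
  proof (intro ballI allI impI)
    fix q :: "real \<times> real" and e :: real assume q: "q \<in> {0..} \<times> UNIV" and e: "e > 0"
    obtain t y where qe: "q = (t, y)" by (cases q)
    have t: "t \<ge> 0" using q qe by simp
    obtain d1 where d1: "d1 > 0" "\<And>s z. s \<ge> 0 \<Longrightarrow> \<bar>s - t\<bar> < d1 \<Longrightarrow> \<bar>z - y\<bar> < d1 \<Longrightarrow> u s z < u t y + e"
      using uu[unfolded usc_closed_def, rule_format, OF t e] by blast
    obtain d2 where d2: "d2 > 0" "\<And>s z. s \<ge> 0 \<Longrightarrow> \<bar>s - t\<bar> < d2 \<Longrightarrow> \<bar>z - y\<bar> < d2 \<Longrightarrow> w s z < w t y + e"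
      using uw[unfolded usc_closed_def, rule_format, OF t e] by blast
    show "\<exists>d>0. \<forall>q'\<in>{0..} \<times> UNIV. dist q' q < d \<longrightarrow> dist (case q' of (t, y) \<Rightarrow> u t y) (case q of (t, y) \<Rightarrow> u t y) < e"
    proof (intro exI[of _ "min d1 d2"] conjI ballI impI)
      fix q' :: "real \<times> real" assume q': "q' \<in> {0..} \<times> UNIV" "dist q' q < min d1 d2"
      obtain s z where q'e: "q' = (s, z)" by (cases q')
      have s: "s \<ge> 0" using q'(1) q'e by simp
      have "\<bar>s - t\<bar> < min d1 d2" "\<bar>z - y\<bar> < min d1 d2"
        using q'(2) dist_fst_le[of q' q] dist_snd_le[of q' q] unfolding qe q'e by (auto simp: dist_real_def)
      then have "u s z < u t y + e" "w s z < w t y + e" using s by (auto intro: d1(2) d2(2))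
      then show "dist (case q' of (t, y) \<Rightarrow> u t y) (case q of (t, y) \<Rightarrow> u t y) < e"
        using w_eq[OF s, of z] w_eq[OF t, of y] unfolding qe q'e by (simp add: dist_real_def abs_less_iff)
    qed (use d1 d2 in simp)
  qed
  have cont': "continuous_on ({0..} \<times> UNIV) (\<lambda>(t, y). - u t y)"
    using continuous_on_minus[OF cont] by (simp add: case_prod_beta)
  have loc: "uniform_limit K (\<lambda>n (t, y). step_function n (x n t) (b n t) y) (\<lambda>(t, y). u t y) sequentially"
    if K: "compact K" "K \<subseteq> {0..} \<times> UNIV" for K
  proof (rule uniform_limitI)
    fix e :: real assume e: "e > 0"
    have cw: "continuous_on K (\<lambda>(t, y). w t y)"
      by (rule continuous_on_eq[OF continuous_on_subset[OF cont' K(2)]]) (use K(2) w_eq in auto)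
    obtain N1 where N1: "\<And>n t y. n \<ge> N1 \<Longrightarrow> (t, y) \<in> K \<Longrightarrow> upper_step n (x n t) (b n t) y - u t y < 0 + e"
      using upper_lim_compact[OF flow K continuous_on_subset[OF cont K(2)], of 0 e] e unfolding u_def
      by (metis diff_self order_refl)
    obtain N2 where N2: "\<And>n t y. n \<ge> N2 \<Longrightarrow> (t, y) \<in> K \<Longrightarrow> upper_step n (x n t) (b' n t) y - w t y < 0 + e"
      using upper_lim_compact[OF flow' K cw, of 0 e] e unfolding w_def
      by (metis diff_self order_refl)
    have "dist (step_function n (x n t) (b n t) y) (u t y) < e" if n: "n \<ge> max N1 N2" and ty: "(t, y) \<in> K" for n t y
    proof -
      have t: "t \<ge> 0" using ty K(2) by auto
      have "step_function n (x n t) (b n t) y - u t y < e"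
        using N1[of n t y] n ty step_le_upper_step[of n "x n t" "b n t" y] by simp
      moreover have "- step_function n (x n t) (b n t) y + u t y < e"
        using N2[of n t y] n ty step_le_upper_step[of n "x n t" "b' n t" y] w_eq[OF t, of y] unfolding step_neg by simp
      ultimately show ?thesis by (simp add: dist_real_def abs_less_iff)
    qed
    then show "\<forall>\<^sub>F n in sequentially. \<forall>q\<in>K. dist (case q of (t, y) \<Rightarrow> step_function n (x n t) (b n t) y) (case q of (t, y) \<Rightarrow> u t y) < e"
      unfolding eventually_sequentially by (intro exI[of _ "max N1 N2"]) auto
  qed
  have conv: "(\<lambda>n. step_function n (x n t) (b n t) y) \<longlonglongrightarrow> u t y" if "t \<ge> 0" for t y
    using tendsto_uniform_limitI[OF loc[of "{(t, y)}"], of "(t, y)"] that by simp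
  \<comment> \<open>\<open>shift\<close> with h = z - y and c = \<omega> |z - y|.\<close>
  have modulus: "modulus_of_continuity \<omega> (u t)" if t: "t > 0" and \<omega>: "modulus_of_continuity \<omega> u0" for t \<omega>
  proof -
    have "u t y - u t z \<le> \<omega> \<bar>z - y\<bar>" for y z
    proof -
      have "u0 y' \<le> u0 (y' + (z - y)) + \<omega> \<bar>z - y\<bar>" for y'
      proof -
        have "\<bar>u0 y' - u0 (y' + (z - y))\<bar> \<le> \<omega> \<bar>y' - (y' + (z - y))\<bar>"
          using \<omega> unfolding modulus_of_continuity_def by blast
        then show ?thesis by (simp add: abs_minus_commute abs_le_iff)
      qed
      from shift[OF this, of t y] w_eq[of t z] t show ?thesis by simp
    qed
    then have "\<bar>u t y - u t z\<bar> \<le> \<omega> \<bar>y - z\<bar>" for y z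
      using abs_minus_commute[of y z] by (metis abs_le_iff minus_diff_eq)
    with \<omega> show ?thesis unfolding modulus_of_continuity_def by simp
  qed
  \<comment> \<open>The same shift argument in terms of a pair e, \<delta>. It holds with one pair
    for all slices, which makes a common barrier possible below.\<close>
  have sp: "\<bar>u t y' - u t y\<bar> \<le> e" if t: "t \<ge> 0" and \<delta>: "\<And>y y'. \<bar>y' - y\<bar> < \<delta> \<Longrightarrow> \<bar>u0 y' - u0 y\<bar> < e" and y: "\<bar>y' - y\<bar> < \<delta>" for t e \<delta> y y'
  proof -
    have "u t y - u t z \<le> e" if yz: "\<bar>z - y\<bar> < \<delta>" for y z
    proof -
      have "u0 y' \<le> u0 (y' + (z - y)) + e" for y'
        using \<delta>[of "y' + (z - y)" y'] yz by (simp add: abs_less_iff)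
      from shift[OF this t, of y] w_eq[OF t, of z] show ?thesis by simp
    qed
    from this[of y' y] this[of y y'] y show ?thesis by (simp add: abs_le_iff abs_minus_commute)
  qed
  have ucont: "uniformly_continuous_on ({0..} \<times> UNIV) (\<lambda>(t, y). u t y)"
    unfolding uniformly_continuous_on_def
  proof (intro allI impI)
    fix e' :: real assume "e' > 0"
    \<comment> \<open>The time increment costs 2 e + e and the space increment e, which stays below
      e' = 8 e.\<close>
    define e where "e = e' / 8"
    have e: "e > 0" using \<open>e' > 0\<close> by (simp add: e_def)
    obtain \<delta> where \<delta>: "\<delta> > 0" "\<And>y y'. \<bar>y' - y\<bar> < \<delta> \<Longrightarrow> \<bar>u0 y' - u0 y\<bar> < e"
      using assms(4)[unfolded uniformly_continuous_on_def, rule_format, OF e] by (auto simp: dist_real_def)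
    obtain A where A: "A > 0" "\<And>f y y'. (\<And>y. \<bar>f y\<bar> \<le> 1) \<Longrightarrow> (\<And>y y'. \<bar>y' - y\<bar> < \<delta> \<Longrightarrow> f y' \<le> f y + e) \<Longrightarrow>
       f y' \<le> f y + e + A * (sqrt (1 + (y' - y)\<^sup>2) - 1)"
      using uniform_modulus_barrier[of 1 \<delta> e] \<delta>(1) e by (metis less_imp_le zero_le_one)
    define \<kappa> where "\<kappa> = barrier_speed A"
    have \<kappa>: "\<kappa> > 0" unfolding \<kappa>_def barrier_speed_def using A(1) by (intro add_nonneg_pos) auto
    have slice: "continuous_on UNIV (u a)" if a: "a \<ge> 0" for a
    proof -
      have "continuous_on UNIV (\<lambda>y. case (a, y) of (t, y) \<Rightarrow> u t y)"
        by (rule continuous_on_compose2[OF cont]) (use a in \<open>auto intro!: continuous_intros\<close>)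
      then show ?thesis by simp
    qed
    \<comment> \<open>Barriers started at time a bound both u and w = - u from above at the later
      time, which gives the two-sided estimate.\<close>
    have time: "\<bar>u s y - u a y\<bar> \<le> 2 * e + \<kappa> * (s - a)" if a: "0 \<le> a" "a \<le> s" for a s y
    proof -
      have s: "s \<ge> 0" using a by simp
      have m: "u a z \<le> u a y + e" "w a z \<le> w a y + e" if "\<bar>z - y\<bar> < \<delta>" for y z
        using sp[OF a(1) \<delta>(2) that] w_eq[OF a(1)] by (simp_all add: abs_le_iff)
      have "u s y \<le> u a y + 2 * e + \<kappa> * (s - a)"
        unfolding u_def \<kappa>_def
      proof (rule upper_lim_time_modulus[OF flow a e A(1)])
        fix y'
        have "u a y' \<le> u a y + e + A * (sqrt (1 + (y' - y)\<^sup>2) - 1)"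
          by (intro A(2) bu a(1) m(1))
        then show "upper_lim x b a y' \<le> upper_lim x b a y + e + A * (sqrt (1 + (y' - y)\<^sup>2) - 1)" by (simp add: u_def)
      qed (use slice[OF a(1)] conv[OF s] in \<open>simp_all add: u_def\<close>)
      moreover have "w s y \<le> w a y + 2 * e + \<kappa> * (s - a)"
        unfolding w_def \<kappa>_def
      proof (rule upper_lim_time_modulus[OF flow' a e A(1)])
        fix y'
        have "w a y' \<le> w a y + e + A * (sqrt (1 + (y' - y)\<^sup>2) - 1)"
          by (intro A(2) bw a(1) m(2))
        then show "upper_lim x b' a y' \<le> upper_lim x b' a y + e + A * (sqrt (1 + (y' - y)\<^sup>2) - 1)" by (simp add: w_def)
        have "w a = (\<lambda>y. - u a y)" using w_eq[OF a(1)] by auto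
        then show "continuous_on UNIV (upper_lim x b' a)"
          using continuous_on_minus[OF slice[OF a(1)]] by (simp add: w_def)
        show "(\<lambda>n. step_function n (x n s) (b' n s) y) \<longlonglongrightarrow> upper_lim x b' s y"
          using tendsto_minus[OF conv[OF s, of y]] w_eq[OF s, of y] unfolding step_neg by (simp add: w_def)
      qed
      ultimately show ?thesis using w_eq[OF a(1), of y] w_eq[OF s, of y] by (simp add: abs_le_iff)
    qed
    show "\<exists>d>0. \<forall>q\<in>{0..} \<times> UNIV. \<forall>q'\<in>{0..} \<times> UNIV. dist q' q < d \<longrightarrow>
      dist (case q' of (t, y) \<Rightarrow> u t y) (case q of (t, y) \<Rightarrow> u t y) < e'"
    proof (intro exI[of _ "min \<delta> (e / \<kappa>)"] conjI ballI impI)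
      fix q q' :: "real \<times> real" assume q: "q \<in> {0..} \<times> UNIV" "q' \<in> {0..} \<times> UNIV" "dist q' q < min \<delta> (e / \<kappa>)"
      obtain t y s z where qe: "q = (t, y)" "q' = (s, z)" by (cases q, cases q')
      have ts: "t \<ge> 0" "s \<ge> 0" using q qe by auto
      have d: "\<bar>s - t\<bar> < e / \<kappa>" "\<bar>z - y\<bar> < \<delta>"
        using q(3) dist_fst_le[of q' q] dist_snd_le[of q' q] unfolding qe by (auto simp: dist_real_def)
      have "\<kappa> * \<bar>s - t\<bar> < e" using d(1) \<kappa> by (simp add: pos_less_divide_eq mult.commute)
      moreover have "\<bar>u s z - u t z\<bar> \<le> 2 * e + \<kappa> * \<bar>s - t\<bar>"
        using time[of t s z] time[of s t z] ts by (cases "t \<le> s") (auto simp: abs_minus_commute)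
      moreover have "\<bar>u t z - u t y\<bar> \<le> e" by (rule sp[OF ts(1) \<delta>(2) d(2)])
      ultimately have "\<bar>u s z - u t y\<bar> < 8 * e" using e by linarith
      then show "dist (case q' of (t, y) \<Rightarrow> u t y) (case q of (t, y) \<Rightarrow> u t y) < e'"
        unfolding qe e_def by (simp add: dist_real_def)
    qed (use \<delta> e \<kappa> in simp)
  qed
  have bu': "\<bar>u t y\<bar> \<le> 1" if "t > 0" for t y using bu that by simp
  have bm: "\<bar>- u t y\<bar> \<le> 1" if "t > 0" for t y using bu' that by simp
  have env: "usc_envelope u t y = u t y" "lsc_envelope u t y = u t y" if t: "t \<ge> 0" for t y
    unfolding lsc_envelope_eq using usc_envelope_continuous[where v = u and x = y, OF bu' t cont] usc_envelope_continuous[where v = "\<lambda>t y. - u t y" and x = y, OF bm t cont'] by simp_all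
  have visc: "viscosity_solution \<rho> u"
    unfolding viscosity_solution_def
  proof (intro conjI)
    show "bounded_Q u" using su unfolding subsolution_def by simp
    show "subsolution \<rho> (usc_envelope u)" by (rule subsolution_cong[OF _ su]) (simp add: env)
    show "supersolution \<rho> (lsc_envelope u)"
      unfolding supersolution_iff by (rule subsolution_cong[OF _ sw]) (simp add: env w_eq)
  qed
  \<comment> \<open>The upper envelope of v is compared with w = - u, and u with the upper envelope
    of - v. These envelopes lie above v and - v, so the two comparisons give v \<le> u and u \<le>
    v.\<close>
  have uniq: "v t y = u t y" if v: "viscosity_solution \<rho> v" "has_initial_datum v u0" and t: "t > 0" for v t y
  proof -
    have bQ: "bounded_Q v" and s1: "subsolution \<rho> (usc_envelope v)" and s2: "supersolution \<rho> (lsc_envelope v)"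
      using v(1) unfolding viscosity_solution_def by simp_all
    obtain B where B: "\<And>t y. t > 0 \<Longrightarrow> \<bar>v t y\<bar> \<le> B" using bounded_Q_D[OF bQ] by blast
    define v' where "v' = (\<lambda>t y. - v t y)"
    have B': "\<bar>v' t y\<bar> \<le> B" if "t > 0" for t y using B[OF that] by (simp add: v'_def)
    define B1 where "B1 = max B 1"
    have s2': "subsolution \<rho> (usc_envelope v')"
      using s2 unfolding supersolution_iff lsc_envelope_eq v'_def by simp
    have i1: "usc_envelope v 0 y = u0 y" for y using v(2) unfolding has_initial_datum_def by simp
    have i2: "usc_envelope v' 0 y = - u0 y" for y
    proof -
      have "lsc_envelope v 0 y = u0 y" using v(2) unfolding has_initial_datum_def by simp
      then show ?thesis unfolding lsc_envelope_eq v'_def by linarith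
    qed
    have "usc_envelope v t y + w t (y + 0) \<le> 0"
    proof (rule comparison[OF assms(1) s1 sw _ _ usc_envelope_usc_closed[where v = v, OF B] uw _ _ assms(4) t, where B = B1])
      show "\<bar>usc_envelope v t y\<bar> \<le> B1" if "t \<ge> 0" for t y using usc_envelope_bound[where v = v, OF B that, of y] by (simp add: B1_def)
      show "\<bar>w t y\<bar> \<le> B1" if "t \<ge> 0" for t y using bw[OF that, of y] by (simp add: B1_def)
    qed (use i1 w0le in simp_all)
    moreover have "u t y + usc_envelope v' t (y + 0) \<le> 0"
    proof (rule comparison[OF assms(1) su s2' _ _ uu usc_envelope_usc_closed[where v = v', OF B'] _ _ assms(4) t, where B = B1])
      show "\<bar>usc_envelope v' t y\<bar> \<le> B1" if "t \<ge> 0" for t y using usc_envelope_bound[where v = v', OF B' that, of y] by (simp add: B1_def)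
      show "\<bar>u t y\<bar> \<le> B1" if "t \<ge> 0" for t y using bu[OF that, of y] by (simp add: B1_def)
    qed (use i2 u0le in simp_all)
    moreover have "v t y \<le> usc_envelope v t y" by (rule usc_envelope_ge[where v = v, OF B t])
    moreover have "v' t y \<le> usc_envelope v' t y" by (rule usc_envelope_ge[where v = v', OF B' t])
    ultimately show ?thesis using w_eq[of t y] t by (simp add: v'_def)
  qed
  have "the_viscosity_solution \<rho> u0 u"
    unfolding the_viscosity_solution_def
  proof (intro conjI allI impI)
    show "has_initial_datum u u0" unfolding has_initial_datum_def using env[OF order_refl] u00 by simp
    show "\<forall>(t, y)\<in>Q. v t y = u t y" if "viscosity_solution \<rho> v \<and> has_initial_datum v u0" for v
      using uniq[OF conjunct1[OF that] conjunct2[OF that]] by (simp add: Q_def)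
  qed (fact visc u00)+
  moreover have "bounded ((\<lambda>(t, y). u t y) ` ({0..} \<times> UNIV))"
    unfolding bounded_iff using bu by (intro exI[of _ 1]) auto
  ultimately show ?thesis using loc ucont modulus by (intro exI[of _ u] conjI allI impI) simp_all
qed

end
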